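(* Let $p\geq 5$ be a prime number and let $\tilde{\mathcal{C}}$ be a fusion category over $k$. Suppose that $\tilde{\mathcal{C}}$ is Grothendieck equivalent to one of the categories $\operatorname{Rep} J_p$ or $\operatorname{Rep} K_p$, where $J_p=k^{\mathbb{S}_{p-1}}\# kC_p$ and $K_p=k^{\mathbb{A}_{p-1}}\# kC_p$ are the bismash product Hopf algebras defined in the context. Then $\tilde{\mathcal{C}}$ is not solvable.
   Context: $k$ is an algebraically closed field of characteristic zero. A fusion category over $k$ is a semisimple rigid $k$-linear monoidal category with finitely many isomorphism classes of simple objects, finite-dimensional Hom spaces and simple unit object $\mathbf{1}$. $\operatorname{Irr}(\mathcal{C})$ is the set of isomorphism classes of simple objects, and the fusion rules are $N_{X,Y}^Z=\dim\operatorname{Hom}(Z,X\otimes Y)$ for $X,Y,Z\in\operatorname{Irr}(\mathcal{C})$. $\operatorname{Rep}H$ is the category of finite-dimensional representations of a semisimple Hopf algebra $H$. Grothendieck equivalence: $\mathcal{C}$ and $\tilde{\mathcal{C}}$ are Grothendieck equivalent if there is a bijection $f:\operatorname{Irr}(\mathcal{C})\to\operatorname{Irr}(\tilde{\mathcal{C}})$ with $f(\mathbf{1})=\mathbf{1}$ and $N_{f(X),f(Y)}^{f(Z)}=N_{X,Y}^Z$ for all $X,Y,Z\in\operatorname{Irr}(\mathcal{C})$. Solvability: for a finite group $G$, $\mathcal{C}$ is a $G$-extension of $\mathcal{D}$ if there is a decomposition $\mathcal{C}=\bigoplus_{g\in G}\mathcal{C}_g$ with all $\mathcal{C}_g\ne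 0$, $\mathcal{C}_g\otimes\mathcal{C}_h\subseteq\mathcal{C}_{gh}$, $\mathcal{C}_g^*\subseteq \mathcal{C}_{g^{-1}}$ and $\mathcal{C}_e\cong\mathcal{D}$. If $G$ acts on $\mathcal{D}$ by tensor autoequivalences $\rho$, the $G$-equivariantization $\mathcal{D}^G$ is the fusion category of pairs $(X,(\mu^g)_{g\in G})$ with isomorphisms $\mu^g:\rho^g(X)\to X$ compatible with the action. $\mathcal{C}$ is solvable if there are fusion categories $\mathrm{Vect}=\mathcal{C}_0,\dots,\mathcal{C}_n=\mathcal{C}$, $n\ge0$, and cyclic groups of prime order $G_1,\dots,G_n$ such that each $\mathcal{C}_i$ is a $G_i$-equivariantization or a $G_i$-extension of $\mathcal{C}_{i-1}$. Bismash products: if a finite group has an exact factorization $F\Gamma$ into subgroups $F,\Gamma$ with $F\cap\Gamma=\{e\}$, then the relation $sx=(s\rhd x)(s\lhd x)$, $s\in\Gamma$, $x\in F$, $s\rhd x\in F$, $s\lhd x\in\Gamma$, defines mutual actions $\Gamma\overset{\lhd}{\leftarrow}\Gamma\times F\overset{\rhd}{\to}F$ (a matched pair $(\Gamma,F)$). The Hopf algebra $k^\Gamma\#kF$ has basis $e_s\#x$ ($s\in\Gamma$, $x\in F$), multiplication $(e_s\#x)(e_t\#y)=\delta_{t,s\lhd x}\,e_s\#xy$, and comultiplication $\Delta(e_s\#x)=\sum_{gh=s}e_g\#(h\rhd x)\otimes e_h\#x$. $J_n$ and $K_n$: for $n\ge2$, $\mathbb{S}_n=\langle z\rangle\Gamma$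 is an exact factorization, where $z=(1\,2\dots n)$, $\langle z\rangle\cong C_n$, and $\Gamma=\{\sigma\in\mathbb{S}_n:\sigma(n)=n\}\cong\mathbb{S}_{n-1}$; $J_n=k^{\mathbb{S}_{n-1}}\#kC_n$ is the associated bismash product. If $n$ is odd, $\Gamma\cap\mathbb{A}_n\cong\mathbb{A}_{n-1}$ is stable under the action $\lhd$ of $\langle z\rangle$, so the actions restrict to a matched pair $(\mathbb{A}_{n-1},C_n)$ (equivalently, the one from the exact factorization $\mathbb{A}_n=\langle z\rangle(\Gamma\cap\mathbb{A}_n)$), and $K_n=k^{\mathbb{A}_{n-1}}\#kC_n$. *)

theory Defs
  imports
    "HOL-Algebra.Sym_Groups"
    "HOL-Algebra.Elementary_Groups"
    "HOL-Number_Theory.Number_Theory"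
    "Jordan_Normal_Form.VS_Connect"
begin

section \<open>Linear monoidal categories\<close>

text \<open>
  The operations on arrows carry no source and target arguments and the Hom-sets need not be
  disjoint, so that matrices can serve as arrows. Every category can be brought into this form by
  tagging arrows with source and target. All laws are required for each typing of the arrows.
  \<open>Hom\<close> is a space of arrows in the record type \<open>module\<close> of the library; of the fields of that
  record only carrier, addition, zero and scalar multiplication are used.
  The structural isomorphisms are \<open>Asc X Y Z : (X \<boxtimes> Y) \<boxtimes> Z \<rightarrow> X \<boxtimes> (Y \<boxtimes> Z)\<close>,
  \<open>LUn X : Unit \<boxtimes> X \<rightarrow> X\<close> and \<open>RUn X : X \<boxtimes> Unit \<rightarrow> X\<close>.
\<close>

record ('o, 'm, 'k) mon_cat =
  Ob   :: "'o set"
  Hom  :: "'o \<Rightarrow> 'o \<Rightarrow> ('k, 'm) module"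
  Ide   :: "'o \<Rightarrow> 'm"
  Cmp  :: "'m \<Rightarrow> 'm \<Rightarrow> 'm"  (infixr "\<Zcomp>\<index>" 70)
  TenO :: "'o \<Rightarrow> 'o \<Rightarrow> 'o"  (infixr "\<boxtimes>\<index>" 75)
  TenA :: "'m \<Rightarrow> 'm \<Rightarrow> 'm"  (infixr "\<star>\<index>" 75)
  Unit :: "'o"
  Asc  :: "'o \<Rightarrow> 'o \<Rightarrow> 'o \<Rightarrow> 'm"
  LUn  :: "'o \<Rightarrow> 'm"
  RUn  :: "'o \<Rightarrow> 'm"

text \<open>\<open>g \<Zcomp> f\<close> is \<open>g\<close> after \<open>f\<close>.\<close>

abbreviation Arr :: "('o, 'm, 'k) mon_cat \<Rightarrow> 'o \<Rightarrow> 'o \<Rightarrow> 'm set"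
  where "Arr C X Y \<equiv> carrier (Hom C X Y)"

abbreviation Zero :: "('o, 'm, 'k) mon_cat \<Rightarrow> 'o \<Rightarrow> 'o \<Rightarrow> 'm"
  where "Zero C X Y \<equiv> zero (Hom C X Y)"

definition isomorphism :: "('o, 'm, 'k) mon_cat \<Rightarrow> 'o \<Rightarrow> 'o \<Rightarrow> 'm \<Rightarrow> bool"
  where "isomorphism C X Y f \<longleftrightarrow> f \<in> Arr C X Y \<and>
    (\<exists>g \<in> Arr C Y X. g \<Zcomp>\<^bsub>C\<^esub> f = Ide C X \<and> f \<Zcomp>\<^bsub>C\<^esub> g = Ide C Y)"

definition inverse_arrow :: "('o, 'm, 'k) mon_cat \<Rightarrow> 'o \<Rightarrow> 'o \<Rightarrow> 'm \<Rightarrow> 'm"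
  where "inverse_arrow C X Y f =
    (THE g. g \<in> Arr C Y X \<and> g \<Zcomp>\<^bsub>C\<^esub> f = Ide C X \<and> f \<Zcomp>\<^bsub>C\<^esub> g = Ide C Y)"

definition isomorphic :: "('o, 'm, 'k) mon_cat \<Rightarrow> 'o \<Rightarrow> 'o \<Rightarrow> bool"
  where "isomorphic C X Y \<longleftrightarrow> X \<in> Ob C \<and> Y \<in> Ob C \<and> (\<exists>f. isomorphism C X Y f)"

locale linear_category =
  fixes C :: "('o, 'm, 'k::field) mon_cat" (structure)
  assumes Hom_vectorspace:
      "\<lbrakk>X \<in> Ob C; Y \<in> Ob C\<rbrakk> \<Longrightarrow> vectorspace class_ring (Hom C X Y)"
    and Id_Arr: "X \<in> Ob C \<Longrightarrow> Ide C X \<in> Arr C X X"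
    and Cmp_linear_right: "\<lbrakk>X \<in> Ob C; Y \<in> Ob C; Z \<in> Ob C; g \<in> Arr C Y Z\<rbrakk> \<Longrightarrow>
      linear_map class_ring (Hom C X Y) (Hom C X Z) (\<lambda>f. g \<Zcomp> f)"
    and Cmp_linear_left: "\<lbrakk>X \<in> Ob C; Y \<in> Ob C; Z \<in> Ob C; f \<in> Arr C X Y\<rbrakk> \<Longrightarrow>
      linear_map class_ring (Hom C Y Z) (Hom C X Z) (\<lambda>g. g \<Zcomp> f)"
    and Cmp_Id_right: "\<lbrakk>X \<in> Ob C; Y \<in> Ob C; f \<in> Arr C X Y\<rbrakk> \<Longrightarrow> f \<Zcomp> Ide C X = f"
    and Cmp_Id_left: "\<lbrakk>X \<in> Ob C; Y \<in> Ob C; f \<in> Arr C X Y\<rbrakk> \<Longrightarrow> Ide C Y \<Zcomp> f = f"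
    and Cmp_assoc: "\<lbrakk>W \<in> Ob C; X \<in> Ob C; Y \<in> Ob C; Z \<in> Ob C;
      f \<in> Arr C W X; g \<in> Arr C X Y; h \<in> Arr C Y Z\<rbrakk> \<Longrightarrow> (h \<Zcomp> g) \<Zcomp> f = h \<Zcomp> (g \<Zcomp> f)"

locale linear_monoidal_category = linear_category +
  assumes Unit_Ob: "Unit C \<in> Ob C"
    and TenO_Ob: "\<lbrakk>X \<in> Ob C; Y \<in> Ob C\<rbrakk> \<Longrightarrow> X \<boxtimes> Y \<in> Ob C"
    and TenA_linear_right:
      "\<lbrakk>X \<in> Ob C; X' \<in> Ob C; Y \<in> Ob C; Y' \<in> Ob C; f \<in> Arr C X X'\<rbrakk> \<Longrightarrow>
      linear_map class_ring (Hom C Y Y') (Hom C (X \<boxtimes> Y) (X' \<boxtimes> Y')) (\<lambda>g. f \<star> g)"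
    and TenA_linear_left:
      "\<lbrakk>X \<in> Ob C; X' \<in> Ob C; Y \<in> Ob C; Y' \<in> Ob C; g \<in> Arr C Y Y'\<rbrakk> \<Longrightarrow>
      linear_map class_ring (Hom C X X') (Hom C (X \<boxtimes> Y) (X' \<boxtimes> Y')) (\<lambda>f. f \<star> g)"
    and TenA_Id: "\<lbrakk>X \<in> Ob C; Y \<in> Ob C\<rbrakk> \<Longrightarrow> Ide C X \<star> Ide C Y = Ide C (X \<boxtimes> Y)"
    and TenA_Cmp:
      "\<lbrakk>X \<in> Ob C; X' \<in> Ob C; X'' \<in> Ob C; Y \<in> Ob C; Y' \<in> Ob C; Y'' \<in> Ob C;
        f \<in> Arr C X X'; f' \<in> Arr C X' X''; g \<in> Arr C Y Y'; g' \<in> Arr C Y' Y''\<rbrakk> \<Longrightarrow>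
      (f' \<Zcomp> f) \<star> (g' \<Zcomp> g) = (f' \<star> g') \<Zcomp> (f \<star> g)"
    and Asc_iso: "\<lbrakk>X \<in> Ob C; Y \<in> Ob C; Z \<in> Ob C\<rbrakk> \<Longrightarrow>
      isomorphism C ((X \<boxtimes> Y) \<boxtimes> Z) (X \<boxtimes> (Y \<boxtimes> Z)) (Asc C X Y Z)"
    and LUn_iso: "X \<in> Ob C \<Longrightarrow> isomorphism C (Unit C \<boxtimes> X) X (LUn C X)"
    and RUn_iso: "X \<in> Ob C \<Longrightarrow> isomorphism C (X \<boxtimes> Unit C) X (RUn C X)"
    and Asc_natural:
      "\<lbrakk>X \<in> Ob C; X' \<in> Ob C; Y \<in> Ob C; Y' \<in> Ob C; Z \<in> Ob C; Z' \<in> Ob C;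
        f \<in> Arr C X X'; g \<in> Arr C Y Y'; h \<in> Arr C Z Z'\<rbrakk> \<Longrightarrow>
      Asc C X' Y' Z' \<Zcomp> ((f \<star> g) \<star> h) = (f \<star> (g \<star> h)) \<Zcomp> Asc C X Y Z"
    and LUn_natural: "\<lbrakk>X \<in> Ob C; Y \<in> Ob C; f \<in> Arr C X Y\<rbrakk> \<Longrightarrow>
      LUn C Y \<Zcomp> (Ide C (Unit C) \<star> f) = f \<Zcomp> LUn C X"
    and RUn_natural: "\<lbrakk>X \<in> Ob C; Y \<in> Ob C; f \<in> Arr C X Y\<rbrakk> \<Longrightarrow>
      RUn C Y \<Zcomp> (f \<star> Ide C (Unit C)) = f \<Zcomp> RUn C X"
    and pentagon: "\<lbrakk>W \<in> Ob C; X \<in> Ob C; Y \<in> Ob C; Z \<in> Ob C\<rbrakk> \<Longrightarrow>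
      Asc C W X (Y \<boxtimes> Z) \<Zcomp> Asc C (W \<boxtimes> X) Y Z
      = (Ide C W \<star> Asc C X Y Z) \<Zcomp> Asc C W (X \<boxtimes> Y) Z \<Zcomp> (Asc C W X Y \<star> Ide C Z)"
    and triangle: "\<lbrakk>X \<in> Ob C; Y \<in> Ob C\<rbrakk> \<Longrightarrow>
      (Ide C X \<star> LUn C Y) \<Zcomp> Asc C X (Unit C) Y = RUn C X \<star> Ide C Y"


section \<open>Fusion categories\<close>

definition zero_object :: "('o, 'm, 'k) mon_cat \<Rightarrow> 'o \<Rightarrow> bool"
  where "zero_object C X \<longleftrightarrow> X \<in> Ob C \<and> Ide C X = Zero C X X"

definition direct_sum ::
    "('o, 'm, 'k) mon_cat \<Rightarrow> 'i set \<Rightarrow> ('i \<Rightarrow> 'o) \<Rightarrow> 'o \<Rightarrow> ('i \<Rightarrow> 'm) \<Rightarrow> ('i \<Rightarrow> 'm) \<Rightarrow> bool"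
  where "direct_sum C I X S inc prj \<longleftrightarrow>
    finite I \<and> S \<in> Ob C \<and>
    (\<forall>i\<in>I. X i \<in> Ob C \<and> inc i \<in> Arr C (X i) S \<and> prj i \<in> Arr C S (X i)) \<and>
    (\<forall>i\<in>I. \<forall>j\<in>I. prj j \<Zcomp>\<^bsub>C\<^esub> inc i = (if i = j then Ide C (X i) else Zero C (X i) (X j))) \<and>
    finsum (Hom C S S) (\<lambda>i. inc i \<Zcomp>\<^bsub>C\<^esub> prj i) I = Ide C S"

definition monic :: "('o, 'm, 'k) mon_cat \<Rightarrow> 'o \<Rightarrow> 'o \<Rightarrow> 'm \<Rightarrow> bool"
  where "monic C X Y f \<longleftrightarrow> f \<in> Arr C X Y \<and>
    (\<forall>W\<in>Ob C. \<forall>g\<in>Arr C W X. \<forall>h\<in>Arr C W X. f \<Zcomp>\<^bsub>C\<^esub> g = f \<Zcomp>\<^bsub>C\<^esub> h \<longrightarrow> g = h)"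

definition epic :: "('o, 'm, 'k) mon_cat \<Rightarrow> 'o \<Rightarrow> 'o \<Rightarrow> 'm \<Rightarrow> bool"
  where "epic C X Y f \<longleftrightarrow> f \<in> Arr C X Y \<and>
    (\<forall>Z\<in>Ob C. \<forall>g\<in>Arr C Y Z. \<forall>h\<in>Arr C Y Z. g \<Zcomp>\<^bsub>C\<^esub> f = h \<Zcomp>\<^bsub>C\<^esub> f \<longrightarrow> g = h)"

text \<open>\<open>is_kernel C X Y f K k\<close>: the arrow \<open>k : K \<rightarrow> X\<close> is a kernel of \<open>f : X \<rightarrow> Y\<close>; dually
  \<open>is_cokernel C X Y f Q q\<close> for \<open>q : Y \<rightarrow> Q\<close>.\<close>

definition is_kernel :: "('o, 'm, 'k) mon_cat \<Rightarrow> 'o \<Rightarrow> 'o \<Rightarrow> 'm \<Rightarrow> 'o \<Rightarrow> 'm \<Rightarrow> bool"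
  where "is_kernel C X Y f K k \<longleftrightarrow>
    K \<in> Ob C \<and> k \<in> Arr C K X \<and> f \<Zcomp>\<^bsub>C\<^esub> k = Zero C K Y \<and>
    (\<forall>W\<in>Ob C. \<forall>h\<in>Arr C W X. f \<Zcomp>\<^bsub>C\<^esub> h = Zero C W Y \<longrightarrow>
      (\<exists>!u. u \<in> Arr C W K \<and> k \<Zcomp>\<^bsub>C\<^esub> u = h))"

definition is_cokernel :: "('o, 'm, 'k) mon_cat \<Rightarrow> 'o \<Rightarrow> 'o \<Rightarrow> 'm \<Rightarrow> 'o \<Rightarrow> 'm \<Rightarrow> bool"
  where "is_cokernel C X Y f Q q \<longleftrightarrow>
    Q \<in> Ob C \<and> q \<in> Arr C Y Q \<and> q \<Zcomp>\<^bsub>C\<^esub> f = Zero C X Q \<and>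
    (\<forall>Z\<in>Ob C. \<forall>h\<in>Arr C Y Z. h \<Zcomp>\<^bsub>C\<^esub> f = Zero C X Z \<longrightarrow>
      (\<exists>!u. u \<in> Arr C Q Z \<and> u \<Zcomp>\<^bsub>C\<^esub> q = h))"

locale abelian_linear_category = linear_category +
  assumes direct_sums: "(\<And>i. i < n \<Longrightarrow> V i \<in> Ob C) \<Longrightarrow>
      \<exists>S inc prj. direct_sum C {..<n::nat} V S inc prj"
    and kernels: "\<lbrakk>X \<in> Ob C; Y \<in> Ob C; f \<in> Arr C X Y\<rbrakk> \<Longrightarrow> \<exists>K k. is_kernel C X Y f K k"
    and cokernels: "\<lbrakk>X \<in> Ob C; Y \<in> Ob C; f \<in> Arr C X Y\<rbrakk> \<Longrightarrow> \<exists>Q q. is_cokernel C X Y f Q q"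
    and monic_is_kernel: "\<lbrakk>X \<in> Ob C; Y \<in> Ob C; monic C X Y f\<rbrakk> \<Longrightarrow>
      \<exists>Z\<in>Ob C. \<exists>g\<in>Arr C Y Z. is_kernel C Y Z g X f"
    and epic_is_cokernel: "\<lbrakk>X \<in> Ob C; Y \<in> Ob C; epic C X Y f\<rbrakk> \<Longrightarrow>
      \<exists>W\<in>Ob C. \<exists>g\<in>Arr C W X. is_cokernel C W X g Y f"

definition simple_object :: "('o, 'm, 'k) mon_cat \<Rightarrow> 'o \<Rightarrow> bool"
  where "simple_object C X \<longleftrightarrow> X \<in> Ob C \<and> \<not> zero_object C X \<and>
    (\<forall>Y\<in>Ob C. \<forall>f. monic C Y X f \<longrightarrow> zero_object C Y \<or> isomorphism C Y X f)"

definition iso_class :: "('o, 'm, 'k) mon_cat \<Rightarrow> 'o \<Rightarrow> 'o set"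
  where "iso_class C X = {Y. isomorphic C X Y}"

definition Irr :: "('o, 'm, 'k) mon_cat \<Rightarrow> 'o set set"
  where "Irr C = iso_class C ` {X. simple_object C X}"

text \<open>\<open>X'\<close> is a left dual of \<open>X\<close> (equivalently \<open>X\<close> is a right dual of \<open>X'\<close>): there are
  \<open>ev : X' \<boxtimes> X \<rightarrow> Unit\<close> and \<open>coev : Unit \<rightarrow> X \<boxtimes> X'\<close> satisfying the two zigzag identities.\<close>

definition left_dual :: "('o, 'm, 'k) mon_cat \<Rightarrow> 'o \<Rightarrow> 'o \<Rightarrow> bool"
  where "left_dual C X X' \<longleftrightarrow> X \<in> Ob C \<and> X' \<in> Ob C \<and>
    (\<exists>ev \<in> Arr C (X' \<boxtimes>\<^bsub>C\<^esub> X) (Unit C). \<exists>coev \<in> Arr C (Unit C) (X \<boxtimes>\<^bsub>C\<^esub> X').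
      RUn C X \<Zcomp>\<^bsub>C\<^esub> (Ide C X \<star>\<^bsub>C\<^esub> ev) \<Zcomp>\<^bsub>C\<^esub> Asc C X X' X \<Zcomp>\<^bsub>C\<^esub> (coev \<star>\<^bsub>C\<^esub> Ide C X) = LUn C X \<and>
      LUn C X' \<Zcomp>\<^bsub>C\<^esub> (ev \<star>\<^bsub>C\<^esub> Ide C X') \<Zcomp>\<^bsub>C\<^esub>
        inverse_arrow C ((X' \<boxtimes>\<^bsub>C\<^esub> X) \<boxtimes>\<^bsub>C\<^esub> X') (X' \<boxtimes>\<^bsub>C\<^esub> (X \<boxtimes>\<^bsub>C\<^esub> X')) (Asc C X' X X') \<Zcomp>\<^bsub>C\<^esub>
        (Ide C X' \<star>\<^bsub>C\<^esub> coev) = RUn C X')"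

locale fusion_category = linear_monoidal_category + abelian_linear_category +
  assumes semisimple: "X \<in> Ob C \<Longrightarrow>
      \<exists>(n::nat) V inc prj. (\<forall>i<n. simple_object C (V i)) \<and> direct_sum C {..<n} V X inc prj"
    and has_left_duals: "X \<in> Ob C \<Longrightarrow> \<exists>Y. left_dual C X Y"
    and has_right_duals: "X \<in> Ob C \<Longrightarrow> \<exists>Y. left_dual C Y X"
    and finite_Irr: "finite (Irr C)"
    and finite_dim_Hom:
      "\<lbrakk>X \<in> Ob C; Y \<in> Ob C\<rbrakk> \<Longrightarrow> vectorspace.fin_dim class_ring (Hom C X Y)"
    and simple_Unit: "simple_object C (Unit C)"


section \<open>Grothendieck equivalence\<close>

definition representative :: "'o set \<Rightarrow> 'o"
  where "representative A = (SOME X. X \<in> A)"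

text \<open>The fusion rule \<open>dim Hom(Z, X \<boxtimes> Y)\<close> for isomorphism classes; \<open>fusion_rule C A B D\<close> has the
  outer index \<open>Z\<close> last.\<close>

definition fusion_rule :: "('o, 'm, 'k::field) mon_cat \<Rightarrow> 'o set \<Rightarrow> 'o set \<Rightarrow> 'o set \<Rightarrow> nat"
  where "fusion_rule C A B D = vectorspace.dim class_ring
    (Hom C (representative D) (representative A \<boxtimes>\<^bsub>C\<^esub> representative B))"

definition grothendieck_equivalent ::
    "('o, 'm, 'k::field) mon_cat \<Rightarrow> ('p, 'n, 'k) mon_cat \<Rightarrow> bool"
  where "grothendieck_equivalent C D \<longleftrightarrow>
    (\<exists>f. bij_betw f (Irr C) (Irr D) \<and>
      f (iso_class C (Unit C)) = iso_class D (Unit D) \<and>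
      (\<forall>X\<in>Irr C. \<forall>Y\<in>Irr C. \<forall>Z\<in>Irr C.
        fusion_rule D (f X) (f Y) (f Z) = fusion_rule C X Y Z))"


section \<open>Tensor functors\<close>

text \<open>\<open>FTen F X Y : F X \<boxtimes> F Y \<rightarrow> F (X \<boxtimes> Y)\<close> and \<open>FUn F : Unit \<rightarrow> F Unit\<close>. The action on arrows takes
  source and target as arguments because Hom-sets may overlap.\<close>

record ('o, 'm, 'p, 'n) mon_functor =
  FOb  :: "'o \<Rightarrow> 'p"
  FArr :: "'o \<Rightarrow> 'o \<Rightarrow> 'm \<Rightarrow> 'n"
  FTen :: "'o \<Rightarrow> 'o \<Rightarrow> 'n"
  FUn  :: "'n"

locale tensor_functor =
  C: linear_monoidal_category C + D: linear_monoidal_category D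
  for C :: "('o, 'm, 'k::field) mon_cat" and D :: "('p, 'n, 'k) mon_cat" +
  fixes F :: "('o, 'm, 'p, 'n) mon_functor"
  assumes FOb_Ob: "X \<in> Ob C \<Longrightarrow> FOb F X \<in> Ob D"
    and FArr_linear: "\<lbrakk>X \<in> Ob C; Y \<in> Ob C\<rbrakk> \<Longrightarrow>
      linear_map class_ring (Hom C X Y) (Hom D (FOb F X) (FOb F Y)) (FArr F X Y)"
    and FArr_Id: "X \<in> Ob C \<Longrightarrow> FArr F X X (Ide C X) = Ide D (FOb F X)"
    and FArr_Cmp: "\<lbrakk>X \<in> Ob C; Y \<in> Ob C; Z \<in> Ob C; f \<in> Arr C X Y; g \<in> Arr C Y Z\<rbrakk> \<Longrightarrow>
      FArr F X Z (g \<Zcomp>\<^bsub>C\<^esub> f) = FArr F Y Z g \<Zcomp>\<^bsub>D\<^esub> FArr F X Y f"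
    and FTen_iso: "\<lbrakk>X \<in> Ob C; Y \<in> Ob C\<rbrakk> \<Longrightarrow>
      isomorphism D (FOb F X \<boxtimes>\<^bsub>D\<^esub> FOb F Y) (FOb F (X \<boxtimes>\<^bsub>C\<^esub> Y)) (FTen F X Y)"
    and FUn_iso: "isomorphism D (Unit D) (FOb F (Unit C)) (FUn F)"
    and FTen_natural:
      "\<lbrakk>X \<in> Ob C; X' \<in> Ob C; Y \<in> Ob C; Y' \<in> Ob C; f \<in> Arr C X X'; g \<in> Arr C Y Y'\<rbrakk> \<Longrightarrow>
      FTen F X' Y' \<Zcomp>\<^bsub>D\<^esub> (FArr F X X' f \<star>\<^bsub>D\<^esub> FArr F Y Y' g)
      = FArr F (X \<boxtimes>\<^bsub>C\<^esub> Y) (X' \<boxtimes>\<^bsub>C\<^esub> Y') (f \<star>\<^bsub>C\<^esub> g) \<Zcomp>\<^bsub>D\<^esub> FTen F X Y"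
    and FTen_Asc: "\<lbrakk>X \<in> Ob C; Y \<in> Ob C; Z \<in> Ob C\<rbrakk> \<Longrightarrow>
      FArr F ((X \<boxtimes>\<^bsub>C\<^esub> Y) \<boxtimes>\<^bsub>C\<^esub> Z) (X \<boxtimes>\<^bsub>C\<^esub> (Y \<boxtimes>\<^bsub>C\<^esub> Z)) (Asc C X Y Z) \<Zcomp>\<^bsub>D\<^esub>
        FTen F (X \<boxtimes>\<^bsub>C\<^esub> Y) Z \<Zcomp>\<^bsub>D\<^esub> (FTen F X Y \<star>\<^bsub>D\<^esub> Ide D (FOb F Z))
      = FTen F X (Y \<boxtimes>\<^bsub>C\<^esub> Z) \<Zcomp>\<^bsub>D\<^esub> (Ide D (FOb F X) \<star>\<^bsub>D\<^esub> FTen F Y Z) \<Zcomp>\<^bsub>D\<^esub>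
        Asc D (FOb F X) (FOb F Y) (FOb F Z)"
    and FTen_LUn: "X \<in> Ob C \<Longrightarrow>
      FArr F (Unit C \<boxtimes>\<^bsub>C\<^esub> X) X (LUn C X) \<Zcomp>\<^bsub>D\<^esub> FTen F (Unit C) X \<Zcomp>\<^bsub>D\<^esub>
        (FUn F \<star>\<^bsub>D\<^esub> Ide D (FOb F X)) = LUn D (FOb F X)"
    and FTen_RUn: "X \<in> Ob C \<Longrightarrow>
      FArr F (X \<boxtimes>\<^bsub>C\<^esub> Unit C) X (RUn C X) \<Zcomp>\<^bsub>D\<^esub> FTen F X (Unit C) \<Zcomp>\<^bsub>D\<^esub>
        (Ide D (FOb F X) \<star>\<^bsub>D\<^esub> FUn F) = RUn D (FOb F X)"

locale tensor_equivalence = tensor_functor +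
  assumes fully_faithful: "\<lbrakk>X \<in> Ob C; Y \<in> Ob C\<rbrakk> \<Longrightarrow>
      bij_betw (FArr F X Y) (Arr C X Y) (Arr D (FOb F X) (FOb F Y))"
    and essentially_surjective: "Z \<in> Ob D \<Longrightarrow> \<exists>X\<in>Ob C. isomorphic D (FOb F X) Z"

definition tensor_equivalent :: "('o, 'm, 'k::field) mon_cat \<Rightarrow> ('p, 'n, 'k) mon_cat \<Rightarrow> bool"
  where "tensor_equivalent C D \<longleftrightarrow> (\<exists>F. tensor_equivalence C D F)"

definition identity_functor :: "('o, 'm, 'k) mon_cat \<Rightarrow> ('o, 'm, 'o, 'm) mon_functor"
  where "identity_functor C = \<lparr> FOb = (\<lambda>X. X), FArr = (\<lambda>X Y f. f),
    FTen = (\<lambda>X Y. Ide C (X \<boxtimes>\<^bsub>C\<^esub> Y)), FUn = Ide C (Unit C) \<rparr>"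

text \<open>The composite \<open>F G\<close> of two tensor endofunctors of \<open>C\<close>, with \<open>G\<close> applied first.\<close>

definition compose_functors :: "('o, 'm, 'k) mon_cat \<Rightarrow>
    ('o, 'm, 'o, 'm) mon_functor \<Rightarrow> ('o, 'm, 'o, 'm) mon_functor \<Rightarrow> ('o, 'm, 'o, 'm) mon_functor"
  where "compose_functors C F G =
    \<lparr> FOb = (\<lambda>X. FOb F (FOb G X)),
      FArr = (\<lambda>X Y f. FArr F (FOb G X) (FOb G Y) (FArr G X Y f)),
      FTen = (\<lambda>X Y. FArr F (FOb G X \<boxtimes>\<^bsub>C\<^esub> FOb G Y) (FOb G (X \<boxtimes>\<^bsub>C\<^esub> Y)) (FTen G X Y) \<Zcomp>\<^bsub>C\<^esub>
        FTen F (FOb G X) (FOb G Y)),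
      FUn = FArr F (Unit C) (FOb G (Unit C)) (FUn G) \<Zcomp>\<^bsub>C\<^esub> FUn F \<rparr>"

definition monoidal_nat_iso :: "('o, 'm, 'k) mon_cat \<Rightarrow> ('p, 'n, 'k) mon_cat \<Rightarrow>
    ('o, 'm, 'p, 'n) mon_functor \<Rightarrow> ('o, 'm, 'p, 'n) mon_functor \<Rightarrow> ('o \<Rightarrow> 'n) \<Rightarrow> bool"
  where "monoidal_nat_iso C D F G \<eta> \<longleftrightarrow>
    (\<forall>X\<in>Ob C. isomorphism D (FOb F X) (FOb G X) (\<eta> X)) \<and>
    (\<forall>X\<in>Ob C. \<forall>Y\<in>Ob C. \<forall>f\<in>Arr C X Y.
      \<eta> Y \<Zcomp>\<^bsub>D\<^esub> FArr F X Y f = FArr G X Y f \<Zcomp>\<^bsub>D\<^esub> \<eta> X) \<and>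
    (\<forall>X\<in>Ob C. \<forall>Y\<in>Ob C.
      \<eta> (X \<boxtimes>\<^bsub>C\<^esub> Y) \<Zcomp>\<^bsub>D\<^esub> FTen F X Y = FTen G X Y \<Zcomp>\<^bsub>D\<^esub> (\<eta> X \<star>\<^bsub>D\<^esub> \<eta> Y)) \<and>
    \<eta> (Unit C) \<Zcomp>\<^bsub>D\<^esub> FUn F = FUn G"


section \<open>Extensions and equivariantizations\<close>

text \<open>\<open>C\<close> is a \<open>G\<close>-extension of \<open>D\<close>. The components are full replete subcategories, given by their
  sets of objects; replacing the object set of \<open>C\<close> by one of them yields the full subcategory.\<close>

definition group_extension ::
    "'g monoid \<Rightarrow> ('p, 'n, 'k::field) mon_cat \<Rightarrow> ('o, 'm, 'k) mon_cat \<Rightarrow> bool"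
  where "group_extension G D C \<longleftrightarrow> group G \<and> finite (carrier G) \<and>
    (\<exists>grade :: 'g \<Rightarrow> 'o set.
      (\<forall>g\<in>carrier G. grade g \<subseteq> Ob C \<and>
        (\<forall>X\<in>grade g. \<forall>Y. isomorphic C X Y \<longrightarrow> Y \<in> grade g) \<and>
        (\<exists>X\<in>grade g. \<not> zero_object C X)) \<and>
      (\<forall>X\<in>Ob C. \<exists>Y inc prj. (\<forall>g\<in>carrier G. Y g \<in> grade g) \<and>
        direct_sum C (carrier G) Y X inc prj) \<and>
      (\<forall>g\<in>carrier G. \<forall>h\<in>carrier G. g \<noteq> h \<longrightarrow>
        (\<forall>X\<in>grade g. \<forall>Y\<in>grade h. Arr C X Y = {Zero C X Y})) \<and>
      (\<forall>g\<in>carrier G. \<forall>h\<in>carrier G. \<forall>X\<in>grade g. \<forall>Y\<in>grade h.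
        X \<boxtimes>\<^bsub>C\<^esub> Y \<in> grade (g \<otimes>\<^bsub>G\<^esub> h)) \<and>
      (\<forall>g\<in>carrier G. \<forall>X\<in>grade g. \<forall>Y. left_dual C X Y \<longrightarrow> Y \<in> grade (inv\<^bsub>G\<^esub> g)) \<and>
      tensor_equivalent (C\<lparr>Ob := grade \<one>\<^bsub>G\<^esub>\<rparr>) D)"

text \<open>An action of \<open>G\<close> by tensor autoequivalences \<open>\<rho>\<^sup>g\<close>, with monoidal isomorphisms
  \<open>comp_iso g h X : \<rho>\<^sup>g (\<rho>\<^sup>h X) \<rightarrow> \<rho>\<^sup>g\<^sup>h X\<close> and \<open>unit_iso X : X \<rightarrow> \<rho>\<^sup>e X\<close>; that is, a monoidal functor
  from \<open>G\<close> to the tensor autoequivalences of \<open>C\<close>.\<close>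

record ('g, 'o, 'm) cat_action =
  act :: "'g \<Rightarrow> ('o, 'm, 'o, 'm) mon_functor"
  comp_iso :: "'g \<Rightarrow> 'g \<Rightarrow> 'o \<Rightarrow> 'm"
  unit_iso :: "'o \<Rightarrow> 'm"

locale categorical_action =
  G: group G + C: linear_monoidal_category C
  for G :: "'g monoid" and C :: "('o, 'm, 'k::field) mon_cat" +
  fixes \<rho> :: "('g, 'o, 'm) cat_action"
  assumes act_equivalence: "g \<in> carrier G \<Longrightarrow> tensor_equivalence C C (act \<rho> g)"
    and comp_iso: "\<lbrakk>g \<in> carrier G; h \<in> carrier G\<rbrakk> \<Longrightarrow>
      monoidal_nat_iso C C (compose_functors C (act \<rho> g) (act \<rho> h)) (act \<rho> (g \<otimes>\<^bsub>G\<^esub> h))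
        (comp_iso \<rho> g h)"
    and unit_iso: "monoidal_nat_iso C C (identity_functor C) (act \<rho> \<one>\<^bsub>G\<^esub>) (unit_iso \<rho>)"
    and comp_iso_assoc:
      "\<lbrakk>g \<in> carrier G; h \<in> carrier G; l \<in> carrier G; X \<in> Ob C\<rbrakk> \<Longrightarrow>
      comp_iso \<rho> (g \<otimes>\<^bsub>G\<^esub> h) l X \<Zcomp>\<^bsub>C\<^esub> comp_iso \<rho> g h (FOb (act \<rho> l) X)
      = comp_iso \<rho> g (h \<otimes>\<^bsub>G\<^esub> l) X \<Zcomp>\<^bsub>C\<^esub>
        FArr (act \<rho> g) (FOb (act \<rho> h) (FOb (act \<rho> l) X)) (FOb (act \<rho> (h \<otimes>\<^bsub>G\<^esub> l)) X)
          (comp_iso \<rho> h l X)"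
    and comp_iso_unit_right: "\<lbrakk>g \<in> carrier G; X \<in> Ob C\<rbrakk> \<Longrightarrow>
      comp_iso \<rho> g \<one>\<^bsub>G\<^esub> X \<Zcomp>\<^bsub>C\<^esub>
        FArr (act \<rho> g) X (FOb (act \<rho> \<one>\<^bsub>G\<^esub>) X) (unit_iso \<rho> X) = Ide C (FOb (act \<rho> g) X)"
    and comp_iso_unit_left: "\<lbrakk>g \<in> carrier G; X \<in> Ob C\<rbrakk> \<Longrightarrow>
      comp_iso \<rho> \<one>\<^bsub>G\<^esub> g X \<Zcomp>\<^bsub>C\<^esub> unit_iso \<rho> (FOb (act \<rho> g) X) = Ide C (FOb (act \<rho> g) X)"

definition equivariant_object :: "'g monoid \<Rightarrow> ('o, 'm, 'k) mon_cat \<Rightarrow> ('g, 'o, 'm) cat_action \<Rightarrow>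
    'o \<times> ('g \<Rightarrow> 'm) \<Rightarrow> bool"
  where "equivariant_object G C \<rho> = (\<lambda>(X, \<mu>). X \<in> Ob C \<and> \<mu> \<in> extensional (carrier G) \<and>
    (\<forall>g\<in>carrier G. isomorphism C (FOb (act \<rho> g) X) X (\<mu> g)) \<and>
    (\<forall>g\<in>carrier G. \<forall>h\<in>carrier G.
      \<mu> (g \<otimes>\<^bsub>G\<^esub> h) \<Zcomp>\<^bsub>C\<^esub> comp_iso \<rho> g h X
      = \<mu> g \<Zcomp>\<^bsub>C\<^esub> FArr (act \<rho> g) (FOb (act \<rho> h) X) X (\<mu> h)) \<and>
    \<mu> \<one>\<^bsub>G\<^esub> \<Zcomp>\<^bsub>C\<^esub> unit_iso \<rho> X = Ide C X)"

definition equivariantization :: "'g monoid \<Rightarrow> ('o, 'm, 'k) mon_cat \<Rightarrow> ('g, 'o, 'm) cat_action \<Rightarrow>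
    ('o \<times> ('g \<Rightarrow> 'm), 'm, 'k) mon_cat"
  where "equivariantization G C \<rho> =
    \<lparr> Ob = {A. equivariant_object G C \<rho> A},
      Hom = (\<lambda>(X, \<mu>) (Y, \<nu>). (Hom C X Y)\<lparr>carrier := {f \<in> Arr C X Y.
        \<forall>g\<in>carrier G. f \<Zcomp>\<^bsub>C\<^esub> \<mu> g = \<nu> g \<Zcomp>\<^bsub>C\<^esub> FArr (act \<rho> g) X Y f}\<rparr>),
      Ide = (\<lambda>(X, \<mu>). Ide C X),
      Cmp = Cmp C,
      TenO = (\<lambda>(X, \<mu>) (Y, \<nu>). (X \<boxtimes>\<^bsub>C\<^esub> Y, \<lambda>g\<in>carrier G. (\<mu> g \<star>\<^bsub>C\<^esub> \<nu> g) \<Zcomp>\<^bsub>C\<^esub>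
        inverse_arrow C (FOb (act \<rho> g) X \<boxtimes>\<^bsub>C\<^esub> FOb (act \<rho> g) Y) (FOb (act \<rho> g) (X \<boxtimes>\<^bsub>C\<^esub> Y))
          (FTen (act \<rho> g) X Y))),
      TenA = TenA C,
      Unit = (Unit C, \<lambda>g\<in>carrier G.
        inverse_arrow C (Unit C) (FOb (act \<rho> g) (Unit C)) (FUn (act \<rho> g))),
      Asc = (\<lambda>(X, \<mu>) (Y, \<nu>) (Z, \<xi>). Asc C X Y Z),
      LUn = (\<lambda>(X, \<mu>). LUn C X),
      RUn = (\<lambda>(X, \<mu>). RUn C X) \<rparr>"

definition group_equivariantization ::
    "'g monoid \<Rightarrow> ('p, 'n, 'k::field) mon_cat \<Rightarrow> ('o, 'm, 'k) mon_cat \<Rightarrow> bool"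
  where "group_equivariantization G D C \<longleftrightarrow> finite (carrier G) \<and>
    (\<exists>\<rho>. categorical_action G D \<rho> \<and> tensor_equivalent (equivariantization G D \<rho>) C)"


section \<open>Vector spaces and solvability\<close>

text \<open>The Kronecker product; the index pair \<open>(i, i')\<close> is encoded as \<open>i * r + i'\<close>, where \<open>r\<close> is the size
  of the second factor. With this encoding it is strictly associative and unital.\<close>

definition kronecker :: "'k::semiring_1 mat \<Rightarrow> 'k mat \<Rightarrow> 'k mat"
  where "kronecker A B = mat (dim_row A * dim_row B) (dim_col A * dim_col B)
    (\<lambda>(i, j). A $$ (i div dim_row B, j div dim_col B) * B $$ (i mod dim_row B, j mod dim_col B))"

text \<open>Finite-dimensional vector spaces, with the spaces \<open>k\<^sup>n\<close> as objects.\<close>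

definition Vect :: "(nat, 'k::field mat, 'k) mon_cat"
  where "Vect =
    \<lparr> Ob = UNIV,
      Hom = (\<lambda>m n. module_mat TYPE('k) n m),
      Ide = (\<lambda>n. 1\<^sub>m n),
      Cmp = (*),
      TenO = (*),
      TenA = kronecker,
      Unit = 1,
      Asc = (\<lambda>l m n. 1\<^sub>m (l * m * n)),
      LUn = (\<lambda>n. 1\<^sub>m n),
      RUn = (\<lambda>n. 1\<^sub>m n) \<rparr>"

text \<open>The categories of the chain live on an object type \<open>'u\<close> and an arrow type \<open>'v\<close> that need not be
  those of \<open>C\<close>. Since every notion involved is invariant under tensor equivalence and any finite
  family of categories can be placed on common types, a category is solvable iff it is so for some
  \<open>'u\<close> and \<open>'v\<close>, and it is not solvable iff \<open>\<not> solvable_category TYPE('u) TYPE('v) C\<close> holds for all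
  \<open>'u\<close> and \<open>'v\<close>. Up to isomorphism all cyclic groups of prime order are found on the type \<open>int\<close>.\<close>

definition solvable_category :: "'u itself \<Rightarrow> 'v itself \<Rightarrow> ('o, 'm, 'k::field) mon_cat \<Rightarrow> bool"
  where "solvable_category TYPE('u) TYPE('v) C \<longleftrightarrow>
    (\<exists>(n::nat) (E :: nat \<Rightarrow> ('u, 'v, 'k) mon_cat).
      (\<forall>i\<le>n. fusion_category (E i)) \<and>
      tensor_equivalent Vect (E 0) \<and> tensor_equivalent (E n) C \<and>
      (\<forall>i<n. \<exists>G :: int monoid. group G \<and> cyclic_group G \<and> Factorial_Ring.prime (Coset.order G) \<and>
        (group_equivariantization G (E i) (E (Suc i)) \<or> group_extension G (E i) (E (Suc i)))))"


section \<open>Representations of Hopf algebras\<close>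

text \<open>A finite-dimensional Hopf algebra given by structure constants with respect to a basis:
  \<open>hmult a b c\<close> is the coefficient of \<open>c\<close> in \<open>a b\<close>, \<open>hcomult a b c\<close> that of \<open>b \<otimes> c\<close> in \<open>\<Delta> a\<close>, and
  \<open>hantipode a b\<close> that of \<open>b\<close> in \<open>S a\<close>.\<close>

record ('b, 'k) hopf_algebra =
  hbasis    :: "'b set"
  hmult     :: "'b \<Rightarrow> 'b \<Rightarrow> 'b \<Rightarrow> 'k"
  hunit     :: "'b \<Rightarrow> 'k"
  hcomult   :: "'b \<Rightarrow> 'b \<Rightarrow> 'b \<Rightarrow> 'k"
  hcounit   :: "'b \<Rightarrow> 'k"
  hantipode :: "'b \<Rightarrow> 'b \<Rightarrow> 'k"

text \<open>\<open>(n, R)\<close> is the left module structure on \<open>k\<^sup>n\<close> in which the basis element \<open>b\<close> acts by \<open>R b\<close>.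
  The antipode is not part of the monoidal structure of the representation category; it yields the
  duals, whose existence is a property.\<close>

definition matrix_rep ::
    "('b, 'k::field) hopf_algebra \<Rightarrow> nat \<times> ('b \<Rightarrow> 'k mat) \<Rightarrow> bool"
  where "matrix_rep H = (\<lambda>(n, R). R \<in> hbasis H \<rightarrow>\<^sub>E carrier_mat n n \<and>
    (\<forall>a\<in>hbasis H. \<forall>b\<in>hbasis H.
      R a * R b = mat n n (\<lambda>ij. \<Sum>c\<in>hbasis H. hmult H a b c * R c $$ ij)) \<and>
    mat n n (\<lambda>ij. \<Sum>c\<in>hbasis H. hunit H c * R c $$ ij) = 1\<^sub>m n)"

definition Rep :: "('b, 'k::field) hopf_algebra \<Rightarrow> (nat \<times> ('b \<Rightarrow> 'k mat), 'k mat, 'k) mon_cat"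
  where "Rep H =
    \<lparr> Ob = {V. matrix_rep H V},
      Hom = (\<lambda>(m, R) (n, S). (module_mat TYPE('k) n m)\<lparr>carrier :=
        {T \<in> carrier_mat n m. \<forall>a\<in>hbasis H. T * R a = S a * T}\<rparr>),
      Ide = (\<lambda>(n, R). 1\<^sub>m n),
      Cmp = (*),
      TenO = (\<lambda>(m, R) (n, S). (m * n, \<lambda>a\<in>hbasis H. mat (m * n) (m * n)
        (\<lambda>ij. \<Sum>b\<in>hbasis H. \<Sum>c\<in>hbasis H. hcomult H a b c * kronecker (R b) (S c) $$ ij))),
      TenA = kronecker,
      Unit = (1, \<lambda>a\<in>hbasis H. hcounit H a \<cdot>\<^sub>m 1\<^sub>m 1),
      Asc = (\<lambda>(l, R) (m, S) (n, T). 1\<^sub>m (l * m * n)),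
      LUn = (\<lambda>(n, R). 1\<^sub>m n),
      RUn = (\<lambda>(n, R). 1\<^sub>m n) \<rparr>"


section \<open>Bismash products\<close>

text \<open>For an exact factorization of \<open>M\<close> into \<open>F\<close> and \<open>\<Gamma>\<close>, the product \<open>s x\<close> with \<open>s \<in> \<Gamma>\<close>, \<open>x \<in> F\<close>
  is rewritten as \<open>(s \<rhd> x) (s \<lhd> x)\<close>.\<close>

definition act_left :: "'a monoid \<Rightarrow> 'a set \<Rightarrow> 'a set \<Rightarrow> 'a \<Rightarrow> 'a \<Rightarrow> 'a"
  where "act_left M F \<Gamma> s x = (THE y. y \<in> F \<and> (\<exists>t\<in>\<Gamma>. s \<otimes>\<^bsub>M\<^esub> x = y \<otimes>\<^bsub>M\<^esub> t))"

definition act_right :: "'a monoid \<Rightarrow> 'a set \<Rightarrow> 'a set \<Rightarrow> 'a \<Rightarrow> 'a \<Rightarrow> 'a"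
  where "act_right M F \<Gamma> s x = (THE t. t \<in> \<Gamma> \<and> (\<exists>y\<in>F. s \<otimes>\<^bsub>M\<^esub> x = y \<otimes>\<^bsub>M\<^esub> t))"

text \<open>The Hopf algebra \<open>k\<^sup>\<Gamma> # k F\<close>; the pair \<open>(s, x)\<close> stands for the basis element \<open>e\<^sub>s # x\<close>. Its unit is
  \<open>\<Sum>\<^sub>s e\<^sub>s # 1\<close>, its counit \<open>e\<^sub>s # x \<mapsto> \<delta>\<^sub>s\<^sub>,\<^sub>1\<close> and its antipode
  \<open>e\<^sub>s # x \<mapsto> e\<^sub>t # y\<close> with \<open>t = (s \<lhd> x)\<close> inverted and \<open>y = (s \<rhd> x)\<close> inverted.\<close>

definition bismash_product ::
    "'a monoid \<Rightarrow> 'a set \<Rightarrow> 'a set \<Rightarrow> ('a \<times> 'a, 'k::field) hopf_algebra"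
  where "bismash_product M F \<Gamma> =
    \<lparr> hbasis = \<Gamma> \<times> F,
      hmult = (\<lambda>(s, x) (t, y) c.
        of_bool (t = act_right M F \<Gamma> s x \<and> c = (s, x \<otimes>\<^bsub>M\<^esub> y))),
      hunit = (\<lambda>(s, x). of_bool (x = \<one>\<^bsub>M\<^esub>)),
      hcomult = (\<lambda>(s, x) (g, y) (h, w).
        of_bool (g \<otimes>\<^bsub>M\<^esub> h = s \<and> y = act_left M F \<Gamma> h x \<and> w = x)),
      hcounit = (\<lambda>(s, x). of_bool (s = \<one>\<^bsub>M\<^esub>)),
      hantipode = (\<lambda>(s, x) c.
        of_bool (c = (inv\<^bsub>M\<^esub> (act_right M F \<Gamma> s x), inv\<^bsub>M\<^esub> (act_left M F \<Gamma> s x)))) \<rparr>"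

definition long_cycle :: "nat \<Rightarrow> nat \<Rightarrow> nat"
  where "long_cycle n = cycle_of_list [1..<Suc n]"

text \<open>Products in the library's symmetric and alternating groups are composites of maps. The opposite
  convention gives isomorphic matched pairs, by passing to inverses.\<close>

definition Jhopf :: "nat \<Rightarrow> ((nat \<Rightarrow> nat) \<times> (nat \<Rightarrow> nat), 'k::field) hopf_algebra"
  where "Jhopf n = bismash_product (sym_group n) (generate (sym_group n) {long_cycle n})
    {\<sigma> \<in> carrier (sym_group n). \<sigma> n = n}"

text \<open>Only meant for odd \<open>n\<close>, where the cycle is an even permutation.\<close>

definition Khopf :: "nat \<Rightarrow> ((nat \<Rightarrow> nat) \<times> (nat \<Rightarrow> nat), 'k::field) hopf_algebra"
  where "Khopf n = bismash_product (alt_group n) (generate (alt_group n) {long_cycle n})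
    {\<sigma> \<in> carrier (alt_group n). \<sigma> n = n}"

end

theory Submission
  imports Defs "Jordan_Normal_Form.Determinant"
begin

text \<open>
  Let \<open>F\<close> be the subgroup of \<open>G = sym_group p\<close> generated by the long cycle, and \<open>A\<close> the alternating
  group. A simple module over \<open>J\<^sub>p\<close> or \<open>K\<^sub>p\<close> decomposes over the commutative subalgebra \<open>k\<^sup>\<Gamma>\<close>, and its
  weights form one orbit of \<open>F\<close> in \<open>\<Gamma>\<close>, that is, one double coset \<open>F m F\<close>, its support. Supports
  multiply under tensor products, a double coset with \<open>m\<close> not normalizing \<open>F\<close> supports exactly
  one simple object, and no simple object other than the unit whose support normalizes \<open>F\<close> commutes
  with all others, because nontrivial elements of \<open>F\<close> are centralized by no element of \<open>\<Gamma>\<close> but the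
  identity. These properties only involve which simple objects occur in tensor products, so they
  pass to every Grothendieck equivalent category.

  Now run down a chain witnessing solvability. For an extension by a cyclic group, the degree of a
  simple object depends only on its support: if \<open>D\<close> has support \<open>F\<close> and \<open>X\<close> has support \<open>F m F\<close> with
  \<open>m\<close> not normalizing \<open>F\<close>, then \<open>X\<close> occurs in \<open>D \<otimes> X\<close>, so \<open>D\<close> has trivial degree. The degree thus
  becomes a homomorphism to an abelian group, which is trivial on the perfect group \<open>A\<close>, and the
  trivial component again has supports covering \<open>A\<close>. An equivariantization contains the unit object
  twisted by a nontrivial character of the acting group; this object is invertible, central and not
  isomorphic to the unit. Invertibility forces its support to normalize \<open>F\<close>, so it cannot be
  central. Hence every step is an extension and the supports never shrink to those of \<open>Vect\<close>.
\<close>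

section \<open>Linear categories\<close>

text \<open>The invariant has to survive tensor equivalences, Grothendieck equivalences and both
  kinds of step, so it records only which simple objects occur in tensor products and where they are
  supported. The double cosets fill a group \<open>M\<close> that shrinks along the chain, while the
  alternating group \<open>A\<close> is a lower bound that never shrinks: for p \<ge> 5 it is
  perfect, hence killed by every degree in an abelian group. For the same reason noncentrality must
  be witnessed by an object whose support meets \<open>A\<close>. Such witnesses require a
  nontrivial even permutation that fixes p and normalizes the rotations; multiplication by 4 modulo
  p is one, being the square of multiplication by 2. Primality of p makes each orbit of weights
  either a fixed point or free, so simple modules are one-dimensional or induced, with no
  stabilizers in between. They are handled as explicit matrices. The twisted unit of an
  equivariantization can be told apart from the unit because endomorphisms of the unit are scalars
  all along the chain, a fact inherited from \<open>Vect\<close>.\<close>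

definition hom_nonzero :: "('o, 'm, 'k) mon_cat \<Rightarrow> 'o \<Rightarrow> 'o \<Rightarrow> bool"
  where "hom_nonzero C X Y \<longleftrightarrow> (\<exists>f\<in>Arr C X Y. f \<noteq> Zero C X Y)"

lemma linear_mapD:
  assumes "linear_map K V W T"
  shows "v \<in> carrier V \<Longrightarrow> T v \<in> carrier W"
    and "T \<zero>\<^bsub>V\<^esub> = \<zero>\<^bsub>W\<^esub>"
    and "\<lbrakk>v \<in> carrier V; w \<in> carrier V\<rbrakk> \<Longrightarrow> T (v \<oplus>\<^bsub>V\<^esub> w) = T v \<oplus>\<^bsub>W\<^esub> T w"
    and "\<lbrakk>a \<in> carrier K; v \<in> carrier V\<rbrakk> \<Longrightarrow> T (a \<odot>\<^bsub>V\<^esub> v) = a \<odot>\<^bsub>W\<^esub> T v"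
proof -
  interpret linear_map K V W T by fact
  show "v \<in> carrier V \<Longrightarrow> T v \<in> carrier W" by simp
  show "T \<zero>\<^bsub>V\<^esub> = \<zero>\<^bsub>W\<^esub>" by simp
  show "\<lbrakk>v \<in> carrier V; w \<in> carrier V\<rbrakk> \<Longrightarrow> T (v \<oplus>\<^bsub>V\<^esub> w) = T v \<oplus>\<^bsub>W\<^esub> T w"
    by (rule f_add)
  show "\<lbrakk>a \<in> carrier K; v \<in> carrier V\<rbrakk> \<Longrightarrow> T (a \<odot>\<^bsub>V\<^esub> v) = a \<odot>\<^bsub>W\<^esub> T v"
    by (rule f_smult)
qed

context linear_category
begin

lemma Zero_Arr: "\<lbrakk>X \<in> Ob C; Y \<in> Ob C\<rbrakk> \<Longrightarrow> Zero C X Y \<in> Arr C X Y"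
proof -
  assume "X \<in> Ob C" "Y \<in> Ob C"
  then interpret vectorspace class_ring "Hom C X Y" by (rule Hom_vectorspace)
  show ?thesis by simp
qed

lemma smult_Arr: "\<lbrakk>X \<in> Ob C; Y \<in> Ob C; f \<in> Arr C X Y\<rbrakk> \<Longrightarrow> c \<odot>\<^bsub>Hom C X Y\<^esub> f \<in> Arr C X Y"
proof -
  assume *: "X \<in> Ob C" "Y \<in> Ob C" "f \<in> Arr C X Y"
  then interpret vectorspace class_ring "Hom C X Y" by (intro Hom_vectorspace)
  show ?thesis using * by (intro smult_closed) (auto simp: class_ring_simps)
qed

lemma smult_smult:
  assumes "X \<in> Ob C" "Y \<in> Ob C" "f \<in> Arr C X Y"
  shows "c \<odot>\<^bsub>Hom C X Y\<^esub> (d \<odot>\<^bsub>Hom C X Y\<^esub> f) = (c * d) \<odot>\<^bsub>Hom C X Y\<^esub> f"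
    and "1 \<odot>\<^bsub>Hom C X Y\<^esub> f = f"
    and "0 \<odot>\<^bsub>Hom C X Y\<^esub> f = Zero C X Y"
    and "c \<odot>\<^bsub>Hom C X Y\<^esub> Zero C X Y = Zero C X Y"
proof -
  interpret vectorspace class_ring "Hom C X Y" using assms by (intro Hom_vectorspace)
  show "c \<odot>\<^bsub>Hom C X Y\<^esub> (d \<odot>\<^bsub>Hom C X Y\<^esub> f) = (c * d) \<odot>\<^bsub>Hom C X Y\<^esub> f"
    using smult_assoc1[of c d f] assms by (simp add: class_ring_simps)
  show "1 \<odot>\<^bsub>Hom C X Y\<^esub> f = f"
    using smult_one[of f] assms by (simp add: class_ring_simps)
  show "0 \<odot>\<^bsub>Hom C X Y\<^esub> f = Zero C X Y"
    using lmult_0[of f] assms by (simp add: class_ring_simps)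
  show "c \<odot>\<^bsub>Hom C X Y\<^esub> Zero C X Y = Zero C X Y"
    using rmult_0[of c] by (simp add: class_ring_simps)
qed

lemma smult_eq_Zero:
  assumes "X \<in> Ob C" "Y \<in> Ob C" "f \<in> Arr C X Y" "c \<odot>\<^bsub>Hom C X Y\<^esub> f = Zero C X Y" "f \<noteq> Zero C X Y"
  shows "c = 0"
proof (rule ccontr)
  assume "c \<noteq> 0"
  then have "f = inverse c \<odot>\<^bsub>Hom C X Y\<^esub> (c \<odot>\<^bsub>Hom C X Y\<^esub> f)"
    using assms(1-3) by (simp add: smult_smult)
  also have "\<dots> = Zero C X Y" using assms(1-4) by (simp add: smult_smult)
  finally show False using assms(5) by simp
qed

lemma smult_cancel:
  assumes "X \<in> Ob C" "Y \<in> Ob C" "f \<in> Arr C X Y" "c \<odot>\<^bsub>Hom C X Y\<^esub> f = d \<odot>\<^bsub>Hom C X Y\<^esub> f"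
    "f \<noteq> Zero C X Y"
  shows "c = d"
proof -
  interpret vectorspace class_ring "Hom C X Y" using assms by (intro Hom_vectorspace)
  have "(c - d) \<odot>\<^bsub>Hom C X Y\<^esub> f \<oplus>\<^bsub>Hom C X Y\<^esub> d \<odot>\<^bsub>Hom C X Y\<^esub> f = c \<odot>\<^bsub>Hom C X Y\<^esub> f"
    using smult_l_distr[of "c - d" d f] assms by (simp add: class_ring_simps)
  then have "(c - d) \<odot>\<^bsub>Hom C X Y\<^esub> f \<oplus>\<^bsub>Hom C X Y\<^esub> d \<odot>\<^bsub>Hom C X Y\<^esub> f = d \<odot>\<^bsub>Hom C X Y\<^esub> f"
    using assms by simp
  then have "(c - d) \<odot>\<^bsub>Hom C X Y\<^esub> f = Zero C X Y"
    using M.add.l_cancel_one[of "d \<odot>\<^bsub>Hom C X Y\<^esub> f" "(c - d) \<odot>\<^bsub>Hom C X Y\<^esub> f"]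
      smult_Arr[OF assms(1-3)] by simp
  then show ?thesis using smult_eq_Zero[of X Y f "c - d"] assms by simp
qed

lemma Cmp_Arr: "\<lbrakk>X \<in> Ob C; Y \<in> Ob C; Z \<in> Ob C; f \<in> Arr C X Y; g \<in> Arr C Y Z\<rbrakk> \<Longrightarrow> g \<Zcomp> f \<in> Arr C X Z"
  using linear_mapD(1)[OF Cmp_linear_right] by blast

lemma Cmp_Zero_right:
  "\<lbrakk>X \<in> Ob C; Y \<in> Ob C; Z \<in> Ob C; g \<in> Arr C Y Z\<rbrakk> \<Longrightarrow> g \<Zcomp> Zero C X Y = Zero C X Z"
  using linear_mapD(2)[OF Cmp_linear_right] by blast

lemma Cmp_Zero_left:
  "\<lbrakk>X \<in> Ob C; Y \<in> Ob C; Z \<in> Ob C; f \<in> Arr C X Y\<rbrakk> \<Longrightarrow> Zero C Y Z \<Zcomp> f = Zero C X Z"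
  using linear_mapD(2)[OF Cmp_linear_left] by blast

lemma Cmp_smult_right:
  "\<lbrakk>X \<in> Ob C; Y \<in> Ob C; Z \<in> Ob C; f \<in> Arr C X Y; g \<in> Arr C Y Z\<rbrakk> \<Longrightarrow>
    g \<Zcomp> (c \<odot>\<^bsub>Hom C X Y\<^esub> f) = c \<odot>\<^bsub>Hom C X Z\<^esub> (g \<Zcomp> f)"
  using linear_mapD(4)[OF Cmp_linear_right, where a = c] by (simp add: class_ring_simps)

lemma Cmp_smult_left:
  "\<lbrakk>X \<in> Ob C; Y \<in> Ob C; Z \<in> Ob C; f \<in> Arr C X Y; g \<in> Arr C Y Z\<rbrakk> \<Longrightarrow>
    (c \<odot>\<^bsub>Hom C Y Z\<^esub> g) \<Zcomp> f = c \<odot>\<^bsub>Hom C X Z\<^esub> (g \<Zcomp> f)"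
  using linear_mapD(4)[OF Cmp_linear_left, where a = c] by (simp add: class_ring_simps)

lemma isomorphismE:
  assumes "isomorphism C X Y f"
  obtains g where "f \<in> Arr C X Y" "g \<in> Arr C Y X" "g \<Zcomp> f = Ide C X" "f \<Zcomp> g = Ide C Y"
    "isomorphism C Y X g"
  using assms unfolding isomorphism_def by blast

lemma isomorphism_Ide: "X \<in> Ob C \<Longrightarrow> isomorphism C X X (Ide C X)"
  unfolding isomorphism_def using Id_Arr Cmp_Id_left by blast

lemma isomorphism_Cmp:
  assumes "isomorphism C X Y f" "isomorphism C Y Z g" "X \<in> Ob C" "Y \<in> Ob C" "Z \<in> Ob C"
  shows "isomorphism C X Z (g \<Zcomp> f)"
proof -
  obtain f' where f: "f \<in> Arr C X Y" "f' \<in> Arr C Y X" "f' \<Zcomp> f = Ide C X" "f \<Zcomp> f' = Ide C Y"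
    using assms(1) unfolding isomorphism_def by blast
  obtain g' where g: "g \<in> Arr C Y Z" "g' \<in> Arr C Z Y" "g' \<Zcomp> g = Ide C Y" "g \<Zcomp> g' = Ide C Z"
    using assms(2) unfolding isomorphism_def by blast
  have "(f' \<Zcomp> g') \<Zcomp> (g \<Zcomp> f) = f' \<Zcomp> ((g' \<Zcomp> g) \<Zcomp> f)"
    using f(1,2) g(1,2) assms by (simp add: Cmp_assoc Cmp_Arr)
  moreover have "(g \<Zcomp> f) \<Zcomp> (f' \<Zcomp> g') = g \<Zcomp> ((f \<Zcomp> f') \<Zcomp> g')"
    using f(1,2) g(1,2) assms by (simp add: Cmp_assoc Cmp_Arr)
  moreover have "f' \<Zcomp> g' \<in> Arr C Z X" "g \<Zcomp> f \<in> Arr C X Z" using f g assms Cmp_Arr by auto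
  ultimately show ?thesis
    unfolding isomorphism_def using f g assms by (auto simp: Cmp_Id_left intro!: bexI[of _ "f' \<Zcomp> g'"])
qed

lemma inverse_arrow_eq:
  assumes "X \<in> Ob C" "Y \<in> Ob C" "f \<in> Arr C X Y" "g \<in> Arr C Y X" "g \<Zcomp> f = Ide C X" "f \<Zcomp> g = Ide C Y"
  shows "inverse_arrow C X Y f = g"
  unfolding inverse_arrow_def
proof (rule the_equality)
  fix h assume h: "h \<in> Arr C Y X \<and> h \<Zcomp> f = Ide C X \<and> f \<Zcomp> h = Ide C Y"
  then have "h = h \<Zcomp> (f \<Zcomp> g)" using assms by (simp add: Cmp_Id_right)
  also have "\<dots> = (h \<Zcomp> f) \<Zcomp> g" using assms h by (subst Cmp_assoc) auto
  finally show "h = g" using h assms by (simp add: Cmp_Id_left)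
qed (use assms in auto)

lemma inverse_arrow:
  assumes "isomorphism C X Y f" "X \<in> Ob C" "Y \<in> Ob C"
  shows "inverse_arrow C X Y f \<in> Arr C Y X" "inverse_arrow C X Y f \<Zcomp> f = Ide C X"
    "f \<Zcomp> inverse_arrow C X Y f = Ide C Y" "isomorphism C Y X (inverse_arrow C X Y f)"
proof -
  obtain g where g: "f \<in> Arr C X Y" "g \<in> Arr C Y X" "g \<Zcomp> f = Ide C X" "f \<Zcomp> g = Ide C Y"
    "isomorphism C Y X g"
    using isomorphismE[OF assms(1)] by blast
  have "inverse_arrow C X Y f = g" using inverse_arrow_eq assms g by blast
  then show "inverse_arrow C X Y f \<in> Arr C Y X" "inverse_arrow C X Y f \<Zcomp> f = Ide C X"
    "f \<Zcomp> inverse_arrow C X Y f = Ide C Y" "isomorphism C Y X (inverse_arrow C X Y f)"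
    using g by auto
qed

lemma isomorphicI: "\<lbrakk>isomorphism C X Y f; X \<in> Ob C; Y \<in> Ob C\<rbrakk> \<Longrightarrow> isomorphic C X Y"
  unfolding isomorphic_def by blast

lemma isomorphic_Ob: "isomorphic C X Y \<Longrightarrow> X \<in> Ob C" "isomorphic C X Y \<Longrightarrow> Y \<in> Ob C"
  unfolding isomorphic_def by auto

lemma isomorphic_refl: "X \<in> Ob C \<Longrightarrow> isomorphic C X X"
  using isomorphism_Ide isomorphicI by blast

lemma isomorphic_sym: "isomorphic C X Y \<Longrightarrow> isomorphic C Y X"
  unfolding isomorphic_def isomorphism_def by blast

lemma isomorphic_trans [trans]: "\<lbrakk>isomorphic C X Y; isomorphic C Y Z\<rbrakk> \<Longrightarrow> isomorphic C X Z"
  unfolding isomorphic_def using isomorphism_Cmp by blast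

lemma iso_class_eq_iff:
  "\<lbrakk>X \<in> Ob C; Y \<in> Ob C\<rbrakk> \<Longrightarrow> iso_class C X = iso_class C Y \<longleftrightarrow> isomorphic C X Y"
  unfolding iso_class_def using isomorphic_refl isomorphic_sym isomorphic_trans by blast

lemma representative_iso_class: "X \<in> Ob C \<Longrightarrow> isomorphic C X (representative (iso_class C X))"
  unfolding representative_def iso_class_def mem_Collect_eq
  by (rule someI[where P = "isomorphic C X"]) (rule isomorphic_refl)

lemma hom_nonzero_isomorphic_aux:
  assumes "isomorphic C X X'" "isomorphic C Y Y'" "hom_nonzero C X Y"
  shows "hom_nonzero C X' Y'"
proof -
  note Ob = isomorphic_Ob[OF assms(1)] isomorphic_Ob[OF assms(2)]
  obtain u where u: "isomorphism C X X' u" using assms(1) unfolding isomorphic_def by blast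
  obtain v where v: "isomorphism C Y Y' v" using assms(2) unfolding isomorphic_def by blast
  obtain u' where u': "u \<in> Arr C X X'" "u' \<in> Arr C X' X" "u' \<Zcomp> u = Ide C X"
    using isomorphismE[OF u] by blast
  obtain v' where v': "v \<in> Arr C Y Y'" "v' \<in> Arr C Y' Y" "v' \<Zcomp> v = Ide C Y"
    using isomorphismE[OF v] by blast
  obtain f where f: "f \<in> Arr C X Y" "f \<noteq> Zero C X Y" using assms(3) unfolding hom_nonzero_def by blast
  have "v \<Zcomp> (f \<Zcomp> u') \<noteq> Zero C X' Y'"
  proof
    assume z: "v \<Zcomp> (f \<Zcomp> u') = Zero C X' Y'"
    have "f = (v' \<Zcomp> v) \<Zcomp> (f \<Zcomp> (u' \<Zcomp> u))" using f u' v' Ob by (simp add: Cmp_Id_left Cmp_Id_right)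
    also have "\<dots> = v' \<Zcomp> ((v \<Zcomp> (f \<Zcomp> u')) \<Zcomp> u)"
      using f u'(1,2) v'(1,2) Ob by (simp add: Cmp_assoc Cmp_Arr)
    also have "\<dots> = Zero C X Y" using z u' v' Ob by (simp add: Cmp_Zero_left Cmp_Zero_right)
    finally show False using f by simp
  qed
  then show ?thesis unfolding hom_nonzero_def using f u' v' Ob by (meson Cmp_Arr)
qed

lemma hom_nonzero_isomorphic:
  "\<lbrakk>isomorphic C X X'; isomorphic C Y Y'\<rbrakk> \<Longrightarrow> hom_nonzero C X Y \<longleftrightarrow> hom_nonzero C X' Y'"
  using hom_nonzero_isomorphic_aux isomorphic_sym by blast

lemma hom_nonzero_refl: "X \<in> Ob C \<Longrightarrow> \<not> zero_object C X \<Longrightarrow> hom_nonzero C X X"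
  unfolding hom_nonzero_def zero_object_def using Id_Arr by blast

lemma Arr_zero_source: "\<lbrakk>zero_object C X; Y \<in> Ob C; f \<in> Arr C X Y\<rbrakk> \<Longrightarrow> f = Zero C X Y"
  unfolding zero_object_def using Cmp_Id_right Cmp_Zero_right by metis

lemma Arr_zero_target: "\<lbrakk>zero_object C Y; X \<in> Ob C; f \<in> Arr C X Y\<rbrakk> \<Longrightarrow> f = Zero C X Y"
  unfolding zero_object_def using Cmp_Id_left Cmp_Zero_left by metis

lemma zero_object_isomorphic: "isomorphic C X Y \<Longrightarrow> zero_object C X \<Longrightarrow> zero_object C Y"
  using hom_nonzero_isomorphic[of X Y X Y] hom_nonzero_refl Arr_zero_source
    isomorphic_Ob unfolding hom_nonzero_def by metis

lemma isomorphism_monic: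
  assumes "isomorphism C X Y f" "X \<in> Ob C" "Y \<in> Ob C"
  shows "monic C X Y f"
proof -
  obtain g where g: "f \<in> Arr C X Y" "g \<in> Arr C Y X" "g \<Zcomp> f = Ide C X"
    using isomorphismE[OF assms(1)] by blast
  have "h = g \<Zcomp> (f \<Zcomp> h)" if "W \<in> Ob C" "h \<in> Arr C W X" for W h
    using that g assms by (metis Cmp_assoc Cmp_Id_left)
  then show ?thesis unfolding monic_def using g by metis
qed

lemma split_monic:
  assumes "X \<in> Ob C" "Y \<in> Ob C" "f \<in> Arr C X Y" "g \<in> Arr C Y X" "g \<Zcomp> f = Ide C X"
  shows "monic C X Y f"
proof -
  have "h = g \<Zcomp> (f \<Zcomp> h)" if "W \<in> Ob C" "h \<in> Arr C W X" for W h
    using that assms by (metis Cmp_assoc Cmp_Id_left)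
  then show ?thesis unfolding monic_def using assms by metis
qed

lemma monic_Cmp:
  assumes "monic C X Y f" "monic C Y Z g" "X \<in> Ob C" "Y \<in> Ob C" "Z \<in> Ob C"
  shows "monic C X Z (g \<Zcomp> f)"
  unfolding monic_def
proof (intro conjI ballI impI)
  have fg: "f \<in> Arr C X Y" "g \<in> Arr C Y Z" using assms unfolding monic_def by auto
  then show "g \<Zcomp> f \<in> Arr C X Z" using assms Cmp_Arr by blast
  fix W h k assume *: "W \<in> Ob C" "h \<in> Arr C W X" "k \<in> Arr C W X" "(g \<Zcomp> f) \<Zcomp> h = (g \<Zcomp> f) \<Zcomp> k"
  then have "g \<Zcomp> (f \<Zcomp> h) = g \<Zcomp> (f \<Zcomp> k)" using fg assms by (simp add: Cmp_assoc)
  then have "f \<Zcomp> h = f \<Zcomp> k" using assms * fg unfolding monic_def by (meson Cmp_Arr)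
  then show "h = k" using assms * unfolding monic_def by blast
qed

lemma simple_objectD: "simple_object C X \<Longrightarrow> X \<in> Ob C" "simple_object C X \<Longrightarrow> \<not> zero_object C X"
  unfolding simple_object_def by auto

text \<open>Retracts embed by split monics, which simplicity turns into isomorphisms.\<close>

lemma simple_split:
  assumes "simple_object C X" "V \<in> Ob C" "\<not> zero_object C V" "i \<in> Arr C V X" "p \<in> Arr C X V"
    "p \<Zcomp> i = Ide C V"
  shows "isomorphism C V X i"
  using assms split_monic[of V X i p] unfolding simple_object_def by blast

text \<open>A monic into \<open>X'\<close> followed by the isomorphism to \<open>X\<close> is a
  monic into \<open>X\<close>, hence invertible; composing back recovers the original arrow.\<close>

lemma simple_object_isomorphic:
  assumes "isomorphic C X X'" "simple_object C X"
  shows "simple_object C X'"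
proof -
  note Ob = isomorphic_Ob[OF assms(1)]
  obtain v where v: "isomorphism C X' X v"
    using isomorphic_sym[OF assms(1)] unfolding isomorphic_def by blast
  obtain v' where v': "v \<in> Arr C X' X" "v' \<in> Arr C X X'" "v' \<Zcomp> v = Ide C X'" "isomorphism C X X' v'"
    using isomorphismE[OF v] by blast
  have "isomorphism C Y X' f" if Y: "Y \<in> Ob C" "monic C Y X' f" "\<not> zero_object C Y" for Y f
  proof -
    have f: "f \<in> Arr C Y X'" using Y unfolding monic_def by blast
    have "monic C Y X (v \<Zcomp> f)" using Y Ob v isomorphism_monic monic_Cmp by blast
    then have "isomorphism C Y X (v \<Zcomp> f)" using assms(2) Y unfolding simple_object_def by blast
    then have "isomorphism C Y X' (v' \<Zcomp> (v \<Zcomp> f))" using isomorphism_Cmp v' Ob Y by blast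
    moreover have "v' \<Zcomp> (v \<Zcomp> f) = f" using f v' Y Ob by (metis Cmp_assoc Cmp_Id_left)
    ultimately show ?thesis by simp
  qed
  moreover have "\<not> zero_object C X'"
    using assms zero_object_isomorphic isomorphic_sym unfolding simple_object_def by blast
  ultimately show ?thesis unfolding simple_object_def using Ob by blast
qed

end

section \<open>Tensor products and isomorphism\<close>

context linear_monoidal_category
begin

lemma TenA_Arr:
  "\<lbrakk>X \<in> Ob C; X' \<in> Ob C; Y \<in> Ob C; Y' \<in> Ob C; f \<in> Arr C X X'; g \<in> Arr C Y Y'\<rbrakk> \<Longrightarrow>
    f \<star> g \<in> Arr C (X \<boxtimes> Y) (X' \<boxtimes> Y')"
  using linear_mapD(1)[OF TenA_linear_right] by blast

lemma isomorphism_TenA: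
  assumes "isomorphism C X X' f" "isomorphism C Y Y' g" "X \<in> Ob C" "X' \<in> Ob C" "Y \<in> Ob C" "Y' \<in> Ob C"
  shows "isomorphism C (X \<boxtimes> Y) (X' \<boxtimes> Y') (f \<star> g)"
proof -
  obtain f' where f: "f \<in> Arr C X X'" "f' \<in> Arr C X' X" "f' \<Zcomp> f = Ide C X" "f \<Zcomp> f' = Ide C X'"
    using assms(1) unfolding isomorphism_def by blast
  obtain g' where g: "g \<in> Arr C Y Y'" "g' \<in> Arr C Y' Y" "g' \<Zcomp> g = Ide C Y" "g \<Zcomp> g' = Ide C Y'"
    using assms(2) unfolding isomorphism_def by blast
  have "(f' \<star> g') \<Zcomp> (f \<star> g) = Ide C (X \<boxtimes> Y)" "(f \<star> g) \<Zcomp> (f' \<star> g') = Ide C (X' \<boxtimes> Y')"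
    using f g assms TenA_Cmp[symmetric] TenA_Id by auto
  then show ?thesis unfolding isomorphism_def using f g assms TenA_Arr by blast
qed

lemma isomorphic_TenO:
  "\<lbrakk>isomorphic C X X'; isomorphic C Y Y'\<rbrakk> \<Longrightarrow> isomorphic C (X \<boxtimes> Y) (X' \<boxtimes> Y')"
  unfolding isomorphic_def using isomorphism_TenA TenO_Ob by blast

lemma hom_nonzero_TenO:
  "\<lbrakk>isomorphic C X X'; isomorphic C Y Y'; isomorphic C Z Z'\<rbrakk> \<Longrightarrow>
    hom_nonzero C Z (X \<boxtimes> Y) \<longleftrightarrow> hom_nonzero C Z' (X' \<boxtimes> Y')"
  using hom_nonzero_isomorphic isomorphic_TenO by blast

end

lemma (in tensor_functor) FArr_Arr:
  "\<lbrakk>X \<in> Ob C; Y \<in> Ob C; f \<in> Arr C X Y\<rbrakk> \<Longrightarrow> FArr F X Y f \<in> Arr D (FOb F X) (FOb F Y)"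
  using linear_mapD(1)[OF FArr_linear] by blast

lemma (in tensor_functor) FArr_Zero:
  "\<lbrakk>X \<in> Ob C; Y \<in> Ob C\<rbrakk> \<Longrightarrow> FArr F X Y (Zero C X Y) = Zero D (FOb F X) (FOb F Y)"
  using linear_mapD(2)[OF FArr_linear] by blast

lemma (in tensor_functor) FArr_smult:
  "\<lbrakk>X \<in> Ob C; Y \<in> Ob C; f \<in> Arr C X Y\<rbrakk> \<Longrightarrow>
    FArr F X Y (c \<odot>\<^bsub>Hom C X Y\<^esub> f) = c \<odot>\<^bsub>Hom D (FOb F X) (FOb F Y)\<^esub> FArr F X Y f"
  using linear_mapD(4)[OF FArr_linear, where a = c] by (simp add: class_ring_simps)

lemma (in tensor_functor) FOb_TenO:
  "\<lbrakk>X \<in> Ob C; Y \<in> Ob C\<rbrakk> \<Longrightarrow> isomorphic D (FOb F X \<boxtimes>\<^bsub>D\<^esub> FOb F Y) (FOb F (X \<boxtimes>\<^bsub>C\<^esub> Y))"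
  using D.isomorphicI[OF FTen_iso] by (simp add: FOb_Ob C.TenO_Ob D.TenO_Ob)

lemma (in tensor_functor) FOb_Unit: "isomorphic D (Unit D) (FOb F (Unit C))"
  using D.isomorphicI[OF FUn_iso] by (simp add: FOb_Ob C.Unit_Ob D.Unit_Ob)

section \<open>Invariance of simple objects under tensor equivalence\<close>

context tensor_equivalence
begin

lemma FArr_inject:
  "\<lbrakk>X \<in> Ob C; Y \<in> Ob C; f \<in> Arr C X Y; g \<in> Arr C X Y\<rbrakk> \<Longrightarrow> FArr F X Y f = FArr F X Y g \<longleftrightarrow> f = g"
  using fully_faithful[of X Y] unfolding bij_betw_def by (auto dest: inj_onD)

lemma FArr_surj:
  assumes "X \<in> Ob C" "Y \<in> Ob C" "g \<in> Arr D (FOb F X) (FOb F Y)"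
  obtains f where "f \<in> Arr C X Y" "FArr F X Y f = g"
  using fully_faithful[OF assms(1,2)] assms(3) that unfolding bij_betw_def by (metis imageE)

lemma isomorphism_FArr:
  assumes "X \<in> Ob C" "Y \<in> Ob C" "f \<in> Arr C X Y"
  shows "isomorphism D (FOb F X) (FOb F Y) (FArr F X Y f) \<longleftrightarrow> isomorphism C X Y f"
proof
  assume "isomorphism C X Y f"
  then obtain g where "g \<in> Arr C Y X" "g \<Zcomp>\<^bsub>C\<^esub> f = Ide C X" "f \<Zcomp>\<^bsub>C\<^esub> g = Ide C Y"
    unfolding isomorphism_def by blast
  then show "isomorphism D (FOb F X) (FOb F Y) (FArr F X Y f)"
    unfolding isomorphism_def using assms FArr_Arr FArr_Cmp FArr_Id by metis
next
  assume "isomorphism D (FOb F X) (FOb F Y) (FArr F X Y f)"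
  then obtain h where h: "h \<in> Arr D (FOb F Y) (FOb F X)"
    "h \<Zcomp>\<^bsub>D\<^esub> FArr F X Y f = Ide D (FOb F X)" "FArr F X Y f \<Zcomp>\<^bsub>D\<^esub> h = Ide D (FOb F Y)"
    unfolding isomorphism_def by blast
  obtain g where g: "g \<in> Arr C Y X" "FArr F Y X g = h" using FArr_surj h assms by metis
  have "FArr F X X (g \<Zcomp>\<^bsub>C\<^esub> f) = FArr F X X (Ide C X)" "FArr F Y Y (f \<Zcomp>\<^bsub>C\<^esub> g) = FArr F Y Y (Ide C Y)"
    using h g assms FArr_Cmp[of X Y X f g] FArr_Cmp[of Y X Y g f] by (simp_all add: FArr_Id)
  then have "g \<Zcomp>\<^bsub>C\<^esub> f = Ide C X" "f \<Zcomp>\<^bsub>C\<^esub> g = Ide C Y"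
    using FArr_inject[OF assms(1,1) C.Cmp_Arr[OF assms(1,2,1,3) g(1)] C.Id_Arr[OF assms(1)]]
      FArr_inject[OF assms(2,2) C.Cmp_Arr[OF assms(2,1,2) g(1) assms(3)] C.Id_Arr[OF assms(2)]]
    by simp_all
  then show "isomorphism C X Y f" unfolding isomorphism_def using assms g by blast
qed

lemma isomorphic_FOb:
  assumes "X \<in> Ob C" "Y \<in> Ob C"
  shows "isomorphic D (FOb F X) (FOb F Y) \<longleftrightarrow> isomorphic C X Y"
proof
  assume "isomorphic D (FOb F X) (FOb F Y)"
  then obtain g where g: "isomorphism D (FOb F X) (FOb F Y) g" unfolding isomorphic_def by blast
  then have "g \<in> Arr D (FOb F X) (FOb F Y)" unfolding isomorphism_def by blast
  then obtain f where "f \<in> Arr C X Y" "FArr F X Y f = g" using FArr_surj[OF assms] by metis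
  then show "isomorphic C X Y" using g isomorphism_FArr[OF assms] assms C.isomorphicI by metis
next
  assume "isomorphic C X Y"
  then obtain f where f: "isomorphism C X Y f" unfolding isomorphic_def by blast
  then have "f \<in> Arr C X Y" unfolding isomorphism_def by blast
  then show "isomorphic D (FOb F X) (FOb F Y)"
    using f isomorphism_FArr[OF assms] assms D.isomorphicI FOb_Ob by metis
qed

lemma FArr_eq_Zero:
  "\<lbrakk>X \<in> Ob C; Y \<in> Ob C; f \<in> Arr C X Y\<rbrakk> \<Longrightarrow>
    FArr F X Y f = Zero D (FOb F X) (FOb F Y) \<longleftrightarrow> f = Zero C X Y"
  using FArr_inject[of X Y f "Zero C X Y"] FArr_Zero[of X Y] C.Zero_Arr[of X Y] by simp

lemma hom_nonzero_FOb:
  assumes "X \<in> Ob C" "Y \<in> Ob C"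
  shows "hom_nonzero D (FOb F X) (FOb F Y) \<longleftrightarrow> hom_nonzero C X Y"
proof
  assume "hom_nonzero D (FOb F X) (FOb F Y)"
  then obtain g where "g \<in> Arr D (FOb F X) (FOb F Y)" "g \<noteq> Zero D (FOb F X) (FOb F Y)"
    unfolding hom_nonzero_def by blast
  then show "hom_nonzero C X Y"
    using FArr_surj[OF assms] FArr_eq_Zero[OF assms] unfolding hom_nonzero_def by metis
next
  assume "hom_nonzero C X Y"
  then show "hom_nonzero D (FOb F X) (FOb F Y)"
    using FArr_Arr[OF assms] FArr_eq_Zero[OF assms] unfolding hom_nonzero_def by metis
qed

lemma hom_nonzero_FOb_TenO:
  assumes "X \<in> Ob C" "Y \<in> Ob C" "Z \<in> Ob C"
  shows "hom_nonzero D (FOb F Z) (FOb F X \<boxtimes>\<^bsub>D\<^esub> FOb F Y) \<longleftrightarrow> hom_nonzero C Z (X \<boxtimes>\<^bsub>C\<^esub> Y)"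
  using D.hom_nonzero_isomorphic[OF D.isomorphic_refl[OF FOb_Ob[OF assms(3)]] FOb_TenO[OF assms(1,2)]]
    hom_nonzero_FOb[OF assms(3) C.TenO_Ob[OF assms(1,2)]] by simp

lemma zero_object_FOb:
  assumes "X \<in> Ob C"
  shows "zero_object D (FOb F X) \<longleftrightarrow> zero_object C X"
  unfolding zero_object_def
  using FArr_eq_Zero[OF assms assms C.Id_Arr[OF assms]] FArr_Id[OF assms] FOb_Ob[OF assms] assms
  by simp

lemma monic_FArr:
  assumes "X \<in> Ob C" "Y \<in> Ob C" "f \<in> Arr C X Y"
  shows "monic D (FOb F X) (FOb F Y) (FArr F X Y f) \<longleftrightarrow> monic C X Y f"
proof
  assume *: "monic D (FOb F X) (FOb F Y) (FArr F X Y f)"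
  show "monic C X Y f"
    unfolding monic_def
  proof (intro conjI ballI impI)
    fix W g h assume W: "W \<in> Ob C" "g \<in> Arr C W X" "h \<in> Arr C W X" "f \<Zcomp>\<^bsub>C\<^esub> g = f \<Zcomp>\<^bsub>C\<^esub> h"
    then have "FArr F X Y f \<Zcomp>\<^bsub>D\<^esub> FArr F W X g = FArr F X Y f \<Zcomp>\<^bsub>D\<^esub> FArr F W X h"
      using assms by (metis FArr_Cmp)
    then have "FArr F W X g = FArr F W X h"
      using * FOb_Ob[OF W(1)] FArr_Arr[OF W(1) assms(1) W(2)] FArr_Arr[OF W(1) assms(1) W(3)]
      unfolding monic_def by simp
    then show "g = h" using FArr_inject[OF W(1) assms(1) W(2,3)] by simp
  qed fact
next
  assume *: "monic C X Y f"
  show "monic D (FOb F X) (FOb F Y) (FArr F X Y f)"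
    unfolding monic_def
  proof (intro conjI ballI impI)
    show "FArr F X Y f \<in> Arr D (FOb F X) (FOb F Y)" using assms FArr_Arr by blast
    fix W g h assume W: "W \<in> Ob D" "g \<in> Arr D W (FOb F X)" "h \<in> Arr D W (FOb F X)"
      "FArr F X Y f \<Zcomp>\<^bsub>D\<^esub> g = FArr F X Y f \<Zcomp>\<^bsub>D\<^esub> h"
    \<comment> \<open>The test object \<open>W\<close> need not be a value of \<open>F\<close>.
      Precomposing with an isomorphism from some \<open>FOb F V\<close> brings both arrows into the
      range of \<open>FArr\<close>, where the monicity of \<open>f\<close> applies.\<close>
    obtain V u where V: "V \<in> Ob C" "isomorphism D (FOb F V) W u"
      using essentially_surjective[OF W(1)] unfolding isomorphic_def by blast
    obtain u' where u: "u \<in> Arr D (FOb F V) W" "u' \<in> Arr D W (FOb F V)" "u \<Zcomp>\<^bsub>D\<^esub> u' = Ide D W"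
      using D.isomorphismE[OF V(2)] by blast
    note Ob = FOb_Ob[OF V(1)] FOb_Ob[OF assms(1)] FOb_Ob[OF assms(2)] W(1)
    obtain g0 where g0: "g0 \<in> Arr C V X" "FArr F V X g0 = g \<Zcomp>\<^bsub>D\<^esub> u"
      using FArr_surj[OF V(1) assms(1) D.Cmp_Arr[OF Ob(1) W(1) Ob(2) u(1) W(2)]] by metis
    obtain h0 where h0: "h0 \<in> Arr C V X" "FArr F V X h0 = h \<Zcomp>\<^bsub>D\<^esub> u"
      using FArr_surj[OF V(1) assms(1) D.Cmp_Arr[OF Ob(1) W(1) Ob(2) u(1) W(3)]] by metis
    have "FArr F X Y f \<Zcomp>\<^bsub>D\<^esub> (g \<Zcomp>\<^bsub>D\<^esub> u) = FArr F X Y f \<Zcomp>\<^bsub>D\<^esub> (h \<Zcomp>\<^bsub>D\<^esub> u)"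
      using W(4) D.Cmp_assoc[OF Ob(1) W(1) Ob(2,3) u(1) _ FArr_Arr[OF assms]] W(2,3) by metis
    then have "FArr F V Y (f \<Zcomp>\<^bsub>C\<^esub> g0) = FArr F V Y (f \<Zcomp>\<^bsub>C\<^esub> h0)"
      using g0 h0 V(1) assms FArr_Cmp[of V X Y g0 f] FArr_Cmp[of V X Y h0 f] by simp
    then have "f \<Zcomp>\<^bsub>C\<^esub> g0 = f \<Zcomp>\<^bsub>C\<^esub> h0"
      using FArr_inject[OF V(1) assms(2) C.Cmp_Arr[OF V(1) assms(1,2) g0(1) assms(3)]
          C.Cmp_Arr[OF V(1) assms(1,2) h0(1) assms(3)]] by simp
    then have "g0 = h0" using * V g0 h0 unfolding monic_def by blast
    then have "(g \<Zcomp>\<^bsub>D\<^esub> u) \<Zcomp>\<^bsub>D\<^esub> u' = (h \<Zcomp>\<^bsub>D\<^esub> u) \<Zcomp>\<^bsub>D\<^esub> u'" using g0 h0 by simp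
    then show "g = h" using u W Ob by (simp add: D.Cmp_assoc D.Cmp_Id_right)
  qed
qed

lemma simple_object_FOb:
  assumes "X \<in> Ob C"
  shows "simple_object D (FOb F X) \<longleftrightarrow> simple_object C X"
proof
  assume *: "simple_object D (FOb F X)"
  have "isomorphism C Y X f" if "Y \<in> Ob C" "monic C Y X f" "\<not> zero_object C Y" for Y f
  proof -
    have f: "f \<in> Arr C Y X" using that unfolding monic_def by blast
    have "isomorphism D (FOb F Y) (FOb F X) (FArr F Y X f)"
      using * that monic_FArr[OF that(1) assms f] zero_object_FOb[OF that(1)] FOb_Ob[OF that(1)]
      unfolding simple_object_def by blast
    then show ?thesis using isomorphism_FArr[OF that(1) assms f] by blast
  qed
  then show "simple_object C X"
    using * assms zero_object_FOb[OF assms] unfolding simple_object_def by blast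
next
  assume *: "simple_object C X"
  have "isomorphism D Y (FOb F X) f" if Y: "Y \<in> Ob D" "monic D Y (FOb F X) f" "\<not> zero_object D Y" for Y f
  proof -
    note Ob = FOb_Ob[OF assms] Y(1)
    have f: "f \<in> Arr D Y (FOb F X)" using that unfolding monic_def by blast
    \<comment> \<open>Replacing the subobject \<open>Y\<close> by an isomorphic
      \<open>FOb F V\<close> makes its embedding the image of an arrow of \<open>C\<close>.\<close>
    obtain V u where V: "V \<in> Ob C" "isomorphism D (FOb F V) Y u"
      using essentially_surjective[OF Y(1)] unfolding isomorphic_def by blast
    obtain u' where u: "u \<in> Arr D (FOb F V) Y" "u' \<in> Arr D Y (FOb F V)" "u \<Zcomp>\<^bsub>D\<^esub> u' = Ide D Y"
      "isomorphism D Y (FOb F V) u'"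
      using D.isomorphismE[OF V(2)] by blast
    note Ob = Ob FOb_Ob[OF V(1)]
    have m: "monic D (FOb F V) (FOb F X) (f \<Zcomp>\<^bsub>D\<^esub> u)"
      using D.monic_Cmp[OF D.isomorphism_monic[OF V(2) Ob(3,2)] Y(2) Ob(3,2,1)] .
    then obtain f0 where f0: "f0 \<in> Arr C V X" "FArr F V X f0 = f \<Zcomp>\<^bsub>D\<^esub> u"
      using FArr_surj[OF V(1) assms] unfolding monic_def by metis
    have "\<not> zero_object C V"
      using Y(3) V Ob D.zero_object_isomorphic[of "FOb F V" Y] zero_object_FOb[OF V(1)] D.isomorphicI by blast
    then have "isomorphism C V X f0"
      using * V(1) m f0 monic_FArr[OF V(1) assms f0(1)] unfolding simple_object_def by metis
    then have "isomorphism D (FOb F V) (FOb F X) (f \<Zcomp>\<^bsub>D\<^esub> u)"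
      using isomorphism_FArr[OF V(1) assms f0(1)] f0 by metis
    then have "isomorphism D Y (FOb F X) ((f \<Zcomp>\<^bsub>D\<^esub> u) \<Zcomp>\<^bsub>D\<^esub> u')"
      using D.isomorphism_Cmp[OF u(4) _ Ob(2,3,1)] by blast
    moreover have "(f \<Zcomp>\<^bsub>D\<^esub> u) \<Zcomp>\<^bsub>D\<^esub> u' = f"
      using u f Ob by (simp add: D.Cmp_assoc D.Cmp_Id_right)
    ultimately show ?thesis by simp
  qed
  then show "simple_object D (FOb F X)"
    using * zero_object_FOb[OF assms] FOb_Ob[OF assms] unfolding simple_object_def by blast
qed

lemma simple_object_preimage:
  assumes "simple_object D Y"
  obtains X where "simple_object C X" "isomorphic D (FOb F X) Y"
proof -
  obtain X where X: "X \<in> Ob C" "isomorphic D (FOb F X) Y"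
    using essentially_surjective[OF D.simple_objectD(1)[OF assms]] by blast
  then show thesis
    using that[of X] D.simple_object_isomorphic[OF D.isomorphic_sym[OF X(2)] assms]
      simple_object_FOb[OF X(1)] by simp
qed

end

section \<open>Supports in double cosets\<close>

definition double_coset :: "('a, 'b) monoid_scheme \<Rightarrow> 'a set \<Rightarrow> 'a \<Rightarrow> 'a set"
  where "double_coset G F m = {x \<otimes>\<^bsub>G\<^esub> m \<otimes>\<^bsub>G\<^esub> y | x y. x \<in> F \<and> y \<in> F}"

text \<open>The condition m F \<subseteq> F m, written without inverses so that it depends on the
  multiplication alone. For a finite subgroup \<open>F\<close> it says that \<open>m\<close>
  normalizes \<open>F\<close>.\<close>

definition normalizes :: "('a, 'b) monoid_scheme \<Rightarrow> 'a set \<Rightarrow> 'a \<Rightarrow> bool"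
  where "normalizes G F m \<longleftrightarrow> (\<forall>x\<in>F. \<exists>y\<in>F. m \<otimes>\<^bsub>G\<^esub> x = y \<otimes>\<^bsub>G\<^esub> m)"

text \<open>\<open>M\<close> is the union of all supports. About the category, the axioms mention
  only simplicity, isomorphism, the unit and nonvanishing of Hom into a tensor product, so they can
  be transported. In \<open>supp_noncentral\<close> the support of \<open>W\<close> has to meet
  \<open>A\<close>: objects supported in \<open>A\<close> stay in the trivial component of every
  extension, so the witness is still there after each step down.\<close>

locale coset_support =
  fixes G :: "('a, 'b) monoid_scheme" and F A M :: "'a set"
    and E :: "('o, 'm, 'k) mon_cat" and supp :: "'o \<Rightarrow> 'a set"
  assumes supp_isomorphic: "\<lbrakk>simple_object E X; isomorphic E X Y\<rbrakk> \<Longrightarrow> supp X = supp Y"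
    and supp_simple_Unit: "simple_object E (Unit E)"
    and supp_Unit: "supp (Unit E) = F"
    and supp_nonempty: "simple_object E X \<Longrightarrow> supp X \<noteq> {}"
    and supp_subset: "simple_object E X \<Longrightarrow> supp X \<subseteq> M"
    and supp_double_coset: "\<lbrakk>simple_object E X; m \<in> supp X\<rbrakk> \<Longrightarrow> supp X = double_coset G F m"
    and supp_onto: "m \<in> M \<Longrightarrow> \<exists>X. simple_object E X \<and> m \<in> supp X"
    and supp_mult: "\<lbrakk>simple_object E X; simple_object E Y; a \<in> supp X; b \<in> supp Y\<rbrakk> \<Longrightarrow>
      \<exists>Z. simple_object E Z \<and> hom_nonzero E Z (X \<boxtimes>\<^bsub>E\<^esub> Y) \<and> a \<otimes>\<^bsub>G\<^esub> b \<in> supp Z"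
    and supp_free: "\<lbrakk>simple_object E X; simple_object E Y; m \<in> supp X; m \<in> supp Y;
      \<not> normalizes G F m\<rbrakk> \<Longrightarrow> isomorphic E X Y"
    and supp_noncentral: "\<lbrakk>simple_object E Z; m \<in> supp Z; normalizes G F m;
      \<not> isomorphic E Z (Unit E)\<rbrakk> \<Longrightarrow>
      \<exists>W V. simple_object E W \<and> simple_object E V \<and> supp W \<inter> A \<noteq> {} \<and>
        hom_nonzero E V (Z \<boxtimes>\<^bsub>E\<^esub> W) \<noteq> hom_nonzero E V (W \<boxtimes>\<^bsub>E\<^esub> Z)"

text \<open>\<open>M\<close> is quantified because an extension step replaces it by the kernel of
  the degree; the bound \<open>A\<close> is the part that persists.\<close>

definition has_coset_support ::
    "('a, 'b) monoid_scheme \<Rightarrow> 'a set \<Rightarrow> 'a set \<Rightarrow> ('o, 'm, 'k) mon_cat \<Rightarrow> bool"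
  where "has_coset_support G F A E \<longleftrightarrow>
    (\<exists>M supp. subgroup M G \<and> A \<subseteq> M \<and> coset_support G F A M E supp)"

text \<open>A relation rather than a function serves equivalences in both directions as well as
  bijections of isomorphism classes. The choice made by \<open>SOME\<close> is immaterial, since all
  objects related to \<open>Y\<close> are isomorphic and \<open>s\<close> is constant on isomorphism
  classes.\<close>

lemma coset_support_transfer:
  fixes R :: "'o \<Rightarrow> 'p \<Rightarrow> bool"
  assumes S: "coset_support G F A M C s" and D: "linear_category D"
    and total: "\<And>X. simple_object C X \<Longrightarrow> \<exists>Y. R X Y"
    and surj: "\<And>Y. simple_object D Y \<Longrightarrow> \<exists>X. R X Y"
    and sim: "\<And>X Y. R X Y \<Longrightarrow> simple_object C X \<and> simple_object D Y"
    and iso: "\<And>X X' Y Y'. \<lbrakk>R X Y; R X' Y'\<rbrakk> \<Longrightarrow> isomorphic C X X' \<longleftrightarrow> isomorphic D Y Y'"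
    and unit: "R (Unit C) (Unit D)"
    and hom: "\<And>X X' Y Y' Z Z'. \<lbrakk>R X X'; R Y Y'; R Z Z'\<rbrakk> \<Longrightarrow>
      hom_nonzero C Z (X \<boxtimes>\<^bsub>C\<^esub> Y) \<longleftrightarrow> hom_nonzero D Z' (X' \<boxtimes>\<^bsub>D\<^esub> Y')"
  shows "coset_support G F A M D (\<lambda>Y. s (SOME X. R X Y))"
proof -
  interpret S: coset_support G F A M C s by fact
  interpret D: linear_category D by fact
  define t where "t = (\<lambda>Y. s (SOME X. R X Y))"
  have t: "t Y = s X" if "R X Y" for X Y
  proof -
    have R: "R (SOME X. R X Y) Y" using that by (rule someI)
    have "isomorphic D Y Y" using that sim D.isomorphic_refl D.simple_objectD(1) by blast
    then have "isomorphic C X (SOME X. R X Y)" using iso[OF that R] by simp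
    then show ?thesis unfolding t_def using S.supp_isomorphic sim[OF that] by metis
  qed
  show ?thesis
    unfolding t_def[symmetric]
  proof
    fix X Y assume XY: "simple_object D X" "isomorphic D X Y"
    obtain X' where X': "R X' X" using surj XY by blast
    obtain Y' where Y': "R Y' Y" using surj D.simple_object_isomorphic[OF XY(2,1)] by blast
    show "t X = t Y"
      using t[OF X'] t[OF Y'] iso[OF X' Y'] S.supp_isomorphic[of X' Y'] sim[OF X'] XY by simp
  next
    show "simple_object D (Unit D)" using sim[OF unit] by simp
    show "t (Unit D) = F" using t[OF unit] S.supp_Unit by simp
  next
    fix X assume "simple_object D X"
    then obtain X' where X': "R X' X" using surj by blast
    show "t X \<noteq> {}" "t X \<subseteq> M" using t[OF X'] S.supp_nonempty S.supp_subset sim[OF X'] by auto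
    fix m assume "m \<in> t X"
    then show "t X = double_coset G F m" using t[OF X'] S.supp_double_coset sim[OF X'] by simp
  next
    fix m assume "m \<in> M"
    then obtain X where X: "simple_object C X" "m \<in> s X" using S.supp_onto by blast
    then obtain Y where "R X Y" using total by blast
    then show "\<exists>X. simple_object D X \<and> m \<in> t X" using t sim X by metis
  next
    fix X Y a b assume XY: "simple_object D X" "simple_object D Y" "a \<in> t X" "b \<in> t Y"
    obtain X' where X': "R X' X" using surj XY by blast
    obtain Y' where Y': "R Y' Y" using surj XY by blast
    obtain Z' where Z': "simple_object C Z'" "hom_nonzero C Z' (X' \<boxtimes>\<^bsub>C\<^esub> Y')" "a \<otimes>\<^bsub>G\<^esub> b \<in> s Z'"
      using S.supp_mult[of X' Y' a b] sim[OF X'] sim[OF Y'] XY t[OF X'] t[OF Y'] by auto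
    obtain Z where Z: "R Z' Z" using total Z' by blast
    show "\<exists>Z. simple_object D Z \<and> hom_nonzero D Z (X \<boxtimes>\<^bsub>D\<^esub> Y) \<and> a \<otimes>\<^bsub>G\<^esub> b \<in> t Z"
      using Z' hom[OF X' Y' Z] t[OF Z] sim[OF Z] by auto
  next
    fix X Y m assume XY: "simple_object D X" "simple_object D Y" "m \<in> t X" "m \<in> t Y" "\<not> normalizes G F m"
    obtain X' where X': "R X' X" using surj XY by blast
    obtain Y' where Y': "R Y' Y" using surj XY by blast
    show "isomorphic D X Y"
      using iso[OF X' Y'] S.supp_free[of X' Y' m] XY t[OF X'] t[OF Y'] sim[OF X'] sim[OF Y'] by simp
  next
    fix Z m assume Z: "simple_object D Z" "m \<in> t Z" "normalizes G F m" "\<not> isomorphic D Z (Unit D)"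
    obtain Z' where Z': "R Z' Z" using surj Z by blast
    obtain W' V' where W': "simple_object C W'" "simple_object C V'" "s W' \<inter> A \<noteq> {}"
        "hom_nonzero C V' (Z' \<boxtimes>\<^bsub>C\<^esub> W') \<noteq> hom_nonzero C V' (W' \<boxtimes>\<^bsub>C\<^esub> Z')"
      using S.supp_noncentral[of Z' m] sim[OF Z'] iso[OF Z' unit] Z t[OF Z'] by auto
    obtain W where W: "R W' W" using total W' by blast
    obtain V where V: "R V' V" using total W' by blast
    show "\<exists>W V. simple_object D W \<and> simple_object D V \<and> t W \<inter> A \<noteq> {} \<and>
        hom_nonzero D V (Z \<boxtimes>\<^bsub>D\<^esub> W) \<noteq> hom_nonzero D V (W \<boxtimes>\<^bsub>D\<^esub> Z)"
      using W' hom[OF Z' W V] hom[OF W Z' V] t[OF W] sim[OF W] sim[OF V] by auto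
  qed
qed

section \<open>Transport of supports along tensor equivalences\<close>

context tensor_equivalence
begin

definition matches :: "'a \<Rightarrow> 'd \<Rightarrow> bool"
  where "matches X Y \<longleftrightarrow> simple_object C X \<and> simple_object D Y \<and> isomorphic D (FOb F X) Y"

lemma matches_isomorphic:
  assumes "matches X Y" "matches X' Y'"
  shows "isomorphic C X X' \<longleftrightarrow> isomorphic D Y Y'"
proof -
  have X: "X \<in> Ob C" "isomorphic D (FOb F X) Y" "X' \<in> Ob C" "isomorphic D (FOb F X') Y'"
    using assms C.simple_objectD(1) unfolding matches_def by auto
  have "isomorphic D (FOb F X) (FOb F X') \<longleftrightarrow> isomorphic D Y Y'"
    using X(2,4) D.isomorphic_sym D.isomorphic_trans by meson
  then show ?thesis using isomorphic_FOb[OF X(1,3)] by simp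
qed

lemma matches_hom_nonzero:
  assumes "matches X X'" "matches Y Y'" "matches Z Z'"
  shows "hom_nonzero C Z (X \<boxtimes>\<^bsub>C\<^esub> Y) \<longleftrightarrow> hom_nonzero D Z' (X' \<boxtimes>\<^bsub>D\<^esub> Y')"
proof -
  have Ob: "X \<in> Ob C" "Y \<in> Ob C" "Z \<in> Ob C"
    using assms C.simple_objectD(1) unfolding matches_def by auto
  have iso: "isomorphic D (FOb F X) X'" "isomorphic D (FOb F Y) Y'" "isomorphic D (FOb F Z) Z'"
    using assms unfolding matches_def by auto
  show ?thesis using hom_nonzero_FOb_TenO[OF Ob] D.hom_nonzero_TenO[OF iso] by simp
qed

lemma matches_total: "simple_object C X \<Longrightarrow> \<exists>Y. matches X Y"
  using simple_object_FOb[of X] D.isomorphic_refl FOb_Ob C.simple_objectD(1)[of X]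
  unfolding matches_def by blast

lemma matches_surj: "simple_object D Y \<Longrightarrow> \<exists>X. matches X Y"
  using simple_object_preimage[of Y] unfolding matches_def by blast

text \<open>The transfer is run in both directions, and each time the unit is known to be simple
  only on the side that already carries the support.\<close>

lemma matches_Unit:
  assumes "simple_object C (Unit C) \<or> simple_object D (Unit D)"
  shows "matches (Unit C) (Unit D)"
proof -
  have "simple_object C (Unit C) \<longleftrightarrow> simple_object D (Unit D)"
    using simple_object_FOb[OF C.Unit_Ob] D.simple_object_isomorphic FOb_Unit D.isomorphic_sym by blast
  then show ?thesis using assms FOb_Unit D.isomorphic_sym unfolding matches_def by blast
qed

lemma has_coset_support_iff: "has_coset_support G H A C \<longleftrightarrow> has_coset_support G H A D"
proof
  assume "has_coset_support G H A C"
  then obtain M s where M: "subgroup M G" "A \<subseteq> M" "coset_support G H A M C s"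
    unfolding has_coset_support_def by blast
  have "coset_support G H A M D (\<lambda>Y. s (SOME X. matches X Y))"
    using M(3) D.linear_category_axioms matches_total matches_surj _ matches_isomorphic
      matches_Unit matches_hom_nonzero
  proof (rule coset_support_transfer)
    show "matches X Y \<Longrightarrow> simple_object C X \<and> simple_object D Y" for X Y
      unfolding matches_def by simp
    show "simple_object C (Unit C) \<or> simple_object D (Unit D)"
      using M(3) by (simp add: coset_support.supp_simple_Unit)
  qed
  then show "has_coset_support G H A D" unfolding has_coset_support_def using M by blast
next
  assume "has_coset_support G H A D"
  then obtain M s where M: "subgroup M G" "A \<subseteq> M" "coset_support G H A M D s"
    unfolding has_coset_support_def by blast
  have "coset_support G H A M C (\<lambda>Y. s (SOME X. matches Y X))"
    using M(3) C.linear_category_axioms matches_surj matches_total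
  proof (rule coset_support_transfer)
    show "matches Y X \<Longrightarrow> simple_object D X \<and> simple_object C Y" for X Y
      unfolding matches_def by simp
    show "matches (Unit C) (Unit D)"
      using M(3) matches_Unit by (simp add: coset_support.supp_simple_Unit)
  qed (simp_all add: matches_isomorphic matches_hom_nonzero)
  then show "has_coset_support G H A C" unfolding has_coset_support_def using M by blast
qed

end

section \<open>Graded extensions\<close>

lemma (in abelian_group) minus_eq_zero_iff:
  assumes "a \<in> carrier G" "b \<in> carrier G"
  shows "a \<ominus> b = \<zero> \<longleftrightarrow> a = b"
  using assms minus_equality[of a "\<ominus> b"] by (auto simp: minus_eq r_neg)

lemma linear_map_finsum_zero:
  assumes T: "linear_map K V W T" and "finite I" and "\<And>i. i \<in> I \<Longrightarrow> v i \<in> carrier V"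
    and "\<And>i. i \<in> I \<Longrightarrow> T (v i) = \<zero>\<^bsub>W\<^esub>"
  shows "T (finsum V v I) = \<zero>\<^bsub>W\<^esub>"
proof -
  interpret linear_map K V W T by fact
  have V: "abelian_monoid V"
    using T unfolding linear_map_def vectorspace_def module_def abelian_group_def by auto
  show ?thesis using assms(2-4)
  proof (induction rule: finite_induct)
    case empty
    then show ?case by simp
  next
    case (insert i I)
    then have "finsum V v I \<in> carrier V" by (intro abelian_monoid.finsum_closed[OF V]) auto
    then show ?case using insert by (simp add: Pi_def abelian_monoid.finsum_insert[OF V])
  qed
qed

text \<open>Arrows can be subtracted, so two arrows equalized by \<open>f\<close> differ by one that
  \<open>f\<close> annihilates.\<close>

lemma (in linear_category) monicI_zero:
  assumes X: "X \<in> Ob C" "Y \<in> Ob C" and f: "f \<in> Arr C X Y"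
    and zero: "\<And>W u. \<lbrakk>W \<in> Ob C; u \<in> Arr C W X; f \<Zcomp> u = Zero C W Y\<rbrakk> \<Longrightarrow> u = Zero C W X"
  shows "monic C X Y f"
  unfolding monic_def
proof (intro conjI ballI impI f)
  fix W g h assume W: "W \<in> Ob C" "g \<in> Arr C W X" "h \<in> Arr C W X" "f \<Zcomp> g = f \<Zcomp> h"
  interpret L: linear_map class_ring "Hom C W X" "Hom C W Y" "\<lambda>u. f \<Zcomp> u"
    using Cmp_linear_right W X f by blast
  have ab: "abelian_group (Hom C W X)" "abelian_group (Hom C W Y)"
    using Hom_vectorspace[of W X] Hom_vectorspace[of W Y] W X
    unfolding vectorspace_def module_def by auto
  have "f \<Zcomp> (g \<ominus>\<^bsub>Hom C W X\<^esub> h) = (f \<Zcomp> g) \<ominus>\<^bsub>Hom C W Y\<^esub> (f \<Zcomp> h)"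
    using L.f_minus W by blast
  also have "\<dots> = Zero C W Y" using W Cmp_Arr[OF W(1) X W(3) f] abelian_group.minus_eq_zero_iff[OF ab(2)] by simp
  finally have "g \<ominus>\<^bsub>Hom C W X\<^esub> h = Zero C W X"
    using zero[OF W(1)] abelian_group.minus_closed[OF ab(1)] W by simp
  then show "g = h" using W abelian_group.minus_eq_zero_iff[OF ab(1)] by simp
qed

text \<open>Commutators vanish in an abelian group and generate the perfect group \<open>A\<close>.
  The induction also carries membership in \<open>A\<close>, because \<open>d\<close> is
  multiplicative only there.\<close>

lemma hom_derived_trivial:
  assumes "group G" "subgroup A G" "derived G A = A" "comm_group K" "d \<in> hom (G\<lparr>carrier := A\<rparr>) K" "a \<in> A"
  shows "d a = \<one>\<^bsub>K\<^esub>"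
proof -
  interpret G: group G by fact
  interpret K: comm_group K by fact
  interpret A: subgroup A G by fact
  interpret GA: group "G\<lparr>carrier := A\<rparr>" using A.subgroup_is_group[OF G.group_axioms] .
  interpret d: group_hom "G\<lparr>carrier := A\<rparr>" K d
    using assms(5) by unfold_locales
  have "\<And>x. x \<in> A \<Longrightarrow> d x \<in> carrier K" using d.hom_closed by simp
  have d_inv: "d (inv\<^bsub>G\<^esub> x) = inv\<^bsub>K\<^esub> d x" if "x \<in> A" for x
    using d.hom_inv[of x] that G.m_inv_consistent[OF assms(2) that] by simp
  have mult: "d (x \<otimes>\<^bsub>G\<^esub> y) = d x \<otimes>\<^bsub>K\<^esub> d y" if "x \<in> A" "y \<in> A" for x y
    using d.hom_mult[of x y] that by simp
  have "a \<in> generate G (\<Union>h1\<in>A. \<Union>h2\<in>A. {h1 \<otimes>\<^bsub>G\<^esub> h2 \<otimes>\<^bsub>G\<^esub> inv\<^bsub>G\<^esub> h1 \<otimes>\<^bsub>G\<^esub> inv\<^bsub>G\<^esub> h2})"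
    using assms unfolding derived_def by simp
  then have "a \<in> A \<and> d a = \<one>\<^bsub>K\<^esub>"
  proof induction
    case one
    then show ?case using d.hom_one by simp
  next
    case (incl h)
    then obtain x y where "x \<in> A" "y \<in> A" and h: "h = x \<otimes>\<^bsub>G\<^esub> y \<otimes>\<^bsub>G\<^esub> inv\<^bsub>G\<^esub> x \<otimes>\<^bsub>G\<^esub> inv\<^bsub>G\<^esub> y" by blast
    moreover have "d x \<otimes>\<^bsub>K\<^esub> d y \<otimes>\<^bsub>K\<^esub> inv\<^bsub>K\<^esub> d x \<otimes>\<^bsub>K\<^esub> inv\<^bsub>K\<^esub> d y = \<one>\<^bsub>K\<^esub>"
      using d.hom_closed[of x] d.hom_closed[of y] \<open>x \<in> A\<close> \<open>y \<in> A\<close>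
      by (simp add: K.m_comm[of "d x" "d y"] K.m_assoc K.inv_solve_right)
    ultimately show ?case by (simp add: mult d_inv)
  next
    case (inv h)
    then obtain x y where "x \<in> A" "y \<in> A" and h: "h = x \<otimes>\<^bsub>G\<^esub> y \<otimes>\<^bsub>G\<^esub> inv\<^bsub>G\<^esub> x \<otimes>\<^bsub>G\<^esub> inv\<^bsub>G\<^esub> y" by blast
    moreover have "d x \<otimes>\<^bsub>K\<^esub> d y \<otimes>\<^bsub>K\<^esub> inv\<^bsub>K\<^esub> d x \<otimes>\<^bsub>K\<^esub> inv\<^bsub>K\<^esub> d y = \<one>\<^bsub>K\<^esub>"
      using d.hom_closed[of x] d.hom_closed[of y] \<open>x \<in> A\<close> \<open>y \<in> A\<close>
      by (simp add: K.m_comm[of "d x" "d y"] K.m_assoc K.inv_solve_right)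
    moreover have "d (inv\<^bsub>G\<^esub> h) = inv\<^bsub>K\<^esub> d h" "h \<in> A"
      using \<open>x \<in> A\<close> \<open>y \<in> A\<close> h by (auto intro: d_inv)
    ultimately show ?case by (simp add: mult d_inv)
  next
    case (eng h1 h2)
    then show ?case by (simp add: mult)
  qed
  then show ?thesis by simp
qed

text \<open>The element of \<open>A\<close> outside the normalizer is used twice: it forces trivial
  degree on objects supported on \<open>F\<close>, and it rules out \<open>Vect\<close> at the
  bottom of the chain.\<close>

locale coset_setting = group G for G :: "('a, 'b) monoid_scheme" (structure) +
  fixes F A :: "'a set"
  assumes F: "subgroup F G" and A: "subgroup A G" and F_A: "F \<subseteq> A"
    and perfect: "derived G A = A"
    and not_normal: "\<exists>m\<in>A. \<not> normalizes G F m"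

lemma (in group) double_coset_self: "subgroup F G \<Longrightarrow> m \<in> carrier G \<Longrightarrow> m \<in> double_coset G F m"
  unfolding double_coset_def using subgroup.one_closed[of F G]
  by (intro CollectI exI[of _ \<one>]) simp

text \<open>The contents of \<open>group_extension\<close> with the degree maps fixed. That the
  trivial component is again linear monoidal is assumed here; in the application it comes with the
  tensor equivalence to \<open>D\<close>.\<close>

locale graded_category = linear_monoidal_category E + K: group K
  for E :: "('o, 'm, 'k::field) mon_cat" (structure) and K :: "'g monoid" +
  fixes grade :: "'g \<Rightarrow> 'o set"
  assumes grade_Ob: "k \<in> carrier K \<Longrightarrow> grade k \<subseteq> Ob E"
    and grade_isomorphic: "\<lbrakk>k \<in> carrier K; X \<in> grade k; isomorphic E X Y\<rbrakk> \<Longrightarrow> Y \<in> grade k"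
    and grade_decomp: "X \<in> Ob E \<Longrightarrow>
      \<exists>Y inc prj. (\<forall>k\<in>carrier K. Y k \<in> grade k) \<and> direct_sum E (carrier K) Y X inc prj"
    and grade_orthogonal: "\<lbrakk>k \<in> carrier K; l \<in> carrier K; k \<noteq> l; X \<in> grade k; Y \<in> grade l\<rbrakk> \<Longrightarrow>
      Arr E X Y = {Zero E X Y}"
    and grade_TenO: "\<lbrakk>k \<in> carrier K; l \<in> carrier K; X \<in> grade k; Y \<in> grade l\<rbrakk> \<Longrightarrow>
      X \<boxtimes> Y \<in> grade (k \<otimes>\<^bsub>K\<^esub> l)"
    and grade_monoidal: "linear_monoidal_category (E\<lparr>Ob := grade \<one>\<^bsub>K\<^esub>\<rparr>)"
begin

abbreviation E1 where "E1 \<equiv> E\<lparr>Ob := grade \<one>\<^bsub>K\<^esub>\<rparr>"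

lemma grade_hom_nonzero:
  "\<lbrakk>k \<in> carrier K; l \<in> carrier K; X \<in> grade k; Y \<in> grade l; hom_nonzero E X Y\<rbrakk> \<Longrightarrow> k = l"
  unfolding hom_nonzero_def using grade_orthogonal by blast

text \<open>The identity of \<open>X\<close> is the sum of the projections to homogeneous summands,
  so a nonzero \<open>f\<close> cannot vanish on all of them.\<close>

lemma component:
  assumes X: "X \<in> Ob E" "W \<in> Ob E" and f: "f \<in> Arr E X W" "f \<noteq> Zero E X W"
  obtains k Y i p where "k \<in> carrier K" "Y \<in> grade k" "Y \<in> Ob E" "i \<in> Arr E Y X" "p \<in> Arr E X Y"
    "p \<Zcomp> i = Ide E Y" "f \<Zcomp> i \<noteq> Zero E Y W"
proof -
  obtain Y inc prj where Y: "\<And>k. k \<in> carrier K \<Longrightarrow> Y k \<in> grade k"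
    and sum: "direct_sum E (carrier K) Y X inc prj"
    using grade_decomp[OF X(1)] by blast
  have fin: "finite (carrier K)" and sum_Ide: "finsum (Hom E X X) (\<lambda>k. inc k \<Zcomp> prj k) (carrier K) = Ide E X"
    and ip: "\<And>k. k \<in> carrier K \<Longrightarrow> Y k \<in> Ob E" "\<And>k. k \<in> carrier K \<Longrightarrow> inc k \<in> Arr E (Y k) X"
      "\<And>k. k \<in> carrier K \<Longrightarrow> prj k \<in> Arr E X (Y k)"
      "\<And>k. k \<in> carrier K \<Longrightarrow> prj k \<Zcomp> inc k = Ide E (Y k)"
    using sum unfolding direct_sum_def by auto
  have "\<exists>k\<in>carrier K. f \<Zcomp> inc k \<noteq> Zero E (Y k) W"
  proof (rule ccontr)
    assume neg: "\<not> ?thesis"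
    have "f \<Zcomp> finsum (Hom E X X) (\<lambda>k. inc k \<Zcomp> prj k) (carrier K) = Zero E X W"
    proof (rule linear_map_finsum_zero[OF Cmp_linear_right[OF X(1,1) X(2) f(1)] fin])
      fix k assume k: "k \<in> carrier K"
      show "inc k \<Zcomp> prj k \<in> Arr E X X" using Cmp_Arr ip k X by blast
      have "f \<Zcomp> (inc k \<Zcomp> prj k) = (f \<Zcomp> inc k) \<Zcomp> prj k"
        using Cmp_assoc[OF X(1) ip(1)[OF k] X ip(3,2)[OF k] f(1)] by simp
      also have "\<dots> = Zero E X W" using neg k Cmp_Zero_left[OF X(1) ip(1)[OF k] X(2) ip(3)[OF k]] by simp
      finally show "f \<Zcomp> (inc k \<Zcomp> prj k) = Zero E X W" .
    qed
    then show False using sum_Ide f X Cmp_Id_right by simp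
  qed
  then obtain k where k: "k \<in> carrier K" "f \<Zcomp> inc k \<noteq> Zero E (Y k) W" by blast
  show ?thesis by (rule that[OF k(1) Y ip k(2)]) (use k in simp_all)
qed

text \<open>In the decomposition of the identity of \<open>X\<close> every term of degree other than
  \<open>k\<close> vanishes, so the inclusion of the \<open>k\<close>-summand is invertible.\<close>

lemma in_grade:
  assumes X: "X \<in> Ob E" and k: "k \<in> carrier K"
    and zero: "\<And>l Y i. \<lbrakk>l \<in> carrier K; l \<noteq> k; Y \<in> grade l; Y \<in> Ob E; i \<in> Arr E Y X\<rbrakk> \<Longrightarrow> i = Zero E Y X"
  shows "X \<in> grade k"
proof -
  obtain Y inc prj where Y: "\<And>k. k \<in> carrier K \<Longrightarrow> Y k \<in> grade k"
    and sum: "direct_sum E (carrier K) Y X inc prj"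
    using grade_decomp[OF X(1)] by blast
  have fin: "finite (carrier K)" and sum_Ide: "finsum (Hom E X X) (\<lambda>k. inc k \<Zcomp> prj k) (carrier K) = Ide E X"
    and ip: "\<And>k. k \<in> carrier K \<Longrightarrow> Y k \<in> Ob E" "\<And>k. k \<in> carrier K \<Longrightarrow> inc k \<in> Arr E (Y k) X"
      "\<And>k. k \<in> carrier K \<Longrightarrow> prj k \<in> Arr E X (Y k)"
      "\<And>k. k \<in> carrier K \<Longrightarrow> prj k \<Zcomp> inc k = Ide E (Y k)"
    using sum unfolding direct_sum_def by auto
  have ipX: "inc k \<Zcomp> prj k \<in> Arr E X X" if "k \<in> carrier K" for k
    using Cmp_Arr[OF X ip(1) X ip(3,2)] that by simp
  interpret V: vectorspace class_ring "Hom E X X" using Hom_vectorspace X by blast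
  have "finsum (Hom E X X) (\<lambda>l. inc l \<Zcomp> prj l) (carrier K)
      = finsum (Hom E X X) (\<lambda>l. if k = l then inc l \<Zcomp> prj l else Zero E X X) (carrier K)"
  proof (rule V.M.add.finprod_cong')
    show "(\<lambda>l. if k = l then inc l \<Zcomp> prj l else Zero E X X) \<in> carrier K \<rightarrow> Arr E X X"
      using ipX Zero_Arr[OF X X] by (auto simp: Pi_iff)
    fix l assume l: "l \<in> carrier K"
    show "inc l \<Zcomp> prj l = (if k = l then inc l \<Zcomp> prj l else Zero E X X)"
      using zero[OF l _ Y[OF l] ip(1,2)[OF l]] Cmp_Zero_left[OF X ip(1)[OF l] X ip(3)[OF l]] by auto
  qed simp
  also have "\<dots> = inc k \<Zcomp> prj k"
    using V.M.add.finprod_singleton[OF k fin, of "\<lambda>l. inc l \<Zcomp> prj l"] ipX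
    by (simp add: Pi_iff)
  finally have "inc k \<Zcomp> prj k = Ide E X" using sum_Ide by simp
  then have "isomorphism E (Y k) X (inc k)" unfolding isomorphism_def using ip k by blast
  then have "isomorphic E (Y k) X" using ip k X isomorphicI by blast
  then show ?thesis using grade_isomorphic k Y by blast
qed

text \<open>By \<open>component\<close>, applied to the identity, some homogeneous summand is
  nonzero; a nonzero retract of a simple object is isomorphic to it.\<close>

lemma simple_in_grade:
  assumes "simple_object E X"
  shows "\<exists>k\<in>carrier K. X \<in> grade k"
proof -
  have X: "X \<in> Ob E" "Ide E X \<noteq> Zero E X X"
    using simple_objectD[OF assms] unfolding zero_object_def by auto
  obtain k Y i p where Y: "k \<in> carrier K" "Y \<in> grade k" "Y \<in> Ob E" "i \<in> Arr E Y X" "p \<in> Arr E X Y"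
    "p \<Zcomp> i = Ide E Y" "Ide E X \<Zcomp> i \<noteq> Zero E Y X"
    using component[OF X(1,1) Id_Arr[OF X(1)] X(2)] by blast
  then have "\<not> zero_object E Y" using Arr_zero_source X Cmp_Id_left by metis
  then have "isomorphic E Y X" using simple_split[OF assms] isomorphicI Y X by blast
  then show ?thesis using grade_isomorphic Y by blast
qed

text \<open>Simplicity in \<open>E\<close> and in \<open>E1\<close> tests different families of
  subobjects, and monicity is tested on different objects. Orthogonality of the components
  reconciles both.\<close>

lemma simple_E1_iff: "simple_object E1 X \<longleftrightarrow> simple_object E X \<and> X \<in> grade \<one>\<^bsub>K\<^esub>"
proof
  interpret E1: linear_monoidal_category E1 by (rule grade_monoidal)
  have one: "\<one>\<^bsub>K\<^esub> \<in> carrier K" by simp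
  note Ob1 = subsetD[OF grade_Ob[OF one]]
  {
    assume X: "simple_object E1 X"
    then have X1: "X \<in> grade \<one>\<^bsub>K\<^esub>" "X \<in> Ob E" unfolding simple_object_def using Ob1 by auto
    have "isomorphism E Y X f" if Y: "Y \<in> Ob E" "monic E Y X f" "\<not> zero_object E Y" for Y f
    proof -
      have f: "f \<in> Arr E Y X" using Y unfolding monic_def by blast
      \<comment> \<open>Subobjects of an object of trivial degree have trivial degree: an arrow into
        \<open>Y\<close> from another degree becomes zero after \<open>f\<close>, hence is zero
        because \<open>f\<close> is monic.\<close>
      have "Y \<in> grade \<one>\<^bsub>K\<^esub>"
      proof (rule in_grade[OF Y(1) one])
        fix l V i assume l: "l \<in> carrier K" "l \<noteq> \<one>\<^bsub>K\<^esub>" "V \<in> grade l" "V \<in> Ob E" "i \<in> Arr E V Y"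
        have "f \<Zcomp> i = Zero E V X"
          using grade_orthogonal[OF l(1) one l(2,3) X1(1)] Cmp_Arr[OF l(4) Y(1) X1(2) l(5) f] by simp
        then have "f \<Zcomp> i = f \<Zcomp> Zero E V Y" using Cmp_Zero_right[OF l(4) Y(1) X1(2) f] by simp
        then show "i = Zero E V Y"
          using Y(2) l(4,5) Zero_Arr[OF l(4) Y(1)] unfolding monic_def by blast
      qed
      moreover have "monic E1 Y X f"
        using Y(2) Ob1 unfolding monic_def by auto
      ultimately have "isomorphism E1 Y X f"
        using X Y(1,3) unfolding simple_object_def zero_object_def by auto
      then show ?thesis unfolding isomorphism_def by simp
    qed
    moreover have "\<not> zero_object E X" using X X1 unfolding simple_object_def zero_object_def by auto
    ultimately show "simple_object E X \<and> X \<in> grade \<one>\<^bsub>K\<^esub>"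
      unfolding simple_object_def using X1 by blast
  next
    assume X: "simple_object E X \<and> X \<in> grade \<one>\<^bsub>K\<^esub>"
    then have XE: "X \<in> Ob E" using Ob1 by blast
    have "isomorphism E1 Y X f" if Y: "Y \<in> grade \<one>\<^bsub>K\<^esub>" "monic E1 Y X f" "\<not> zero_object E1 Y" for Y f
    proof -
      have f: "f \<in> Arr E Y X" using Y unfolding monic_def by simp
      have YE: "Y \<in> Ob E" using Y Ob1 by blast
      \<comment> \<open>If \<open>f\<close> kills a nonzero \<open>u\<close>, then \<open>u\<close>
        is nonzero on some homogeneous summand \<open>V\<close>. As \<open>V\<close> maps
        nontrivially to \<open>Y\<close>, it has trivial degree, and there \<open>f\<close> is
        already known to be monic.\<close>
      have "monic E Y X f"
      proof (rule monicI_zero[OF YE XE f])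
        fix W u assume W: "W \<in> Ob E" "u \<in> Arr E W Y" "f \<Zcomp> u = Zero E W X"
        show "u = Zero E W Y"
        proof (rule ccontr)
          assume "u \<noteq> Zero E W Y"
          then obtain k V i p where V: "k \<in> carrier K" "V \<in> grade k" "V \<in> Ob E" "i \<in> Arr E V W"
            "u \<Zcomp> i \<noteq> Zero E V Y"
            using component[OF W(1) YE W(2)] by blast
          have ui: "u \<Zcomp> i \<in> Arr E V Y" using Cmp_Arr V W YE by blast
          have "k = \<one>\<^bsub>K\<^esub>"
            using grade_hom_nonzero[OF V(1) one V(2) Y(1)] ui V(5) unfolding hom_nonzero_def by blast
          then have V1: "V \<in> grade \<one>\<^bsub>K\<^esub>" using V by simp
          have "f \<Zcomp> (u \<Zcomp> i) = (f \<Zcomp> u) \<Zcomp> i" using Cmp_assoc[OF V(3) W(1) YE XE V(4) W(2) f] by simp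
          also have "\<dots> = Zero E V X" using W(3) Cmp_Zero_left[OF V(3) W(1) XE V(4)] by simp
          also have "\<dots> = f \<Zcomp> Zero E V Y" using Cmp_Zero_right[OF V(3) YE XE f] by simp
          finally have "u \<Zcomp> i = Zero E V Y"
            using Y(2) V1 ui Zero_Arr[OF V(3) YE] unfolding monic_def by simp
          then show False using V by simp
        qed
      qed
      moreover have "\<not> zero_object E Y" using Y unfolding zero_object_def by simp
      ultimately have "isomorphism E Y X f"
        using X YE unfolding simple_object_def by blast
      then show ?thesis unfolding isomorphism_def by simp
    qed
    moreover have "\<not> zero_object E1 X" using X unfolding simple_object_def zero_object_def by auto
    ultimately show "simple_object E1 X"
      unfolding simple_object_def using X by auto
  }
qed

lemma isomorphic_E1_iff:
  "isomorphic E1 X Y \<longleftrightarrow> X \<in> grade \<one>\<^bsub>K\<^esub> \<and> Y \<in> grade \<one>\<^bsub>K\<^esub> \<and> isomorphic E X Y"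
  using grade_Ob[of "\<one>\<^bsub>K\<^esub>"] unfolding isomorphic_def isomorphism_def by auto

lemma hom_nonzero_E1 [simp]: "hom_nonzero E1 X Y \<longleftrightarrow> hom_nonzero E X Y"
  unfolding hom_nonzero_def by simp

end

context coset_setting
begin

text \<open>The kernel \<open>N\<close> of the degree map takes the place of \<open>M\<close>.
  Commutativity of \<open>K\<close> is what puts the perfect group \<open>A\<close> inside
  \<open>N\<close>.\<close>

lemma has_coset_support_grade:
  fixes E :: "('o, 'm, 'k::field) mon_cat" and K :: "'g monoid"
  assumes E: "graded_category E K grade" and K: "comm_group K" and supp: "has_coset_support G F A E"
  shows "has_coset_support G F A (E\<lparr>Ob := grade \<one>\<^bsub>K\<^esub>\<rparr>)"
proof -
  interpret K: comm_group K by fact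
  interpret E: graded_category E K grade by fact
  obtain M s where M: "subgroup M G" "A \<subseteq> M" and "coset_support G F A M E s"
    using supp unfolding has_coset_support_def by blast
  interpret S: coset_support G F A M E s by fact
  interpret M: subgroup M G by fact
  note hom = E.grade_hom_nonzero
  have tensor: "l = j \<otimes>\<^bsub>K\<^esub> k"
    if "hom_nonzero E Z (X \<boxtimes>\<^bsub>E\<^esub> Y)" "X \<in> grade j" "Y \<in> grade k" "Z \<in> grade l"
      "j \<in> carrier K" "k \<in> carrier K" "l \<in> carrier K" for X Y Z j k l
    using hom[of l "j \<otimes>\<^bsub>K\<^esub> k" Z "X \<boxtimes>\<^bsub>E\<^esub> Y"] E.grade_TenO[of j k X Y] that by simp
  have one: "k = \<one>\<^bsub>K\<^esub>"
    if D: "simple_object E D" "\<one> \<in> s D" "D \<in> grade k" "k \<in> carrier K" for D k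
  proof -
    obtain m where m: "m \<in> A" "\<not> normalizes G F m" using not_normal by blast
    obtain X where X: "simple_object E X" "m \<in> s X" using S.supp_onto m M by blast
    obtain l where l: "l \<in> carrier K" "X \<in> grade l" using E.simple_in_grade[OF X(1)] by blast
    obtain Y where Y: "simple_object E Y" "hom_nonzero E Y (D \<boxtimes>\<^bsub>E\<^esub> X)" "\<one> \<otimes> m \<in> s Y"
      using S.supp_mult[OF D(1) X(1) D(2) X(2)] by blast
    have "m \<in> s Y" using Y(3) m M M.mem_carrier by auto
    then have "isomorphic E X Y" using S.supp_free X Y m by blast
    then have "Y \<in> grade l" using E.grade_isomorphic l by blast
    then have "l = k \<otimes>\<^bsub>K\<^esub> l" using tensor[OF Y(2) D(3)] l D(4) by blast
    then show ?thesis using l D(4) by (metis K.l_one K.one_closed K.right_cancel)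
  qed
  \<comment> \<open>Objects sharing an element \<open>m\<close> need not be isomorphic when
    \<open>m\<close> normalizes \<open>F\<close>. Tensoring each with the same \<open>W\<close>
    supported at \<open>inv m\<close> produces a constituent supported at \<one>, whose degree is
    trivial by \<open>one\<close>; hence both degrees are inverse to that of
    \<open>W\<close>.\<close>
  have unique: "k = l"
    if X: "simple_object E X" "m \<in> s X" "X \<in> grade k" "k \<in> carrier K"
      and Y: "simple_object E Y" "m \<in> s Y" "Y \<in> grade l" "l \<in> carrier K" for X Y m k l
  proof -
    have m: "m \<in> M" using S.supp_subset X by blast
    obtain W where W: "simple_object E W" "inv m \<in> s W" using S.supp_onto M.m_inv_closed[OF m] by blast
    obtain w where w: "w \<in> carrier K" "W \<in> grade w" using E.simple_in_grade[OF W(1)] by blast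
    have *: "w \<otimes>\<^bsub>K\<^esub> k' = \<one>\<^bsub>K\<^esub>" if X: "simple_object E X" "m \<in> s X" "X \<in> grade k'" "k' \<in> carrier K" for X k'
    proof -
      obtain D where D: "simple_object E D" "hom_nonzero E D (W \<boxtimes>\<^bsub>E\<^esub> X)" "inv m \<otimes> m \<in> s D"
        using S.supp_mult[OF W(1) X(1) W(2) X(2)] by blast
      obtain d where d: "d \<in> carrier K" "D \<in> grade d" using E.simple_in_grade[OF D(1)] by blast
      have "d = \<one>\<^bsub>K\<^esub>" using one[OF D(1) _ d(2,1)] D(3) m M.mem_carrier by simp
      then show ?thesis using tensor[OF D(2) w(2) X(3) d(2) w(1) X(4) d(1)] by simp
    qed
    show ?thesis using *[OF X] *[OF Y] w X(4) Y(4) by (metis K.Units_eq K.Units_l_cancel)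
  qed
  \<comment> \<open>By \<open>unique\<close> the degree can be read off from any element of the
    support.\<close>
  define d where "d m = (THE k. k \<in> carrier K \<and> (\<exists>X. simple_object E X \<and> m \<in> s X \<and> X \<in> grade k))" for m
  have d: "d m = k" if "simple_object E X" "m \<in> s X" "X \<in> grade k" "k \<in> carrier K" for X m k
    unfolding d_def by (rule the_equality) (use that unique in blast)+
  have ex: "\<exists>X. simple_object E X \<and> m \<in> s X \<and> X \<in> grade (d m) \<and> d m \<in> carrier K" if "m \<in> M" for m
    using S.supp_onto[OF that] E.simple_in_grade d by metis
  have d_mult: "d (a \<otimes> b) = d a \<otimes>\<^bsub>K\<^esub> d b" if ab: "a \<in> M" "b \<in> M" for a b
  proof -
    obtain X where X: "simple_object E X" "a \<in> s X" "X \<in> grade (d a)" "d a \<in> carrier K" using ex ab by blast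
    obtain Y where Y: "simple_object E Y" "b \<in> s Y" "Y \<in> grade (d b)" "d b \<in> carrier K" using ex ab by blast
    obtain Z where Z: "simple_object E Z" "hom_nonzero E Z (X \<boxtimes>\<^bsub>E\<^esub> Y)" "a \<otimes> b \<in> s Z"
      using S.supp_mult[OF X(1) Y(1) X(2) Y(2)] by blast
    obtain k where k: "k \<in> carrier K" "Z \<in> grade k" using E.simple_in_grade[OF Z(1)] by blast
    show ?thesis using d[OF Z(1,3) k(2,1)] tensor[OF Z(2) X(3) Y(3) k(2) X(4) Y(4) k(1)] by simp
  qed
  have d_carrier: "d m \<in> carrier K" if "m \<in> M" for m using ex[OF that] by blast
  define N where "N = {m \<in> M. d m = \<one>\<^bsub>K\<^esub>}"
  have d_one: "d \<one> = \<one>\<^bsub>K\<^esub>" using ex[OF M.one_closed] one by blast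
  have N: "subgroup N G"
  proof (rule subgroupI)
    show "N \<subseteq> carrier G" unfolding N_def using M.subset by blast
    have "\<one> \<in> N" unfolding N_def using d_one M.one_closed by blast
    then show "N \<noteq> {}" by blast
    show "inv a \<in> N" if "a \<in> N" for a
    proof -
      have a: "a \<in> M" "d a = \<one>\<^bsub>K\<^esub>" using that unfolding N_def by auto
      have "d (inv a) = d (inv a) \<otimes>\<^bsub>K\<^esub> d a" using a d_carrier M.m_inv_closed by simp
      also have "\<dots> = \<one>\<^bsub>K\<^esub>" using d_mult[of "inv a" a] a M.m_inv_closed d_one M.mem_carrier by simp
      finally show ?thesis unfolding N_def using a M.m_inv_closed by simp
    qed
    show "a \<otimes> b \<in> N" if "a \<in> N" "b \<in> N" for a b
      using that d_mult M.m_closed unfolding N_def by simp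
  qed
  have A_N: "A \<subseteq> N"
  proof
    fix a assume a: "a \<in> A"
    have "d \<in> hom (G\<lparr>carrier := A\<rparr>) K"
      unfolding hom_def using d_mult d_carrier M(2) by auto
    then have "d a = \<one>\<^bsub>K\<^esub>" by (rule hom_derived_trivial[OF group_axioms A perfect K _ a])
    then show "a \<in> N" unfolding N_def using a M(2) by blast
  qed
  have deg: "X \<in> grade \<one>\<^bsub>K\<^esub>" if X: "simple_object E X" "m \<in> s X" "m \<in> N" for X m
  proof -
    obtain k where k: "k \<in> carrier K" "X \<in> grade k" using E.simple_in_grade[OF X(1)] by blast
    then have "k = \<one>\<^bsub>K\<^esub>" using d[OF X(1,2) k(2,1)] X(3) unfolding N_def by simp
    then show ?thesis using k by simp
  qed
  have in_N: "m \<in> N" if "simple_object E X" "m \<in> s X" "X \<in> grade \<one>\<^bsub>K\<^esub>" for X m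
    using d[OF that K.one_closed] S.supp_subset[OF that(1)] that(2) unfolding N_def by blast
  have sim: "simple_object (E\<lparr>Ob := grade \<one>\<^bsub>K\<^esub>\<rparr>) X \<longleftrightarrow> simple_object E X \<and> X \<in> grade \<one>\<^bsub>K\<^esub>" for X
    by (rule E.simple_E1_iff)
  have iso: "isomorphic (E\<lparr>Ob := grade \<one>\<^bsub>K\<^esub>\<rparr>) X Y \<longleftrightarrow>
    X \<in> grade \<one>\<^bsub>K\<^esub> \<and> Y \<in> grade \<one>\<^bsub>K\<^esub> \<and> isomorphic E X Y" for X Y
    by (rule E.isomorphic_E1_iff)
  interpret E1: linear_monoidal_category "E\<lparr>Ob := grade \<one>\<^bsub>K\<^esub>\<rparr>" by (rule E.grade_monoidal)
  have unit: "Unit E \<in> grade \<one>\<^bsub>K\<^esub>" using E1.Unit_Ob by simp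
  have "coset_support G F A N (E\<lparr>Ob := grade \<one>\<^bsub>K\<^esub>\<rparr>) s" (is "coset_support G F A N ?E1 s")
  proof (rule coset_support.intro)
    fix X Y assume "simple_object ?E1 X" "isomorphic ?E1 X Y"
    then show "s X = s Y" using S.supp_isomorphic by (simp add: sim iso)
  next
    show "simple_object ?E1 (Unit ?E1)" using S.supp_simple_Unit unit by (simp add: sim)
    show "s (Unit ?E1) = F" using S.supp_Unit by simp
  next
    fix X assume X: "simple_object ?E1 X"
    then show "s X \<noteq> {}" "s X \<subseteq> N" using S.supp_nonempty in_N[of X] by (auto simp: sim)
    show "s X = double_coset G F m" if "m \<in> s X" for m using X S.supp_double_coset that by (simp add: sim)
  next
    fix m assume m: "m \<in> N"
    then obtain X where "simple_object E X" "m \<in> s X" using S.supp_onto unfolding N_def by blast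
    then show "\<exists>X. simple_object ?E1 X \<and> m \<in> s X" using deg[OF _ _ m] by (auto simp: sim)
  next
    fix X Y a b assume X: "simple_object ?E1 X" and Y: "simple_object ?E1 Y" and ab: "a \<in> s X" "b \<in> s Y"
    obtain Z where Z: "simple_object E Z" "hom_nonzero E Z (X \<boxtimes>\<^bsub>E\<^esub> Y)" "a \<otimes> b \<in> s Z"
      using S.supp_mult[of X Y a b] X Y ab by (auto simp: sim)
    have "a \<otimes> b \<in> N" using in_N[of X a] in_N[of Y b] X Y ab subgroup.m_closed[OF N] by (simp add: sim)
    then show "\<exists>Z. simple_object ?E1 Z \<and> hom_nonzero ?E1 Z (X \<boxtimes>\<^bsub>?E1\<^esub> Y) \<and> a \<otimes> b \<in> s Z"
      using Z deg[OF Z(1,3)] by (auto simp: sim)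
  next
    fix X Y m assume "simple_object ?E1 X" "simple_object ?E1 Y" "m \<in> s X" "m \<in> s Y" "\<not> normalizes G F m"
    then show "isomorphic ?E1 X Y" using S.supp_free[of X Y m] by (simp add: sim iso)
  next
    fix Z m assume Z: "simple_object ?E1 Z" "m \<in> s Z" "normalizes G F m" "\<not> isomorphic ?E1 Z (Unit ?E1)"
    obtain W V where W: "simple_object E W" "simple_object E V" "s W \<inter> A \<noteq> {}"
        "hom_nonzero E V (Z \<boxtimes>\<^bsub>E\<^esub> W) \<noteq> hom_nonzero E V (W \<boxtimes>\<^bsub>E\<^esub> Z)"
      using S.supp_noncentral[of Z m] Z unit by (auto simp: sim iso)
    have W1: "W \<in> grade \<one>\<^bsub>K\<^esub>" using deg[OF W(1)] W(3) A_N by auto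
    have Z1: "Z \<in> grade \<one>\<^bsub>K\<^esub>" using Z(1) by (simp add: sim)
    obtain v where v: "v \<in> carrier K" "V \<in> grade v" using E.simple_in_grade[OF W(2)] by blast
    \<comment> \<open>Exactly one of the two Hom spaces is nonzero, so \<open>V\<close> occurs in a
      product of two objects of trivial degree.\<close>
    have "v = \<one>\<^bsub>K\<^esub>"
      using W(4) tensor[OF _ Z1 W1 v(2) _ _ v(1)] tensor[OF _ W1 Z1 v(2) _ _ v(1)] by auto
    then show "\<exists>W V. simple_object ?E1 W \<and> simple_object ?E1 V \<and> s W \<inter> A \<noteq> {} \<and>
        hom_nonzero ?E1 V (Z \<boxtimes>\<^bsub>?E1\<^esub> W) \<noteq> hom_nonzero ?E1 V (W \<boxtimes>\<^bsub>?E1\<^esub> Z)"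
      using W W1 v by (intro exI[of _ W] exI[of _ V]) (simp add: sim)
  qed
  then show ?thesis unfolding has_coset_support_def using N A_N by blast
qed

lemma has_coset_support_extension:
  assumes "linear_monoidal_category E" "group_extension K D E" "comm_group K" "has_coset_support G F A E"
  shows "has_coset_support G F A D"
proof -
  interpret E: linear_monoidal_category E by fact
  obtain grade where g: "\<forall>g\<in>carrier K. grade g \<subseteq> Ob E \<and>
        (\<forall>X\<in>grade g. \<forall>Y. isomorphic E X Y \<longrightarrow> Y \<in> grade g) \<and>
        (\<exists>X\<in>grade g. \<not> zero_object E X)"
      "\<forall>X\<in>Ob E. \<exists>Y inc prj. (\<forall>g\<in>carrier K. Y g \<in> grade g) \<and>
        direct_sum E (carrier K) Y X inc prj"
      "\<forall>g\<in>carrier K. \<forall>h\<in>carrier K. g \<noteq> h \<longrightarrow>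
        (\<forall>X\<in>grade g. \<forall>Y\<in>grade h. Arr E X Y = {Zero E X Y})"
      "\<forall>g\<in>carrier K. \<forall>h\<in>carrier K. \<forall>X\<in>grade g. \<forall>Y\<in>grade h.
        X \<boxtimes>\<^bsub>E\<^esub> Y \<in> grade (g \<otimes>\<^bsub>K\<^esub> h)"
      "tensor_equivalent (E\<lparr>Ob := grade \<one>\<^bsub>K\<^esub>\<rparr>) D"
    using assms(2) unfolding group_extension_def by (elim conjE exE) (rule that, assumption+)
  obtain \<Phi> where "tensor_equivalence (E\<lparr>Ob := grade \<one>\<^bsub>K\<^esub>\<rparr>) D \<Phi>"
    using g(5) unfolding tensor_equivalent_def by blast
  then interpret T: tensor_equivalence "E\<lparr>Ob := grade \<one>\<^bsub>K\<^esub>\<rparr>" D \<Phi> .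
  interpret K: comm_group K by fact
  have "graded_category E K grade"
  proof (intro graded_category.intro graded_category_axioms.intro assms(1) K.is_group)
    show "linear_monoidal_category (E\<lparr>Ob := grade \<one>\<^bsub>K\<^esub>\<rparr>)"
      by (rule T.C.linear_monoidal_category_axioms)
  next
    fix k assume k: "k \<in> carrier K"
    show "grade k \<subseteq> Ob E" using g(1) k by simp
    show "Y \<in> grade k" if "X \<in> grade k" "isomorphic E X Y" for X Y using g(1) k that by simp
  next
    fix X assume "X \<in> Ob E"
    then show "\<exists>Y inc prj. (\<forall>k\<in>carrier K. Y k \<in> grade k) \<and> direct_sum E (carrier K) Y X inc prj"
      using g(2) by simp
  next
    fix k l X Y assume "k \<in> carrier K" "l \<in> carrier K" "X \<in> grade k" "Y \<in> grade l"
    then show "X \<boxtimes>\<^bsub>E\<^esub> Y \<in> grade (k \<otimes>\<^bsub>K\<^esub> l)" "k \<noteq> l \<Longrightarrow> Arr E X Y = {Zero E X Y}"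
      using g(3,4) by simp_all
  qed
  then show ?thesis using has_coset_support_grade assms(3,4) T.has_coset_support_iff by blast
qed

end

section \<open>Characters of groups of prime order\<close>

text \<open>A root of 1 + z + ... + z^(p-1). It differs from 1 because there the value is p, which
  is nonzero in characteristic zero.\<close>

lemma ex_nontrivial_root_of_unity:
  assumes "Factorial_Ring.prime (p::nat)"
  shows "\<exists>z::'k::{alg_closed_field, field_char_0}. z ^ p = 1 \<and> z \<noteq> 1"
proof -
  have p: "p > 1" using assms prime_gt_1_nat by blast
  obtain z :: 'k where z: "(\<Sum>k\<le>p - 1. 1 * z ^ k) = 0"
    using alg_closed[of "p - 1" "\<lambda>_. 1"] p by auto
  have eq: "{..<p} = {..p - 1}" using p by auto
  have sum: "(\<Sum>k<p. z ^ k) = 0" using z unfolding eq by simp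
  have "z \<noteq> 1" using sum p by auto
  moreover have "z ^ p = 1" using power_diff_1_eq[of z p] sum by simp
  ultimately show ?thesis by blast
qed

lemma power_cong_mod:
  fixes z :: "'k::field"
  assumes "z ^ p = 1" "[i = j] (mod p)"
  shows "z ^ i = z ^ j"
proof -
  have "z ^ i = z ^ (i mod p)" for i
    using assms(1) div_mult_mod_eq[of i p] by (metis mult.commute mult_1 power_add power_mult power_one)
  then show ?thesis using assms(2) unfolding cong_def by metis
qed

text \<open>A group of prime order is generated by any \<open>a\<close> other than \<one>; send
  \<open>a\<close> to a nontrivial root of unity.\<close>

lemma (in group) ex_faithful_character:
  assumes p: "Factorial_Ring.prime (Coset.order G)"
  shows "\<exists>\<chi>::'a \<Rightarrow> 'k::{alg_closed_field, field_char_0}.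
    (\<forall>x\<in>carrier G. \<forall>y\<in>carrier G. \<chi> (x \<otimes> y) = \<chi> x * \<chi> y) \<and>
    (\<forall>x\<in>carrier G. \<chi> x = 1 \<longleftrightarrow> x = \<one>) \<and> (\<forall>x\<in>carrier G. \<chi> x ^ Coset.order G = 1)"
proof -
  have fin: "finite (carrier G)" using p prime_gt_0_nat by (auto simp: Coset.order_def intro: card_ge_0_finite)
  have "Coset.order G > 1" using p prime_gt_1_nat by blast
  then obtain a where a: "a \<in> carrier G" "a \<noteq> \<one>"
    unfolding Coset.order_def by (metis One_nat_def card_1_singleton_iff is_singletonI' is_singleton_altdef
      less_irrefl one_closed empty_iff)
  have ord: "ord a = Coset.order G"
    using ord_dvd_group_order[OF a(1)] p a ord_eq_1[OF a(1)] unfolding prime_nat_iff by blast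
  have "generate G {a} = carrier G"
    using generate_pow_card[OF a(1)] ord fin generate_incl[of "{a}"] a
    by (intro card_subset_eq) (auto simp: Coset.order_def)
  then have pow: "\<exists>i::nat. x = a [^] i" if "x \<in> carrier G" for x
    using generate_pow_on_finite_carrier[OF fin a(1)] that by blast
  obtain z :: 'k where z: "z ^ Coset.order G = 1" "z \<noteq> 1" using ex_nontrivial_root_of_unity[OF p] by blast
  \<comment> \<open>The exponent is determined only modulo the group order, and powers of
    \<open>z\<close> depend on no more than that.\<close>
  define \<chi> where "\<chi> x = z ^ (SOME i::nat. x = a [^] i)" for x
  have \<chi>: "\<chi> (a [^] i) = z ^ i" for i :: nat
  proof -
    define j where "j = (SOME j::nat. a [^] i = a [^] j)"
    have "a [^] i = a [^] j" unfolding j_def by (rule someI[where P = "\<lambda>j. a [^] i = a [^] j"]) (rule refl)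
    then have "a [^] int i = a [^] int j" unfolding int_pow_int .
    then have "int (ord a) dvd int j - int i" unfolding int_pow_eq[OF a(1)] .
    then have "[int j = int i] (mod int (Coset.order G))"
      unfolding ord cong_iff_dvd_diff .
    then have "[j = i] (mod Coset.order G)" by (simp only: cong_int_iff)
    then show ?thesis unfolding \<chi>_def j_def by (rule power_cong_mod[OF z(1)])
  qed
  have "\<chi> (x \<otimes> y) = \<chi> x * \<chi> y" if xy: "x \<in> carrier G" "y \<in> carrier G" for x y
  proof -
    obtain i j :: nat where ij: "x = a [^] i" "y = a [^] j" using pow[OF xy(1)] pow[OF xy(2)] by blast
    then have "x \<otimes> y = a [^] (i + j)" using nat_pow_mult[OF a(1)] by simp
    then show ?thesis using ij \<chi> by (simp add: power_add)
  qed
  moreover have "\<chi> x = 1 \<longleftrightarrow> x = \<one>" if x: "x \<in> carrier G" for x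
  proof -
    obtain i :: nat where i: "x = a [^] i" using pow[OF x] by blast
    show ?thesis
    proof
      assume "\<chi> x = 1"
      then have zi: "z ^ i = 1" using i \<chi> by simp
      show "x = \<one>"
      proof (rule ccontr)
        assume "x \<noteq> \<one>"
        then have "\<not> Coset.order G dvd i" using i pow_eq_id[OF a(1)] ord by metis
        then have "coprime i (Coset.order G)" using p prime_imp_coprime coprime_commute by blast
        \<comment> \<open>If i is invertible modulo the order with inverse u, then z = z^(i u) = 1,
          which is excluded.\<close>
        then obtain u where "[i * u = 1] (mod Coset.order G)" using cong_solve_coprime_nat by auto
        then have "z ^ (i * u) = z ^ 1" using power_cong_mod z(1) by blast
        then show False using zi z(2) by (simp add: power_mult)
      qed
    next
      assume "x = \<one>"
      then have "x = a [^] (0::nat)" by simp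
      then show "\<chi> x = 1" using \<chi>[of 0] by simp
    qed
  qed
  moreover have "\<chi> x ^ Coset.order G = 1" if x: "x \<in> carrier G" for x
  proof -
    obtain i :: nat where i: "x = a [^] i" using pow[OF x] by blast
    have "\<chi> x ^ Coset.order G = (z ^ Coset.order G) ^ i" unfolding i \<chi> by (metis mult.commute power_mult)
    then show ?thesis using z by simp
  qed
  ultimately show ?thesis by blast
qed

section \<open>Equivariantizations\<close>

text \<open>The monoidal axioms for the equivariantization are part of the locale; they are
  available whenever it is tensor equivalent to another category.\<close>

locale equivariantized = categorical_action K D \<rho> +
  EQ: linear_monoidal_category "equivariantization K D \<rho>"
  for K :: "'g monoid" and D :: "('o, 'm, 'k::field) mon_cat" and \<rho> :: "('g, 'o, 'm) cat_action"
begin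

abbreviation Eq where "Eq \<equiv> equivariantization K D \<rho>"

text \<open>The tensor product with the one-dimensional representation \<chi> of \<open>K\<close>,
  realized by rescaling the equivariant structure. The underlying object is unchanged, so
  compatibility with tensor products becomes an equality instead of an isomorphism.\<close>

definition twist :: "('g \<Rightarrow> 'k) \<Rightarrow> 'o \<times> ('g \<Rightarrow> 'm) \<Rightarrow> 'o \<times> ('g \<Rightarrow> 'm)"
  where "twist \<chi> = (\<lambda>(X, \<mu>). (X, \<lambda>g\<in>carrier K. \<chi> g \<odot>\<^bsub>Hom D (FOb (act \<rho> g) X) X\<^esub> \<mu> g))"

lemma tf: "g \<in> carrier K \<Longrightarrow> tensor_functor D D (act \<rho> g)"
  using act_equivalence unfolding tensor_equivalence_def by blast

lemma act_Ob: "g \<in> carrier K \<Longrightarrow> X \<in> Ob D \<Longrightarrow> FOb (act \<rho> g) X \<in> Ob D"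
  using tensor_functor.FOb_Ob[OF tf] .

lemma Ob_Eq: "Ob Eq = {A. equivariant_object K D \<rho> A}"
  unfolding equivariantization_def by simp

lemma Hom_Eq: "Hom Eq (X, \<mu>) (Y, \<nu>) = (Hom D X Y)\<lparr>carrier := {f \<in> Arr D X Y.
        \<forall>g\<in>carrier K. f \<Zcomp>\<^bsub>D\<^esub> \<mu> g = \<nu> g \<Zcomp>\<^bsub>D\<^esub> FArr (act \<rho> g) X Y f}\<rparr>"
  unfolding equivariantization_def by simp

lemma Ide_Eq: "Ide Eq (X, \<mu>) = Ide D X" and Cmp_Eq: "Cmp Eq = Cmp D"
  unfolding equivariantization_def by simp_all

lemma TenO_Eq: "TenO Eq (X, \<mu>) (Y, \<nu>) = (X \<boxtimes>\<^bsub>D\<^esub> Y, \<lambda>g\<in>carrier K. (\<mu> g \<star>\<^bsub>D\<^esub> \<nu> g) \<Zcomp>\<^bsub>D\<^esub>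
        inverse_arrow D (FOb (act \<rho> g) X \<boxtimes>\<^bsub>D\<^esub> FOb (act \<rho> g) Y) (FOb (act \<rho> g) (X \<boxtimes>\<^bsub>D\<^esub> Y))
          (FTen (act \<rho> g) X Y))"
  unfolding equivariantization_def by simp

lemma equivariant_objectD:
  assumes "(X, \<mu>) \<in> Ob Eq"
  shows "X \<in> Ob D" "\<mu> \<in> extensional (carrier K)"
    "g \<in> carrier K \<Longrightarrow> isomorphism D (FOb (act \<rho> g) X) X (\<mu> g)"
    "g \<in> carrier K \<Longrightarrow> \<mu> g \<in> Arr D (FOb (act \<rho> g) X) X"
    "\<lbrakk>g \<in> carrier K; h \<in> carrier K\<rbrakk> \<Longrightarrow> \<mu> (g \<otimes>\<^bsub>K\<^esub> h) \<Zcomp>\<^bsub>D\<^esub> comp_iso \<rho> g h X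
      = \<mu> g \<Zcomp>\<^bsub>D\<^esub> FArr (act \<rho> g) (FOb (act \<rho> h) X) X (\<mu> h)"
    "\<mu> \<one>\<^bsub>K\<^esub> \<Zcomp>\<^bsub>D\<^esub> unit_iso \<rho> X = Ide D X"
  using assms unfolding Ob_Eq equivariant_object_def isomorphism_def by auto

lemma isomorphism_smult:
  assumes "isomorphism D X Y f" "X \<in> Ob D" "Y \<in> Ob D" "c \<noteq> 0"
  shows "isomorphism D X Y (c \<odot>\<^bsub>Hom D X Y\<^esub> f)"
proof -
  obtain g where g: "f \<in> Arr D X Y" "g \<in> Arr D Y X" "g \<Zcomp>\<^bsub>D\<^esub> f = Ide D X" "f \<Zcomp>\<^bsub>D\<^esub> g = Ide D Y"
    using C.isomorphismE[OF assms(1)] by blast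
  let ?f = "c \<odot>\<^bsub>Hom D X Y\<^esub> f" and ?g = "inverse c \<odot>\<^bsub>Hom D Y X\<^esub> g"
  have fg: "?f \<in> Arr D X Y" "?g \<in> Arr D Y X" using g assms C.smult_Arr by auto
  have "?g \<Zcomp>\<^bsub>D\<^esub> ?f = Ide D X"
    using C.Cmp_smult_left[OF assms(2,3,2) fg(1) g(2)] C.Cmp_smult_right[OF assms(2,3,2) g(1,2)]
      g assms(2,4) C.smult_smult[OF assms(2,2) C.Id_Arr] by simp
  moreover have "?f \<Zcomp>\<^bsub>D\<^esub> ?g = Ide D Y"
    using C.Cmp_smult_left[OF assms(3,2,3) fg(2) g(1)] C.Cmp_smult_right[OF assms(3,2,3) g(2,1)]
      g assms(3,4) C.smult_smult[OF assms(3,3) C.Id_Arr] by simp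
  ultimately show ?thesis unfolding isomorphism_def using fg by blast
qed

context
  fixes \<chi> :: "'g \<Rightarrow> 'k"
  assumes \<chi>_mult: "\<And>g h. \<lbrakk>g \<in> carrier K; h \<in> carrier K\<rbrakk> \<Longrightarrow> \<chi> (g \<otimes>\<^bsub>K\<^esub> h) = \<chi> g * \<chi> h"
    and \<chi>_one: "\<chi> \<one>\<^bsub>K\<^esub> = 1" and \<chi>_nonzero: "\<And>g. g \<in> carrier K \<Longrightarrow> \<chi> g \<noteq> 0"
begin

lemma twist_Ob:
  assumes "B \<in> Ob Eq"
  shows "twist \<chi> B \<in> Ob Eq"
proof -
  obtain X \<mu> where B: "B = (X, \<mu>)" by (cases B)
  note eq = equivariant_objectD[OF assms[unfolded B]]
  let ?\<nu> = "\<lambda>g\<in>carrier K. \<chi> g \<odot>\<^bsub>Hom D (FOb (act \<rho> g) X) X\<^esub> \<mu> g"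
  have "isomorphism D (FOb (act \<rho> g) X) X (?\<nu> g)" if "g \<in> carrier K" for g
    using isomorphism_smult[OF eq(3)[OF that] act_Ob[OF that eq(1)] eq(1) \<chi>_nonzero[OF that]] that by simp
  \<comment> \<open>Both sides acquire the factor \<chi>(g) \<chi>(h): on the left by
    multiplicativity of \<chi>, on the right from the two structure arrows, as composition and the
    functor of \<open>g\<close> are linear.\<close>
  moreover have "?\<nu> (g \<otimes>\<^bsub>K\<^esub> h) \<Zcomp>\<^bsub>D\<^esub> comp_iso \<rho> g h X
      = ?\<nu> g \<Zcomp>\<^bsub>D\<^esub> FArr (act \<rho> g) (FOb (act \<rho> h) X) X (?\<nu> h)"
    if gh: "g \<in> carrier K" "h \<in> carrier K" for g h
  proof -
    note obs = act_Ob[OF gh(2) eq(1)] act_Ob[OF gh(1) eq(1)] act_Ob[OF gh(1) act_Ob[OF gh(2) eq(1)]]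
    have ghK: "g \<otimes>\<^bsub>K\<^esub> h \<in> carrier K" using gh by simp
    have ci: "comp_iso \<rho> g h X \<in> Arr D (FOb (act \<rho> g) (FOb (act \<rho> h) X)) (FOb (act \<rho> (g \<otimes>\<^bsub>K\<^esub> h)) X)"
      using comp_iso[OF gh] eq(1)
      unfolding monoidal_nat_iso_def isomorphism_def compose_functors_def by simp
    interpret T: tensor_functor D D "act \<rho> g" using tf gh by blast
    let ?m = "FArr (act \<rho> g) (FOb (act \<rho> h) X) X (\<mu> h)"
    have m: "?m \<in> Arr D (FOb (act \<rho> g) (FOb (act \<rho> h) X)) (FOb (act \<rho> g) X)"
      using T.FArr_Arr[OF obs(1) eq(1) eq(4)[OF gh(2)]] .
    have "?\<nu> (g \<otimes>\<^bsub>K\<^esub> h) \<Zcomp>\<^bsub>D\<^esub> comp_iso \<rho> g h X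
      = (\<chi> g * \<chi> h) \<odot>\<^bsub>Hom D (FOb (act \<rho> g) (FOb (act \<rho> h) X)) X\<^esub> (\<mu> g \<Zcomp>\<^bsub>D\<^esub> ?m)"
      using C.Cmp_smult_left[OF obs(3) act_Ob[OF ghK eq(1)] eq(1) ci eq(4)[OF ghK]] eq(5)[OF gh] ghK
        \<chi>_mult[OF gh] by simp
    also have "\<dots> = ?\<nu> g \<Zcomp>\<^bsub>D\<^esub> (\<chi> h \<odot>\<^bsub>Hom D (FOb (act \<rho> g) (FOb (act \<rho> h) X)) (FOb (act \<rho> g) X)\<^esub> ?m)"
      using C.Cmp_smult_left[OF obs(3,2) eq(1) _ eq(4)[OF gh(1)]] C.smult_Arr[OF obs(3,2) m]
        C.Cmp_smult_right[OF obs(3,2) eq(1) m eq(4)[OF gh(1)]]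
        C.smult_smult(1)[OF obs(3) eq(1) C.Cmp_Arr[OF obs(3,2) eq(1) m eq(4)[OF gh(1)]]] gh by simp
    also have "\<dots> = ?\<nu> g \<Zcomp>\<^bsub>D\<^esub> FArr (act \<rho> g) (FOb (act \<rho> h) X) X (?\<nu> h)"
      using T.FArr_smult[OF obs(1) eq(1) eq(4)[OF gh(2)]] gh by simp
    finally show ?thesis .
  qed
  moreover have "?\<nu> \<one>\<^bsub>K\<^esub> \<Zcomp>\<^bsub>D\<^esub> unit_iso \<rho> X = Ide D X"
    using C.smult_smult(2)[OF act_Ob[OF G.one_closed eq(1)] eq(1) eq(4)[OF G.one_closed]] eq(6) \<chi>_one by simp
  ultimately show ?thesis
    unfolding B twist_def Ob_Eq equivariant_object_def using eq(1) by auto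
qed

lemma twist_Arr:
  assumes "B \<in> Ob Eq" "B' \<in> Ob Eq" "f \<in> Arr Eq B B'"
  shows "f \<in> Arr Eq (twist \<chi> B) (twist \<chi> B')"
proof -
  obtain X \<mu> Y \<nu> where B: "B = (X, \<mu>)" "B' = (Y, \<nu>)" by (cases B; cases B')
  note eq = equivariant_objectD[OF assms(1)[unfolded B]] and eq' = equivariant_objectD[OF assms(2)[unfolded B]]
  have f: "f \<in> Arr D X Y" "\<And>g. g \<in> carrier K \<Longrightarrow> f \<Zcomp>\<^bsub>D\<^esub> \<mu> g = \<nu> g \<Zcomp>\<^bsub>D\<^esub> FArr (act \<rho> g) X Y f"
    using assms(3) unfolding B Hom_Eq by auto
  have "f \<Zcomp>\<^bsub>D\<^esub> (\<chi> g \<odot>\<^bsub>Hom D (FOb (act \<rho> g) X) X\<^esub> \<mu> g)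
    = (\<chi> g \<odot>\<^bsub>Hom D (FOb (act \<rho> g) Y) Y\<^esub> \<nu> g) \<Zcomp>\<^bsub>D\<^esub> FArr (act \<rho> g) X Y f" if g: "g \<in> carrier K" for g
    using C.Cmp_smult_right[OF act_Ob[OF g eq(1)] eq(1) eq'(1) eq(4)[OF g] f(1)]
      C.Cmp_smult_left[OF act_Ob[OF g eq(1)] act_Ob[OF g eq'(1)] eq'(1)
        tensor_functor.FArr_Arr[OF tf[OF g] eq(1) eq'(1) f(1)] eq'(4)[OF g]] f(2)[OF g] by simp
  then show ?thesis unfolding B twist_def using f by (simp add: Hom_Eq)
qed

lemma twist_isomorphic:
  assumes "isomorphic Eq B B'"
  shows "isomorphic Eq (twist \<chi> B) (twist \<chi> B')"
proof -
  have Ob: "B \<in> Ob Eq" "B' \<in> Ob Eq" using assms unfolding isomorphic_def by auto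
  have Ide: "Ide Eq (twist \<chi> B) = Ide Eq B" for B unfolding twist_def by (cases B) (simp add: Ide_Eq)
  obtain f g where "f \<in> Arr Eq B B'" "g \<in> Arr Eq B' B" "g \<Zcomp>\<^bsub>Eq\<^esub> f = Ide Eq B" "f \<Zcomp>\<^bsub>Eq\<^esub> g = Ide Eq B'"
    using assms unfolding isomorphic_def isomorphism_def by blast
  then show ?thesis
    unfolding isomorphic_def isomorphism_def Ide using twist_Arr[OF Ob] twist_Arr[OF Ob(2,1)] twist_Ob Ob by blast
qed

text \<open>The scalar can be pulled out of either tensor factor, so it does not matter which factor
  is twisted. This is the source of centrality.\<close>

lemma twist_TenO:
  assumes "B \<in> Ob Eq" "B' \<in> Ob Eq"
  shows "twist \<chi> B \<boxtimes>\<^bsub>Eq\<^esub> B' = twist \<chi> (B \<boxtimes>\<^bsub>Eq\<^esub> B')" "B \<boxtimes>\<^bsub>Eq\<^esub> twist \<chi> B' = twist \<chi> (B \<boxtimes>\<^bsub>Eq\<^esub> B')"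
proof -
  obtain X \<mu> Y \<nu> where B: "B = (X, \<mu>)" "B' = (Y, \<nu>)" by (cases B; cases B')
  note eq = equivariant_objectD[OF assms(1)[unfolded B]] and eq' = equivariant_objectD[OF assms(2)[unfolded B]]
  {
    fix g assume g: "g \<in> carrier K"
    interpret T: tensor_functor D D "act \<rho> g" using tf g by blast
    note obs = act_Ob[OF g eq(1)] act_Ob[OF g eq'(1)]
    let ?S = "FOb (act \<rho> g) X \<boxtimes>\<^bsub>D\<^esub> FOb (act \<rho> g) Y" and ?T = "FOb (act \<rho> g) (X \<boxtimes>\<^bsub>D\<^esub> Y)"
    let ?i = "inverse_arrow D ?S ?T (FTen (act \<rho> g) X Y)"
    have ST: "?S \<in> Ob D" "?T \<in> Ob D" "X \<boxtimes>\<^bsub>D\<^esub> Y \<in> Ob D"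
      using C.TenO_Ob act_Ob g eq(1) eq'(1) by auto
    have i: "?i \<in> Arr D ?T ?S" using C.inverse_arrow(1)[OF T.FTen_iso[OF eq(1) eq'(1)] ST(1,2)] .
    have mn: "\<mu> g \<star>\<^bsub>D\<^esub> \<nu> g \<in> Arr D ?S (X \<boxtimes>\<^bsub>D\<^esub> Y)"
      using C.TenA_Arr obs eq(1,4) eq'(1,4) g by blast
    have s: "(\<chi> g \<odot>\<^bsub>Hom D ?S (X \<boxtimes>\<^bsub>D\<^esub> Y)\<^esub> (\<mu> g \<star>\<^bsub>D\<^esub> \<nu> g)) \<Zcomp>\<^bsub>D\<^esub> ?i
      = \<chi> g \<odot>\<^bsub>Hom D ?T (X \<boxtimes>\<^bsub>D\<^esub> Y)\<^esub> ((\<mu> g \<star>\<^bsub>D\<^esub> \<nu> g) \<Zcomp>\<^bsub>D\<^esub> ?i)"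
      by (rule C.Cmp_smult_left[OF ST(2,1,3) i mn])
    have "(\<chi> g \<odot>\<^bsub>Hom D (FOb (act \<rho> g) X) X\<^esub> \<mu> g) \<star>\<^bsub>D\<^esub> \<nu> g
      = \<chi> g \<odot>\<^bsub>Hom D ?S (X \<boxtimes>\<^bsub>D\<^esub> Y)\<^esub> (\<mu> g \<star>\<^bsub>D\<^esub> \<nu> g)"
      using linear_mapD(4)[OF C.TenA_linear_left[OF obs(1) eq(1) obs(2) eq'(1) eq'(4)[OF g]],
          where a = "\<chi> g"] eq(4)[OF g] by (simp add: class_ring_simps)
    with s have 1: "((\<chi> g \<odot>\<^bsub>Hom D (FOb (act \<rho> g) X) X\<^esub> \<mu> g) \<star>\<^bsub>D\<^esub> \<nu> g) \<Zcomp>\<^bsub>D\<^esub> ?i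
      = \<chi> g \<odot>\<^bsub>Hom D ?T (X \<boxtimes>\<^bsub>D\<^esub> Y)\<^esub> ((\<mu> g \<star>\<^bsub>D\<^esub> \<nu> g) \<Zcomp>\<^bsub>D\<^esub> ?i)" by simp
    have "\<mu> g \<star>\<^bsub>D\<^esub> (\<chi> g \<odot>\<^bsub>Hom D (FOb (act \<rho> g) Y) Y\<^esub> \<nu> g)
      = \<chi> g \<odot>\<^bsub>Hom D ?S (X \<boxtimes>\<^bsub>D\<^esub> Y)\<^esub> (\<mu> g \<star>\<^bsub>D\<^esub> \<nu> g)"
      using linear_mapD(4)[OF C.TenA_linear_right[OF obs(1) eq(1) obs(2) eq'(1) eq(4)[OF g]],
          where a = "\<chi> g"] eq'(4)[OF g] by (simp add: class_ring_simps)
    with s have 2: "(\<mu> g \<star>\<^bsub>D\<^esub> (\<chi> g \<odot>\<^bsub>Hom D (FOb (act \<rho> g) Y) Y\<^esub> \<nu> g)) \<Zcomp>\<^bsub>D\<^esub> ?i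
      = \<chi> g \<odot>\<^bsub>Hom D ?T (X \<boxtimes>\<^bsub>D\<^esub> Y)\<^esub> ((\<mu> g \<star>\<^bsub>D\<^esub> \<nu> g) \<Zcomp>\<^bsub>D\<^esub> ?i)" by simp
    note 1 2
  }
  then show "twist \<chi> B \<boxtimes>\<^bsub>Eq\<^esub> B' = twist \<chi> (B \<boxtimes>\<^bsub>Eq\<^esub> B')" "B \<boxtimes>\<^bsub>Eq\<^esub> twist \<chi> B' = twist \<chi> (B \<boxtimes>\<^bsub>Eq\<^esub> B')"
    unfolding B twist_def by (auto simp: TenO_Eq intro!: restrict_ext)
qed

end

end

text \<open>This property climbs the chain from \<open>Vect\<close>: the unit of an extension lies
  in the trivial component, and the unit of an equivariantization has the old unit underneath. It
  makes the twisted unit simple and distinguishes it from the unit.\<close>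

definition scalar_Unit_endomorphisms :: "('o, 'm, 'k) mon_cat \<Rightarrow> bool"
  where "scalar_Unit_endomorphisms C \<longleftrightarrow>
    (\<forall>f\<in>Arr C (Unit C) (Unit C). \<exists>c. f = c \<odot>\<^bsub>Hom C (Unit C) (Unit C)\<^esub> Ide C (Unit C))"

context linear_category
begin

text \<open>Conjugation by the isomorphism carries scalars to the same scalars.\<close>

lemma scalar_endomorphism_isomorphic:
  assumes iso: "isomorphic C X Y" and X: "\<And>f. f \<in> Arr C X X \<Longrightarrow> \<exists>c. f = c \<odot>\<^bsub>Hom C X X\<^esub> Ide C X"
    and f: "f \<in> Arr C Y Y"
  shows "\<exists>c. f = c \<odot>\<^bsub>Hom C Y Y\<^esub> Ide C Y"
proof -
  note Ob = isomorphic_Ob[OF iso]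
  obtain u v where u: "u \<in> Arr C X Y" "v \<in> Arr C Y X" "v \<Zcomp> u = Ide C X" "u \<Zcomp> v = Ide C Y"
    using iso unfolding isomorphic_def isomorphism_def by blast
  have fu: "f \<Zcomp> u \<in> Arr C X Y" using Cmp_Arr[OF Ob(1,2,2) u(1) f] .
  obtain c where c: "v \<Zcomp> (f \<Zcomp> u) = c \<odot>\<^bsub>Hom C X X\<^esub> Ide C X"
    using X[OF Cmp_Arr[OF Ob(1,2,1) fu u(2)]] by blast
  have "f = (u \<Zcomp> v) \<Zcomp> (f \<Zcomp> (u \<Zcomp> v))"
    using Cmp_Id_left[OF Ob(2,2) f] Cmp_Id_right[OF Ob(2,2) f] u(4) by simp
  also have "\<dots> = (u \<Zcomp> (v \<Zcomp> (f \<Zcomp> u))) \<Zcomp> v"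
    using f u(1,2) Ob by (simp add: Cmp_assoc Cmp_Arr)
  also have "\<dots> = c \<odot>\<^bsub>Hom C Y Y\<^esub> Ide C Y"
    using c u Ob by (simp add: Cmp_smult_right Cmp_smult_left Cmp_Id_right Id_Arr)
  finally show ?thesis by blast
qed

end

context tensor_equivalence
begin

lemma scalar_endomorphism_FOb:
  assumes "X \<in> Ob C"
  shows "(\<forall>f\<in>Arr C X X. \<exists>c. f = c \<odot>\<^bsub>Hom C X X\<^esub> Ide C X) \<longleftrightarrow>
    (\<forall>f\<in>Arr D (FOb F X) (FOb F X). \<exists>c. f = c \<odot>\<^bsub>Hom D (FOb F X) (FOb F X)\<^esub> Ide D (FOb F X))"
proof (intro iffI ballI)
  have sm: "FArr F X X (c \<odot>\<^bsub>Hom C X X\<^esub> Ide C X) = c \<odot>\<^bsub>Hom D (FOb F X) (FOb F X)\<^esub> Ide D (FOb F X)" for c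
    using FArr_smult[OF assms assms C.Id_Arr[OF assms]] FArr_Id[OF assms] by simp
  {
    fix g assume *: "\<forall>f\<in>Arr C X X. \<exists>c. f = c \<odot>\<^bsub>Hom C X X\<^esub> Ide C X" and g: "g \<in> Arr D (FOb F X) (FOb F X)"
    obtain f where f: "f \<in> Arr C X X" "FArr F X X f = g" using FArr_surj[OF assms assms g] by metis
    then obtain c where "f = c \<odot>\<^bsub>Hom C X X\<^esub> Ide C X" using * by blast
    then show "\<exists>c. g = c \<odot>\<^bsub>Hom D (FOb F X) (FOb F X)\<^esub> Ide D (FOb F X)" using sm f(2) by blast
  next
    fix f assume *: "\<forall>f\<in>Arr D (FOb F X) (FOb F X). \<exists>c. f = c \<odot>\<^bsub>Hom D (FOb F X) (FOb F X)\<^esub> Ide D (FOb F X)"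
      and f: "f \<in> Arr C X X"
    obtain c where "FArr F X X f = c \<odot>\<^bsub>Hom D (FOb F X) (FOb F X)\<^esub> Ide D (FOb F X)"
      using * FArr_Arr[OF assms assms f] by blast
    then have "FArr F X X f = FArr F X X (c \<odot>\<^bsub>Hom C X X\<^esub> Ide C X)" unfolding sm .
    then have "f = c \<odot>\<^bsub>Hom C X X\<^esub> Ide C X"
      unfolding FArr_inject[OF assms assms f C.smult_Arr[OF assms assms C.Id_Arr[OF assms]]] .
    then show "\<exists>c. f = c \<odot>\<^bsub>Hom C X X\<^esub> Ide C X" by blast
  }
qed

lemma scalar_Unit_endomorphisms_iff:
  "scalar_Unit_endomorphisms C \<longleftrightarrow> scalar_Unit_endomorphisms D"
proof -
  have "(\<forall>f\<in>Arr D (FOb F (Unit C)) (FOb F (Unit C)).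
      \<exists>c. f = c \<odot>\<^bsub>Hom D (FOb F (Unit C)) (FOb F (Unit C))\<^esub> Ide D (FOb F (Unit C))) \<longleftrightarrow>
    (\<forall>f\<in>Arr D (Unit D) (Unit D). \<exists>c. f = c \<odot>\<^bsub>Hom D (Unit D) (Unit D)\<^esub> Ide D (Unit D))"
    using D.scalar_endomorphism_isomorphic[OF FOb_Unit]
      D.scalar_endomorphism_isomorphic[OF D.isomorphic_sym[OF FOb_Unit]] by (intro iffI ballI) simp_all
  then show ?thesis
    unfolding scalar_Unit_endomorphisms_def using scalar_endomorphism_FOb[OF C.Unit_Ob] by simp
qed

end

section \<open>Simplicity from endomorphisms, and Schur's lemma\<close>

context fusion_category
begin

text \<open>Take a simple summand \<open>W\<close> of \<open>X\<close>. The idempotent of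
  \<open>X\<close> cutting it out is a scalar fixing the nonzero inclusion of \<open>W\<close>, so
  it is the identity and \<open>W\<close> is all of \<open>X\<close>.\<close>

lemma simple_if_scalar:
  assumes X: "X \<in> Ob C" "\<not> zero_object C X" and sc: "\<And>f. f \<in> Arr C X X \<Longrightarrow> \<exists>c. f = c \<odot>\<^bsub>Hom C X X\<^esub> Ide C X"
  shows "simple_object C X"
proof -
  obtain n :: nat and V inc prj where V: "\<forall>i<n. simple_object C (V i)" "direct_sum C {..<n} V X inc prj"
    using semisimple[OF X(1)] by blast
  have sum: "finsum (Hom C X X) (\<lambda>i. inc i \<Zcomp> prj i) {..<n} = Ide C X"
    using V(2) unfolding direct_sum_def by blast
  interpret H: vectorspace class_ring "Hom C X X" using Hom_vectorspace X by blast
  have "n \<noteq> 0"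
  proof
    assume "n = 0"
    then have "Ide C X = Zero C X X" using sum by simp
    then show False using X unfolding zero_object_def by simp
  qed
  then have n: "0 < n" by simp
  define i p W where "i = inc 0" and "p = prj 0" and "W = V 0"
  have W: "simple_object C W" "W \<in> Ob C" "\<not> zero_object C W"
    using V(1) n simple_objectD unfolding W_def by auto
  have ip: "i \<in> Arr C W X" "p \<in> Arr C X W" "p \<Zcomp> i = Ide C W"
    using V(2) n unfolding direct_sum_def i_def p_def W_def by auto
  obtain c where c: "i \<Zcomp> p = c \<odot>\<^bsub>Hom C X X\<^esub> Ide C X" using sc Cmp_Arr[OF X(1) W(2) X(1) ip(2,1)] by blast
  have "1 \<odot>\<^bsub>Hom C W X\<^esub> i = (i \<Zcomp> p) \<Zcomp> i"
    using ip W(2) X(1) by (simp add: Cmp_assoc smult_smult Cmp_Id_right)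
  also have "\<dots> = c \<odot>\<^bsub>Hom C W X\<^esub> i"
    unfolding c using Cmp_smult_left[OF W(2) X(1,1) ip(1) Id_Arr[OF X(1)]] Cmp_Id_left[OF W(2) X(1) ip(1)] by simp
  finally have "1 \<odot>\<^bsub>Hom C W X\<^esub> i = c \<odot>\<^bsub>Hom C W X\<^esub> i" .
  moreover have "i \<noteq> Zero C W X"
    using W(2,3) ip(3) Cmp_Zero_right[OF W(2) X(1) W(2) ip(2)] unfolding zero_object_def by auto
  ultimately have "c = 1" using smult_cancel[OF W(2) X(1) ip(1)] by blast
  then have "i \<Zcomp> p = Ide C X" using c smult_smult(2)[OF X(1,1) Id_Arr[OF X(1)]] by simp
  then have "isomorphism C W X i" unfolding isomorphism_def using ip by blast
  then show ?thesis using simple_object_isomorphic[OF isomorphicI W(1)] W(2) X(1) by blast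
qed

text \<open>The kernel of a nonzero arrow is a proper subobject of the simple source, hence zero;
  the arrow is then monic into a simple target.\<close>

lemma simple_hom_nonzero_isomorphic:
  assumes "simple_object C X" "simple_object C Y" "hom_nonzero C X Y"
  shows "isomorphic C X Y"
proof -
  note Ob = simple_objectD(1)[OF assms(1)] simple_objectD(1)[OF assms(2)]
  obtain f where f: "f \<in> Arr C X Y" "f \<noteq> Zero C X Y" using assms(3) unfolding hom_nonzero_def by blast
  obtain K k where "is_kernel C X Y f K k" using kernels[OF Ob f(1)] by blast
  then have K: "K \<in> Ob C" "k \<in> Arr C K X" "f \<Zcomp> k = Zero C K Y"
    and uniq: "\<And>W h. \<lbrakk>W \<in> Ob C; h \<in> Arr C W X; f \<Zcomp> h = Zero C W Y\<rbrakk> \<Longrightarrow> \<exists>!u. u \<in> Arr C W K \<and> k \<Zcomp> u = h"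
    unfolding is_kernel_def by auto
  have "monic C K X k"
    unfolding monic_def
  proof (intro conjI ballI impI K(2))
    fix W g h assume W: "W \<in> Ob C" "g \<in> Arr C W K" "h \<in> Arr C W K" "k \<Zcomp> g = k \<Zcomp> h"
    have "f \<Zcomp> (k \<Zcomp> g) = (f \<Zcomp> k) \<Zcomp> g" using Cmp_assoc[OF W(1) K(1) Ob W(2) K(2) f(1)] by simp
    also have "\<dots> = Zero C W Y" using K(3) Cmp_Zero_left[OF W(1) K(1) Ob(2) W(2)] by simp
    finally have "\<exists>!u. u \<in> Arr C W K \<and> k \<Zcomp> u = k \<Zcomp> g"
      using uniq[OF W(1) Cmp_Arr[OF W(1) K(1) Ob(1) W(2) K(2)]] by blast
    then show "g = h" using W(2-4) by metis
  qed
  then have *: "zero_object C K \<or> isomorphism C K X k"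
    using assms(1) K(1) unfolding simple_object_def by blast
  have "\<not> isomorphism C K X k"
  proof
    assume "isomorphism C K X k"
    then obtain h where h: "h \<in> Arr C X K" "k \<Zcomp> h = Ide C X" unfolding isomorphism_def by blast
    have "f = (f \<Zcomp> k) \<Zcomp> h"
      using Cmp_assoc[OF Ob(1) K(1) Ob h(1) K(2) f(1)] h(2) Cmp_Id_right[OF Ob f(1)] by simp
    then show False using K(3) Cmp_Zero_left[OF Ob(1) K(1) Ob(2) h(1)] f(2) by simp
  qed
  with * have zK: "zero_object C K" by blast
  have "monic C X Y f"
  proof (rule monicI_zero[OF Ob f(1)])
    fix W u assume W: "W \<in> Ob C" "u \<in> Arr C W X" "f \<Zcomp> u = Zero C W Y"
    obtain v where v: "v \<in> Arr C W K" "k \<Zcomp> v = u" using uniq[OF W] by blast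
    have "v = Zero C W K" using Arr_zero_target[OF zK W(1) v(1)] .
    then show "u = Zero C W X" using v(2) Cmp_Zero_right[OF W(1) K(1) Ob(1) K(2)] by simp
  qed
  then have "isomorphism C X Y f"
    using assms(1,2) Ob unfolding simple_object_def by blast
  then show ?thesis using isomorphicI Ob by blast
qed

end

section \<open>The unit object twisted by a character\<close>

context equivariantized
begin

lemma scalar_Unit_endomorphisms_Eq:
  assumes "scalar_Unit_endomorphisms D"
  shows "scalar_Unit_endomorphisms Eq"
  unfolding scalar_Unit_endomorphisms_def
proof
  fix f assume f: "f \<in> Arr Eq (Unit Eq) (Unit Eq)"
  obtain \<mu> where U: "Unit Eq = (Unit D, \<mu>)" unfolding equivariantization_def by simp
  have "f \<in> Arr D (Unit D) (Unit D)" using f unfolding U Hom_Eq by simp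
  then obtain c where "f = c \<odot>\<^bsub>Hom D (Unit D) (Unit D)\<^esub> Ide D (Unit D)"
    using assms unfolding scalar_Unit_endomorphisms_def by blast
  then show "\<exists>c. f = c \<odot>\<^bsub>Hom Eq (Unit Eq) (Unit Eq)\<^esub> Ide Eq (Unit Eq)"
    unfolding U Hom_Eq Ide_Eq by auto
qed

lemma twist_Unit_scalar:
  assumes "scalar_Unit_endomorphisms D" "f \<in> Arr Eq (twist \<chi> (Unit Eq)) (twist \<chi> (Unit Eq))"
  shows "\<exists>c. f = c \<odot>\<^bsub>Hom Eq (twist \<chi> (Unit Eq)) (twist \<chi> (Unit Eq))\<^esub> Ide Eq (twist \<chi> (Unit Eq))"
proof -
  obtain \<mu> where U: "twist \<chi> (Unit Eq) = (Unit D, \<mu>)" unfolding equivariantization_def twist_def by simp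
  have "f \<in> Arr D (Unit D) (Unit D)" using assms(2) unfolding U Hom_Eq by simp
  then obtain c where "f = c \<odot>\<^bsub>Hom D (Unit D) (Unit D)\<^esub> Ide D (Unit D)"
    using assms(1) unfolding scalar_Unit_endomorphisms_def by blast
  then show ?thesis unfolding U Hom_Eq Ide_Eq by auto
qed

context
  fixes \<chi> :: "'g \<Rightarrow> 'k"
  assumes \<chi>_mult: "\<And>g h. \<lbrakk>g \<in> carrier K; h \<in> carrier K\<rbrakk> \<Longrightarrow> \<chi> (g \<otimes>\<^bsub>K\<^esub> h) = \<chi> g * \<chi> h"
    and \<chi>_one: "\<chi> \<one>\<^bsub>K\<^esub> = 1" and \<chi>_nonzero: "\<And>g. g \<in> carrier K \<Longrightarrow> \<chi> g \<noteq> 0"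
begin

text \<open>Both products are twists of objects isomorphic to \<open>B\<close>, by
  \<open>twist_TenO\<close> and the unit isomorphisms.\<close>

lemma twist_Unit_central:
  assumes "B \<in> Ob Eq"
  shows "isomorphic Eq (twist \<chi> (Unit Eq) \<boxtimes>\<^bsub>Eq\<^esub> B) (B \<boxtimes>\<^bsub>Eq\<^esub> twist \<chi> (Unit Eq))"
proof -
  have "isomorphic Eq (Unit Eq \<boxtimes>\<^bsub>Eq\<^esub> B) B"
    using EQ.isomorphicI[OF EQ.LUn_iso[OF assms]] EQ.TenO_Ob[OF EQ.Unit_Ob assms] assms by blast
  also have "isomorphic Eq B (B \<boxtimes>\<^bsub>Eq\<^esub> Unit Eq)"
    using EQ.isomorphic_sym[OF EQ.isomorphicI[OF EQ.RUn_iso[OF assms]]]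
      EQ.TenO_Ob[OF assms EQ.Unit_Ob] assms by blast
  finally show ?thesis
    using twist_TenO[OF \<chi>_mult \<chi>_one \<chi>_nonzero EQ.Unit_Ob assms] twist_TenO[OF \<chi>_mult \<chi>_one \<chi>_nonzero assms EQ.Unit_Ob]
      twist_isomorphic[OF \<chi>_mult \<chi>_one \<chi>_nonzero] by simp
qed

text \<open>An isomorphism is a nonzero scalar c; its equivariance at \<open>g\<close> reads c
  \<mu>(g) = c \<chi>(g) \<mu>(g) with \<mu>(g) nonzero, which forces \<chi>(g) = 1.\<close>

lemma twist_Unit_not_isomorphic:
  assumes sc: "scalar_Unit_endomorphisms D" and nz: "\<not> zero_object D (Unit D)"
    and g: "g \<in> carrier K" "\<chi> g \<noteq> 1"
  shows "\<not> isomorphic Eq (Unit Eq) (twist \<chi> (Unit Eq))"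
proof
  assume "isomorphic Eq (Unit Eq) (twist \<chi> (Unit Eq))"
  then obtain f where f: "isomorphism Eq (Unit Eq) (twist \<chi> (Unit Eq)) f" unfolding isomorphic_def by blast
  obtain \<mu> where U: "Unit Eq = (Unit D, \<mu>)" unfolding equivariantization_def by simp
  note eq = equivariant_objectD[OF EQ.Unit_Ob[unfolded U]]
  interpret T: tensor_functor D D "act \<rho> g" using tf g by blast
  note obs = act_Ob[OF g(1) C.Unit_Ob] C.Unit_Ob
  let ?H = "Hom D (FOb (act \<rho> g) (Unit D)) (Unit D)"
  have fD: "f \<in> Arr D (Unit D) (Unit D)"
    and fe: "f \<Zcomp>\<^bsub>D\<^esub> \<mu> g = (\<chi> g \<odot>\<^bsub>?H\<^esub> \<mu> g) \<Zcomp>\<^bsub>D\<^esub> FArr (act \<rho> g) (Unit D) (Unit D) f"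
    using f g unfolding isomorphism_def U twist_def by (auto simp: Hom_Eq)
  have "f \<noteq> Zero D (Unit D) (Unit D)"
  proof
    assume z: "f = Zero D (Unit D) (Unit D)"
    obtain h where "h \<in> Arr D (Unit D) (Unit D)" "h \<Zcomp>\<^bsub>D\<^esub> f = Ide D (Unit D)"
      using f unfolding isomorphism_def U twist_def by (auto simp: Hom_Eq Ide_Eq Cmp_Eq)
    then show False
      using z nz C.Cmp_Zero_right[OF obs(2,2,2)] obs unfolding zero_object_def by auto
  qed
  moreover obtain c where c: "f = c \<odot>\<^bsub>Hom D (Unit D) (Unit D)\<^esub> Ide D (Unit D)"
    using sc fD unfolding scalar_Unit_endomorphisms_def by blast
  ultimately have c0: "c \<noteq> 0" using C.smult_smult(3)[OF obs(2,2) C.Id_Arr[OF obs(2)]] by auto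
  have m0: "\<mu> g \<noteq> Zero D (FOb (act \<rho> g) (Unit D)) (Unit D)"
  proof
    assume z: "\<mu> g = Zero D (FOb (act \<rho> g) (Unit D)) (Unit D)"
    obtain h where h: "h \<in> Arr D (Unit D) (FOb (act \<rho> g) (Unit D))" "\<mu> g \<Zcomp>\<^bsub>D\<^esub> h = Ide D (Unit D)"
      using eq(3)[OF g(1)] unfolding isomorphism_def by blast
    then show False using z nz obs C.Cmp_Zero_left[OF obs(2,1,2) h(1)] unfolding zero_object_def by simp
  qed
  have "f \<Zcomp>\<^bsub>D\<^esub> \<mu> g = c \<odot>\<^bsub>?H\<^esub> \<mu> g"
    unfolding c using C.Cmp_smult_left[OF obs(1,2,2) eq(4)[OF g(1)] C.Id_Arr[OF obs(2)]]
      C.Cmp_Id_left[OF obs eq(4)[OF g(1)]] by simp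
  moreover have "(\<chi> g \<odot>\<^bsub>?H\<^esub> \<mu> g) \<Zcomp>\<^bsub>D\<^esub> FArr (act \<rho> g) (Unit D) (Unit D) f = (c * \<chi> g) \<odot>\<^bsub>?H\<^esub> \<mu> g"
    unfolding c
    using T.FArr_smult[OF obs(2,2) C.Id_Arr[OF obs(2)]] T.FArr_Id[OF obs(2)]
      C.Cmp_smult_right[OF obs(1,1,2) C.Id_Arr[OF obs(1)] C.smult_Arr[OF obs eq(4)[OF g(1)]]]
      C.Cmp_Id_right[OF obs C.smult_Arr[OF obs eq(4)[OF g(1)]]]
      C.smult_smult(1)[OF obs eq(4)[OF g(1)]] by simp
  ultimately have "c \<odot>\<^bsub>?H\<^esub> \<mu> g = (c * \<chi> g) \<odot>\<^bsub>?H\<^esub> \<mu> g" using fe by simp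
  then have "c = c * \<chi> g" using C.smult_cancel[OF obs eq(4)[OF g(1)] _ m0] by blast
  then show False using c0 g(2) by simp
qed

end

text \<open>The objects are equal, not merely isomorphic, since equivariant structures are
  extensional on \<open>K\<close>.\<close>

lemma twist_inverse:
  assumes "B \<in> Ob Eq" "\<And>g. g \<in> carrier K \<Longrightarrow> \<chi> g * \<psi> g = 1"
  shows "twist \<chi> (twist \<psi> B) = B"
proof -
  obtain X \<mu> where B: "B = (X, \<mu>)" by (cases B)
  note eq = equivariant_objectD[OF assms(1)[unfolded B]]
  have "(\<lambda>g\<in>carrier K. \<chi> g \<odot>\<^bsub>Hom D (FOb (act \<rho> g) X) X\<^esub> (\<psi> g \<odot>\<^bsub>Hom D (FOb (act \<rho> g) X) X\<^esub> \<mu> g)) = \<mu>"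
  proof (rule extensionalityI[OF _ eq(2)])
    fix g assume g: "g \<in> carrier K"
    then show "(\<lambda>g\<in>carrier K. \<chi> g \<odot>\<^bsub>Hom D (FOb (act \<rho> g) X) X\<^esub> (\<psi> g \<odot>\<^bsub>Hom D (FOb (act \<rho> g) X) X\<^esub> \<mu> g)) g = \<mu> g"
      using assms(2) C.smult_smult(1,2)[OF act_Ob[OF g eq(1)] eq(1) eq(4)[OF g]] by simp
  qed simp
  moreover have "twist \<chi> (twist \<psi> B) = (X, \<lambda>g\<in>carrier K. \<chi> g \<odot>\<^bsub>Hom D (FOb (act \<rho> g) X) X\<^esub>
      (\<psi> g \<odot>\<^bsub>Hom D (FOb (act \<rho> g) X) X\<^esub> \<mu> g))"
    unfolding B twist_def by (simp cong: restrict_cong)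
  ultimately show ?thesis unfolding B by simp
qed

end

section \<open>Solvable categories\<close>

context coset_setting
begin

text \<open>Every simple constituent of Z \<boxtimes> W is the unit, so products of support elements
  of \<open>Z\<close> and \<open>W\<close> fall into \<open>F\<close>. This makes the support of
  \<open>Z\<close> normalize \<open>F\<close>, and \<open>supp_noncentral\<close> contradicts
  centrality.\<close>

lemma no_central_invertible_object:
  fixes E :: "('o, 'm, 'k::field) mon_cat"
  assumes E: "fusion_category E" and supp: "has_coset_support G F A E"
    and Z: "simple_object E Z" and W: "simple_object E W"
    and inverse: "isomorphic E (Z \<boxtimes>\<^bsub>E\<^esub> W) (Unit E)" and nontrivial: "\<not> isomorphic E Z (Unit E)"
    and central: "\<And>X. X \<in> Ob E \<Longrightarrow> isomorphic E (Z \<boxtimes>\<^bsub>E\<^esub> X) (X \<boxtimes>\<^bsub>E\<^esub> Z)"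
  shows False
proof -
  interpret E: fusion_category E by fact
  obtain M s where M: "subgroup M G" "A \<subseteq> M" and "coset_support G F A M E s"
    using supp unfolding has_coset_support_def by blast
  interpret S: coset_support G F A M E s by fact
  interpret M: subgroup M G by fact
  interpret F: subgroup F G by (rule F)
  have mult: "a \<otimes> b \<in> F" if ab: "a \<in> s Z" "b \<in> s W" for a b
  proof -
    obtain D where D: "simple_object E D" "hom_nonzero E D (Z \<boxtimes>\<^bsub>E\<^esub> W)" "a \<otimes> b \<in> s D"
      using S.supp_mult[OF Z W ab] by blast
    have "hom_nonzero E D (Unit E)"
      using E.hom_nonzero_isomorphic[OF E.isomorphic_refl[OF E.simple_objectD(1)[OF D(1)]] inverse] D(2) by simp
    then have "isomorphic E D (Unit E)"
      using E.simple_hom_nonzero_isomorphic[OF D(1) E.simple_Unit] by blast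
    then show ?thesis using S.supp_isomorphic[OF D(1)] S.supp_Unit D(3) by simp
  qed
  obtain m where m: "m \<in> s Z" using S.supp_nonempty[OF Z] by blast
  obtain b where b: "b \<in> s W" using S.supp_nonempty[OF W] by blast
  have mG: "m \<in> carrier G" using S.supp_subset[OF Z] m M.mem_carrier by blast
  have bG: "b \<in> carrier G" using S.supp_subset[OF W] b M.mem_carrier by blast
  \<comment> \<open>Since m x also lies in the support of \<open>Z\<close>, both m x b and m b lie
    in \<open>F\<close>, and their quotient is the conjugate of x by m.\<close>
  have "normalizes G F m"
    unfolding normalizes_def
  proof
    fix x assume x: "x \<in> F"
    then have xG: "x \<in> carrier G" by (rule F.mem_carrier)
    have "\<one> \<otimes> m \<otimes> x \<in> double_coset G F m"
      unfolding double_coset_def using F.one_closed x by blast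
    then have "m \<otimes> x \<in> s Z" using S.supp_double_coset[OF Z m] mG by simp
    then have "(m \<otimes> x \<otimes> b) \<otimes> inv (m \<otimes> b) \<in> F"
      using mult b m by blast
    moreover have "(m \<otimes> x \<otimes> b) \<otimes> inv (m \<otimes> b) \<otimes> m = m \<otimes> x"
      using mG bG xG by (simp add: inv_mult_group m_assoc inv_solve_left)
    ultimately show "\<exists>y\<in>F. m \<otimes> x = y \<otimes> m" by metis
  qed
  then obtain X V where "simple_object E X" "simple_object E V"
      "hom_nonzero E V (Z \<boxtimes>\<^bsub>E\<^esub> X) \<noteq> hom_nonzero E V (X \<boxtimes>\<^bsub>E\<^esub> Z)"
    using S.supp_noncentral[OF Z m _ nontrivial] by blast
  then show False
    using E.hom_nonzero_isomorphic[OF E.isomorphic_refl central] E.simple_objectD(1) by blast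
qed

text \<open>The inverse of the twisted unit is the unit twisted by the inverse character. Both are
  studied in the equivariantization and moved to \<open>E\<close> along the equivalence.\<close>

lemma no_coset_support_equivariantization:
  fixes E :: "('o, 'm, 'k::{alg_closed_field, field_char_0}) mon_cat" and D :: "('p, 'n, 'k) mon_cat"
  assumes K: "group K" "Factorial_Ring.prime (Coset.order K)" and D: "fusion_category D" and E: "fusion_category E"
    and eq: "group_equivariantization K D E" and sc: "scalar_Unit_endomorphisms D"
  shows "\<not> has_coset_support G F A E"
proof
  assume supp: "has_coset_support G F A E"
  interpret K: group K by fact
  interpret D: fusion_category D by fact
  interpret E: fusion_category E by fact
  obtain \<rho> \<Phi> where \<rho>: "categorical_action K D \<rho>"
    and \<Phi>: "tensor_equivalence (equivariantization K D \<rho>) E \<Phi>"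
    using eq unfolding group_equivariantization_def tensor_equivalent_def by blast
  interpret T: tensor_equivalence "equivariantization K D \<rho>" E \<Phi> by fact
  interpret Q: equivariantized K D \<rho>
    using \<rho> T.C.linear_monoidal_category_axioms by (rule equivariantized.intro)
  obtain \<chi> :: "_ \<Rightarrow> 'k" where \<chi>: "\<And>x y. \<lbrakk>x \<in> carrier K; y \<in> carrier K\<rbrakk> \<Longrightarrow> \<chi> (x \<otimes>\<^bsub>K\<^esub> y) = \<chi> x * \<chi> y"
      "\<And>x. x \<in> carrier K \<Longrightarrow> \<chi> x = 1 \<longleftrightarrow> x = \<one>\<^bsub>K\<^esub>" "\<And>x. x \<in> carrier K \<Longrightarrow> \<chi> x ^ Coset.order K = 1"
    using K.ex_faithful_character[OF K(2), where 'k = 'k] by blast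
  define \<psi> where "\<psi> g = inverse (\<chi> g)" for g
  have \<chi>1: "\<chi> \<one>\<^bsub>K\<^esub> = 1" using \<chi>(2) by simp
  have \<chi>0: "\<chi> g \<noteq> 0" if "g \<in> carrier K" for g
    using \<chi>(3)[OF that] prime_gt_0_nat[OF K(2)] by (auto simp: power_0_left)
  have \<psi>: "\<And>x y. \<lbrakk>x \<in> carrier K; y \<in> carrier K\<rbrakk> \<Longrightarrow> \<psi> (x \<otimes>\<^bsub>K\<^esub> y) = \<psi> x * \<psi> y" "\<psi> \<one>\<^bsub>K\<^esub> = 1"
      "\<And>x. x \<in> carrier K \<Longrightarrow> \<psi> x \<noteq> 0"
    using \<chi>(1) \<chi>1 \<chi>0 unfolding \<psi>_def by simp_all
  have "carrier K \<noteq> {\<one>\<^bsub>K\<^esub>}" using prime_gt_1_nat[OF K(2)] unfolding Coset.order_def by auto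
  then obtain g where g: "g \<in> carrier K" "g \<noteq> \<one>\<^bsub>K\<^esub>" using K.one_closed by blast
  let ?U = "Unit Q.Eq" and ?Z = "Q.twist \<chi> (Unit Q.Eq)" and ?W = "Q.twist \<psi> (Unit Q.Eq)"
  note U = T.C.Unit_Ob
  have Z: "?Z \<in> Ob Q.Eq" using Q.twist_Ob[OF \<chi>(1) \<chi>1 \<chi>0 U] .
  have W: "?W \<in> Ob Q.Eq" using Q.twist_Ob[OF \<psi> U] .
  have UU: "isomorphic Q.Eq (?U \<boxtimes>\<^bsub>Q.Eq\<^esub> ?U) ?U"
    using T.C.isomorphicI[OF T.C.LUn_iso[OF U] T.C.TenO_Ob[OF U U] U] .
  have "?Z \<boxtimes>\<^bsub>Q.Eq\<^esub> ?W = Q.twist \<chi> (Q.twist \<psi> (?U \<boxtimes>\<^bsub>Q.Eq\<^esub> ?U))"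
    using Q.twist_TenO(1)[OF \<chi>(1) \<chi>1 \<chi>0 U W] Q.twist_TenO(2)[OF \<psi> U U] by simp
  also have "\<dots> = ?U \<boxtimes>\<^bsub>Q.Eq\<^esub> ?U"
    by (rule Q.twist_inverse[OF T.C.TenO_Ob[OF U U]]) (use \<chi>0 in \<open>simp add: \<psi>_def\<close>)
  finally have ZW: "isomorphic Q.Eq (?Z \<boxtimes>\<^bsub>Q.Eq\<^esub> ?W) ?U" using UU by simp
  have nzU: "\<not> zero_object D (Unit D)" using D.simple_objectD(2)[OF D.simple_Unit] .
  have nz: "\<not> zero_object Q.Eq (Q.twist \<alpha> ?U)" for \<alpha>
  proof -
    obtain \<mu> where U: "Q.twist \<alpha> ?U = (Unit D, \<mu>)" unfolding equivariantization_def Q.twist_def by simp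
    show ?thesis using nzU D.Unit_Ob unfolding U zero_object_def Q.Hom_Eq Q.Ide_Eq by simp
  qed
  \<comment> \<open>Twisting leaves the unit of \<open>D\<close> as underlying object, so
    endomorphisms remain scalars and \<open>simple_if_scalar\<close> applies in the fusion category
    \<open>E\<close>.\<close>
  have simple: "simple_object E (FOb \<Phi> (Q.twist \<alpha> ?U))"
    if ob: "Q.twist \<alpha> ?U \<in> Ob Q.Eq" for \<alpha>
  proof (rule E.simple_if_scalar)
    show "FOb \<Phi> (Q.twist \<alpha> ?U) \<in> Ob E" using T.FOb_Ob[OF ob] .
    show "\<not> zero_object E (FOb \<Phi> (Q.twist \<alpha> ?U))" using T.zero_object_FOb[OF ob] nz by simp
    show "\<exists>c. f = c \<odot>\<^bsub>Hom E (FOb \<Phi> (Q.twist \<alpha> ?U)) (FOb \<Phi> (Q.twist \<alpha> ?U))\<^esub> Ide E (FOb \<Phi> (Q.twist \<alpha> ?U))"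
      if "f \<in> Arr E (FOb \<Phi> (Q.twist \<alpha> ?U)) (FOb \<Phi> (Q.twist \<alpha> ?U))" for f
      using T.scalar_endomorphism_FOb[OF ob] Q.twist_Unit_scalar[OF sc] that by blast
  qed
  show False
  proof (rule no_central_invertible_object[OF E supp simple[OF Z] simple[OF W]])
    have "isomorphic E (FOb \<Phi> ?Z \<boxtimes>\<^bsub>E\<^esub> FOb \<Phi> ?W) (FOb \<Phi> (?Z \<boxtimes>\<^bsub>Q.Eq\<^esub> ?W))"
      by (rule T.FOb_TenO[OF Z W])
    also have "isomorphic E (FOb \<Phi> (?Z \<boxtimes>\<^bsub>Q.Eq\<^esub> ?W)) (FOb \<Phi> ?U)"
      using T.isomorphic_FOb[OF T.C.TenO_Ob[OF Z W] U] ZW by simp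
    also have "isomorphic E (FOb \<Phi> ?U) (Unit E)" by (rule E.isomorphic_sym[OF T.FOb_Unit])
    finally show "isomorphic E (FOb \<Phi> ?Z \<boxtimes>\<^bsub>E\<^esub> FOb \<Phi> ?W) (Unit E)" .
  next
    show "\<not> isomorphic E (FOb \<Phi> ?Z) (Unit E)"
    proof
      assume "isomorphic E (FOb \<Phi> ?Z) (Unit E)"
      also have "isomorphic E (Unit E) (FOb \<Phi> ?U)" by (rule T.FOb_Unit)
      finally have "isomorphic Q.Eq ?Z ?U" using T.isomorphic_FOb[OF Z U] by simp
      then show False
        using Q.twist_Unit_not_isomorphic[OF \<chi>(1) \<chi>1 \<chi>0 sc nzU g(1)] g \<chi>(2) T.C.isomorphic_sym by blast
    qed
  next
    fix X assume X: "X \<in> Ob E"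
    obtain B where B: "B \<in> Ob Q.Eq" "isomorphic E (FOb \<Phi> B) X" using T.essentially_surjective[OF X] by blast
    have rZ: "isomorphic E (FOb \<Phi> ?Z) (FOb \<Phi> ?Z)" using E.isomorphic_refl[OF T.FOb_Ob[OF Z]] .
    have "isomorphic E (FOb \<Phi> ?Z \<boxtimes>\<^bsub>E\<^esub> X) (FOb \<Phi> ?Z \<boxtimes>\<^bsub>E\<^esub> FOb \<Phi> B)"
      using E.isomorphic_TenO[OF rZ E.isomorphic_sym[OF B(2)]] .
    also have "isomorphic E (FOb \<Phi> ?Z \<boxtimes>\<^bsub>E\<^esub> FOb \<Phi> B) (FOb \<Phi> (?Z \<boxtimes>\<^bsub>Q.Eq\<^esub> B))"
      by (rule T.FOb_TenO[OF Z B(1)])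
    also have "isomorphic E (FOb \<Phi> (?Z \<boxtimes>\<^bsub>Q.Eq\<^esub> B)) (FOb \<Phi> (B \<boxtimes>\<^bsub>Q.Eq\<^esub> ?Z))"
      using T.isomorphic_FOb[OF T.C.TenO_Ob[OF Z B(1)] T.C.TenO_Ob[OF B(1) Z]]
        Q.twist_Unit_central[OF \<chi>(1) \<chi>1 \<chi>0 B(1)] by simp
    also have "isomorphic E (FOb \<Phi> (B \<boxtimes>\<^bsub>Q.Eq\<^esub> ?Z)) (FOb \<Phi> B \<boxtimes>\<^bsub>E\<^esub> FOb \<Phi> ?Z)"
      by (rule E.isomorphic_sym[OF T.FOb_TenO[OF B(1) Z]])
    also have "isomorphic E (FOb \<Phi> B \<boxtimes>\<^bsub>E\<^esub> FOb \<Phi> ?Z) (X \<boxtimes>\<^bsub>E\<^esub> FOb \<Phi> ?Z)"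
      using E.isomorphic_TenO[OF B(2) rZ] .
    finally show "isomorphic E (FOb \<Phi> ?Z \<boxtimes>\<^bsub>E\<^esub> X) (X \<boxtimes>\<^bsub>E\<^esub> FOb \<Phi> ?Z)" .
  qed
qed

end

text \<open>Restricting the objects to the trivial component changes neither the unit nor its Hom
  space.\<close>

lemma scalar_Unit_endomorphisms_extension:
  assumes "group_extension K D E" "scalar_Unit_endomorphisms D"
  shows "scalar_Unit_endomorphisms E"
proof -
  obtain grade where "tensor_equivalent (E\<lparr>Ob := grade \<one>\<^bsub>K\<^esub>\<rparr>) D"
    using assms(1) unfolding group_extension_def by (elim conjE exE) (rule that, assumption)
  then obtain \<Phi> where "tensor_equivalence (E\<lparr>Ob := grade \<one>\<^bsub>K\<^esub>\<rparr>) D \<Phi>"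
    unfolding tensor_equivalent_def by blast
  then have "scalar_Unit_endomorphisms (E\<lparr>Ob := grade \<one>\<^bsub>K\<^esub>\<rparr>)"
    using tensor_equivalence.scalar_Unit_endomorphisms_iff assms(2) by blast
  then show ?thesis unfolding scalar_Unit_endomorphisms_def by simp
qed

lemma scalar_Unit_endomorphisms_equivariantization:
  assumes "group_equivariantization K D E" "scalar_Unit_endomorphisms D"
  shows "scalar_Unit_endomorphisms E"
proof -
  obtain \<rho> \<Phi> where \<rho>: "categorical_action K D \<rho>"
    and \<Phi>: "tensor_equivalence (equivariantization K D \<rho>) E \<Phi>"
    using assms(1) unfolding group_equivariantization_def tensor_equivalent_def by blast
  interpret T: tensor_equivalence "equivariantization K D \<rho>" E \<Phi> by fact
  interpret Q: equivariantized K D \<rho>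
    using \<rho> T.C.linear_monoidal_category_axioms by (rule equivariantized.intro)
  show ?thesis using Q.scalar_Unit_endomorphisms_Eq[OF assms(2)] T.scalar_Unit_endomorphisms_iff by blast
qed

lemma scalar_Unit_endomorphisms_Vect: "scalar_Unit_endomorphisms (Vect :: (nat, 'k::field mat, 'k) mon_cat)"
  unfolding scalar_Unit_endomorphisms_def
proof
  fix f :: "'k mat" assume "f \<in> Arr Vect (Unit Vect) (Unit Vect)"
  then have "f \<in> carrier_mat 1 1" unfolding Vect_def by (simp add: module_mat_simps)
  then have "f = (f $$ (0, 0)) \<cdot>\<^sub>m 1\<^sub>m 1" by (intro eq_matI) auto
  then show "\<exists>c. f = c \<odot>\<^bsub>Hom Vect (Unit Vect) (Unit Vect)\<^esub> Ide Vect (Unit Vect)"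
    unfolding Vect_def by (auto simp: module_mat_simps)
qed

text \<open>Every nonzero k^n has k^1 as a retract, so a simple one is isomorphic to the
  unit.\<close>

lemma simple_Vect_equivalent:
  fixes E :: "('o, 'm, 'k::field) mon_cat"
  assumes "tensor_equivalence Vect E \<Phi>" "simple_object E X"
  shows "isomorphic E X (Unit E)"
proof -
  interpret T: tensor_equivalence Vect E \<Phi> by fact
  let ?V = "Vect :: (nat, 'k mat, 'k) mon_cat"
  obtain n where n: "simple_object ?V n" "isomorphic E (FOb \<Phi> n) X"
    using T.simple_object_preimage[OF assms(2)] by blast
  have ob: "m \<in> Ob ?V" for m unfolding Vect_def by simp
  have "n \<noteq> 0"
  proof
    assume "n = 0"
    then have "zero_object ?V n" unfolding zero_object_def Vect_def by (auto simp: module_mat_simps)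
    then show False using n(1) unfolding simple_object_def by blast
  qed
  \<comment> \<open>Inclusion of, and projection to, the first coordinate.\<close>
  let ?i = "mat n 1 (\<lambda>(i, j). of_bool (i = 0)) :: 'k mat" and ?p = "mat 1 n (\<lambda>(i, j). of_bool (j = 0)) :: 'k mat"
  have "?p * ?i = 1\<^sub>m 1"
  proof (rule eq_matI)
    fix i j assume "i < dim_row (1\<^sub>m 1 :: 'k mat)" "j < dim_col (1\<^sub>m 1 :: 'k mat)"
    then show "(?p * ?i) $$ (i, j) = 1\<^sub>m 1 $$ (i, j)"
      using \<open>n \<noteq> 0\<close> by (auto simp: scalar_prod_def if_distrib cong: if_cong)
  qed auto
  then have "isomorphism ?V 1 n ?i"
    using T.C.simple_split[OF n(1) ob, of 1 ?i ?p]
    unfolding Vect_def zero_object_def by (simp add: module_mat_simps mat_eq_iff)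
  then have "isomorphic ?V (Unit ?V) n" using T.C.isomorphicI ob unfolding Vect_def by simp
  then have "isomorphic E (FOb \<Phi> (Unit ?V)) (FOb \<Phi> n)" using T.isomorphic_FOb[OF ob ob] by simp
  then show ?thesis
    using T.D.isomorphic_trans[OF T.FOb_Unit] n(2) T.D.isomorphic_trans T.D.isomorphic_sym by blast
qed

section \<open>Descent along a chain witnessing solvability\<close>

context coset_setting
begin

text \<open>All simple objects would be the unit, so \<open>A\<close> would be contained in
  \<open>F\<close>, whose elements normalize \<open>F\<close>.\<close>

lemma no_coset_support_Vect:
  assumes "tensor_equivalence Vect E \<Phi>"
  shows "\<not> has_coset_support G F A E"
proof
  assume "has_coset_support G F A E"
  then obtain M s where M: "subgroup M G" "A \<subseteq> M" and "coset_support G F A M E s"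
    unfolding has_coset_support_def by blast
  interpret S: coset_support G F A M E s by fact
  interpret F: subgroup F G by (rule F)
  obtain m where m: "m \<in> A" "\<not> normalizes G F m" using not_normal by blast
  obtain X where X: "simple_object E X" "m \<in> s X" using S.supp_onto m M by blast
  have "m \<in> F"
    using S.supp_isomorphic[OF X(1) simple_Vect_equivalent[OF assms X(1)]] S.supp_Unit X(2) by simp
  have "normalizes G F m"
    unfolding normalizes_def
  proof
    fix x assume "x \<in> F"
    then have "m \<otimes> x = (m \<otimes> x \<otimes> inv m) \<otimes> m" "m \<otimes> x \<otimes> inv m \<in> F"
      using \<open>m \<in> F\<close> F.mem_carrier by (simp_all add: m_assoc)
    then show "\<exists>y\<in>F. m \<otimes> x = y \<otimes> m" by blast
  qed
  then show False using m by simp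
qed

theorem coset_support_not_solvable:
  fixes C :: "('o, 'm, 'k::{alg_closed_field, field_char_0}) mon_cat"
  assumes supp: "has_coset_support G F A C"
  shows "\<not> solvable_category TYPE('u) TYPE('v) C"
proof
  assume "solvable_category TYPE('u) TYPE('v) C"
  then obtain n and E :: "nat \<Rightarrow> ('u, 'v, 'k) mon_cat"
    where fus: "\<And>i. i \<le> n \<Longrightarrow> fusion_category (E i)" and E0: "tensor_equivalent Vect (E 0)"
      and En: "tensor_equivalent (E n) C"
      and step: "\<And>i. i < n \<Longrightarrow> \<exists>K :: int monoid. group K \<and> cyclic_group K \<and> Factorial_Ring.prime (Coset.order K) \<and>
        (group_equivariantization K (E i) (E (Suc i)) \<or> group_extension K (E i) (E (Suc i)))"
    unfolding solvable_category_def by blast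
  obtain \<Phi>0 where \<Phi>0: "tensor_equivalence Vect (E 0) \<Phi>0" using E0 unfolding tensor_equivalent_def by blast
  obtain \<Phi> where \<Phi>: "tensor_equivalence (E n) C \<Phi>" using En unfolding tensor_equivalent_def by blast
  have scalar: "scalar_Unit_endomorphisms (E i)" if "i \<le> n" for i
    using that
  proof (induction i)
    case 0
    show ?case
      using tensor_equivalence.scalar_Unit_endomorphisms_iff[OF \<Phi>0] scalar_Unit_endomorphisms_Vect by blast
  next
    case (Suc i)
    then show ?case
      using step[of i] scalar_Unit_endomorphisms_extension scalar_Unit_endomorphisms_equivariantization
      by (metis Suc_le_lessD less_imp_le_nat)
  qed
  \<comment> \<open>The support is pulled down from \<open>E n\<close>, while the scalar property
    used to exclude equivariantizations was pushed up from \<open>E 0\<close>.\<close>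
  have "has_coset_support G F A (E 0)"
  proof (rule inc_induct[of 0 n "\<lambda>i. has_coset_support G F A (E i)"])
    show "has_coset_support G F A (E n)"
      using tensor_equivalence.has_coset_support_iff[OF \<Phi>] supp by blast
    fix i assume i: "i < n" and IH: "has_coset_support G F A (E (Suc i))"
    obtain K :: "int monoid" where K: "group K" "cyclic_group K" "Factorial_Ring.prime (Coset.order K)"
      and GE: "group_equivariantization K (E i) (E (Suc i)) \<or> group_extension K (E i) (E (Suc i))"
      using step[OF i] by blast
    have fus': "fusion_category (E i)" "fusion_category (E (Suc i))" using fus i by auto
    have "\<not> group_equivariantization K (E i) (E (Suc i))"
      using no_coset_support_equivariantization[OF K(1,3) fus'] scalar[of i] i IH by auto
    then have "group_extension K (E i) (E (Suc i))" using GE by blast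
    moreover have "comm_group K"
      using group.cyclic_imp_abelian_group[OF K(1,2)] .
    moreover have "linear_monoidal_category (E (Suc i))"
      using fus'(2) unfolding fusion_category_def by blast
    ultimately show "has_coset_support G F A (E i)" using has_coset_support_extension IH by blast
  qed simp
  then show False using no_coset_support_Vect[OF \<Phi>0] by blast
qed

end

section \<open>Dimensions of spaces of matrices\<close>

text \<open>Independent subsets of \<open>W\<close> are independent in \<open>V\<close>, so their
  sizes are bounded, and a maximal one generates \<open>W\<close>.\<close>

lemma (in vectorspace) subspace_fin_dim:
  assumes W: "subspace K W V" and fd: fin_dim
  shows "vectorspace.fin_dim K (V\<lparr>carrier := W\<rparr>)"
proof -
  interpret W: vectorspace K "V\<lparr>carrier := W\<rparr>" using W by (rule subspace_is_vs)
  have sub: "submodule K W V" using W by simp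
  have "W \<subseteq> carrier V" using sub unfolding submodule_def by blast
  have li: "finite B \<and> card B \<le> dim" if "B \<subseteq> W \<and> \<not> W.lin_dep B" for B
  proof -
    have "\<not> lin_dep B" using span_li_not_depend(2)[OF _ sub, of B] that by simp
    then show ?thesis using li_le_dim[OF fd, of B] that \<open>W \<subseteq> carrier V\<close> by blast
  qed
  have "\<not> W.lin_dep {}" unfolding W.lin_dep_def by blast
  then obtain B where B: "finite B" "maximal B (\<lambda>S. S \<subseteq> W \<and> \<not> W.lin_dep S)"
    using maximal_exists[of "\<lambda>S. S \<subseteq> W \<and> \<not> W.lin_dep S" dim "{}"] li by blast
  then have "W.gen_set B" using W.max_li_is_gen[of B] by simp
  then show ?thesis unfolding W.fin_dim_def using B unfolding maximal_def by auto
qed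

lemma (in vectorspace) dim_eq_0_iff:
  assumes fin_dim
  shows "dim = 0 \<longleftrightarrow> carrier V = {\<zero>\<^bsub>V\<^esub>}"
proof
  obtain B where B: "finite B" "basis B" using finite_basis_exists[OF assms] by blast
  assume "dim = 0"
  then have "B = {}" using dim_basis[OF B] B(1) by simp
  then show "carrier V = {\<zero>\<^bsub>V\<^esub>}" using B(2) span_empty unfolding basis_def by simp
next
  assume *: "carrier V = {\<zero>\<^bsub>V\<^esub>}"
  have "span {} = carrier V" using * span_empty by simp
  then have "basis {}" unfolding basis_def using finite_lin_indpt2[of "{}"] by (auto simp: lin_dep_def)
  then show "dim = 0" using dim_basis[of "{}"] by simp
qed

text \<open>Reading a vector of length nr * nc row by row maps onto the matrices.\<close>

lemma fin_dim_module_mat: "vectorspace.fin_dim class_ring (module_mat TYPE('k::field) nr nc)"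
proof -
  interpret S: vec_space "TYPE('k)" "nr * nc" .
  define \<phi> :: "'k vec \<Rightarrow> 'k mat" where "\<phi> v = mat nr nc (\<lambda>(i, j). v $ (i * nc + j))" for v
  have idx: "i * nc + j < nr * nc" if "i < nr" "j < nc" for i j
  proof -
    have "i * nc + j < Suc i * nc" using that by simp
    also have "\<dots> \<le> nr * nc" using that by (intro mult_le_mono1) simp
    finally show ?thesis .
  qed
  have "linear_map class_ring (module_vec TYPE('k) (nr * nc)) (module_mat TYPE('k) nr nc) \<phi>"
    unfolding linear_map_def mod_hom_def mod_hom_axioms_def
    using vec_vs matrix_vs
    by (auto simp: vectorspace_def module_hom_def module_vec_simps module_mat_simps class_ring_simps
        \<phi>_def idx intro!: eq_matI)
  then interpret L: linear_map class_ring "module_vec TYPE('k) (nr * nc)" "module_mat TYPE('k) nr nc" \<phi> .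
  have "A \<in> \<phi> ` carrier_vec (nr * nc)" if A: "A \<in> carrier_mat nr nc" for A
  proof (rule image_eqI)
    let ?v = "vec (nr * nc) (\<lambda>k. A $$ (k div nc, k mod nc))"
    show "?v \<in> carrier_vec (nr * nc)" by simp
    show "A = \<phi> ?v" using A by (auto simp: \<phi>_def idx intro!: eq_matI)
  qed
  then have "\<phi> ` carrier (module_vec TYPE('k) (nr * nc)) = carrier (module_mat TYPE('k) nr nc)"
    by (auto simp: module_vec_simps module_mat_simps \<phi>_def)
  moreover have "vectorspace.fin_dim class_ring (module_vec TYPE('k) (nr * nc))"
    using S.fin_dim by simp
  ultimately show ?thesis by (intro L.surj_fin_dim)
qed

section \<open>Exact factorizations\<close>

locale exact_factorization = group M for M :: "'a monoid" (structure) +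
  fixes F \<Gamma> :: "'a set"
  assumes F: "subgroup F M" and \<Gamma>: "subgroup \<Gamma> M" and finite_M: "finite (carrier M)"
    and inter: "F \<inter> \<Gamma> = {\<one>}"
    and factor: "m \<in> carrier M \<Longrightarrow> \<exists>x\<in>F. \<exists>s\<in>\<Gamma>. m = x \<otimes> s"
begin

sublocale F: subgroup F M by (rule F)
sublocale \<Gamma>: subgroup \<Gamma> M by (rule \<Gamma>)

abbreviation left_act (infixr "\<triangleright>" 75) where "s \<triangleright> x \<equiv> act_left M F \<Gamma> s x"
abbreviation right_act (infixl "\<triangleleft>" 75) where "s \<triangleleft> x \<equiv> act_right M F \<Gamma> s x"

text \<open>The quotient of the two factorizations lies in both subgroups, hence is \<one>.\<close>

lemma factor_unique:
  assumes "x \<in> F" "y \<in> F" "s \<in> \<Gamma>" "t \<in> \<Gamma>" "x \<otimes> s = y \<otimes> t"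
  shows "x = y" "s = t"
proof -
  note c = F.mem_carrier[OF assms(1)] F.mem_carrier[OF assms(2)] \<Gamma>.mem_carrier[OF assms(3)] \<Gamma>.mem_carrier[OF assms(4)]
  have "inv y \<otimes> x = inv y \<otimes> (x \<otimes> s) \<otimes> inv s" using c by (simp add: m_assoc)
  also have "\<dots> = t \<otimes> inv s" using c by (simp add: assms(5) flip: m_assoc)
  finally have eq: "inv y \<otimes> x = t \<otimes> inv s" .
  have "inv y \<otimes> x \<in> F" "t \<otimes> inv s \<in> \<Gamma>" using assms(1-4) by simp_all
  then have "inv y \<otimes> x \<in> F \<inter> \<Gamma>" using eq by simp
  then have 1: "inv y \<otimes> x = \<one>" using inter by blast
  show "x = y" using 1 c by (metis inv_equality inv_inv inv_closed)
  then show "s = t" using assms(5) c by simp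
qed

lemma act_eqI:
  assumes "s \<in> \<Gamma>" "x \<in> F" "y \<in> F" "t \<in> \<Gamma>" "s \<otimes> x = y \<otimes> t"
  shows "s \<triangleright> x = y" "s \<triangleleft> x = t"
proof -
  have *: "y' = y \<and> t' = t" if "y' \<in> F" "t' \<in> \<Gamma>" "s \<otimes> x = y' \<otimes> t'" for y' t'
    using factor_unique[of y' y t' t] assms(3,4) that unfolding assms(5) by simp
  show "s \<triangleright> x = y"
    unfolding act_left_def using assms(3-5) * by (intro the_equality) blast+
  show "s \<triangleleft> x = t"
    unfolding act_right_def using assms(3-5) * by (intro the_equality) blast+
qed

lemma act:
  assumes "s \<in> \<Gamma>" "x \<in> F"
  shows "s \<triangleright> x \<in> F" "s \<triangleleft> x \<in> \<Gamma>" "s \<otimes> x = (s \<triangleright> x) \<otimes> (s \<triangleleft> x)"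
proof -
  have "s \<otimes> x \<in> carrier M" using assms by simp
  then obtain y t where *: "y \<in> F" "t \<in> \<Gamma>" "s \<otimes> x = y \<otimes> t" using factor by blast
  show "s \<triangleright> x \<in> F" "s \<triangleleft> x \<in> \<Gamma>" "s \<otimes> x = (s \<triangleright> x) \<otimes> (s \<triangleleft> x)"
    using act_eqI[OF assms *] * by simp_all
qed

text \<open>One of the two matched pair laws: factor s (x y) = (s x) y in two ways and compare. The
  law for products in \<Gamma> is obtained in the same way.\<close>

lemma act_mult_right:
  assumes "s \<in> \<Gamma>" "x \<in> F" "y \<in> F"
  shows "s \<triangleright> (x \<otimes> y) = (s \<triangleright> x) \<otimes> ((s \<triangleleft> x) \<triangleright> y)" "s \<triangleleft> (x \<otimes> y) = s \<triangleleft> x \<triangleleft> y"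
proof -
  note a = act[OF assms(1,2)] and b = act[OF act(2)[OF assms(1,2)] assms(3)]
  have "s \<otimes> (x \<otimes> y) = (s \<triangleright> x) \<otimes> ((s \<triangleleft> x) \<otimes> y)"
    using a assms by (simp flip: m_assoc)
  also have "\<dots> = ((s \<triangleright> x) \<otimes> ((s \<triangleleft> x) \<triangleright> y)) \<otimes> (s \<triangleleft> x \<triangleleft> y)"
    using a(1,2) b by (simp add: m_assoc)
  finally have *: "s \<otimes> (x \<otimes> y) = \<dots>" .
  show "s \<triangleright> (x \<otimes> y) = (s \<triangleright> x) \<otimes> ((s \<triangleleft> x) \<triangleright> y)" "s \<triangleleft> (x \<otimes> y) = s \<triangleleft> x \<triangleleft> y"
    using act_eqI[OF _ _ _ _ *] a b assms by simp_all
qed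

lemma act_mult_left:
  assumes "g \<in> \<Gamma>" "h \<in> \<Gamma>" "x \<in> F"
  shows "(g \<otimes> h) \<triangleright> x = g \<triangleright> (h \<triangleright> x)" "(g \<otimes> h) \<triangleleft> x = (g \<triangleleft> (h \<triangleright> x)) \<otimes> (h \<triangleleft> x)"
proof -
  note a = act[OF assms(2,3)] and b = act[OF assms(1) act(1)[OF assms(2,3)]]
  have "(g \<otimes> h) \<otimes> x = (g \<otimes> (h \<triangleright> x)) \<otimes> (h \<triangleleft> x)"
    using a assms by (simp add: m_assoc)
  also have "\<dots> = (g \<triangleright> (h \<triangleright> x)) \<otimes> ((g \<triangleleft> (h \<triangleright> x)) \<otimes> (h \<triangleleft> x))"
    using a(1,2) b by (simp add: m_assoc)
  finally have *: "(g \<otimes> h) \<otimes> x = \<dots>" .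
  show "(g \<otimes> h) \<triangleright> x = g \<triangleright> (h \<triangleright> x)" "(g \<otimes> h) \<triangleleft> x = (g \<triangleleft> (h \<triangleright> x)) \<otimes> (h \<triangleleft> x)"
    using act_eqI[OF _ _ _ _ *] a b assms by simp_all
qed

lemma act_one:
  "s \<in> \<Gamma> \<Longrightarrow> s \<triangleright> \<one> = \<one>" "s \<in> \<Gamma> \<Longrightarrow> s \<triangleleft> \<one> = s" "x \<in> F \<Longrightarrow> \<one> \<triangleright> x = x" "x \<in> F \<Longrightarrow> \<one> \<triangleleft> x = \<one>"
  using act_eqI[of s \<one> \<one> s] act_eqI[of \<one> x x \<one>] by auto

lemma right_act_inv:
  assumes "s \<in> \<Gamma>" "x \<in> F"
  shows "s \<triangleleft> x \<triangleleft> inv x = s" "s \<triangleleft> inv x \<triangleleft> x = s"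
  using act_mult_right(2)[of s x "inv x"] act_mult_right(2)[of s "inv x" x] assms act_one by simp_all

lemma right_act_eq_iff:
  assumes "s \<in> \<Gamma>" "t \<in> \<Gamma>" "x \<in> F"
  shows "s \<triangleleft> x = t \<longleftrightarrow> s = t \<triangleleft> inv x"
  using right_act_inv assms by metis

lemma finite_F: "finite F" and finite_\<Gamma>: "finite \<Gamma>"
  using finite_M F.subset \<Gamma>.subset finite_subset by blast+

end

section \<open>Representation categories\<close>

text \<open>The passage from fusion rules, which are dimensions, to
  \<open>hom_nonzero\<close>.\<close>

lemma (in linear_category) dim_Hom_eq_0_iff:
  assumes "X \<in> Ob C" "Y \<in> Ob C" "vectorspace.fin_dim class_ring (Hom C X Y)"
  shows "vectorspace.dim class_ring (Hom C X Y) = 0 \<longleftrightarrow> \<not> hom_nonzero C X Y"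
proof -
  have V: "vectorspace class_ring (Hom C X Y)" using Hom_vectorspace assms by blast
  show ?thesis
    using vectorspace.dim_eq_0_iff[OF V assms(3)] Zero_Arr[OF assms(1,2)] unfolding hom_nonzero_def by auto
qed

lemma Rep_Ob: "(n, R) \<in> Ob (Rep H) \<longleftrightarrow> matrix_rep H (n, R)"
  and Rep_Hom: "Hom (Rep H) (m, R) (n, S) = (module_mat TYPE('k::field) n m)\<lparr>carrier :=
    {T \<in> carrier_mat n m. \<forall>a\<in>hbasis H. T * R a = S a * T}\<rparr>"
  and Rep_Arr: "T \<in> Arr (Rep H) (m, R) (n, S) \<longleftrightarrow>
    T \<in> carrier_mat n m \<and> (\<forall>a\<in>hbasis H. T * R a = S a * T)"
  and Rep_Zero: "Zero (Rep H) (m, R) (n, S) = 0\<^sub>m n m"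
  and Rep_Ide: "Ide (Rep H) (n, R) = 1\<^sub>m n"
  and Rep_Cmp: "Cmp (Rep H) = (*)"
  for H :: "('b, 'k::field) hopf_algebra"
  unfolding Rep_def by (simp_all add: module_mat_simps)

lemma Rep_carrier: "\<lbrakk>(n, R) \<in> Ob (Rep H); a \<in> hbasis H\<rbrakk> \<Longrightarrow> R a \<in> carrier_mat n n"
  unfolding Rep_Ob matrix_rep_def by auto

lemma Rep_Hom_subspace:
  fixes H :: "('b, 'k::field) hopf_algebra"
  assumes "(m, R) \<in> Ob (Rep H)" "(n, S) \<in> Ob (Rep H)"
  shows "subspace class_ring {T \<in> carrier_mat n m. \<forall>a\<in>hbasis H. T * R a = S a * T} (module_mat TYPE('k) n m)"
proof -
  note car = Rep_carrier[OF assms(1)] Rep_carrier[OF assms(2)]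
  have "module class_ring (module_mat TYPE('k) n m)" using matrix_vs unfolding vectorspace_def by blast
  then have "submodule class_ring {T \<in> carrier_mat n m. \<forall>a\<in>hbasis H. T * R a = S a * T} (module_mat TYPE('k) n m)"
  proof (rule submodule.intro)
    fix T U assume "T \<in> {T \<in> carrier_mat n m. \<forall>a\<in>hbasis H. T * R a = S a * T}"
      "U \<in> {T \<in> carrier_mat n m. \<forall>a\<in>hbasis H. T * R a = S a * T}"
    then have TU: "T \<in> carrier_mat n m" "U \<in> carrier_mat n m"
      "\<And>a. a \<in> hbasis H \<Longrightarrow> T * R a = S a * T" "\<And>a. a \<in> hbasis H \<Longrightarrow> U * R a = S a * U" by auto
    have "(T + U) * R a = S a * (T + U)" if a: "a \<in> hbasis H" for a
      using TU car[OF a] a by (simp add: add_mult_distrib_mat[of T n m U] mult_add_distrib_mat[of "S a" n n T m U])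
    then show "T \<oplus>\<^bsub>module_mat TYPE('k) n m\<^esub> U \<in> {T \<in> carrier_mat n m. \<forall>a\<in>hbasis H. T * R a = S a * T}"
      using TU by (simp add: module_mat_simps)
  next
    show "\<zero>\<^bsub>module_mat TYPE('k) n m\<^esub> \<in> {T \<in> carrier_mat n m. \<forall>a\<in>hbasis H. T * R a = S a * T}"
      using car by (auto simp: module_mat_simps left_mult_zero_mat[of _ m m] right_mult_zero_mat[of _ n n])
  next
    fix c :: 'k and T assume "T \<in> {T \<in> carrier_mat n m. \<forall>a\<in>hbasis H. T * R a = S a * T}"
    then have T: "T \<in> carrier_mat n m" "\<And>a. a \<in> hbasis H \<Longrightarrow> T * R a = S a * T" by auto
    have "(c \<cdot>\<^sub>m T) * R a = S a * (c \<cdot>\<^sub>m T)" if a: "a \<in> hbasis H" for a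
      using T car[OF a] a by (simp add: mult_smult_assoc_mat[of T n m] mult_smult_distrib[of "S a" n n T m])
    then show "c \<odot>\<^bsub>module_mat TYPE('k) n m\<^esub> T \<in> {T \<in> carrier_mat n m. \<forall>a\<in>hbasis H. T * R a = S a * T}"
      using T by (simp add: module_mat_simps)
  qed (auto simp: module_mat_simps)
  then show ?thesis unfolding subspace_def using matrix_vs by blast
qed

lemma Rep_Hom_vectorspace:
  assumes "X \<in> Ob (Rep H)" "Y \<in> Ob (Rep H)"
  shows "vectorspace class_ring (Hom (Rep H) X Y)"
  using assms vectorspace.subspace_is_vs[OF matrix_vs Rep_Hom_subspace]
  by (cases X; cases Y) (simp add: Rep_Hom)

lemma Rep_Hom_fin_dim:
  assumes "X \<in> Ob (Rep H)" "Y \<in> Ob (Rep H)"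
  shows "vectorspace.fin_dim class_ring (Hom (Rep H) X Y)"
  using assms vectorspace.subspace_fin_dim[OF matrix_vs Rep_Hom_subspace fin_dim_module_mat]
  by (cases X; cases Y) (simp add: Rep_Hom)

lemma Rep_Cmp_Arr:
  assumes "(l, R) \<in> Ob (Rep H)" "(m, S) \<in> Ob (Rep H)" "(n, T) \<in> Ob (Rep H)"
    and f: "f \<in> Arr (Rep H) (l, R) (m, S)" and g: "g \<in> Arr (Rep H) (m, S) (n, T)"
  shows "g * f \<in> Arr (Rep H) (l, R) (n, T)"
proof -
  have fg: "f \<in> carrier_mat m l" "g \<in> carrier_mat n m" using f g unfolding Rep_Arr by auto
  have "(g * f) * R a = T a * (g * f)" if a: "a \<in> hbasis H" for a
  proof -
    note car = Rep_carrier[OF assms(1) a] Rep_carrier[OF assms(2) a] Rep_carrier[OF assms(3) a]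
    have "(g * f) * R a = g * (f * R a)" using fg car by (simp add: assoc_mult_mat[of g n m f l])
    also have "\<dots> = g * (S a * f)" using f a unfolding Rep_Arr by simp
    also have "\<dots> = (g * S a) * f" using fg car by (simp add: assoc_mult_mat[of g n m "S a" m f l])
    also have "\<dots> = (T a * g) * f" using g a unfolding Rep_Arr by simp
    also have "\<dots> = T a * (g * f)" using fg car by (simp add: assoc_mult_mat[of "T a" n n g m f l])
    finally show ?thesis .
  qed
  then show ?thesis unfolding Rep_Arr using fg by simp
qed

text \<open>The linear structure supports the general theory of simple objects; tensor products of
  modules are computed separately with Kronecker products.\<close>

lemma linear_category_Rep: "linear_category (Rep H)"
  for H :: "('b, 'k::field) hopf_algebra"
proof (rule linear_category.intro)
  fix X Y :: "nat \<times> ('b \<Rightarrow> 'k mat)" assume XY: "X \<in> Ob (Rep H)" "Y \<in> Ob (Rep H)"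
  then show "vectorspace class_ring (Hom (Rep H) X Y)" by (rule Rep_Hom_vectorspace)
  {
    fix f assume f: "f \<in> Arr (Rep H) X Y"
    obtain m R n S where eq: "X = (m, R)" "Y = (n, S)" by (cases X; cases Y)
    have "f \<in> carrier_mat n m" using f unfolding eq Rep_Arr by blast
    then show "f \<Zcomp>\<^bsub>Rep H\<^esub> Ide (Rep H) X = f" "Ide (Rep H) Y \<Zcomp>\<^bsub>Rep H\<^esub> f = f"
      unfolding eq Rep_Ide Rep_Cmp by simp_all
  }
next
  fix X :: "nat \<times> ('b \<Rightarrow> 'k mat)" assume X: "X \<in> Ob (Rep H)"
  obtain n R where eq: "X = (n, R)" by (cases X)
  have "1\<^sub>m n * R a = R a * 1\<^sub>m n" if "a \<in> hbasis H" for a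
    using Rep_carrier[OF X[unfolded eq] that] by simp
  then show "Ide (Rep H) X \<in> Arr (Rep H) X X" unfolding eq Rep_Arr Rep_Ide by simp
next
  fix X Y Z :: "nat \<times> ('b \<Rightarrow> 'k mat)" assume ob: "X \<in> Ob (Rep H)" "Y \<in> Ob (Rep H)" "Z \<in> Ob (Rep H)"
  obtain l R m S n T where XYZ: "X = (l, R)" "Y = (m, S)" "Z = (n, T)" by (cases X; cases Y; cases Z)
  note vs = Rep_Hom_vectorspace[OF ob(1,2)] Rep_Hom_vectorspace[OF ob(1,3)] Rep_Hom_vectorspace[OF ob(2,3)]
  {
    fix g assume g: "g \<in> Arr (Rep H) Y Z"
    show "linear_map class_ring (Hom (Rep H) X Y) (Hom (Rep H) X Z) (\<lambda>f. g \<Zcomp>\<^bsub>Rep H\<^esub> f)"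
    proof (intro linear_map.intro vs mod_hom.intro mod_hom_axioms.intro)
      show "module class_ring (Hom (Rep H) X Y)" "module class_ring (Hom (Rep H) X Z)"
        using vs unfolding vectorspace_def by auto
      have gm: "g \<in> carrier_mat n m" using g unfolding XYZ Rep_Arr by blast
      have "g * f \<in> Arr (Rep H) X Z" if "f \<in> Arr (Rep H) X Y" for f
        using Rep_Cmp_Arr ob that g unfolding XYZ by blast
      then show "(\<lambda>f. g \<Zcomp>\<^bsub>Rep H\<^esub> f) \<in> module_hom class_ring (Hom (Rep H) X Y) (Hom (Rep H) X Z)"
        unfolding module_hom_def Rep_Cmp XYZ
        by (auto simp: Rep_Hom module_mat_simps mult_add_distrib_mat[OF gm] mult_smult_distrib[OF gm])
    qed
  next
    fix f assume f: "f \<in> Arr (Rep H) X Y"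
    show "linear_map class_ring (Hom (Rep H) Y Z) (Hom (Rep H) X Z) (\<lambda>g. g \<Zcomp>\<^bsub>Rep H\<^esub> f)"
    proof (intro linear_map.intro vs mod_hom.intro mod_hom_axioms.intro)
      show "module class_ring (Hom (Rep H) Y Z)" "module class_ring (Hom (Rep H) X Z)"
        using vs unfolding vectorspace_def by auto
      have fm: "f \<in> carrier_mat m l" using f unfolding XYZ Rep_Arr by blast
      have "g * f \<in> Arr (Rep H) X Z" if "g \<in> Arr (Rep H) Y Z" for g
        using Rep_Cmp_Arr ob that f unfolding XYZ by blast
      then show "(\<lambda>g. g \<Zcomp>\<^bsub>Rep H\<^esub> f) \<in> module_hom class_ring (Hom (Rep H) Y Z) (Hom (Rep H) X Z)"
        unfolding module_hom_def Rep_Cmp XYZ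
        by (auto simp: Rep_Hom module_mat_simps add_mult_distrib_mat[OF _ _ fm] mult_smult_assoc_mat[OF _ fm])
    qed
  }
next
  fix W X Y Z :: "nat \<times> ('b \<Rightarrow> 'k mat)" and f g h
  assume "f \<in> Arr (Rep H) W X" "g \<in> Arr (Rep H) X Y" "h \<in> Arr (Rep H) Y Z"
  then show "(h \<Zcomp>\<^bsub>Rep H\<^esub> g) \<Zcomp>\<^bsub>Rep H\<^esub> f = h \<Zcomp>\<^bsub>Rep H\<^esub> (g \<Zcomp>\<^bsub>Rep H\<^esub> f)"
    by (cases W; cases X; cases Y; cases Z) (auto simp only: Rep_Arr Rep_Cmp assoc_mult_mat)
qed

section \<open>The Kronecker product\<close>

lemma kronecker_carrier [simp]:
  "\<lbrakk>A \<in> carrier_mat a b; B \<in> carrier_mat c d\<rbrakk> \<Longrightarrow> kronecker A B \<in> carrier_mat (a * c) (b * d)"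
  unfolding kronecker_def by auto

lemma kronecker_index:
  assumes "A \<in> carrier_mat a b" "B \<in> carrier_mat c d" "i < a * c" "j < b * d"
  shows "kronecker A B $$ (i, j) = A $$ (i div c, j div d) * B $$ (i mod c, j mod d)"
  using assms unfolding kronecker_def by auto

text \<open>Quotient and remainder by d run through all pairs exactly once.\<close>

lemma sum_product_index:
  fixes f :: "nat \<Rightarrow> nat \<Rightarrow> 'k::comm_monoid_add"
  shows "(\<Sum>k<b * d. f (k div d) (k mod d)) = (\<Sum>i<b. \<Sum>j<d. f i j)"
proof (cases "d = 0")
  case False
  then have d: "d > 0" by simp
  have "(\<Sum>i<b. \<Sum>j<d. f i j) = (\<Sum>(i, j)\<in>{..<b} \<times> {..<d}. f i j)" by (simp add: sum.cartesian_product)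
  also have "\<dots> = (\<Sum>k<b * d. f (k div d) (k mod d))"
  proof (rule sum.reindex_bij_witness[of _ "\<lambda>k. (k div d, k mod d)" "\<lambda>(i, j). i * d + j"])
    fix p assume "p \<in> {..<b} \<times> {..<d}"
    then obtain i j where p: "p = (i, j)" "i < b" "j < d" by auto
    have "i * d + j < Suc i * d" using p by simp
    also have "\<dots> \<le> b * d" using p by (intro mult_le_mono1) simp
    finally show "(case p of (i, j) \<Rightarrow> i * d + j) \<in> {..<b * d}" using p by simp
  next
    fix k assume "k \<in> {..<b * d}"
    then show "(k div d, k mod d) \<in> {..<b} \<times> {..<d}"
      using d by (simp add: less_mult_imp_div_less)
  qed (use d in auto)
  finally show ?thesis by simp
qed simp

text \<open>The mixed-product rule; entrywise it is the factorization of a double sum.\<close>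

lemma kronecker_mult:
  fixes A B :: "'k::comm_ring_1 mat"
  assumes A: "A \<in> carrier_mat a b" "A' \<in> carrier_mat b c" and B: "B \<in> carrier_mat d e" "B' \<in> carrier_mat e f"
  shows "kronecker A B * kronecker A' B' = kronecker (A * A') (B * B')"
proof (rule eq_matI)
  have k: "kronecker A B \<in> carrier_mat (a * d) (b * e)" "kronecker A' B' \<in> carrier_mat (b * e) (c * f)"
    "kronecker (A * A') (B * B') \<in> carrier_mat (a * d) (c * f)"
    using assms by simp_all
  fix i j assume "i < dim_row (kronecker (A * A') (B * B'))" "j < dim_col (kronecker (A * A') (B * B'))"
  then have ij: "i < a * d" "j < c * f" using k by auto
  then have pos: "d > 0" "f > 0" by (auto intro: Suc_lessI gr0I)
  have idx: "i div d < a" "i mod d < d" "j div f < c" "j mod f < f"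
    using ij pos by (auto simp: less_mult_imp_div_less)
  have kl: "kronecker A B $$ (i, l) = A $$ (i div d, l div e) * B $$ (i mod d, l mod e)"
    "kronecker A' B' $$ (l, j) = A' $$ (l div e, j div f) * B' $$ (l mod e, j mod f)" if "l < b * e" for l
    using kronecker_index[OF A(1) B(1) ij(1) that] kronecker_index[OF A(2) B(2) that ij(2)] by auto
  have "(kronecker A B * kronecker A' B') $$ (i, j)
    = (\<Sum>l<b * e. kronecker A B $$ (i, l) * kronecker A' B' $$ (l, j))"
    using k ij by (simp add: scalar_prod_def atLeast0LessThan)
  also have "\<dots> = (\<Sum>l<b * e. (\<lambda>u v. A $$ (i div d, u) * A' $$ (u, j div f) *
      (B $$ (i mod d, v) * B' $$ (v, j mod f))) (l div e) (l mod e))"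
    by (intro sum.cong refl) (simp add: kl)
  also have "\<dots> = (\<Sum>u<b. \<Sum>v<e. A $$ (i div d, u) * A' $$ (u, j div f) *
      (B $$ (i mod d, v) * B' $$ (v, j mod f)))" by (rule sum_product_index)
  also have "\<dots> = (\<Sum>u<b. A $$ (i div d, u) * A' $$ (u, j div f)) *
      (\<Sum>v<e. B $$ (i mod d, v) * B' $$ (v, j mod f))" by (simp add: sum_product)
  also have "\<dots> = (A * A') $$ (i div d, j div f) * (B * B') $$ (i mod d, j mod f)"
    using idx A B by (simp add: scalar_prod_def atLeast0LessThan)
  also have "\<dots> = kronecker (A * A') (B * B') $$ (i, j)"
    using kronecker_index[OF mult_carrier_mat[OF A] mult_carrier_mat[OF B] ij] by simp
  finally show "(kronecker A B * kronecker A' B') $$ (i, j) = kronecker (A * A') (B * B') $$ (i, j)" .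
qed (use assms in \<open>simp_all add: kronecker_def\<close>)

lemma kronecker_one: "kronecker (1\<^sub>m a) (1\<^sub>m b) = (1\<^sub>m (a * b) :: 'k::semiring_1 mat)"
proof (rule eq_matI)
  fix i j assume "i < dim_row (1\<^sub>m (a * b) :: 'k mat)" "j < dim_col (1\<^sub>m (a * b) :: 'k mat)"
  then have ij: "i < a * b" "j < a * b" by auto
  then have "b > 0" by (auto intro: gr0I)
  moreover have "i = j \<longleftrightarrow> i div b = j div b \<and> i mod b = j mod b" by (metis div_mult_mod_eq)
  ultimately show "kronecker (1\<^sub>m a) (1\<^sub>m b) $$ (i, j) = (1\<^sub>m (a * b) :: 'k mat) $$ (i, j)"
    using ij by (simp add: kronecker_index[of _ a a _ b b] less_mult_imp_div_less)
qed (simp_all add: kronecker_def)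

text \<open>The product of a nonzero entry of \<open>A\<close> and one of \<open>B\<close> is an
  entry of the Kronecker product.\<close>

lemma kronecker_eq_zero:
  fixes A B :: "'k::field mat"
  assumes A: "A \<in> carrier_mat a b" "A \<noteq> 0\<^sub>m a b" and B: "B \<in> carrier_mat c d" "B \<noteq> 0\<^sub>m c d"
  shows "kronecker A B \<noteq> 0\<^sub>m (a * c) (b * d)"
proof
  assume z: "kronecker A B = 0\<^sub>m (a * c) (b * d)"
  obtain i j where ij: "i < a" "j < b" "A $$ (i, j) \<noteq> 0" using A by (auto simp: mat_eq_iff)
  obtain k l where kl: "k < c" "l < d" "B $$ (k, l) \<noteq> 0" using B by (auto simp: mat_eq_iff)
  have "i * c + k < Suc i * c" using kl by simp
  also have "\<dots> \<le> a * c" using ij by (intro mult_le_mono1) simp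
  finally have 1: "i * c + k < a * c" .
  have "j * d + l < Suc j * d" using kl by simp
  also have "\<dots> \<le> b * d" using ij by (intro mult_le_mono1) simp
  finally have 2: "j * d + l < b * d" .
  have "kronecker A B $$ (i * c + k, j * d + l) = A $$ (i, j) * B $$ (k, l)"
    using kronecker_index[OF A(1) B(1) 1 2] kl by simp
  then show False using z 1 2 ij kl by simp
qed

section \<open>Simple modules of bismash products\<close>

text \<open>An injective square matrix is invertible, and the inverse of an intertwiner
  intertwines.\<close>

lemma isomorphism_Rep:
  fixes H :: "('b, 'k::field) hopf_algebra"
  assumes V: "(n, R) \<in> Ob (Rep H)" "(n, S) \<in> Ob (Rep H)" and f: "f \<in> Arr (Rep H) (n, R) (n, S)"
    and inj: "\<And>v. \<lbrakk>v \<in> carrier_vec n; f *\<^sub>v v = 0\<^sub>v n\<rbrakk> \<Longrightarrow> v = 0\<^sub>v n"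
  shows "isomorphism (Rep H) (n, R) (n, S) f"
proof -
  have fm: "f \<in> carrier_mat n n" and comm: "\<And>a. a \<in> hbasis H \<Longrightarrow> f * R a = S a * f"
    using f unfolding Rep_Arr by auto
  have "det f \<noteq> 0" using det_0_iff_vec_prod_zero_field[OF fm] inj by blast
  then obtain g where g: "g \<in> carrier_mat n n" "g * f = 1\<^sub>m n" "f * g = 1\<^sub>m n"
    using det_non_zero_imp_unit[OF fm] unfolding Units_def ring_mat_def by auto
  have "g * S a = R a * g" if a: "a \<in> hbasis H" for a
  proof -
    note car = Rep_carrier[OF V(1) a] Rep_carrier[OF V(2) a]
    have "g * S a = g * (S a * (f * g))" using g car by simp
    also have "\<dots> = g * ((S a * f) * g)" using g(1) car fm by (simp add: assoc_mult_mat[of _ n n _ n _ n])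
    also have "\<dots> = (g * f) * (R a * g)"
      using g(1) car fm by (simp add: comm[OF a, symmetric] assoc_mult_mat[of _ n n _ n _ n])
    also have "\<dots> = R a * g" using g car by simp
    finally show ?thesis .
  qed
  then have "g \<in> Arr (Rep H) (n, S) (n, R)" unfolding Rep_Arr using g by simp
  then show ?thesis unfolding isomorphism_def Rep_Cmp Rep_Ide using f g by blast
qed

context exact_factorization
begin

abbreviation H :: "('a \<times> 'a, 'k::field) hopf_algebra" where "H \<equiv> bismash_product M F \<Gamma>"

lemma hbasis_H [simp]: "hbasis H = \<Gamma> \<times> F"
  unfolding bismash_product_def by simp

text \<open>The structure constants are indicator functions, so all sums over the basis collapse by
  this rule. \<open>P\<close> collects the conditions that do not involve the summation
  index.\<close>

lemma sum_of_bool_mult: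
  fixes f :: "'c \<Rightarrow> 'k::semiring_1"
  assumes "finite I"
  shows "(\<Sum>c\<in>I. of_bool (P \<and> c = d) * f c) = (if P \<and> d \<in> I then f d else 0)"
proof -
  have "(\<Sum>c\<in>I. of_bool (P \<and> c = d) * f c) = (\<Sum>c\<in>I. if c = d then (if P then f d else 0) else 0)"
    by (intro sum.cong) auto
  then show ?thesis using assms by (simp add: sum.delta)
qed

text \<open>The module axioms with the structure constants evaluated. The last clause says that the
  idempotents e_s # 1 sum to the identity.\<close>

lemma Ob_RepH:
  fixes R :: "'a \<times> 'a \<Rightarrow> 'k::field mat"
  shows "(n, R) \<in> Ob (Rep H) \<longleftrightarrow> R \<in> \<Gamma> \<times> F \<rightarrow>\<^sub>E carrier_mat n n \<and>
    (\<forall>s\<in>\<Gamma>. \<forall>x\<in>F. \<forall>t\<in>\<Gamma>. \<forall>y\<in>F.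
      R (s, x) * R (t, y) = (if t = s \<triangleleft> x then R (s, x \<otimes> y) else 0\<^sub>m n n)) \<and>
    (\<forall>i<n. \<forall>j<n. (\<Sum>s\<in>\<Gamma>. R (s, \<one>) $$ (i, j)) = of_bool (i = j))"
proof (cases "R \<in> \<Gamma> \<times> F \<rightarrow>\<^sub>E carrier_mat n n")
  case True
  have fin: "finite (\<Gamma> \<times> F)" using finite_F finite_\<Gamma> by simp
  have mult: "mat n n (\<lambda>ij. \<Sum>c\<in>\<Gamma> \<times> F. hmult H (s, x) (t, y) c * R c $$ ij)
      = (if t = s \<triangleleft> x then R (s, x \<otimes> y) else 0\<^sub>m n n)"
    if st: "s \<in> \<Gamma>" "x \<in> F" "y \<in> F" for s x t y
  proof -
    have "R (s, x \<otimes> y) \<in> carrier_mat n n" using True st by auto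
    moreover have "(\<Sum>c\<in>\<Gamma> \<times> F. hmult H (s, x) (t, y) c * R c $$ ij)
      = (if t = s \<triangleleft> x then R (s, x \<otimes> y) $$ ij else 0)" for ij
      using st by (simp add: bismash_product_def sum_of_bool_mult[OF fin])
    ultimately show ?thesis by (intro eq_matI) auto
  qed
  have "(\<Sum>c\<in>\<Gamma> \<times> F. hunit H c * R c $$ ij) = (\<Sum>s\<in>\<Gamma>. R (s, \<one>) $$ ij)" for ij
  proof -
    have "(\<Sum>c\<in>\<Gamma> \<times> F. hunit H c * R c $$ ij) = (\<Sum>s\<in>\<Gamma>. \<Sum>x\<in>F. of_bool (x = \<one>) * R (s, x) $$ ij)"
      unfolding sum.cartesian_product by (intro sum.cong) (auto simp: bismash_product_def)
    then show ?thesis by (simp add: sum_of_bool_mult[OF finite_F, of True, simplified])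
  qed
  then have unit: "mat n n (\<lambda>ij. \<Sum>c\<in>\<Gamma> \<times> F. hunit H c * R c $$ ij) = 1\<^sub>m n \<longleftrightarrow>
    (\<forall>i<n. \<forall>j<n. (\<Sum>s\<in>\<Gamma>. R (s, \<one>) $$ (i, j)) = of_bool (i = j))"
    by (auto simp: mat_eq_iff)
  show ?thesis
    unfolding Rep_Ob matrix_rep_def using True mult unit by (simp del: PiE_iff)
next
  case False
  then show ?thesis unfolding Rep_Ob matrix_rep_def by simp
qed

lemma repD:
  assumes "(n, R) \<in> Ob (Rep H)"
  shows "\<lbrakk>s \<in> \<Gamma>; x \<in> F\<rbrakk> \<Longrightarrow> R (s, x) \<in> carrier_mat n n"
    and "\<lbrakk>s \<in> \<Gamma>; x \<in> F; t \<in> \<Gamma>; y \<in> F\<rbrakk> \<Longrightarrow> R (s, x) * R (t, y) = (if t = s \<triangleleft> x then R (s, x \<otimes> y) else 0\<^sub>m n n)"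
    and "\<lbrakk>i < n; j < n\<rbrakk> \<Longrightarrow> (\<Sum>s\<in>\<Gamma>. R (s, \<one>) $$ (i, j)) = of_bool (i = j)"
  using assms unfolding Ob_RepH by auto

text \<open>The idempotent e_s # 1 acts as the projection onto the weight space of \<open>s\<close>
  under the subalgebra of functions on \<Gamma>.\<close>

definition weights :: "nat \<times> ('a \<times> 'a \<Rightarrow> 'k::field mat) \<Rightarrow> 'a set"
  where "weights = (\<lambda>(n, R). {s \<in> \<Gamma>. R (s, \<one>) \<noteq> 0\<^sub>m n n})"

lemma weights_nonempty:
  assumes V: "(n, R) \<in> Ob (Rep H)" and n: "n \<noteq> 0"
  shows "weights (n, R) \<noteq> {}"
proof
  assume "weights (n, R) = {}"
  then have "R (s, \<one>) = 0\<^sub>m n n" if "s \<in> \<Gamma>" for s using that unfolding weights_def by blast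
  then have "(\<Sum>s\<in>\<Gamma>. R (s, \<one>) $$ (0, 0)) = 0" using n by simp
  then show False using repD(3)[OF V, of 0 0] n by simp
qed

text \<open>\<open>f\<close> is the sum of its composites with the weight projections. Each
  composite vanishes on one side or the other if no weight is shared.\<close>

lemma weights_hom_nonzero:
  assumes V: "(m, R) \<in> Ob (Rep H)" "(n, S) \<in> Ob (Rep H)" and f: "f \<in> Arr (Rep H) (m, R) (n, S)" "f \<noteq> 0\<^sub>m n m"
  shows "\<exists>s. s \<in> weights (m, R) \<and> s \<in> weights (n, S)"
proof (rule ccontr)
  assume neg: "\<not> ?thesis"
  have fm: "f \<in> carrier_mat n m" using f unfolding Rep_Arr by blast
  have z: "f * R (s, \<one>) = 0\<^sub>m n m" if s: "s \<in> \<Gamma>" for s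
  proof (cases "R (s, \<one>) = 0\<^sub>m m m")
    case True
    then show ?thesis using fm by simp
  next
    case False
    then have "S (s, \<one>) = 0\<^sub>m n n" using neg s unfolding weights_def by auto
    moreover have "f * R (s, \<one>) = S (s, \<one>) * f" using f s unfolding Rep_Arr by simp
    ultimately show ?thesis using fm by simp
  qed
  have "f $$ (i, j) = 0" if ij: "i < n" "j < m" for i j
  proof -
    have "f $$ (i, j) = (\<Sum>k<m. f $$ (i, k) * of_bool (k = j))"
      using ij by (simp add: of_bool_def if_distrib cong: if_cong)
    also have "\<dots> = (\<Sum>k<m. f $$ (i, k) * (\<Sum>s\<in>\<Gamma>. R (s, \<one>) $$ (k, j)))"
      using ij repD(3)[OF V(1)] by simp
    also have "\<dots> = (\<Sum>s\<in>\<Gamma>. \<Sum>k<m. f $$ (i, k) * R (s, \<one>) $$ (k, j))"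
      unfolding sum_distrib_left by (rule sum.swap)
    also have "\<dots> = (\<Sum>s\<in>\<Gamma>. (f * R (s, \<one>)) $$ (i, j))"
    proof (rule sum.cong[OF refl])
      fix s assume s: "s \<in> \<Gamma>"
      show "(\<Sum>k<m. f $$ (i, k) * R (s, \<one>) $$ (k, j)) = (f * R (s, \<one>)) $$ (i, j)"
        using fm repD(1)[OF V(1) s F.one_closed] ij by (simp add: scalar_prod_def atLeast0LessThan)
    qed
    also have "\<dots> = 0" using z ij by simp
    finally show ?thesis .
  qed
  then have "f = 0\<^sub>m n m" using fm by (intro eq_matI) auto
  then show False using f by simp
qed

lemma weights_isomorphic:
  assumes "isomorphic (Rep H) V W"
  shows "weights V \<subseteq> weights W"
proof
  fix s assume s: "s \<in> weights V"
  obtain m R n S where eq: "V = (m, R)" "W = (n, S)" by (cases V; cases W)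
  have V: "(m, R) \<in> Ob (Rep H)" "(n, S) \<in> Ob (Rep H)" using assms unfolding isomorphic_def eq by auto
  obtain f g where f: "f \<in> Arr (Rep H) (m, R) (n, S)" "g \<in> Arr (Rep H) (n, S) (m, R)" "g * f = 1\<^sub>m m"
    using assms unfolding isomorphic_def isomorphism_def eq Rep_Cmp Rep_Ide by blast
  have fm: "f \<in> carrier_mat n m" "g \<in> carrier_mat m n" using f unfolding Rep_Arr by auto
  have s: "s \<in> \<Gamma>" "R (s, \<one>) \<noteq> 0\<^sub>m m m" using s unfolding eq weights_def by auto
  note car = repD(1)[OF V(1) s(1) F.one_closed] repD(1)[OF V(2) s(1) F.one_closed]
  have "S (s, \<one>) \<noteq> 0\<^sub>m n n"
  proof
    assume z: "S (s, \<one>) = 0\<^sub>m n n"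
    have "R (s, \<one>) = (g * f) * R (s, \<one>)" using f car by simp
    also have "\<dots> = g * (f * R (s, \<one>))" using fm car by (simp add: assoc_mult_mat[of g m n f m])
    also have "f * R (s, \<one>) = S (s, \<one>) * f" using f s unfolding Rep_Arr by simp
    also have "g * \<dots> = 0\<^sub>m m m" using z fm by simp
    finally show False using s by simp
  qed
  then show "s \<in> weights W" unfolding eq weights_def using s by simp
qed

text \<open>If \<open>s\<close> is fixed by \<open>F\<close>, the elements e_s # x multiply like a
  copy of the group algebra of \<open>F\<close>, which acts here through \<chi>.\<close>

definition one_dim :: "'a \<Rightarrow> ('a \<Rightarrow> 'k::field) \<Rightarrow> nat \<times> ('a \<times> 'a \<Rightarrow> 'k mat)"
  where "one_dim s \<chi> = (1, \<lambda>(t, x)\<in>\<Gamma> \<times> F. mat 1 1 (\<lambda>_. of_bool (t = s) * \<chi> x))"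

text \<open>Matrix indices are numbers, so the elements of \<open>F\<close> are listed once and for
  all.\<close>

definition enum :: "nat \<Rightarrow> 'a"
  where "enum = (SOME h. bij_betw h {0..<card F} F)"

text \<open>The module induced from the one-dimensional \<open>k\<^sup>\<Gamma>\<close>-module of weight \<open>s\<close>. The basis vector with
  index \<open>a\<close> has weight \<open>s \<triangleleft> enum a\<close>.\<close>

definition induced :: "'a \<Rightarrow> nat \<times> ('a \<times> 'a \<Rightarrow> 'k::field mat)"
  where "induced s = (card F, \<lambda>(t, x)\<in>\<Gamma> \<times> F. mat (card F) (card F)
    (\<lambda>(a, b). of_bool (t = s \<triangleleft> enum a \<and> enum a \<otimes> x = enum b)))"

definition fixed_weight :: "'a \<Rightarrow> bool" where "fixed_weight s \<longleftrightarrow> (\<forall>x\<in>F. s \<triangleleft> x = s)"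

definition character :: "('a \<Rightarrow> 'k::field) \<Rightarrow> bool"
  where "character \<chi> \<longleftrightarrow> \<chi> \<one> = 1 \<and> (\<forall>x\<in>F. \<forall>y\<in>F. \<chi> (x \<otimes> y) = \<chi> x * \<chi> y)"

lemma bij_enum: "bij_betw enum {..<card F} F"
  unfolding enum_def using someI_ex[OF ex_bij_betw_nat_finite[OF finite_F]] by (simp add: lessThan_atLeast0)

lemma enum_F: "a < card F \<Longrightarrow> enum a \<in> F"
  using bij_enum unfolding bij_betw_def by blast

lemma enum_inject: "\<lbrakk>a < card F; b < card F\<rbrakk> \<Longrightarrow> enum a = enum b \<longleftrightarrow> a = b"
  using bij_enum unfolding bij_betw_def by (auto dest: inj_onD)

lemma enum_surj: "x \<in> F \<Longrightarrow> \<exists>a<card F. enum a = x"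
  using bij_enum unfolding bij_betw_def by (metis imageE lessThan_iff)

lemma sum_enum: "(\<Sum>a<card F. f (enum a)) = (\<Sum>x\<in>F. f x)"
  by (rule sum.reindex_bij_betw[OF bij_enum])

lemma one_dim_Ob:
  assumes s: "s \<in> \<Gamma>" "fixed_weight s" and \<chi>: "character \<chi>"
  shows "one_dim s \<chi> \<in> Ob (Rep H)"
proof -
  have "mat 1 1 (\<lambda>_. of_bool (u = s) * \<chi> x) * mat 1 1 (\<lambda>_. of_bool (t = s) * \<chi> y)
    = (if t = u \<triangleleft> x then mat 1 1 (\<lambda>_. of_bool (u = s) * \<chi> (x \<otimes> y)) else 0\<^sub>m 1 1)"
    if st: "u \<in> \<Gamma>" "x \<in> F" "t \<in> \<Gamma>" "y \<in> F" for u x t y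
  proof -
    have "t = s \<longleftrightarrow> t = u \<triangleleft> x" if "u = s" using s(2) st that unfolding fixed_weight_def by simp
    then show ?thesis
      using \<chi> st unfolding character_def by (intro eq_matI) (auto simp: scalar_prod_def)
  qed
  moreover have "(\<Sum>t\<in>\<Gamma>. of_bool (t = s) * \<chi> \<one>) = 1"
    using sum_of_bool_mult[OF finite_\<Gamma>, of True s "\<lambda>_. \<chi> \<one>"] s \<chi> unfolding character_def by simp
  ultimately show ?thesis unfolding one_dim_def Ob_RepH by (auto simp: PiE_iff)
qed

lemma weights_one_dim: "s \<in> \<Gamma> \<Longrightarrow> character \<chi> \<Longrightarrow> weights (one_dim s \<chi>) = {s}"
  unfolding weights_def one_dim_def character_def by (auto simp: mat_eq_iff)

lemma induced_Ob:
  assumes s: "s \<in> \<Gamma>"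
  shows "(induced s :: nat \<times> ('a \<times> 'a \<Rightarrow> 'k::field mat)) \<in> Ob (Rep H)"
proof -
  let ?R = "\<lambda>t x. mat (card F) (card F)
    (\<lambda>(a, b). of_bool (t = s \<triangleleft> enum a \<and> enum a \<otimes> x = enum b) :: 'k)"
  have "?R t x * ?R u y = (if u = t \<triangleleft> x then ?R t (x \<otimes> y) else 0\<^sub>m (card F) (card F))"
    if st: "t \<in> \<Gamma>" "x \<in> F" "u \<in> \<Gamma>" "y \<in> F" for t x u y
  proof (rule eq_matI)
    let ?E = "if u = t \<triangleleft> x then ?R t (x \<otimes> y) else 0\<^sub>m (card F) (card F)"
    fix a b assume "a < dim_row ?E" "b < dim_col ?E"
    then have ab: "a < card F" "b < card F" by (auto split: if_splits)
    have a: "enum a \<in> F" using enum_F ab by blast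
    have "(?R t x * ?R u y) $$ (a, b) = (\<Sum>c<card F. of_bool (t = s \<triangleleft> enum a \<and> enum a \<otimes> x = enum c) *
        of_bool (u = s \<triangleleft> enum c \<and> enum c \<otimes> y = enum b))"
      using ab by (simp add: scalar_prod_def atLeast0LessThan)
    also have "\<dots> = (\<Sum>w\<in>F. of_bool (t = s \<triangleleft> enum a \<and> w = enum a \<otimes> x) *
        of_bool (u = s \<triangleleft> w \<and> w \<otimes> y = enum b))"
      unfolding sum_enum[symmetric] by (intro sum.cong) auto
    also have "\<dots> = of_bool (t = s \<triangleleft> enum a \<and> u = s \<triangleleft> (enum a \<otimes> x) \<and> enum a \<otimes> x \<otimes> y = enum b)"
      unfolding sum_of_bool_mult[OF finite_F] using a st by simp
    also have "\<dots> = ?E $$ (a, b)"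
      using ab a st act_mult_right(2)[OF s a st(2)] by (auto simp: m_assoc)
    finally show "(?R t x * ?R u y) $$ (a, b) = ?E $$ (a, b)" .
  qed auto
  moreover have "(\<Sum>t\<in>\<Gamma>. ?R t \<one> $$ (a, b)) = of_bool (a = b)" if ab: "a < card F" "b < card F" for a b
  proof -
    have a: "enum a \<in> F" "s \<triangleleft> enum a \<in> \<Gamma>" using enum_F ab act s by auto
    have "(\<Sum>t\<in>\<Gamma>. ?R t \<one> $$ (a, b)) = (\<Sum>t\<in>\<Gamma>. of_bool (a = b \<and> t = s \<triangleleft> enum a) * 1)"
      using ab a enum_inject[OF ab] by (intro sum.cong) auto
    also have "\<dots> = of_bool (a = b)" unfolding sum_of_bool_mult[OF finite_\<Gamma>] using a by simp
    finally show ?thesis .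
  qed
  ultimately show ?thesis unfolding induced_def Ob_RepH by (auto simp: PiE_iff)
qed

lemma weights_induced:
  assumes s: "s \<in> \<Gamma>"
  shows "weights (induced s :: nat \<times> ('a \<times> 'a \<Rightarrow> 'k::field mat)) = {s \<triangleleft> x | x. x \<in> F}"
proof -
  {
    fix t assume t: "t \<in> \<Gamma>"
    let ?R = "mat (card F) (card F) (\<lambda>(a, b). of_bool (t = s \<triangleleft> enum a \<and> enum a \<otimes> \<one> = enum b) :: 'k)"
    have "?R \<noteq> 0\<^sub>m (card F) (card F) \<longleftrightarrow> (\<exists>a<card F. t = s \<triangleleft> enum a)"
    proof
      assume "\<exists>a<card F. t = s \<triangleleft> enum a"
      then obtain a where a: "a < card F" "t = s \<triangleleft> enum a" by blast
      then have "?R $$ (a, a) = 1" using enum_F[OF a(1)] by simp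
      moreover have "(0\<^sub>m (card F) (card F) :: 'k mat) $$ (a, a) = 0" using a(1) by simp
      ultimately show "?R \<noteq> 0\<^sub>m (card F) (card F)" by (metis zero_neq_one)
    next
      assume "?R \<noteq> 0\<^sub>m (card F) (card F)"
      then obtain a b where "a < card F" "b < card F" "?R $$ (a, b) \<noteq> 0" by (auto simp: mat_eq_iff)
      then show "\<exists>a<card F. t = s \<triangleleft> enum a" by auto
    qed
  }
  then have "t \<in> weights (induced s :: nat \<times> ('a \<times> 'a \<Rightarrow> 'k mat)) \<longleftrightarrow>
      t \<in> \<Gamma> \<and> (\<exists>a<card F. t = s \<triangleleft> enum a)" for t
    unfolding weights_def induced_def by auto
  then show ?thesis using enum_surj enum_F act(2)[OF s] by (auto; metis)
qed

end

text \<open>Stabilizers of weights are subgroups of \<open>F\<close>, so prime order leaves only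
  fixed weights and weights with a free orbit.\<close>

locale prime_factorization = exact_factorization +
  assumes prime_F: "Factorial_Ring.prime (card F)"
begin

text \<open>Lagrange's theorem, stated for subsets so that it applies to stabilizers of weights and
  to kernels of characters.\<close>

lemma proper_subgroup_of_F_trivial:
  assumes S: "S \<subseteq> F" "S \<noteq> F" "\<one> \<in> S"
    and closed: "\<And>x y. \<lbrakk>x \<in> S; y \<in> S\<rbrakk> \<Longrightarrow> x \<otimes> y \<in> S" "\<And>x. x \<in> S \<Longrightarrow> inv x \<in> S"
  shows "S = {\<one>}"
proof -
  interpret GF: group "M\<lparr>carrier := F\<rparr>" by (rule F.subgroup_is_group[OF group_axioms])
  have "subgroup S (M\<lparr>carrier := F\<rparr>)"
    using S closed m_inv_consistent[OF F] by (intro GF.subgroupI) auto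
  then have "card (rcosets\<^bsub>M\<lparr>carrier := F\<rparr>\<^esub> S) * card S = card F"
    using GF.lagrange by (simp add: Coset.order_def)
  then have "card S dvd card F" by (metis dvd_triv_right)
  moreover have "card S < card F" using finite_F S by (intro psubset_card_mono) auto
  ultimately have "card S = 1" using prime_F unfolding prime_nat_iff by auto
  then obtain a where "S = {a}" by (rule card_1_singletonE)
  then show ?thesis using S(3) by blast
qed

lemma free_weight:
  assumes s: "s \<in> \<Gamma>" "\<not> fixed_weight s" and x: "x \<in> F" "s \<triangleleft> x = s"
  shows "x = \<one>"
proof -
  have "{x \<in> F. s \<triangleleft> x = s} = {\<one>}"
  proof (rule proper_subgroup_of_F_trivial)
    show "{x \<in> F. s \<triangleleft> x = s} \<noteq> F" using s(2) unfolding fixed_weight_def by blast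
    show "inv x \<in> {x \<in> F. s \<triangleleft> x = s}" if "x \<in> {x \<in> F. s \<triangleleft> x = s}" for x
      using right_act_eq_iff[OF s(1) s(1), of x] that by auto
  qed (use act_one(2)[OF s(1)] act_mult_right(2)[OF s(1)] in auto)
  then show ?thesis using x by blast
qed

lemma free_weight_inject:
  assumes s: "s \<in> \<Gamma>" "\<not> fixed_weight s" and xy: "x \<in> F" "y \<in> F" "s \<triangleleft> x = s \<triangleleft> y"
  shows "x = y"
proof -
  have "s \<triangleleft> (x \<otimes> inv y) = s"
    using act_mult_right(2)[OF s(1) xy(1) F.m_inv_closed[OF xy(2)]] right_act_inv[OF s(1) xy(2)] xy(3) by simp
  then have "x \<otimes> inv y = \<one>" using free_weight[OF s] xy by simp
  then show ?thesis using xy F.mem_carrier by (metis inv_closed inv_inv inv_equality)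
qed

lemma fixed_weight_act:
  assumes "s \<in> \<Gamma>" "\<not> fixed_weight s" "x \<in> F"
  shows "\<not> fixed_weight (s \<triangleleft> x)"
  using assms right_act_inv(1)[of s x] unfolding fixed_weight_def
  by (metis F.m_inv_closed)

text \<open>At x = \<one> the hypothesis says that \<open>v\<close> is a weight vector for
  \<open>s\<close>, so basis elements of any other weight annihilate it.\<close>

lemma hom_one_dim:
  fixes V :: "nat \<times> ('a \<times> 'a \<Rightarrow> 'k::field mat)"
  assumes V: "(n, R) \<in> Ob (Rep H)" and s: "s \<in> \<Gamma>" "fixed_weight s" and \<chi>: "character \<chi>"
    and v: "v \<in> carrier_vec n" "\<And>x. x \<in> F \<Longrightarrow> R (s, x) *\<^sub>v v = \<chi> x \<cdot>\<^sub>v v"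
  shows "mat n 1 (\<lambda>(i, j). v $ i) \<in> Arr (Rep H) (one_dim s \<chi>) (n, R)"
proof -
  let ?T = "mat n 1 (\<lambda>(i, j). v $ i)"
  have RT: "(R (t, x) * ?T) $$ (i, 0) = (R (t, x) *\<^sub>v v) $ i" if "t \<in> \<Gamma>" "x \<in> F" "i < n" for t x i
    using repD(1)[OF V that(1,2)] that(3) v(1) by (auto simp: scalar_prod_def)
  have z: "R (t, x) *\<^sub>v v = 0\<^sub>v n" if t: "t \<in> \<Gamma>" "x \<in> F" "t \<noteq> s" for t x
  proof -
    have "s \<noteq> t \<triangleleft> x" using t right_act_eq_iff[OF t(1) s(1) t(2)] s(2) unfolding fixed_weight_def by auto
    then have "R (t, x) * R (s, \<one>) = 0\<^sub>m n n" using repD(2)[OF V t(1,2) s(1) F.one_closed] by simp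
    moreover have "R (t, x) *\<^sub>v (R (s, \<one>) *\<^sub>v v) = (R (t, x) * R (s, \<one>)) *\<^sub>v v"
      using assoc_mult_mat_vec[OF repD(1)[OF V t(1,2)] repD(1)[OF V s(1) F.one_closed] v(1)] by simp
    moreover have "R (s, \<one>) *\<^sub>v v = v" using v \<chi> unfolding character_def by simp
    moreover have "0\<^sub>m n n *\<^sub>v v = 0\<^sub>v n" using v(1) by (intro eq_vecI) auto
    ultimately show ?thesis by simp
  qed
  have "?T * mat 1 1 (\<lambda>_. of_bool (t = s) * \<chi> x) = R (t, x) * ?T" if t: "t \<in> \<Gamma>" "x \<in> F" for t x
  proof (rule eq_matI)
    fix i j assume "i < dim_row (R (t, x) * ?T)" "j < dim_col (R (t, x) * ?T)"
    then have ij: "i < n" "j = 0" using repD(1)[OF V t] by auto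
    show "(?T * mat 1 1 (\<lambda>_. of_bool (t = s) * \<chi> x)) $$ (i, j) = (R (t, x) * ?T) $$ (i, j)"
      using ij RT[OF t ij(1)] v z[OF t] t by (auto simp: scalar_prod_def)
  qed (use repD(1)[OF V t] in auto)
  then show ?thesis unfolding one_dim_def Rep_Arr by simp
qed

text \<open>Frobenius reciprocity. Any \<open>v\<close> is allowed, as the element of weight s
  \<lhd> b acting through the inverse of b begins by projecting to weight \<open>s\<close>.\<close>

lemma hom_induced:
  fixes R :: "'a \<times> 'a \<Rightarrow> 'k::field mat"
  assumes V: "(n, R) \<in> Ob (Rep H)" and s: "s \<in> \<Gamma>" and v: "v \<in> carrier_vec n"
  shows "mat n (card F) (\<lambda>(i, b). (R (s \<triangleleft> enum b, inv (enum b)) *\<^sub>v v) $ i) \<in> Arr (Rep H) (induced s) (n, R)"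
proof -
  let ?p = "card F"
  let ?T = "mat n ?p (\<lambda>(i, b). (R (s \<triangleleft> enum b, inv (enum b)) *\<^sub>v v) $ i)"
  let ?R = "\<lambda>t x. mat ?p ?p (\<lambda>(a, b). of_bool (t = s \<triangleleft> enum a \<and> enum a \<otimes> x = enum b)) :: 'k mat"
  have "?T * ?R t x = R (t, x) * ?T" if t: "t \<in> \<Gamma>" "x \<in> F" for t x
  proof (rule eq_matI)
    fix i b assume "i < dim_row (R (t, x) * ?T)" "b < dim_col (R (t, x) * ?T)"
    then have ib: "i < n" "b < ?p" using repD(1)[OF V t] by auto
    let ?b = "enum b"
    have b: "?b \<in> F" "inv ?b \<in> F" "s \<triangleleft> ?b \<in> \<Gamma>" using enum_F[OF ib(2)] act s by auto
    have bx: "?b \<otimes> inv x \<in> F" "s \<triangleleft> (?b \<otimes> inv x) = s \<triangleleft> ?b \<triangleleft> inv x"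
      using b t act_mult_right(2)[OF s] by auto
    have ix: "inv (?b \<otimes> inv x) = x \<otimes> inv ?b" using b t by (simp add: inv_mult_group F.mem_carrier)
    have "(?T * ?R t x) $$ (i, b) = (\<Sum>a<?p. (R (s \<triangleleft> enum a, inv (enum a)) *\<^sub>v v) $ i *
        of_bool (t = s \<triangleleft> enum a \<and> enum a \<otimes> x = ?b))"
      using ib by (simp add: scalar_prod_def atLeast0LessThan)
    also have "\<dots> = (\<Sum>w\<in>F. (R (s \<triangleleft> w, inv w) *\<^sub>v v) $ i * of_bool (t = s \<triangleleft> w \<and> w \<otimes> x = ?b))"
      by (rule sum_enum)
    also have "\<dots> = (\<Sum>w\<in>F. of_bool (True \<and> w = ?b \<otimes> inv x) * (of_bool (t = s \<triangleleft> w) * (R (s \<triangleleft> w, inv w) *\<^sub>v v) $ i))"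
    proof (rule sum.cong[OF refl])
      fix w assume "w \<in> F"
      then have "w \<otimes> x = ?b \<longleftrightarrow> w = ?b \<otimes> inv x" using b t F.mem_carrier inv_solve_right by auto
      then show "(R (s \<triangleleft> w, inv w) *\<^sub>v v) $ i * of_bool (t = s \<triangleleft> w \<and> w \<otimes> x = ?b)
        = of_bool (True \<and> w = ?b \<otimes> inv x) * (of_bool (t = s \<triangleleft> w) * (R (s \<triangleleft> w, inv w) *\<^sub>v v) $ i)"
        by (cases "w = ?b \<otimes> inv x") auto
    qed
    also have "\<dots> = of_bool (t = s \<triangleleft> ?b \<triangleleft> inv x) * (R (t, x \<otimes> inv ?b) *\<^sub>v v) $ i"
      unfolding sum_of_bool_mult[OF finite_F] using bx ix by auto
    also have "\<dots> = of_bool (s \<triangleleft> ?b = t \<triangleleft> x) * (R (t, x \<otimes> inv ?b) *\<^sub>v v) $ i"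
      using right_act_eq_iff[OF t(1) b(3) t(2)] by auto
    also have "\<dots> = ((R (t, x) * R (s \<triangleleft> ?b, inv ?b)) *\<^sub>v v) $ i"
      using repD(2)[OF V t b(3,2)] v ib(1) by auto
    also have "\<dots> = (R (t, x) *\<^sub>v (R (s \<triangleleft> ?b, inv ?b) *\<^sub>v v)) $ i"
      using assoc_mult_mat_vec[OF repD(1)[OF V t] repD(1)[OF V b(3,2)] v] by simp
    also have "\<dots> = (R (t, x) * ?T) $$ (i, b)"
      using ib repD(1)[OF V t] repD(1)[OF V b(3,2)] v by (auto simp: scalar_prod_def)
    finally show "(?T * ?R t x) $$ (i, b) = (R (t, x) * ?T) $$ (i, b)" .
  qed (use repD(1)[OF V t] in auto)
  then show ?thesis unfolding induced_def Rep_Arr by simp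
qed

text \<open>Averaging over \<open>F\<close> against the powers of a faithful character projects onto eigenspaces.\<close>

lemma ex_eigenvector:
  fixes R :: "'a \<times> 'a \<Rightarrow> 'k::{alg_closed_field, field_char_0} mat"
  assumes V: "(n, R) \<in> Ob (Rep H)" and s: "s \<in> weights (n, R)" "fixed_weight s"
  shows "\<exists>\<chi> v. character \<chi> \<and> v \<in> carrier_vec n \<and> v \<noteq> 0\<^sub>v n \<and> (\<forall>x\<in>F. R (s, x) *\<^sub>v v = \<chi> x \<cdot>\<^sub>v v)"
proof -
  interpret GF: group "M\<lparr>carrier := F\<rparr>" by (rule F.subgroup_is_group[OF group_axioms])
  have p: "Factorial_Ring.prime (Coset.order (M\<lparr>carrier := F\<rparr>))" using prime_F unfolding Coset.order_def by simp
  obtain \<psi> :: "'a \<Rightarrow> 'k" where \<psi>_all: "\<forall>x\<in>F. \<forall>y\<in>F. \<psi> (x \<otimes> y) = \<psi> x * \<psi> y"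
      "\<forall>x\<in>F. \<psi> x = 1 \<longleftrightarrow> x = \<one>" "\<forall>x\<in>F. \<psi> x ^ card F = 1"
    using GF.ex_faithful_character[OF p, where 'k = 'k] by (auto simp: Coset.order_def)
  note \<psi> = bspec[OF bspec[OF \<psi>_all(1)]] bspec[OF \<psi>_all(2)] bspec[OF \<psi>_all(3)]
  have s\<Gamma>: "s \<in> \<Gamma>" and nz: "R (s, \<one>) \<noteq> 0\<^sub>m n n" using s unfolding weights_def by auto
  have fx: "s \<triangleleft> x = s" if "x \<in> F" for x using s(2) that unfolding fixed_weight_def by blast
  have car: "R (s, x) \<in> carrier_mat n n" if "x \<in> F" for x using repD(1)[OF V s\<Gamma> that] .
  obtain i0 j0 where ij0: "i0 < n" "j0 < n" "R (s, \<one>) $$ (i0, j0) \<noteq> 0"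
    using nz car[OF F.one_closed] by (auto simp: mat_eq_iff)
  \<comment> \<open>A column of |F| times the projector onto the eigenspace of the character
    \<psi>^j. The column \<open>j0\<close> is one in which the weight projection is nonzero.\<close>
  define u where "u j = vec n (\<lambda>i. \<Sum>x\<in>F. \<psi> (inv x) ^ j * R (s, x) $$ (i, j0))" for j :: nat
  have u: "u j \<in> carrier_vec n" for j unfolding u_def by simp
  have eig: "R (s, y) *\<^sub>v u j = (\<psi> y ^ j) \<cdot>\<^sub>v u j" if y: "y \<in> F" for y j
  proof (rule eq_vecI)
    fix i assume "i < dim_vec ((\<psi> y ^ j) \<cdot>\<^sub>v u j)"
    then have i: "i < n" by (simp add: u_def)
    have "(R (s, y) *\<^sub>v u j) $ i = (\<Sum>k<n. R (s, y) $$ (i, k) * (\<Sum>x\<in>F. \<psi> (inv x) ^ j * R (s, x) $$ (k, j0)))"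
      using car[OF y] i by (simp add: u_def scalar_prod_def atLeast0LessThan)
    also have "\<dots> = (\<Sum>x\<in>F. \<Sum>k<n. R (s, y) $$ (i, k) * (\<psi> (inv x) ^ j * R (s, x) $$ (k, j0)))"
      unfolding sum_distrib_left by (rule sum.swap)
    also have "\<dots> = (\<Sum>x\<in>F. \<psi> (inv x) ^ j * R (s, y \<otimes> x) $$ (i, j0))"
    proof (rule sum.cong[OF refl])
      fix x assume x: "x \<in> F"
      have "R (s, y \<otimes> x) = R (s, y) * R (s, x)" using repD(2)[OF V s\<Gamma> y s\<Gamma> x] fx[OF y] by simp
      then show "(\<Sum>k<n. R (s, y) $$ (i, k) * (\<psi> (inv x) ^ j * R (s, x) $$ (k, j0)))
          = \<psi> (inv x) ^ j * R (s, y \<otimes> x) $$ (i, j0)"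
        using car[OF y] car[OF x] i ij0 by (simp add: scalar_prod_def atLeast0LessThan sum_distrib_left ac_simps)
    qed
    also have "\<dots> = (\<Sum>x\<in>F. \<psi> y ^ j * (\<psi> (inv x) ^ j * R (s, x) $$ (i, j0)))"
    proof (rule sum.reindex_bij_witness[of _ "\<lambda>x. inv y \<otimes> x" "\<lambda>x. y \<otimes> x"])
      fix x assume x: "x \<in> F"
      have c: "x \<in> carrier M" "y \<in> carrier M" using x y F.mem_carrier by auto
      show "inv y \<otimes> (y \<otimes> x) = x" "y \<otimes> (inv y \<otimes> x) = x" using c by (simp_all flip: m_assoc)
      show "y \<otimes> x \<in> F" "inv y \<otimes> x \<in> F" using x y by auto
      have "inv x = inv (y \<otimes> x) \<otimes> y" using c by (simp add: inv_mult_group m_assoc)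
      then have "\<psi> (inv x) = \<psi> (inv (y \<otimes> x) \<otimes> y)" by simp
      also have "\<dots> = \<psi> (inv (y \<otimes> x)) * \<psi> y" using x y by (intro \<psi>(1)) auto
      finally show "\<psi> y ^ j * (\<psi> (inv (y \<otimes> x)) ^ j * R (s, y \<otimes> x) $$ (i, j0)) = \<psi> (inv x) ^ j * R (s, y \<otimes> x) $$ (i, j0)"
        by (simp add: power_mult_distrib ac_simps)
    qed
    also have "\<dots> = ((\<psi> y ^ j) \<cdot>\<^sub>v u j) $ i" using i by (simp add: u_def sum_distrib_left)
    finally show "(R (s, y) *\<^sub>v u j) $ i = ((\<psi> y ^ j) \<cdot>\<^sub>v u j) $ i" .
  qed (use car[OF y] in \<open>simp add: u_def\<close>)
  \<comment> \<open>Summing over all j recovers, by orthogonality of characters, |F| times column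
    \<open>j0\<close> of the weight projection. Its entry at \<open>i0\<close> is nonzero in
    characteristic zero.\<close>
  have "\<exists>j. u j \<noteq> 0\<^sub>v n"
  proof (rule ccontr)
    assume "\<not> ?thesis"
    then have "(\<Sum>j<card F. u j $ i0) = 0" using ij0 by simp
    moreover have "(\<Sum>j<card F. u j $ i0) = (\<Sum>x\<in>F. (\<Sum>j<card F. \<psi> (inv x) ^ j) * R (s, x) $$ (i0, j0))"
      using ij0 unfolding u_def by (simp add: sum_distrib_right) (rule sum.swap)
    moreover have "\<dots> = (\<Sum>x\<in>F. of_bool (True \<and> x = \<one>) * (of_nat (card F) * R (s, x) $$ (i0, j0)))"
    proof (rule sum.cong[OF refl])
      fix x assume x: "x \<in> F"
      have "(\<Sum>j<card F. \<psi> (inv x) ^ j) = of_bool (x = \<one>) * of_nat (card F)"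
      proof (cases "x = \<one>")
        case True
        then show ?thesis using \<psi>(2)[of \<one>] by simp
      next
        case False
        then have "\<psi> (inv x) \<noteq> 1" using \<psi>(2)[of "inv x"] x F.mem_carrier by (simp add: inv_eq_1_iff)
        moreover have "\<psi> (inv x) ^ card F - 1 = (\<psi> (inv x) - 1) * (\<Sum>j<card F. \<psi> (inv x) ^ j)"
          by (rule power_diff_1_eq)
        ultimately show ?thesis using False \<psi>(3)[of "inv x"] x by simp
      qed
      then show "(\<Sum>j<card F. \<psi> (inv x) ^ j) * R (s, x) $$ (i0, j0)
        = of_bool (True \<and> x = \<one>) * (of_nat (card F) * R (s, x) $$ (i0, j0))" by simp
    qed
    moreover have "\<dots> = of_nat (card F) * R (s, \<one>) $$ (i0, j0)"
      unfolding sum_of_bool_mult[OF finite_F] by simp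
    moreover have "(of_nat (card F) :: 'k) \<noteq> 0" using prime_F by auto
    ultimately show False using ij0 by auto
  qed
  then obtain j where j: "u j \<noteq> 0\<^sub>v n" by blast
  have "character (\<lambda>x. \<psi> x ^ j)" using \<psi>(1) \<psi>(2)[of \<one>] unfolding character_def by (simp add: power_mult_distrib)
  then show ?thesis using eig u j by blast
qed

end

section \<open>Classification of the simple modules\<close>

context prime_factorization
begin

text \<open>Representatives of all simple modules: characters over fixed weights and induced modules
  over free ones. \<open>standard_simple\<close> and \<open>simple_standard\<close> establish
  this.\<close>

definition standard_module :: "nat \<times> ('a \<times> 'a \<Rightarrow> 'k::field mat) \<Rightarrow> bool"
  where "standard_module S \<longleftrightarrow>
    (\<exists>s\<in>\<Gamma>. fixed_weight s \<and> (\<exists>\<chi>. character \<chi> \<and> S = one_dim s \<chi>)) \<or>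
    (\<exists>s\<in>\<Gamma>. \<not> fixed_weight s \<and> S = induced s)"

lemma standard_Ob: "standard_module S \<Longrightarrow> S \<in> Ob (Rep H)"
  unfolding standard_module_def using one_dim_Ob induced_Ob by blast

lemma standard_cases:
  assumes "standard_module S"
  obtains (one_dim) s \<chi> where "s \<in> \<Gamma>" "fixed_weight s" "character \<chi>" "S = one_dim s \<chi>"
    | (induced) s where "s \<in> \<Gamma>" "\<not> fixed_weight s" "S = induced s"
  using assms unfolding standard_module_def by blast

lemma induced_weight_not_fixed:
  assumes "s \<in> \<Gamma>" "\<not> fixed_weight s" "t \<in> weights (induced s :: nat \<times> ('a \<times> 'a \<Rightarrow> 'k::field mat))"
  shows "\<not> fixed_weight t"
  using assms(3) fixed_weight_act[OF assms(1,2)] unfolding weights_induced[OF assms(1)] by blast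

lemma one_dim_hom_injective:
  fixes f u :: "'k::field mat"
  assumes f: "f \<in> carrier_mat n 1" "f \<noteq> 0\<^sub>m n 1" and u: "u \<in> carrier_mat 1 q" "f * u = 0\<^sub>m n q"
  shows "u = 0\<^sub>m 1 q"
proof -
  obtain i where i: "i < n" "f $$ (i, 0) \<noteq> 0" using f by (auto simp: mat_eq_iff)
  have "u $$ (0, j) = 0" if j: "j < q" for j
  proof -
    have "f $$ (i, 0) * u $$ (0, j) = (f * u) $$ (i, j)" using f(1) u(1) i j by (simp add: scalar_prod_def)
    then show ?thesis using u(2) i j by simp
  qed
  then show ?thesis using u(1) by (intro eq_matI) auto
qed

text \<open>Freeness of the orbit makes the algebra act on the induced module by all matrix units.
  These move any column of \<open>f\<close> to any other, so no column vanishes, and they isolate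
  single rows of \<open>u\<close>.\<close>

lemma induced_hom_injective:
  fixes R :: "'a \<times> 'a \<Rightarrow> 'k::field mat"
  assumes s: "s \<in> \<Gamma>" "\<not> fixed_weight s" and V: "(n, R) \<in> Ob (Rep H)"
    and f: "f \<in> Arr (Rep H) (induced s) (n, R)" "f \<noteq> 0\<^sub>m n (card F)"
    and u: "u \<in> carrier_mat (card F) q" "f * u = 0\<^sub>m n q"
  shows "u = 0\<^sub>m (card F) q"
proof -
  let ?p = "card F"
  let ?R = "\<lambda>t x. mat ?p ?p (\<lambda>(a, b). of_bool (t = s \<triangleleft> enum a \<and> enum a \<otimes> x = enum b)) :: 'k mat"
  have fm: "f \<in> carrier_mat n ?p" and comm: "\<And>t x. \<lbrakk>t \<in> \<Gamma>; x \<in> F\<rbrakk> \<Longrightarrow> f * ?R t x = R (t, x) * f"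
    using f unfolding induced_def Rep_Arr by auto
  have free: "s \<triangleleft> enum a = s \<triangleleft> enum b \<longleftrightarrow> a = b" if "a < ?p" "b < ?p" for a b
    using free_weight_inject[OF s enum_F[OF that(1)] enum_F[OF that(2)]] enum_inject[OF that] by auto
  have tG: "s \<triangleleft> enum b \<in> \<Gamma>" if "b < ?p" for b using act s enum_F[OF that] by blast
  text \<open>\<open>e\<^sub>t # x\<close> with \<open>t\<close> the weight of index \<open>b\<close> and \<open>x\<close> carrying \<open>b\<close> to \<open>c\<close> acts as a matrix unit.\<close>
  have unit: "(f * ?R (s \<triangleleft> enum b) (inv (enum b) \<otimes> enum c)) $$ (i, a) = (if a = c then f $$ (i, b) else 0)"
    if b: "b < ?p" "c < ?p" and a: "a < ?p" and i: "i < n" for a b c i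
  proof -
    have "(f * ?R (s \<triangleleft> enum b) (inv (enum b) \<otimes> enum c)) $$ (i, a)
      = (\<Sum>d<?p. f $$ (i, d) * of_bool (s \<triangleleft> enum b = s \<triangleleft> enum d \<and> enum d \<otimes> (inv (enum b) \<otimes> enum c) = enum a))"
      using fm i a by (simp add: scalar_prod_def atLeast0LessThan)
    also have "\<dots> = (\<Sum>d<?p. of_bool (a = c \<and> d = b) * f $$ (i, d))"
    proof (rule sum.cong[OF refl])
      fix d assume "d \<in> {..<?p}"
      then have d: "d < ?p" by simp
      have cc: "enum b \<in> carrier M" "enum c \<in> carrier M" using enum_F b F.mem_carrier by auto
      then have "enum b \<otimes> (inv (enum b) \<otimes> enum c) = enum c" by (simp flip: m_assoc)
      then show "f $$ (i, d) * of_bool (s \<triangleleft> enum b = s \<triangleleft> enum d \<and> enum d \<otimes> (inv (enum b) \<otimes> enum c) = enum a)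
        = of_bool (a = c \<and> d = b) * f $$ (i, d)"
        using free[OF b(1) d] enum_inject[OF b(2) a] by auto
    qed
    also have "\<dots> = (if a = c then f $$ (i, b) else 0)"
      by (subst sum_of_bool_mult) (use b in auto)
    finally show ?thesis .
  qed
  have xF: "inv (enum b) \<otimes> enum c \<in> F" if "b < ?p" "c < ?p" for b c using enum_F that by auto
  obtain i0 b0 where ib: "i0 < n" "b0 < ?p" "f $$ (i0, b0) \<noteq> 0" using fm f(2) by (auto simp: mat_eq_iff)
  \<comment> \<open>The matrix unit from \<open>b0\<close> to \<open>b\<close> carries column
    \<open>b\<close> of \<open>f\<close> to column \<open>b0\<close>; if the former were zero, so
    would be the latter.\<close>
  have col: "\<exists>i<n. f $$ (i, b) \<noteq> 0" if b: "b < ?p" for b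
  proof (rule ccontr)
    assume neg: "\<not> ?thesis"
    have "f $$ (i0, b0) = (R (s \<triangleleft> enum b0, inv (enum b0) \<otimes> enum b) * f) $$ (i0, b)"
      using unit[OF ib(2) b b ib(1)] comm[OF tG[OF ib(2)] xF[OF ib(2) b]] by simp
    also have "\<dots> = 0"
      using neg fm ib b repD(1)[OF V tG[OF ib(2)] xF[OF ib(2) b]] by (auto simp: scalar_prod_def intro!: sum.neutral)
    finally show False using ib by simp
  qed
  have "u $$ (b, j) = 0" if b: "b < ?p" and j: "j < q" for b j
  proof -
    obtain i where i: "i < n" "f $$ (i, b) \<noteq> 0" using col[OF b] by blast
    let ?t = "s \<triangleleft> enum b" and ?x = "inv (enum b) \<otimes> enum b"
    have Rc: "R (?t, ?x) \<in> carrier_mat n n" by (rule repD(1)[OF V tG[OF b] xF[OF b b]])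
    have "R (?t, ?x) * (f * u) = (R (?t, ?x) * f) * u" using Rc fm u(1) by (simp add: assoc_mult_mat[of _ n n f ?p u q])
    then have z: "(f * ?R ?t ?x) * u = 0\<^sub>m n q" using comm[OF tG[OF b] xF[OF b b]] Rc u(2) by simp
    have "((f * ?R ?t ?x) * u) $$ (i, j) = (\<Sum>a<?p. (f * ?R ?t ?x) $$ (i, a) * u $$ (a, j))"
      using fm u(1) i j by (simp add: scalar_prod_def[of "row _ _"] atLeast0LessThan)
    also have "\<dots> = (\<Sum>a<?p. of_bool (True \<and> a = b) * (f $$ (i, b) * u $$ (a, j)))"
      by (intro sum.cong) (simp_all add: unit[OF b b _ i(1)])
    also have "\<dots> = f $$ (i, b) * u $$ (b, j)" by (subst sum_of_bool_mult) (use b in auto)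
    finally show ?thesis using z i j by simp
  qed
  then show ?thesis using u(1) by (intro eq_matI) auto
qed

lemma standard_hom_injective:
  fixes R :: "'a \<times> 'a \<Rightarrow> 'k::field mat"
  assumes S: "standard_module (m, Q)" and V: "(n, R) \<in> Ob (Rep H)"
    and f: "f \<in> Arr (Rep H) (m, Q) (n, R)" "f \<noteq> 0\<^sub>m n m" and u: "u \<in> carrier_mat m q" "f * u = 0\<^sub>m n q"
  shows "u = 0\<^sub>m m q"
  using S
proof (cases rule: standard_cases)
  case (one_dim s \<chi>)
  then have "m = 1" unfolding one_dim_def by simp
  then show ?thesis using one_dim_hom_injective[of f n u q] f u unfolding Rep_Arr by auto
next
  case (induced s)
  then have "m = card F" unfolding induced_def by simp
  then show ?thesis using induced_hom_injective[OF induced(1,2) V] induced(3) f u by simp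
qed

lemma standard_monic:
  assumes S: "standard_module S" and V: "V \<in> Ob (Rep H)"
    and f: "f \<in> Arr (Rep H) S V" "f \<noteq> Zero (Rep H) S V"
  shows "monic (Rep H) S V f"
proof -
  interpret C: linear_category "Rep (H :: ('a \<times> 'a, 'b) hopf_algebra)" by (rule linear_category_Rep)
  obtain m Q n R where eq: "S = (m, Q)" "V = (n, R)" by (cases S; cases V)
  show ?thesis
  proof (rule C.monicI_zero[OF standard_Ob[OF S] V f(1)])
    fix W u assume W: "W \<in> Ob (Rep H)" "u \<in> Arr (Rep H) W S" "f \<Zcomp>\<^bsub>Rep H\<^esub> u = Zero (Rep H) W V"
    obtain q T where W_eq: "W = (q, T)" by (cases W)
    show "u = Zero (Rep H) W S"
      using standard_hom_injective[OF S[unfolded eq] V[unfolded eq], of f u q] f W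
      unfolding eq W_eq Rep_Arr Rep_Zero Rep_Cmp by blast
  qed
qed

text \<open>A common weight forces both modules to be of the same type, hence of the same dimension,
  and an injective square matrix is invertible.\<close>

lemma standard_isomorphism:
  assumes S: "standard_module S" "standard_module T"
    and f: "f \<in> Arr (Rep H) S T" "f \<noteq> Zero (Rep H) S T"
  shows "isomorphism (Rep H) S T f"
proof -
  obtain m Q n R where eq: "S = (m, Q)" "T = (n, R)" by (cases S; cases T)
  note Ob = standard_Ob[OF S(1)] standard_Ob[OF S(2)]
  obtain t where t: "t \<in> weights S" "t \<in> weights T"
    using weights_hom_nonzero[of m Q n R f] Ob f unfolding eq Rep_Zero by blast
  have "m = n"
    using S(1)
  proof (cases rule: standard_cases)
    case (one_dim s \<chi>)
    then have 1: "t = s" using t weights_one_dim by auto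
    show ?thesis using S(2)
    proof (cases rule: standard_cases)
      case (one_dim s' \<chi>')
      then show ?thesis using \<open>S = one_dim s \<chi>\<close> eq unfolding one_dim_def by simp
    next
      case (induced s')
      then have "\<not> fixed_weight t" using t induced_weight_not_fixed by blast
      then show ?thesis using 1 one_dim by simp
    qed
  next
    case (induced s)
    then have 1: "\<not> fixed_weight t" using t induced_weight_not_fixed by blast
    show ?thesis using S(2)
    proof (cases rule: standard_cases)
      case (one_dim s' \<chi>')
      then show ?thesis using 1 t weights_one_dim[OF one_dim(1,3)] by simp
    next
      case (induced s')
      then show ?thesis using \<open>S = induced s\<close> eq unfolding induced_def by simp
    qed
  qed
  note eq = eq[folded this]
  have fm: "f \<in> carrier_mat m m" using f(1) unfolding eq Rep_Arr by blast
  have "v = 0\<^sub>v m" if v: "v \<in> carrier_vec m" "f *\<^sub>v v = 0\<^sub>v m" for v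
  proof -
    let ?u = "mat m 1 (\<lambda>(i, j). v $ i)"
    have "(f * ?u) $$ (i, 0) = (f *\<^sub>v v) $ i" if "i < m" for i
      using fm v(1) that by (auto simp: scalar_prod_def)
    then have "f * ?u = 0\<^sub>m m 1" using fm v by (intro eq_matI) auto
    then have "?u = 0\<^sub>m m 1"
      using standard_hom_injective[OF S(1)[unfolded eq] Ob(2)[unfolded eq], of f ?u 1] f unfolding eq Rep_Zero by simp
    then have "?u $$ (i, 0) = 0" if "i < m" for i using that by simp
    then show ?thesis using v(1) by (intro eq_vecI) auto
  qed
  then show ?thesis using isomorphism_Rep Ob f(1) unfolding eq by blast
qed

text \<open>Over a fixed weight an eigenvector of \<open>F\<close> gives the map; over a free weight
  any vector with nonzero component of that weight does.\<close>

lemma ex_standard_hom: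
  fixes V :: "nat \<times> ('a \<times> 'a \<Rightarrow> 'k::{alg_closed_field, field_char_0} mat)"
  assumes V: "V \<in> Ob (Rep H)" and s: "s \<in> weights V"
  shows "\<exists>S. standard_module S \<and> s \<in> weights S \<and> (\<not> fixed_weight s \<longrightarrow> S = induced s) \<and>
    hom_nonzero (Rep H) S V"
proof -
  obtain n R where eq: "V = (n, R)" by (cases V)
  note V = V[unfolded eq] and s = s[unfolded eq]
  have s\<Gamma>: "s \<in> \<Gamma>" "R (s, \<one>) \<noteq> 0\<^sub>m n n" using s unfolding weights_def by auto
  show ?thesis
  proof (cases "fixed_weight s")
    case True
    obtain \<chi> v where \<chi>: "character \<chi>" "v \<in> carrier_vec n" "v \<noteq> 0\<^sub>v n" "\<forall>x\<in>F. R (s, x) *\<^sub>v v = \<chi> x \<cdot>\<^sub>v v"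
      using ex_eigenvector[OF V s True] by blast
    have "mat n 1 (\<lambda>(i, j). v $ i) \<in> Arr (Rep H) (one_dim s \<chi>) (n, R)"
      using hom_one_dim[OF V s\<Gamma>(1) True \<chi>(1,2)] \<chi>(4) by blast
    moreover have "mat n 1 (\<lambda>(i, j). v $ i) \<noteq> Zero (Rep H) (one_dim s \<chi>) (n, R)"
    proof -
      obtain i where "i < n" "v $ i \<noteq> 0" using \<chi>(2,3) by (auto simp: vec_eq_iff)
      then show ?thesis unfolding one_dim_def Rep_Zero by (auto simp: mat_eq_iff)
    qed
    moreover have "standard_module (one_dim s \<chi>)" unfolding standard_module_def using s\<Gamma> True \<chi> by blast
    ultimately show ?thesis
      unfolding eq hom_nonzero_def using weights_one_dim[OF s\<Gamma>(1) \<chi>(1)] True by blast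
  next
    case False
    note car = repD(1)[OF V s\<Gamma>(1) F.one_closed]
    obtain i j where ij: "i < n" "j < n" "R (s, \<one>) $$ (i, j) \<noteq> 0" using s\<Gamma>(2) car by (auto simp: mat_eq_iff)
    define v :: "'k vec" where "v = unit_vec n j"
    let ?T = "mat n (card F) (\<lambda>(i, b). (R (s \<triangleleft> enum b, inv (enum b)) *\<^sub>v v) $ i)"
    have v: "v \<in> carrier_vec n" unfolding v_def by simp
    obtain b where b: "b < card F" "enum b = \<one>" using enum_surj[OF F.one_closed] by blast
    have "?T $$ (i, b) = R (s, \<one>) $$ (i, j)"
      using b ij car act_one(2)[OF s\<Gamma>(1)] unfolding v_def by simp
    then have "?T \<noteq> 0\<^sub>m n (card F)" using ij b(1) by (metis index_zero_mat(1))
    then have "?T \<noteq> Zero (Rep H) (induced s) (n, R)" unfolding induced_def Rep_Zero .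
    moreover have "?T \<in> Arr (Rep H) (induced s) (n, R)" by (rule hom_induced[OF V s\<Gamma>(1) v])
    moreover have "s \<in> weights (induced s :: nat \<times> ('a \<times> 'a \<Rightarrow> 'k mat))"
      unfolding weights_induced[OF s\<Gamma>(1)] using act_one(2)[OF s\<Gamma>(1)] F.one_closed
      by (intro CollectI exI[of _ \<one>]) simp
    moreover have "standard_module (induced s :: nat \<times> ('a \<times> 'a \<Rightarrow> 'k mat))"
      unfolding standard_module_def using s\<Gamma> False by blast
    ultimately show ?thesis unfolding eq hom_nonzero_def by blast
  qed
qed

lemma weights_nonempty_object:
  assumes "V \<in> Ob (Rep H)" "\<not> zero_object (Rep H) V"
  shows "\<exists>s. s \<in> weights V"
proof -
  obtain n R where eq: "V = (n, R)" by (cases V)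
  have "n \<noteq> 0"
  proof
    assume "n = 0"
    then have "Ide (Rep H) V = Zero (Rep H) V V" unfolding eq Rep_Ide Rep_Zero by auto
    then show False using assms unfolding zero_object_def by blast
  qed
  then show ?thesis using weights_nonempty assms unfolding eq by blast
qed

text \<open>A nonzero subobject receives a nonzero map from a standard module \<open>T\<close>. The
  composite from \<open>T\<close> to \<open>S\<close> is an isomorphism, so the embedding is monic
  with a right inverse.\<close>

lemma standard_simple:
  fixes S :: "nat \<times> ('a \<times> 'a \<Rightarrow> 'k::{alg_closed_field, field_char_0} mat)"
  assumes S: "standard_module S"
  shows "simple_object (Rep H) S"
proof -
  interpret C: linear_category "Rep (H :: ('a \<times> 'a, 'k) hopf_algebra)" by (rule linear_category_Rep)
  note Ob = standard_Ob[OF S]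
  have "\<not> zero_object (Rep H) S"
  proof
    assume z: "zero_object (Rep H) S"
    obtain m Q where eq: "S = (m, Q)" by (cases S)
    have "m \<noteq> 0" using S
    proof (cases rule: standard_cases)
      case (induced s)
      then show ?thesis using eq prime_F unfolding induced_def by auto
    qed (use eq in \<open>simp add: one_dim_def\<close>)
    then have "(1\<^sub>m m :: 'k mat) $$ (0, 0) \<noteq> 0\<^sub>m m m $$ (0, 0)" by simp
    then show False using z unfolding zero_object_def eq Rep_Ide Rep_Zero by metis
  qed
  moreover have "isomorphism (Rep H) Y S f" if Y: "Y \<in> Ob (Rep H)" "monic (Rep H) Y S f" "\<not> zero_object (Rep H) Y" for Y f
  proof -
    have f: "f \<in> Arr (Rep H) Y S" using Y(2) unfolding monic_def by blast
    obtain t where "t \<in> weights Y" using weights_nonempty_object[OF Y(1,3)] by blast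
    then obtain T g where T: "standard_module T" "g \<in> Arr (Rep H) T Y" "g \<noteq> Zero (Rep H) T Y"
      using ex_standard_hom[OF Y(1)] unfolding hom_nonzero_def by blast
    note TOb = standard_Ob[OF T(1)]
    have fg: "f \<Zcomp>\<^bsub>Rep H\<^esub> g \<in> Arr (Rep H) T S" using C.Cmp_Arr[OF TOb Y(1) Ob T(2) f] .
    have "f \<Zcomp>\<^bsub>Rep H\<^esub> g \<noteq> Zero (Rep H) T S"
    proof
      assume "f \<Zcomp>\<^bsub>Rep H\<^esub> g = Zero (Rep H) T S"
      then have "f \<Zcomp>\<^bsub>Rep H\<^esub> g = f \<Zcomp>\<^bsub>Rep H\<^esub> Zero (Rep H) T Y" using C.Cmp_Zero_right[OF TOb Y(1) Ob f] by simp
      then show False using Y(2) T(2,3) TOb C.Zero_Arr[OF TOb Y(1)] unfolding monic_def by blast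
    qed
    then have "isomorphism (Rep H) T S (f \<Zcomp>\<^bsub>Rep H\<^esub> g)" using standard_isomorphism[OF T(1) S fg] by blast
    then obtain h where h: "h \<in> Arr (Rep H) S T" "(f \<Zcomp>\<^bsub>Rep H\<^esub> g) \<Zcomp>\<^bsub>Rep H\<^esub> h = Ide (Rep H) S"
      unfolding isomorphism_def by blast
    let ?k = "g \<Zcomp>\<^bsub>Rep H\<^esub> h"
    have k: "?k \<in> Arr (Rep H) S Y" using C.Cmp_Arr[OF Ob TOb Y(1) h(1) T(2)] .
    have fk: "f \<Zcomp>\<^bsub>Rep H\<^esub> ?k = Ide (Rep H) S" using h(2) C.Cmp_assoc[OF Ob TOb Y(1) Ob h(1) T(2) f] by simp
    have kf: "?k \<Zcomp>\<^bsub>Rep H\<^esub> f \<in> Arr (Rep H) Y Y" using C.Cmp_Arr[OF Y(1) Ob Y(1) f k] .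
    have "f \<Zcomp>\<^bsub>Rep H\<^esub> (?k \<Zcomp>\<^bsub>Rep H\<^esub> f) = (f \<Zcomp>\<^bsub>Rep H\<^esub> ?k) \<Zcomp>\<^bsub>Rep H\<^esub> f"
      using C.Cmp_assoc[OF Y(1) Ob Y(1) Ob f k f] by simp
    also have "\<dots> = f \<Zcomp>\<^bsub>Rep H\<^esub> Ide (Rep H) Y"
      using fk C.Cmp_Id_left[OF Y(1) Ob f] C.Cmp_Id_right[OF Y(1) Ob f] by simp
    finally have "?k \<Zcomp>\<^bsub>Rep H\<^esub> f = Ide (Rep H) Y"
      using Y(1,2) kf C.Id_Arr[OF Y(1)] unfolding monic_def by blast
    then show ?thesis unfolding isomorphism_def using f k fk by blast
  qed
  ultimately show ?thesis unfolding simple_object_def using Ob by blast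
qed

text \<open>The map from \<open>ex_standard_hom\<close> is monic with nonzero source, hence an
  isomorphism onto the simple object.\<close>

lemma simple_standard:
  fixes X :: "nat \<times> ('a \<times> 'a \<Rightarrow> 'k::{alg_closed_field, field_char_0} mat)"
  assumes X: "simple_object (Rep H) X" and s: "s \<in> weights X"
  shows "\<exists>S. standard_module S \<and> s \<in> weights S \<and> (\<not> fixed_weight s \<longrightarrow> S = induced s) \<and>
    isomorphic (Rep H) S X"
proof -
  interpret C: linear_category "Rep (H :: ('a \<times> 'a, 'k) hopf_algebra)" by (rule linear_category_Rep)
  have Ob: "X \<in> Ob (Rep H)" using C.simple_objectD X by blast
  obtain S f where S: "standard_module S" "s \<in> weights S" "f \<in> Arr (Rep H) S X" "f \<noteq> Zero (Rep H) S X"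
      "\<not> fixed_weight s \<longrightarrow> S = induced s"
    using ex_standard_hom[OF Ob s] unfolding hom_nonzero_def by blast
  have "monic (Rep H) S X f" using standard_monic[OF S(1) Ob S(3,4)] .
  moreover have "\<not> zero_object (Rep H) S" using standard_simple[OF S(1)] C.simple_objectD(2) by blast
  ultimately have "isomorphism (Rep H) S X f"
    using X standard_Ob[OF S(1)] unfolding simple_object_def by blast
  then show ?thesis using S C.isomorphicI[OF _ standard_Ob[OF S(1)] Ob] by blast
qed

end

section \<open>Tensor products of modules\<close>

text \<open>Distributivity for sums of matrices in the entrywise form used by the definition of
  \<open>Rep\<close>. A single factor is brought into this form by
  \<open>mat_singleton_sum\<close>.\<close>

lemma mat_sum_mult:
  fixes A B :: "'i \<Rightarrow> 'k::comm_ring_1 mat"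
  assumes A: "\<And>h. h \<in> I \<Longrightarrow> A h \<in> carrier_mat a b" and B: "\<And>k. k \<in> J \<Longrightarrow> B k \<in> carrier_mat b c"
  shows "mat a b (\<lambda>ij. \<Sum>h\<in>I. A h $$ ij) * mat b c (\<lambda>ij. \<Sum>k\<in>J. B k $$ ij)
    = mat a c (\<lambda>ij. \<Sum>h\<in>I. \<Sum>k\<in>J. (A h * B k) $$ ij)"
proof (rule eq_matI)
  fix i j assume "i < dim_row (mat a c (\<lambda>ij. \<Sum>h\<in>I. \<Sum>k\<in>J. (A h * B k) $$ ij))"
    "j < dim_col (mat a c (\<lambda>ij. \<Sum>h\<in>I. \<Sum>k\<in>J. (A h * B k) $$ ij))"
  then have ij: "i < a" "j < c" by auto
  have "(mat a b (\<lambda>ij. \<Sum>h\<in>I. A h $$ ij) * mat b c (\<lambda>ij. \<Sum>k\<in>J. B k $$ ij)) $$ (i, j)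
    = (\<Sum>l<b. (\<Sum>h\<in>I. A h $$ (i, l)) * (\<Sum>k\<in>J. B k $$ (l, j)))"
    using ij by (simp add: scalar_prod_def atLeast0LessThan)
  also have "\<dots> = (\<Sum>l<b. \<Sum>h\<in>I. \<Sum>k\<in>J. A h $$ (i, l) * B k $$ (l, j))"
    by (simp add: sum_product)
  also have "\<dots> = (\<Sum>h\<in>I. \<Sum>l<b. \<Sum>k\<in>J. A h $$ (i, l) * B k $$ (l, j))" by (rule sum.swap)
  also have "\<dots> = (\<Sum>h\<in>I. \<Sum>k\<in>J. \<Sum>l<b. A h $$ (i, l) * B k $$ (l, j))"
    by (intro sum.cong refl sum.swap)
  also have "\<dots> = (\<Sum>h\<in>I. \<Sum>k\<in>J. (A h * B k) $$ (i, j))"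
  proof (intro sum.cong refl)
    fix h k assume "h \<in> I" "k \<in> J"
    then show "(\<Sum>l<b. A h $$ (i, l) * B k $$ (l, j)) = (A h * B k) $$ (i, j)"
      using A[of h] B[of k] ij by (simp add: scalar_prod_def atLeast0LessThan)
  qed
  finally show "(mat a b (\<lambda>ij. \<Sum>h\<in>I. A h $$ ij) * mat b c (\<lambda>ij. \<Sum>k\<in>J. B k $$ ij)) $$ (i, j)
    = mat a c (\<lambda>ij. \<Sum>h\<in>I. \<Sum>k\<in>J. (A h * B k) $$ ij) $$ (i, j)" using ij by simp
qed auto

lemma mat_singleton_sum: "A \<in> carrier_mat a b \<Longrightarrow> mat a b (\<lambda>ij. \<Sum>k\<in>{k0}. A $$ ij) = (A :: 'k::comm_ring_1 mat)"
  by (intro eq_matI) auto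

lemma kronecker_zero_left:
  fixes B :: "'k::semiring_1 mat"
  assumes "B \<in> carrier_mat c d"
  shows "kronecker (0\<^sub>m a b) B = 0\<^sub>m (a * c) (b * d)"
  using assms unfolding kronecker_def by (intro eq_matI) (auto simp: less_mult_imp_div_less)

lemma kronecker_zero_right:
  fixes A :: "'k::semiring_1 mat"
  assumes A: "A \<in> carrier_mat a b"
  shows "kronecker A (0\<^sub>m c d) = 0\<^sub>m (a * c) (b * d)"
proof (rule eq_matI)
  fix i j assume ij: "i < dim_row (0\<^sub>m (a * c) (b * d) :: 'k mat)" "j < dim_col (0\<^sub>m (a * c) (b * d) :: 'k mat)"
  then have "c > 0" "d > 0" by (auto intro: gr0I)
  then show "kronecker A (0\<^sub>m c d) $$ (i, j) = 0\<^sub>m (a * c) (b * d) $$ (i, j)"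
    using A ij unfolding kronecker_def by simp
qed (use A in \<open>simp_all add: kronecker_def\<close>)

context exact_factorization
begin

text \<open>The summand of the coproduct of e_r # x whose second factor is e_h # x; the first factor
  then has index r inv(h).\<close>

definition tensor_term :: "('a \<times> 'a \<Rightarrow> 'k::field mat) \<Rightarrow> ('a \<times> 'a \<Rightarrow> 'k mat) \<Rightarrow> 'a \<Rightarrow> 'a \<Rightarrow> 'a \<Rightarrow> 'k mat"
  where "tensor_term R S r x h = kronecker (R (r \<otimes> inv h, h \<triangleright> x)) (S (h, x))"

definition tensor_rep :: "nat \<Rightarrow> ('a \<times> 'a \<Rightarrow> 'k::field mat) \<Rightarrow> ('a \<times> 'a \<Rightarrow> 'k mat) \<Rightarrow> 'a \<Rightarrow> 'a \<Rightarrow> 'k mat"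
  where "tensor_rep N R S r x = mat N N (\<lambda>ij. \<Sum>h\<in>\<Gamma>. tensor_term R S r x h $$ ij)"

lemma TenO_Rep:
  "TenO (Rep H) (m, R) (n, S) = (m * n, \<lambda>(r, x)\<in>\<Gamma> \<times> F. tensor_rep (m * n) R S r x)"
proof -
  have fin: "finite (\<Gamma> \<times> F)" using finite_F finite_\<Gamma> by simp
  have "(\<Sum>b\<in>\<Gamma> \<times> F. \<Sum>c\<in>\<Gamma> \<times> F. hcomult H (r, x) b c * kronecker (R b) (S c) $$ ij)
      = (\<Sum>h\<in>\<Gamma>. tensor_term R S r x h $$ ij)"
    if r: "r \<in> \<Gamma>" "x \<in> F" for r x ij
  proof -
    have "(\<Sum>b\<in>\<Gamma> \<times> F. \<Sum>c\<in>\<Gamma> \<times> F. hcomult H (r, x) b c * kronecker (R b) (S c) $$ ij)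
      = (\<Sum>c\<in>\<Gamma> \<times> F. \<Sum>b\<in>\<Gamma> \<times> F. hcomult H (r, x) b c * kronecker (R b) (S c) $$ ij)"
      by (rule sum.swap)
    also have "\<dots> = (\<Sum>c\<in>\<Gamma> \<times> F. \<Sum>b\<in>\<Gamma> \<times> F.
        of_bool (snd c = x \<and> b = (r \<otimes> inv (fst c), fst c \<triangleright> x)) * kronecker (R b) (S c) $$ ij)"
    proof (intro sum.cong refl)
      fix b c assume "b \<in> \<Gamma> \<times> F" "c \<in> \<Gamma> \<times> F"
      then obtain g y h w where bc: "b = (g, y)" "c = (h, w)" "g \<in> \<Gamma>" "h \<in> \<Gamma>" by blast
      have "g \<otimes> h = r \<longleftrightarrow> g = r \<otimes> inv h"
        using bc r inv_solve_right[of g r h] \<Gamma>.mem_carrier by auto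
      then show "hcomult H (r, x) b c * kronecker (R b) (S c) $$ ij =
        of_bool (snd c = x \<and> b = (r \<otimes> inv (fst c), fst c \<triangleright> x)) * kronecker (R b) (S c) $$ ij"
        unfolding bc bismash_product_def by auto
    qed
    also have "\<dots> = (\<Sum>c\<in>\<Gamma> \<times> F. if snd c = x then tensor_term R S r x (fst c) $$ ij else 0)"
      by (subst sum_of_bool_mult[OF fin]) (use r act(1) in \<open>auto intro!: sum.cong simp: tensor_term_def\<close>)
    also have "\<dots> = (\<Sum>h\<in>\<Gamma>. \<Sum>w\<in>F. if w = x then tensor_term R S r x h $$ ij else 0)"
      unfolding sum.cartesian_product by (intro sum.cong) auto
    also have "\<dots> = (\<Sum>h\<in>\<Gamma>. tensor_term R S r x h $$ ij)"
      using r finite_F by (simp add: sum.delta)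
    finally show ?thesis .
  qed
  then show ?thesis
    unfolding Rep_def by (auto simp: tensor_rep_def intro!: restrict_ext eq_matI)
qed

lemma tensor_term_carrier:
  assumes "(m, R) \<in> Ob (Rep H)" "(n, S) \<in> Ob (Rep H)" "r \<in> \<Gamma>" "x \<in> F" "h \<in> \<Gamma>"
  shows "tensor_term R S r x h \<in> carrier_mat (m * n) (m * n)"
  unfolding tensor_term_def
  using assms act(1)[OF assms(5,4)] repD(1)[OF assms(1)] repD(1)[OF assms(2)] by simp

text \<open>For fixed second factor the conditions on the first reduce to one on the product, by the
  matched pair law for (g h) \<lhd> x.\<close>

lemma tensor_term_mult:
  assumes V: "(m, R) \<in> Ob (Rep H)" "(n, S) \<in> Ob (Rep H)"
    and r: "r \<in> \<Gamma>" "x \<in> F" "r' \<in> \<Gamma>" "y \<in> F" and h: "h \<in> \<Gamma>" "k \<in> \<Gamma>"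
  shows "tensor_term R S r x h * tensor_term R S r' y k =
    (if r' = r \<triangleleft> x \<and> k = h \<triangleleft> x then tensor_term R S r (x \<otimes> y) h else 0\<^sub>m (m * n) (m * n))"
proof -
  have hx: "h \<triangleright> x \<in> F" "h \<triangleleft> x \<in> \<Gamma>" "k \<triangleright> y \<in> F" using act r h by auto
  have rh: "r \<otimes> inv h \<in> \<Gamma>" "r' \<otimes> inv k \<in> \<Gamma>" "(r \<otimes> inv h) \<triangleleft> (h \<triangleright> x) \<in> \<Gamma>" using r h hx act by auto
  note car = repD(1)[OF V(1) rh(1) hx(1)] repD(1)[OF V(1) rh(2) hx(3)] repD(1)[OF V(2) h(1) r(2)] repD(1)[OF V(2) h(2) r(4)]
  have "tensor_term R S r x h * tensor_term R S r' y k
    = kronecker (R (r \<otimes> inv h, h \<triangleright> x) * R (r' \<otimes> inv k, k \<triangleright> y)) (S (h, x) * S (k, y))"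
    unfolding tensor_term_def by (rule kronecker_mult[OF car])
  also have "\<dots> = (if r' = r \<triangleleft> x \<and> k = h \<triangleleft> x then tensor_term R S r (x \<otimes> y) h else 0\<^sub>m (m * n) (m * n))"
  proof (cases "k = h \<triangleleft> x")
    case False
    then have "S (h, x) * S (k, y) = 0\<^sub>m n n" using repD(2)[OF V(2) h(1) r(2) h(2) r(4)] by simp
    moreover have "R (r \<otimes> inv h, h \<triangleright> x) * R (r' \<otimes> inv k, k \<triangleright> y) \<in> carrier_mat m m" using car by simp
    ultimately show ?thesis using False kronecker_zero_right by simp
  next
    case True
    have "(r \<otimes> inv h) \<otimes> h = r" using r h \<Gamma>.mem_carrier by (simp add: m_assoc)
    then have "((r \<otimes> inv h) \<triangleleft> (h \<triangleright> x)) \<otimes> k = r \<triangleleft> x"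
      using act_mult_left(2)[OF rh(1) h(1) r(2)] True by simp
    then have eq: "r' \<otimes> inv k = (r \<otimes> inv h) \<triangleleft> (h \<triangleright> x) \<longleftrightarrow> r' = r \<triangleleft> x"
      using inv_solve_right'[of "(r \<otimes> inv h) \<triangleleft> (h \<triangleright> x)" r' k] rh(3) r h \<Gamma>.mem_carrier by auto
    have "(h \<triangleright> x) \<otimes> (k \<triangleright> y) = h \<triangleright> (x \<otimes> y)" using act_mult_right(1)[OF h(1) r(2,4)] True by simp
    moreover have "S (h, x) * S (k, y) = S (h, x \<otimes> y)" "S (h, x \<otimes> y) \<in> carrier_mat n n"
      using repD(2)[OF V(2) h(1) r(2) h(2) r(4)] True repD(1)[OF V(2) h(1)] r by auto
    ultimately show ?thesis
      using repD(2)[OF V(1) rh(1) hx(1) rh(2) hx(3)] eq True kronecker_zero_left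
      by (auto simp: tensor_term_def)
  qed
  finally show ?thesis .
qed

lemma TenO_Ob_Rep:
  assumes V: "V \<in> Ob (Rep H)" "W \<in> Ob (Rep H)"
  shows "V \<boxtimes>\<^bsub>Rep H\<^esub> W \<in> Ob (Rep H)"
proof -
  obtain m R n S where eq: "V = (m, R)" "W = (n, S)" by (cases V; cases W)
  note V = V[unfolded eq]
  let ?N = "m * n"
  have "tensor_rep ?N R S r x * tensor_rep ?N R S r' y
      = (if r' = r \<triangleleft> x then tensor_rep ?N R S r (x \<otimes> y) else 0\<^sub>m ?N ?N)"
    if r: "r \<in> \<Gamma>" "x \<in> F" "r' \<in> \<Gamma>" "y \<in> F" for r x r' y
  proof -
    have "tensor_rep ?N R S r x * tensor_rep ?N R S r' y
      = mat ?N ?N (\<lambda>ij. \<Sum>h\<in>\<Gamma>. \<Sum>k\<in>\<Gamma>. (tensor_term R S r x h * tensor_term R S r' y k) $$ ij)"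
      unfolding tensor_rep_def using tensor_term_carrier[OF V] r by (intro mat_sum_mult) auto
    also have "\<dots> = mat ?N ?N (\<lambda>ij. \<Sum>h\<in>\<Gamma>. if r' = r \<triangleleft> x then tensor_term R S r (x \<otimes> y) h $$ ij else 0)"
    proof (rule eq_matI, simp_all, intro sum.cong refl)
      fix i j h assume ij: "i < ?N" "j < ?N" and h: "h \<in> \<Gamma>"
      have "(\<Sum>k\<in>\<Gamma>. (tensor_term R S r x h * tensor_term R S r' y k) $$ (i, j))
        = (\<Sum>k\<in>\<Gamma>. of_bool (r' = r \<triangleleft> x \<and> k = h \<triangleleft> x) * tensor_term R S r (x \<otimes> y) h $$ (i, j))"
        using ij by (intro sum.cong refl) (simp add: tensor_term_mult[OF V r h])
      also have "\<dots> = (if r' = r \<triangleleft> x then tensor_term R S r (x \<otimes> y) h $$ (i, j) else 0)"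
        using act(2)[OF h r(2)] by (simp add: sum_of_bool_mult[OF finite_\<Gamma>, of _ _ "\<lambda>_. tensor_term R S r (x \<otimes> y) h $$ (i, j)"])
      finally show "(\<Sum>k\<in>\<Gamma>. (tensor_term R S r x h * tensor_term R S r' y k) $$ (i, j))
        = (if r' = r \<triangleleft> x then tensor_term R S r (x \<otimes> y) h $$ (i, j) else 0)" .
    qed
    finally show ?thesis by (auto simp: tensor_rep_def intro!: eq_matI)
  qed
  moreover have "(\<Sum>r\<in>\<Gamma>. tensor_rep ?N R S r \<one> $$ (i, j)) = of_bool (i = j)" if ij: "i < ?N" "j < ?N" for i j
  proof -
    have n: "n > 0" using ij by (auto intro: gr0I)
    have idx: "i div n < m" "j div n < m" "i mod n < n" "j mod n < n"
      using ij n by (auto simp: less_mult_imp_div_less)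
    have "(\<Sum>r\<in>\<Gamma>. tensor_rep ?N R S r \<one> $$ (i, j)) = (\<Sum>r\<in>\<Gamma>. \<Sum>h\<in>\<Gamma>. tensor_term R S r \<one> h $$ (i, j))"
      using ij by (simp add: tensor_rep_def)
    also have "\<dots> = (\<Sum>h\<in>\<Gamma>. \<Sum>r\<in>\<Gamma>. tensor_term R S r \<one> h $$ (i, j))" by (rule sum.swap)
    also have "\<dots> = (\<Sum>h\<in>\<Gamma>. \<Sum>g\<in>\<Gamma>. R (g, \<one>) $$ (i div n, j div n) * S (h, \<one>) $$ (i mod n, j mod n))"
    proof (rule sum.cong[OF refl])
      fix h assume h: "h \<in> \<Gamma>"
      show "(\<Sum>r\<in>\<Gamma>. tensor_term R S r \<one> h $$ (i, j))
        = (\<Sum>g\<in>\<Gamma>. R (g, \<one>) $$ (i div n, j div n) * S (h, \<one>) $$ (i mod n, j mod n))"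
      \<comment> \<open>Substituting r = g h turns the double sum into the product of the two unit
        conditions.\<close>
      proof (rule sum.reindex_bij_witness[of _ "\<lambda>g. g \<otimes> h" "\<lambda>r. r \<otimes> inv h"])
        fix r assume r: "r \<in> \<Gamma>"
        have c: "r \<in> carrier M" "h \<in> carrier M" using r h \<Gamma>.mem_carrier by auto
        show "r \<otimes> inv h \<otimes> h = r" "r \<otimes> h \<otimes> inv h = r" using c by (simp_all add: m_assoc)
        show "r \<otimes> inv h \<in> \<Gamma>" "r \<otimes> h \<in> \<Gamma>" using r h by auto
        then show "R (r \<otimes> inv h, \<one>) $$ (i div n, j div n) * S (h, \<one>) $$ (i mod n, j mod n) = tensor_term R S r \<one> h $$ (i, j)"
          using kronecker_index[OF repD(1)[OF V(1) _ F.one_closed] repD(1)[OF V(2) h F.one_closed] ij] h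
          by (simp add: tensor_term_def act_one)
      qed
    qed
    also have "\<dots> = (\<Sum>g\<in>\<Gamma>. R (g, \<one>) $$ (i div n, j div n)) * (\<Sum>h\<in>\<Gamma>. S (h, \<one>) $$ (i mod n, j mod n))"
      unfolding sum_product by (rule sum.swap)
    also have "\<dots> = of_bool (i = j)"
    proof -
      have "i = j \<longleftrightarrow> i div n = j div n \<and> i mod n = j mod n" by (metis div_mult_mod_eq)
      then show ?thesis using repD(3)[OF V(1) idx(1,2)] repD(3)[OF V(2) idx(3,4)] by simp
    qed
    finally show ?thesis .
  qed
  ultimately show ?thesis
    unfolding eq TenO_Rep Ob_RepH by (auto simp: PiE_iff tensor_rep_def)
qed

text \<open>The action of e_(st) # 1 on the tensor product is a sum of orthogonal idempotents, one
  of which is the nonzero product of the projections to the weights \<open>s\<close> and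
  \<open>t\<close>. Multiplying by this one isolates it.\<close>

lemma weights_TenO:
  assumes V: "V \<in> Ob (Rep H)" "W \<in> Ob (Rep H)" and st: "s \<in> weights V" "t \<in> weights W"
  shows "s \<otimes> t \<in> weights (V \<boxtimes>\<^bsub>Rep H\<^esub> W)"
proof (rule ccontr)
  assume neg: "s \<otimes> t \<notin> weights (V \<boxtimes>\<^bsub>Rep H\<^esub> W)"
  obtain m R n S where eq: "V = (m, R)" "W = (n, S)" by (cases V; cases W)
  note V = V[unfolded eq]
  let ?N = "m * n"
  have st: "s \<in> \<Gamma>" "R (s, \<one>) \<noteq> 0\<^sub>m m m" "t \<in> \<Gamma>" "S (t, \<one>) \<noteq> 0\<^sub>m n n"
    using st unfolding eq weights_def by auto
  have stG: "s \<otimes> t \<in> \<Gamma>" using st by simp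
  have z: "tensor_rep ?N R S (s \<otimes> t) \<one> = 0\<^sub>m ?N ?N"
    using neg stG unfolding eq TenO_Rep weights_def by simp
  let ?P = "tensor_term R S (s \<otimes> t) \<one> t"
  have P: "?P \<in> carrier_mat ?N ?N" using tensor_term_carrier[OF V stG F.one_closed st(3)] .
  have "s \<otimes> t \<otimes> inv t = s" using st \<Gamma>.mem_carrier by (simp add: m_assoc)
  then have "?P \<noteq> 0\<^sub>m ?N ?N"
    unfolding tensor_term_def act_one(1)[OF st(3)]
    using kronecker_eq_zero[OF repD(1)[OF V(1) st(1) F.one_closed] st(2) repD(1)[OF V(2) st(3) F.one_closed] st(4)] by simp
  moreover have "tensor_rep ?N R S (s \<otimes> t) \<one> * ?P = ?P"
  proof -
    have "tensor_rep ?N R S (s \<otimes> t) \<one> * mat ?N ?N (\<lambda>ij. \<Sum>k\<in>{t}. ?P $$ ij)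
      = mat ?N ?N (\<lambda>ij. \<Sum>h\<in>\<Gamma>. \<Sum>k\<in>{t}. (tensor_term R S (s \<otimes> t) \<one> h * ?P) $$ ij)"
      unfolding tensor_rep_def
      using tensor_term_carrier[OF V stG F.one_closed] P by (intro mat_sum_mult) auto
    also have "\<dots> = mat ?N ?N (\<lambda>ij. \<Sum>h\<in>\<Gamma>. of_bool (True \<and> h = t) * ?P $$ ij)"
    proof (rule eq_matI, simp_all, intro sum.cong refl)
      fix i j h assume ij: "i < ?N" "j < ?N" and h: "h \<in> \<Gamma>"
      show "(tensor_term R S (s \<otimes> t) \<one> h * ?P) $$ (i, j) = of_bool (h = t) * ?P $$ (i, j)"
        using ij tensor_term_mult[OF V stG F.one_closed stG F.one_closed h st(3)] act_one(2)[OF stG] act_one(2)[OF h]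
        by auto
    qed
    also have "\<dots> = ?P"
      unfolding sum_of_bool_mult[OF finite_\<Gamma>, of True t] using P st(3) by (intro eq_matI) auto
    finally show ?thesis unfolding mat_singleton_sum[OF P] .
  qed
  ultimately show False using z P by simp
qed

lemma kronecker_Arr:
  assumes V: "V \<in> Ob (Rep H)" "W \<in> Ob (Rep H)" "V' \<in> Ob (Rep H)" "W' \<in> Ob (Rep H)"
    and f: "f \<in> Arr (Rep H) V V'" and g: "g \<in> Arr (Rep H) W W'"
  shows "kronecker f g \<in> Arr (Rep H) (V \<boxtimes>\<^bsub>Rep H\<^esub> W) (V' \<boxtimes>\<^bsub>Rep H\<^esub> W')"
proof -
  obtain m R n S where eq: "V = (m, R)" "W = (n, S)" by (cases V; cases W)
  obtain m' R' n' S' where eq': "V' = (m', R')" "W' = (n', S')" by (cases V'; cases W')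
  note V = V[unfolded eq eq'] and f = f[unfolded eq eq'] and g = g[unfolded eq eq']
  have fm: "f \<in> carrier_mat m' m" "g \<in> carrier_mat n' n" using f g unfolding Rep_Arr by auto
  let ?k = "kronecker f g"
  have k: "?k \<in> carrier_mat (m' * n') (m * n)" using fm by simp
  have "?k * tensor_rep (m * n) R S r x = tensor_rep (m' * n') R' S' r x * ?k"
    if r: "r \<in> \<Gamma>" "x \<in> F" for r x
  proof -
    have term_eq: "?k * tensor_term R S r x h = tensor_term R' S' r x h * ?k" if h: "h \<in> \<Gamma>" for h
    proof -
      have hx: "h \<triangleright> x \<in> F" "r \<otimes> inv h \<in> \<Gamma>" using act r h by auto
      have "?k * tensor_term R S r x h = kronecker (f * R (r \<otimes> inv h, h \<triangleright> x)) (g * S (h, x))"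
        unfolding tensor_term_def
        by (rule kronecker_mult[OF fm(1) repD(1)[OF V(1) hx(2,1)] fm(2) repD(1)[OF V(2) h r(2)]])
      also have "\<dots> = kronecker (R' (r \<otimes> inv h, h \<triangleright> x) * f) (S' (h, x) * g)"
        using f g hx h r unfolding Rep_Arr by simp
      also have "\<dots> = tensor_term R' S' r x h * ?k"
        unfolding tensor_term_def
        by (rule kronecker_mult[symmetric, OF repD(1)[OF V(3) hx(2,1)] fm(1) repD(1)[OF V(4) h r(2)] fm(2)])
      finally show ?thesis .
    qed
    have "?k * tensor_rep (m * n) R S r x
      = mat (m' * n') (m * n) (\<lambda>ij. \<Sum>k\<in>{r}. ?k $$ ij) * tensor_rep (m * n) R S r x"
      unfolding mat_singleton_sum[OF k] ..
    also have "\<dots> = mat (m' * n') (m * n) (\<lambda>ij. \<Sum>k\<in>{r}. \<Sum>h\<in>\<Gamma>. (?k * tensor_term R S r x h) $$ ij)"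
      unfolding tensor_rep_def using tensor_term_carrier[OF V(1,2) r] k by (intro mat_sum_mult) auto
    also have "\<dots> = mat (m' * n') (m * n) (\<lambda>ij. \<Sum>h\<in>\<Gamma>. \<Sum>k\<in>{r}. (tensor_term R' S' r x h * ?k) $$ ij)"
      using term_eq by simp
    also have "\<dots> = tensor_rep (m' * n') R' S' r x * mat (m' * n') (m * n) (\<lambda>ij. \<Sum>k\<in>{r}. ?k $$ ij)"
      unfolding tensor_rep_def using tensor_term_carrier[OF V(3,4) r] k by (intro mat_sum_mult[symmetric]) auto
    also have "\<dots> = tensor_rep (m' * n') R' S' r x * ?k" unfolding mat_singleton_sum[OF k] ..
    finally show ?thesis .
  qed
  then show ?thesis unfolding eq eq' TenO_Rep Rep_Arr using k by simp
qed

lemma isomorphic_TenO_Rep: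
  assumes "isomorphic (Rep H) V V'" "isomorphic (Rep H) W W'"
  shows "isomorphic (Rep H) (V \<boxtimes>\<^bsub>Rep H\<^esub> W) (V' \<boxtimes>\<^bsub>Rep H\<^esub> W')"
proof -
  have Ob: "V \<in> Ob (Rep H)" "W \<in> Ob (Rep H)" "V' \<in> Ob (Rep H)" "W' \<in> Ob (Rep H)"
    using assms unfolding isomorphic_def by auto
  obtain f f' where f: "f \<in> Arr (Rep H) V V'" "f' \<in> Arr (Rep H) V' V" "f' * f = Ide (Rep H) V" "f * f' = Ide (Rep H) V'"
    using assms(1) unfolding isomorphic_def isomorphism_def Rep_Cmp by blast
  obtain g g' where g: "g \<in> Arr (Rep H) W W'" "g' \<in> Arr (Rep H) W' W" "g' * g = Ide (Rep H) W" "g * g' = Ide (Rep H) W'"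
    using assms(2) unfolding isomorphic_def isomorphism_def Rep_Cmp by blast
  obtain m R n S where eq: "V = (m, R)" "W = (n, S)" by (cases V; cases W)
  obtain m' R' n' S' where eq': "V' = (m', R')" "W' = (n', S')" by (cases V'; cases W')
  have car: "f \<in> carrier_mat m' m" "f' \<in> carrier_mat m m'" "g \<in> carrier_mat n' n" "g' \<in> carrier_mat n n'"
    using f(1,2) g(1,2) unfolding eq eq' Rep_Arr by auto
  have "kronecker f' g' * kronecker f g = Ide (Rep H) (V \<boxtimes>\<^bsub>Rep H\<^esub> W)"
    "kronecker f g * kronecker f' g' = Ide (Rep H) (V' \<boxtimes>\<^bsub>Rep H\<^esub> W')"
    using kronecker_mult[OF car(2,1,4,3)] kronecker_mult[OF car(1,2,3,4)] f(3,4) g(3,4)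
    unfolding eq eq' TenO_Rep Rep_Ide by (simp_all add: kronecker_one)
  then show ?thesis
    unfolding isomorphic_def isomorphism_def Rep_Cmp
    using kronecker_Arr[OF Ob f(1) g(1)] kronecker_Arr[OF Ob(3,4,1,2) f(2) g(2)] TenO_Ob_Rep Ob by blast
qed

text \<open>The coproduct has h \<rhd> x in its first factor, so the left character is twisted by
  the right weight. This asymmetry is the source of noncentrality.\<close>

lemma TenO_one_dim:
  assumes s: "s \<in> \<Gamma>" and t: "t \<in> \<Gamma>"
  shows "one_dim s (\<chi> :: 'a \<Rightarrow> 'k::field) \<boxtimes>\<^bsub>Rep H\<^esub> one_dim t \<psi> = one_dim (s \<otimes> t) (\<lambda>x. \<chi> (t \<triangleright> x) * \<psi> x)"
proof -
  let ?R = "\<lambda>(u, x)\<in>\<Gamma> \<times> F. mat 1 1 (\<lambda>_. of_bool (u = s) * \<chi> x)"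
  let ?S = "\<lambda>(u, x)\<in>\<Gamma> \<times> F. mat 1 1 (\<lambda>_. of_bool (u = t) * \<psi> x)"
  have "tensor_rep 1 ?R ?S r x = mat 1 1 (\<lambda>_. of_bool (r = s \<otimes> t) * (\<chi> (t \<triangleright> x) * \<psi> x))"
    if r: "r \<in> \<Gamma>" "x \<in> F" for r x
  proof -
    have "(\<Sum>h\<in>\<Gamma>. tensor_term ?R ?S r x h $$ (0, 0))
      = (\<Sum>h\<in>\<Gamma>. of_bool (True \<and> h = t) * (of_bool (r \<otimes> inv h = s) * \<chi> (h \<triangleright> x) * \<psi> x))"
      using r act(1) by (intro sum.cong refl) (simp add: tensor_term_def kronecker_def)
    also have "\<dots> = of_bool (r \<otimes> inv t = s) * \<chi> (t \<triangleright> x) * \<psi> x"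
      unfolding sum_of_bool_mult[OF finite_\<Gamma>] using t by simp
    also have "r \<otimes> inv t = s \<longleftrightarrow> r = s \<otimes> t"
      using inv_solve_right'[of s r t] r s t \<Gamma>.mem_carrier by auto
    finally have *: "(\<Sum>h\<in>\<Gamma>. tensor_term ?R ?S r x h $$ (0, 0)) = of_bool (r = s \<otimes> t) * \<chi> (t \<triangleright> x) * \<psi> x" .
    have m: "mat 1 1 f $$ (0, 0) = f (0, 0)" for f :: "nat \<times> nat \<Rightarrow> 'k" by simp
    show ?thesis
      unfolding tensor_rep_def
    proof (rule eq_matI)
      fix i j assume "i < dim_row (mat 1 1 (\<lambda>_. of_bool (r = s \<otimes> t) * (\<chi> (t \<triangleright> x) * \<psi> x)))"
        "j < dim_col (mat 1 1 (\<lambda>_. of_bool (r = s \<otimes> t) * (\<chi> (t \<triangleright> x) * \<psi> x)))"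
      then have ij: "i = 0" "j = 0" by auto
      show "mat 1 1 (\<lambda>ij. \<Sum>h\<in>\<Gamma>. tensor_term ?R ?S r x h $$ ij) $$ (i, j)
        = mat 1 1 (\<lambda>_. of_bool (r = s \<otimes> t) * (\<chi> (t \<triangleright> x) * \<psi> x)) $$ (i, j)"
        unfolding ij m * by (simp only: mult.assoc)
    qed auto
  qed
  then show ?thesis unfolding one_dim_def TenO_Rep by (auto intro!: restrict_ext)
qed

lemma Unit_Rep: "Unit (Rep H) = one_dim \<one> (\<lambda>_. 1)"
  unfolding one_dim_def Rep_def bismash_product_def by (auto intro!: restrict_ext eq_matI)

lemma hom_nonzero_one_dim:
  assumes s: "s \<in> \<Gamma>" "character \<chi>" and hom: "hom_nonzero (Rep H) (one_dim s \<chi>) (one_dim t \<psi>)"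
  shows "s = t \<and> (\<forall>x\<in>F. \<chi> x = \<psi> x)"
proof -
  let ?R = "\<lambda>s \<chi>. \<lambda>(u, x)\<in>\<Gamma> \<times> F. mat 1 1 (\<lambda>_. of_bool (u = s) * \<chi> x)"
  obtain f where f: "f \<in> carrier_mat 1 1" "\<And>u x. \<lbrakk>u \<in> \<Gamma>; x \<in> F\<rbrakk> \<Longrightarrow> f * ?R s \<chi> (u, x) = ?R t \<psi> (u, x) * f"
    "f \<noteq> 0\<^sub>m 1 1"
    using hom unfolding hom_nonzero_def one_dim_def by (auto simp: Rep_Arr Rep_Zero)
  have f0: "f $$ (0, 0) \<noteq> 0" using f(1,3) by (auto simp: mat_eq_iff)
  have "f $$ (0, 0) * (of_bool (u = s) * \<chi> x) = of_bool (u = t) * \<psi> x * f $$ (0, 0)"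
    if u: "u \<in> \<Gamma>" "x \<in> F" for u x
  proof -
    have "(f * ?R s \<chi> (u, x)) $$ (0, 0) = (?R t \<psi> (u, x) * f) $$ (0, 0)" using f(2)[OF u] by simp
    then show ?thesis using f(1) u by (simp add: scalar_prod_def)
  qed
  then have *: "of_bool (u = s) * \<chi> x = of_bool (u = t) * \<psi> x" if "u \<in> \<Gamma>" "x \<in> F" for u x
    using f0 that by (metis mult.commute mult_left_cancel)
  have st: "s = t" using *[OF s(1) F.one_closed] s(2) unfolding character_def by (cases "s = t") auto
  then show ?thesis using *[OF s(1)] by simp
qed

end

section \<open>Supports of modules\<close>

lemma (in group) double_coset_eq:
  assumes F: "subgroup F G" and m: "m \<in> carrier G" and m': "m' \<in> double_coset G F m"
  shows "double_coset G F m' = double_coset G F m"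
proof -
  interpret F: subgroup F G by (rule F)
  have sub: "double_coset G F a \<subseteq> double_coset G F b" if b: "b \<in> carrier G" and a: "a \<in> double_coset G F b" for a b
  proof
    fix c assume "c \<in> double_coset G F a"
    then obtain x y u v where c: "c = x \<otimes> (u \<otimes> b \<otimes> v) \<otimes> y" "x \<in> F" "y \<in> F" "u \<in> F" "v \<in> F"
      using a unfolding double_coset_def by blast
    have "c = (x \<otimes> u) \<otimes> b \<otimes> (v \<otimes> y)" using c b F.mem_carrier by (simp add: m_assoc)
    then show "c \<in> double_coset G F b" unfolding double_coset_def using c by blast
  qed
  obtain u v where uv: "m' = u \<otimes> m \<otimes> v" "u \<in> F" "v \<in> F" using m' unfolding double_coset_def by blast
  have c: "u \<in> carrier G" "v \<in> carrier G" using uv F.mem_carrier by auto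
  have "inv u \<otimes> m' \<otimes> inv v = m" using uv(1) m c by (simp add: m_assoc) (simp flip: m_assoc)
  then have "m \<in> double_coset G F m'" unfolding double_coset_def using uv by force
  moreover have "m' \<in> carrier G" using uv m c by simp
  ultimately show ?thesis using sub m m' by blast
qed

lemma (in group) normalizes_double_coset:
  assumes F: "subgroup F G" and m: "m \<in> carrier G" "normalizes G F m" and m': "m' \<in> double_coset G F m"
  shows "normalizes G F m'"
  unfolding normalizes_def
proof
  interpret F: subgroup F G by (rule F)
  obtain u v where uv: "m' = u \<otimes> m \<otimes> v" "u \<in> F" "v \<in> F" using m' unfolding double_coset_def by blast
  fix x assume x: "x \<in> F"
  note c = F.mem_carrier[OF x] F.mem_carrier[OF uv(2)] F.mem_carrier[OF uv(3)] m(1)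
  \<comment> \<open>Conjugation by \<open>v\<close> stays inside \<open>F\<close> and brings x next
    to \<open>m\<close>.\<close>
  have "v \<otimes> x \<otimes> inv v \<in> F" using x uv by simp
  then obtain y where y: "y \<in> F" "m \<otimes> (v \<otimes> x \<otimes> inv v) = y \<otimes> m" using m(2) unfolding normalizes_def by blast
  have "m' \<otimes> x = u \<otimes> (m \<otimes> (v \<otimes> x \<otimes> inv v)) \<otimes> v" using uv(1) c by (simp add: m_assoc)
  also have "\<dots> = (u \<otimes> y \<otimes> inv u) \<otimes> m'" using y(2) uv(1) c F.mem_carrier[OF y(1)] by (simp add: m_assoc) (simp flip: m_assoc)
  finally show "\<exists>z\<in>F. m' \<otimes> x = z \<otimes> m'" using y(1) uv(2) by blast
qed

text \<open>It replaces a group on a subgroup's carrier by the full symmetric group, which has the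
  same multiplication.\<close>

lemma coset_support_mult_cong:
  assumes "mult G = mult G'"
  shows "coset_support G F A M E s \<longleftrightarrow> coset_support G' F A M E s"
  unfolding coset_support_def double_coset_def normalizes_def assms ..

lemma (in fusion_category) fusion_rule_eq_0_iff:
  assumes "X \<in> Ob C" "Y \<in> Ob C" "Z \<in> Ob C"
  shows "fusion_rule C (iso_class C X) (iso_class C Y) (iso_class C Z) = 0 \<longleftrightarrow> \<not> hom_nonzero C Z (X \<boxtimes> Y)"
proof -
  note r = representative_iso_class[OF assms(1)] representative_iso_class[OF assms(2)] representative_iso_class[OF assms(3)]
  note Ob = isomorphic_Ob(2)[OF r(3)] TenO_Ob[OF isomorphic_Ob(2)[OF r(1)] isomorphic_Ob(2)[OF r(2)]]
  show ?thesis
    unfolding fusion_rule_def dim_Hom_eq_0_iff[OF Ob finite_dim_Hom[OF Ob]]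
    using hom_nonzero_TenO[OF r] by simp
qed

section \<open>Supports and Grothendieck equivalence\<close>

context exact_factorization
begin

lemma fusion_rule_Rep_eq_0_iff:
  assumes "X \<in> Ob (Rep H)" "Y \<in> Ob (Rep H)" "Z \<in> Ob (Rep H)"
  shows "fusion_rule (Rep H) (iso_class (Rep H) X) (iso_class (Rep H) Y) (iso_class (Rep H) Z) = 0 \<longleftrightarrow>
    \<not> hom_nonzero (Rep H) Z (X \<boxtimes>\<^bsub>Rep H\<^esub> Y)"
proof -
  interpret C: linear_category "Rep (H :: ('a \<times> 'a, 'b) hopf_algebra)" by (rule linear_category_Rep)
  note r = C.representative_iso_class[OF assms(1)] C.representative_iso_class[OF assms(2)]
    C.representative_iso_class[OF assms(3)]
  note Ob = C.isomorphic_Ob(2)[OF r(3)] TenO_Ob_Rep[OF C.isomorphic_Ob(2)[OF r(1)] C.isomorphic_Ob(2)[OF r(2)]]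
  show ?thesis
    unfolding fusion_rule_def C.dim_Hom_eq_0_iff[OF Ob Rep_Hom_fin_dim[OF Ob]]
    using C.hom_nonzero_isomorphic[OF r(3) isomorphic_TenO_Rep[OF r(1,2)]] by simp
qed

text \<open>Objects are related when \<open>f\<close> carries the class of one to the class of the
  other. Equal fusion rules vanish together, which is all that the transfer requires.\<close>

lemma has_coset_support_grothendieck:
  fixes C :: "('o, 'm, 'k::field) mon_cat"
  assumes C: "fusion_category C" and eq: "grothendieck_equivalent C (Rep H)"
    and supp: "coset_support G F' A N (Rep (H :: ('a \<times> 'a, 'k) hopf_algebra)) s"
  shows "\<exists>t. coset_support G F' A N C t"
proof -
  let ?H = "H :: ('a \<times> 'a, 'k) hopf_algebra"
  interpret R: linear_category "Rep ?H" by (rule linear_category_Rep)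
  interpret C: fusion_category C by (rule C)
  obtain f where f: "bij_betw f (Irr C) (Irr (Rep ?H))" "f (iso_class C (Unit C)) = iso_class (Rep ?H) (Unit (Rep ?H))"
    "\<forall>X\<in>Irr C. \<forall>Y\<in>Irr C. \<forall>Z\<in>Irr C. fusion_rule (Rep ?H) (f X) (f Y) (f Z) = fusion_rule C X Y Z"
    using eq unfolding grothendieck_equivalent_def by blast
  define rel where "rel X Y \<longleftrightarrow> simple_object (Rep ?H) X \<and> simple_object C Y \<and>
    iso_class (Rep ?H) X = f (iso_class C Y)" for X Y
  have image: "f ` Irr C = Irr (Rep ?H)" and inj: "inj_on f (Irr C)" using f(1) unfolding bij_betw_def by auto
  have "coset_support G F' A N C (\<lambda>Y. s (SOME X. rel X Y))"
  proof (rule coset_support_transfer[OF supp C.linear_category_axioms])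
    fix X assume X: "simple_object (Rep ?H) X"
    then have "iso_class (Rep ?H) X \<in> Irr (Rep ?H)" unfolding Irr_def by blast
    then have "iso_class (Rep ?H) X \<in> f ` Irr C" unfolding image .
    then show "\<exists>Y. rel X Y" unfolding rel_def Irr_def using X by blast
  next
    fix Y assume Y: "simple_object C Y"
    then have "iso_class C Y \<in> Irr C" unfolding Irr_def by blast
    then have "f (iso_class C Y) \<in> Irr (Rep ?H)" using image by blast
    then show "\<exists>X. rel X Y" unfolding rel_def Irr_def using Y by (auto; metis)
  next
    fix X Y assume "rel X Y"
    then show "simple_object (Rep ?H) X \<and> simple_object C Y" unfolding rel_def by blast
  next
    fix X X' Y Y' assume r: "rel X Y" "rel X' Y'"
    have Irr: "iso_class C Y \<in> Irr C" "iso_class C Y' \<in> Irr C" using r unfolding rel_def Irr_def by auto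
    have "isomorphic (Rep ?H) X X' \<longleftrightarrow> iso_class (Rep ?H) X = iso_class (Rep ?H) X'"
      using R.iso_class_eq_iff R.simple_objectD(1) r unfolding rel_def by metis
    also have "\<dots> \<longleftrightarrow> iso_class C Y = iso_class C Y'"
      using r inj_on_eq_iff[OF inj Irr] unfolding rel_def by simp
    also have "\<dots> \<longleftrightarrow> isomorphic C Y Y'"
      using C.iso_class_eq_iff C.simple_objectD(1) r unfolding rel_def by metis
    finally show "isomorphic (Rep ?H) X X' \<longleftrightarrow> isomorphic C Y Y'" .
  next
    show "rel (Unit (Rep ?H)) (Unit C)"
      unfolding rel_def using f(2) C.simple_Unit coset_support.supp_simple_Unit[OF supp] by simp
  next
    fix X X' Y Y' Z Z' assume r: "rel X X'" "rel Y Y'" "rel Z Z'"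
    have Irr: "iso_class C X' \<in> Irr C" "iso_class C Y' \<in> Irr C" "iso_class C Z' \<in> Irr C"
      using r unfolding rel_def Irr_def by auto
    have Ob: "X \<in> Ob (Rep ?H)" "Y \<in> Ob (Rep ?H)" "Z \<in> Ob (Rep ?H)" "X' \<in> Ob C" "Y' \<in> Ob C" "Z' \<in> Ob C"
      using r R.simple_objectD(1) C.simple_objectD(1) unfolding rel_def by auto
    have "fusion_rule (Rep ?H) (iso_class (Rep ?H) X) (iso_class (Rep ?H) Y) (iso_class (Rep ?H) Z)
      = fusion_rule C (iso_class C X') (iso_class C Y') (iso_class C Z')"
      using f(3) Irr r unfolding rel_def by simp
    then show "hom_nonzero (Rep ?H) Z (X \<boxtimes>\<^bsub>Rep ?H\<^esub> Y) \<longleftrightarrow> hom_nonzero C Z' (X' \<boxtimes>\<^bsub>C\<^esub> Y')"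
      using fusion_rule_Rep_eq_0_iff[OF Ob(1-3)] C.fusion_rule_eq_0_iff[OF Ob(4-6)] by simp
  qed
  then show ?thesis by blast
qed

text \<open>If s x = y s with y in \<open>F\<close>, uniqueness of the factorization gives s \<lhd>
  x = s.\<close>

lemma fixed_weight_iff_normalizes: "s \<in> \<Gamma> \<Longrightarrow> fixed_weight s \<longleftrightarrow> normalizes M F s"
  unfolding fixed_weight_def normalizes_def using act act_eqI(2) by metis

lemma double_coset_meets_\<Gamma>:
  assumes "m \<in> carrier M"
  shows "\<exists>s\<in>\<Gamma>. m \<in> double_coset M F s"
proof -
  obtain x s where xs: "x \<in> F" "s \<in> \<Gamma>" "m = x \<otimes> s" using factor[OF assms] by blast
  then have "m = x \<otimes> s \<otimes> \<one>" using F.mem_carrier \<Gamma>.mem_carrier by simp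
  then have "m \<in> double_coset M F s" unfolding double_coset_def using xs(1) F.one_closed by blast
  then show ?thesis using xs(2) by blast
qed

lemma right_act_double_coset:
  assumes "s \<in> \<Gamma>" "x \<in> F"
  shows "s \<triangleleft> x \<in> double_coset M F s"
proof -
  have "s \<triangleleft> x = inv (s \<triangleright> x) \<otimes> s \<otimes> x"
    using act[OF assms] assms F.mem_carrier \<Gamma>.mem_carrier by (simp add: m_assoc) (simp flip: m_assoc)
  then show ?thesis unfolding double_coset_def using act[OF assms] assms by blast
qed

text \<open>With \<open>right_act_double_coset\<close>: a double coset of \<open>F\<close> meets
  \<Gamma> in exactly one orbit, so orbits of weights and double cosets correspond.\<close>

lemma double_coset_\<Gamma>:
  assumes s: "s \<in> \<Gamma>" and t: "t \<in> \<Gamma>" "t \<in> double_coset M F s"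
  shows "\<exists>y\<in>F. t = s \<triangleleft> y"
proof -
  obtain x y where xy: "t = x \<otimes> s \<otimes> y" "x \<in> F" "y \<in> F" using t unfolding double_coset_def by blast
  note a = act[OF s xy(3)]
  have "\<one> \<otimes> t = (x \<otimes> (s \<triangleright> y)) \<otimes> (s \<triangleleft> y)"
    using a xy s t F.mem_carrier \<Gamma>.mem_carrier by (simp add: m_assoc)
  then have "t = s \<triangleleft> y" using factor_unique(2)[of \<one> "x \<otimes> (s \<triangleright> y)" t "s \<triangleleft> y"] a xy t by simp
  then show ?thesis using xy by blast
qed

text \<open>Taking the union avoids choosing a weight; for a simple module all the double cosets in
  it coincide.\<close>

definition coset_supp :: "nat \<times> ('a \<times> 'a \<Rightarrow> 'k::field mat) \<Rightarrow> 'a set"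
  where "coset_supp V = (\<Union>s\<in>weights V. double_coset M F s)"

lemma character_nonzero: "character \<chi> \<Longrightarrow> x \<in> F \<Longrightarrow> \<chi> x \<noteq> 0"
  unfolding character_def using F.m_inv_closed[of x] F.mem_carrier[of x] by (metis mult_zero_left r_inv zero_neq_one)

lemma character_tensor:
  assumes t: "t \<in> \<Gamma>" "fixed_weight t" and \<chi>: "character \<chi>" "character \<psi>"
  shows "character (\<lambda>x. \<chi> (t \<triangleright> x) * \<psi> x)"
  using assms act_mult_right(1)[OF t(1)] act(1)[OF t(1)] act_one(1)[OF t(1)]
  unfolding character_def fixed_weight_def by simp

lemma fixed_weight_mult:
  assumes "s \<in> \<Gamma>" "fixed_weight s" "t \<in> \<Gamma>" "fixed_weight t"
  shows "fixed_weight (s \<otimes> t)"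
  using assms act_mult_left(2)[OF assms(1,3)] act(1)[OF assms(3)] unfolding fixed_weight_def by simp

end

context prime_factorization
begin

lemma weights_simple:
  fixes X :: "nat \<times> ('a \<times> 'a \<Rightarrow> 'k::{alg_closed_field, field_char_0} mat)"
  assumes X: "simple_object (Rep H) X" and s: "s \<in> weights X"
  shows "weights X = {s \<triangleleft> x | x. x \<in> F}"
proof -
  interpret C: linear_category "Rep (H :: ('a \<times> 'a, 'k) hopf_algebra)" by (rule linear_category_Rep)
  obtain S where S: "standard_module S" "s \<in> weights S" "\<not> fixed_weight s \<longrightarrow> S = induced s" "isomorphic (Rep H) S X"
    using simple_standard[OF X s] by blast
  have s\<Gamma>: "s \<in> \<Gamma>" using s unfolding weights_def by (cases X) auto
  have "weights X = weights S"
    using weights_isomorphic[OF S(4)] weights_isomorphic[OF C.isomorphic_sym[OF S(4)]] by blast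
  also have "\<dots> = {s \<triangleleft> x | x. x \<in> F}"
  proof (cases "fixed_weight s")
    case False
    then show ?thesis using S(3) weights_induced[OF s\<Gamma>] by blast
  next
    case True
    from S(1) show ?thesis
    proof (cases rule: standard_cases)
      case (one_dim u \<chi>)
      then have "weights S = {s}" using weights_one_dim[OF one_dim(1,3)] S(2) by simp
      then show ?thesis using True F.one_closed unfolding fixed_weight_def by (auto intro!: exI[of _ \<one>])
    next
      case (induced u)
      then show ?thesis using induced_weight_not_fixed[OF induced(1,2)] S(2) True by blast
    qed
  qed
  finally show ?thesis .
qed

lemma simple_fixed_weight:
  fixes X :: "nat \<times> ('a \<times> 'a \<Rightarrow> 'k::{alg_closed_field, field_char_0} mat)"
  assumes X: "simple_object (Rep H) X" and s: "s \<in> weights X" "fixed_weight s"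
  shows "\<exists>\<chi>. character \<chi> \<and> isomorphic (Rep H) (one_dim s \<chi>) X"
proof -
  obtain S where S: "standard_module S" "s \<in> weights S" "isomorphic (Rep H) S X"
    using simple_standard[OF X s(1)] by blast
  from S(1) show ?thesis
  proof (cases rule: standard_cases)
    case (one_dim u \<chi>)
    then have "u = s" using weights_one_dim[OF one_dim(1,3)] S(2) by simp
    then show ?thesis using one_dim S(3) by blast
  next
    case (induced u)
    then show ?thesis using induced_weight_not_fixed[OF induced(1,2)] S(2) s(2) by blast
  qed
qed

lemma coset_supp_simple:
  fixes X :: "nat \<times> ('a \<times> 'a \<Rightarrow> 'k::{alg_closed_field, field_char_0} mat)"
  assumes X: "simple_object (Rep H) X" and s: "s \<in> weights X"
  shows "coset_supp X = double_coset M F s"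
proof -
  have s\<Gamma>: "s \<in> \<Gamma>" using s unfolding weights_def by (cases X) auto
  have "double_coset M F t = double_coset M F s" if "t \<in> weights X" for t
    using that double_coset_eq[OF F \<Gamma>.mem_carrier[OF s\<Gamma>] right_act_double_coset[OF s\<Gamma>]]
    unfolding weights_simple[OF X s] by blast
  then show ?thesis unfolding coset_supp_def using s by blast
qed

text \<open>The kernel is a proper subgroup of a group of prime order.\<close>

lemma nontrivial_character_injective:
  assumes \<chi>: "character \<chi>" "\<exists>x\<in>F. \<chi> x \<noteq> 1" and x: "x \<in> F" "y \<in> F" "\<chi> x = \<chi> y"
  shows "x = y"
proof -
  have inv: "\<chi> (inv u) * \<chi> u = 1" if "u \<in> F" for u
    using \<chi>(1) that F.m_inv_closed[OF that] F.mem_carrier[OF that] unfolding character_def by (metis l_inv)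
  have "{u \<in> F. \<chi> u = 1} = {\<one>}"
  proof (rule proper_subgroup_of_F_trivial)
    show "{u \<in> F. \<chi> u = 1} \<noteq> F" using \<chi>(2) by blast
    show "inv u \<in> {u \<in> F. \<chi> u = 1}" if "u \<in> {u \<in> F. \<chi> u = 1}" for u
      using that inv[of u] by simp
  qed (use \<chi>(1) in \<open>auto simp: character_def\<close>)
  moreover have "\<chi> (inv x \<otimes> y) = 1" using \<chi>(1) x inv[OF x(1)] unfolding character_def by simp
  ultimately have "inv x \<otimes> y = \<one>" using x by blast
  then show ?thesis using x F.mem_carrier by (metis inv_closed inv_equality inv_inv)
qed

text \<open>\<open>V\<close> is the first product itself, which is one-dimensional and differs from
  the other product in its character at \<open>x\<close>.\<close>

lemma one_dim_noncentral:
  fixes \<chi> \<psi> :: "'a \<Rightarrow> 'k::{alg_closed_field, field_char_0}"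
  assumes s: "s \<in> \<Gamma>" "fixed_weight s" "character \<chi>" and t: "t \<in> \<Gamma>" "fixed_weight t" "character \<psi>"
    and x: "x \<in> F" "\<chi> (t \<triangleright> x) * \<psi> x \<noteq> \<psi> (s \<triangleright> x) * \<chi> x"
  shows "\<exists>V. simple_object (Rep H) V \<and>
    hom_nonzero (Rep H) V (one_dim s \<chi> \<boxtimes>\<^bsub>Rep H\<^esub> one_dim t \<psi>) \<and>
    \<not> hom_nonzero (Rep H) V (one_dim t \<psi> \<boxtimes>\<^bsub>Rep H\<^esub> one_dim s \<chi>)"
proof -
  interpret C: linear_category "Rep (H :: ('a \<times> 'a, 'k) hopf_algebra)" by (rule linear_category_Rep)
  let ?V = "one_dim (s \<otimes> t) (\<lambda>x. \<chi> (t \<triangleright> x) * \<psi> x)"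
  have st: "s \<otimes> t \<in> \<Gamma>" "fixed_weight (s \<otimes> t)" "character (\<lambda>x. \<chi> (t \<triangleright> x) * \<psi> x)"
    using s t fixed_weight_mult character_tensor by auto
  then have V: "simple_object (Rep H) ?V"
    by (intro standard_simple) (auto simp: standard_module_def)
  have "hom_nonzero (Rep H) ?V ?V" using C.hom_nonzero_refl C.simple_objectD V by blast
  moreover have "\<not> hom_nonzero (Rep H) ?V (one_dim (t \<otimes> s) (\<lambda>x. \<psi> (s \<triangleright> x) * \<chi> x))"
    using hom_nonzero_one_dim[OF st(1,3)] x by blast
  ultimately show ?thesis
    unfolding TenO_one_dim[OF s(1) t(1)] TenO_one_dim[OF t(1) s(1)] using V by blast
qed

lemma coset_support_Rep:
  assumes centralizer: "\<And>s x. \<lbrakk>s \<in> \<Gamma>; x \<in> F; x \<noteq> \<one>; s \<otimes> x = x \<otimes> s\<rbrakk> \<Longrightarrow> s = \<one>"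
    and one: "\<one> \<in> A" and t: "t \<in> \<Gamma>" "t \<in> A" "t \<noteq> \<one>" "normalizes M F t"
  shows "coset_support M F A (carrier M) (Rep (H :: ('a \<times> 'a, 'k::{alg_closed_field, field_char_0}) hopf_algebra)) coset_supp"
proof -
  let ?H = "H :: ('a \<times> 'a, 'k) hopf_algebra"
  interpret C: linear_category "Rep ?H" by (rule linear_category_Rep)
  have w\<Gamma>: "s \<in> \<Gamma>" if "s \<in> weights X" for s and X :: "nat \<times> ('a \<times> 'a \<Rightarrow> 'k mat)"
    using that unfolding weights_def by (cases X) auto
  have dcM: "double_coset M F s \<subseteq> carrier M" if "s \<in> \<Gamma>" for s
    unfolding double_coset_def using that F.mem_carrier \<Gamma>.mem_carrier by auto
  have obtain_weight: "\<exists>s\<in>weights X. m \<in> double_coset M F s" if "m \<in> coset_supp X" for m and X :: "nat \<times> ('a \<times> 'a \<Rightarrow> 'k mat)"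
    using that unfolding coset_supp_def by blast
  have triv: "character (\<lambda>_. 1 :: 'k)" "fixed_weight \<one>" unfolding character_def fixed_weight_def using act_one(4) by auto
  have unit: "simple_object (Rep ?H) (Unit (Rep ?H))"
    unfolding Unit_Rep using triv by (intro standard_simple) (auto simp: standard_module_def)
  show ?thesis
  proof (rule coset_support.intro)
    fix X Y assume "isomorphic (Rep ?H) X Y"
    then have "weights X = weights Y" using weights_isomorphic C.isomorphic_sym by blast
    then show "coset_supp X = coset_supp Y" unfolding coset_supp_def by simp
  next
    show "simple_object (Rep ?H) (Unit (Rep ?H))" by (rule unit)
    have "double_coset M F \<one> = F"
    proof
      show "double_coset M F \<one> \<subseteq> F" unfolding double_coset_def using F.mem_carrier by auto
      have "x = x \<otimes> \<one> \<otimes> \<one>" if "x \<in> F" for x using that F.mem_carrier by simp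
      then show "F \<subseteq> double_coset M F \<one>" unfolding double_coset_def using F.one_closed by blast
    qed
    then show "coset_supp (Unit (Rep ?H)) = F"
      unfolding coset_supp_def Unit_Rep weights_one_dim[OF \<Gamma>.one_closed triv(1)] by simp
  next
    fix X assume X: "simple_object (Rep ?H) X"
    obtain s where s: "s \<in> weights X" using weights_nonempty_object C.simple_objectD[OF X] by blast
    show "coset_supp X \<noteq> {}"
      using coset_supp_simple[OF X s] double_coset_self[OF F \<Gamma>.mem_carrier[OF w\<Gamma>[OF s]]] by blast
    show "coset_supp X \<subseteq> carrier M" using coset_supp_simple[OF X s] dcM[OF w\<Gamma>[OF s]] by simp
    fix m assume "m \<in> coset_supp X"
    then show "coset_supp X = double_coset M F m"
      using coset_supp_simple[OF X s] double_coset_eq[OF F \<Gamma>.mem_carrier[OF w\<Gamma>[OF s]]] by simp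
  next
    fix m assume "m \<in> carrier M"
    then obtain s where s: "s \<in> \<Gamma>" "m \<in> double_coset M F s" using double_coset_meets_\<Gamma> by blast
    have "\<exists>S :: nat \<times> ('a \<times> 'a \<Rightarrow> 'k mat). standard_module S \<and> s \<in> weights S"
    proof (cases "fixed_weight s")
      case True
      then have "standard_module (one_dim s (\<lambda>_. 1 :: 'k))" unfolding standard_module_def using s triv by blast
      moreover have "s \<in> weights (one_dim s (\<lambda>_. 1 :: 'k))" using weights_one_dim[OF s(1) triv(1)] by simp
      ultimately show ?thesis by blast
    next
      case False
      then have "standard_module (induced s :: nat \<times> ('a \<times> 'a \<Rightarrow> 'k mat))" unfolding standard_module_def using s by blast
      moreover have "s \<in> weights (induced s :: nat \<times> ('a \<times> 'a \<Rightarrow> 'k mat))"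
        unfolding weights_induced[OF s(1)] using act_one(2)[OF s(1)] F.one_closed
        by (intro CollectI exI[of _ \<one>]) simp
      ultimately show ?thesis by blast
    qed
    then obtain S :: "nat \<times> ('a \<times> 'a \<Rightarrow> 'k mat)" where "standard_module S" "s \<in> weights S" by blast
    then show "\<exists>X. simple_object (Rep ?H) X \<and> m \<in> coset_supp X"
      using standard_simple s(2) unfolding coset_supp_def by blast
  next
    fix X Y a b assume X: "simple_object (Rep ?H) X" and Y: "simple_object (Rep ?H) Y"
      and ab: "a \<in> coset_supp X" "b \<in> coset_supp Y"
    obtain u v where u: "u \<in> weights X" "a \<in> double_coset M F u" and v: "v \<in> weights Y" "b \<in> double_coset M F v"
      using obtain_weight ab by meson
    obtain x y x' y' where xy: "a = x \<otimes> u \<otimes> y" "b = x' \<otimes> v \<otimes> y'" "x \<in> F" "y \<in> F" "x' \<in> F" "y' \<in> F"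
      using u v unfolding double_coset_def by blast
    have uv: "u \<in> \<Gamma>" "v \<in> \<Gamma>" using w\<Gamma>[OF u(1)] w\<Gamma>[OF v(1)] by auto
    \<comment> \<open>Moving \<open>w\<close> past \<open>u\<close> leaves an element of
      \<open>F\<close> on the left and changes the weight to u \<lhd> w, which is again a weight of
      the simple module \<open>X\<close>.\<close>
    define w where "w = y \<otimes> x'"
    have w: "w \<in> F" unfolding w_def using xy by simp
    note a = act[OF uv(1) w]
    have c: "x \<in> carrier M" "y \<in> carrier M" "x' \<in> carrier M" "y' \<in> carrier M" "u \<in> carrier M" "v \<in> carrier M"
      "w \<in> carrier M" "u \<triangleright> w \<in> carrier M" "u \<triangleleft> w \<in> carrier M"
      using xy uv w a F.mem_carrier \<Gamma>.mem_carrier by auto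
    have "a \<otimes> b = x \<otimes> (u \<otimes> w) \<otimes> v \<otimes> y'" unfolding xy(1,2) w_def using c by (simp add: m_assoc)
    also have "\<dots> = (x \<otimes> (u \<triangleright> w)) \<otimes> ((u \<triangleleft> w) \<otimes> v) \<otimes> y'" unfolding a(3) using c by (simp add: m_assoc)
    finally have abw: "a \<otimes> b \<in> double_coset M F ((u \<triangleleft> w) \<otimes> v)" unfolding double_coset_def using xy a by blast
    have uw: "u \<triangleleft> w \<in> weights X" using weights_simple[OF X u(1)] w by blast
    have Ob: "X \<in> Ob (Rep ?H)" "Y \<in> Ob (Rep ?H)" using X Y C.simple_objectD(1) by auto
    obtain S where "standard_module S" "(u \<triangleleft> w) \<otimes> v \<in> weights S" "hom_nonzero (Rep ?H) S (X \<boxtimes>\<^bsub>Rep ?H\<^esub> Y)"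
      using ex_standard_hom[OF TenO_Ob_Rep[OF Ob] weights_TenO[OF Ob uw v(1)]] by blast
    then show "\<exists>Z. simple_object (Rep ?H) Z \<and> hom_nonzero (Rep ?H) Z (X \<boxtimes>\<^bsub>Rep ?H\<^esub> Y) \<and> a \<otimes> b \<in> coset_supp Z"
      using standard_simple abw unfolding coset_supp_def by blast
  next
    fix X Y m assume X: "simple_object (Rep ?H) X" and Y: "simple_object (Rep ?H) Y"
      and m: "m \<in> coset_supp X" "m \<in> coset_supp Y" "\<not> normalizes M F m"
    obtain u v where u: "u \<in> weights X" "m \<in> double_coset M F u" and v: "v \<in> weights Y" "m \<in> double_coset M F v"
      using obtain_weight m by meson
    have uv: "u \<in> \<Gamma>" "v \<in> \<Gamma>" using w\<Gamma>[OF u(1)] w\<Gamma>[OF v(1)] by auto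
    have "double_coset M F u = double_coset M F v"
      using double_coset_eq[OF F] u(2) v(2) uv \<Gamma>.mem_carrier by metis
    then have "u \<in> double_coset M F v" using double_coset_self[OF F \<Gamma>.mem_carrier[OF uv(1)]] by simp
    then have uY: "u \<in> weights Y" using double_coset_\<Gamma>[OF uv(2,1)] weights_simple[OF Y v(1)] by blast
    have "\<not> fixed_weight u"
      using normalizes_double_coset[OF F \<Gamma>.mem_carrier[OF uv(1)] _ u(2)] m(3) fixed_weight_iff_normalizes[OF uv(1)] by blast
    then have "isomorphic (Rep ?H) (induced u) X" "isomorphic (Rep ?H) (induced u) Y"
      using simple_standard[OF X u(1)] simple_standard[OF Y uY] by auto
    then show "isomorphic (Rep ?H) X Y" using C.isomorphic_sym C.isomorphic_trans by blast
  next
    fix Z m assume Z: "simple_object (Rep ?H) Z" and m: "m \<in> coset_supp Z" "normalizes M F m"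
      and nt: "\<not> isomorphic (Rep ?H) Z (Unit (Rep ?H))"
    obtain s where s: "s \<in> weights Z" "m \<in> double_coset M F s" using obtain_weight[OF m(1)] by blast
    have s\<Gamma>: "s \<in> \<Gamma>" using w\<Gamma>[OF s(1)] .
    have sm: "s \<in> double_coset M F m"
      using double_coset_eq[OF F \<Gamma>.mem_carrier[OF s\<Gamma>] s(2)] double_coset_self[OF F \<Gamma>.mem_carrier[OF s\<Gamma>]] by simp
    have "m \<in> carrier M" using dcM[OF s\<Gamma>] s(2) by blast
    then have sfix: "fixed_weight s"
      using normalizes_double_coset[OF F _ m(2) sm] fixed_weight_iff_normalizes[OF s\<Gamma>] by blast
    obtain \<chi> where \<chi>: "character \<chi>" "isomorphic (Rep ?H) (one_dim s \<chi>) Z"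
      using simple_fixed_weight[OF Z s(1) sfix] by blast
    have "\<exists>u \<psi> x. u \<in> \<Gamma> \<and> u \<in> A \<and> fixed_weight u \<and> character (\<psi> :: 'a \<Rightarrow> 'k) \<and> x \<in> F \<and>
      \<chi> (u \<triangleright> x) * \<psi> x \<noteq> \<psi> (s \<triangleright> x) * \<chi> x"
    proof (cases "s = \<one>")
      \<comment> \<open>For s \<noteq> \<one> take trivial weight and a faithful character \<psi>.
        The products compare \<psi>(x) with \<psi>(s \<rhd> x), and \<open>s\<close> does not
        centralize x.\<close>
      case False
      interpret GF: group "M\<lparr>carrier := F\<rparr>" by (rule F.subgroup_is_group[OF group_axioms])
      have p: "Factorial_Ring.prime (Coset.order (M\<lparr>carrier := F\<rparr>))" using prime_F unfolding Coset.order_def by simp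
      obtain \<psi> :: "'a \<Rightarrow> 'k" where \<psi>: "\<forall>x\<in>F. \<forall>y\<in>F. \<psi> (x \<otimes> y) = \<psi> x * \<psi> y" "\<forall>x\<in>F. \<psi> x = 1 \<longleftrightarrow> x = \<one>"
        using GF.ex_faithful_character[OF p, where 'k = 'k] by (auto simp: Coset.order_def)
      have "F \<noteq> {\<one>}" using prime_F by auto
      then obtain x where x: "x \<in> F" "x \<noteq> \<one>" using F.one_closed by blast
      have \<psi>c: "character \<psi>" "\<exists>x\<in>F. \<psi> x \<noteq> 1" using \<psi> x unfolding character_def by auto
      have sx: "s \<triangleright> x \<noteq> x"
      proof
        assume "s \<triangleright> x = x"
        then have "s \<otimes> x = x \<otimes> s" using act(3)[OF s\<Gamma> x(1)] sfix x(1) unfolding fixed_weight_def by simp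
        then show False using centralizer[OF s\<Gamma> x] False by simp
      qed
      then have "\<psi> (s \<triangleright> x) \<noteq> \<psi> x"
        using nontrivial_character_injective[OF \<psi>c act(1)[OF s\<Gamma> x(1)] x(1)] by blast
      then have "\<chi> (\<one> \<triangleright> x) * \<psi> x \<noteq> \<psi> (s \<triangleright> x) * \<chi> x"
        using character_nonzero[OF \<chi>(1) x(1)] act_one(3)[OF x(1)] by simp
      then show ?thesis using \<Gamma>.one_closed one triv(2) \<psi>c(1) x(1) by blast
    next
      \<comment> \<open>For s = \<one> the character \<chi> is nontrivial. Weight \<open>t\<close>
        with trivial character makes the products compare \<chi>(t \<rhd> x) with \<chi>(x).\<close>
      case True
      have "\<exists>x\<in>F. \<chi> x \<noteq> 1"
      proof (rule ccontr)
        assume "\<not> ?thesis"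
        then have "one_dim s \<chi> = Unit (Rep ?H)" unfolding Unit_Rep True one_dim_def by (auto intro!: restrict_ext)
        then show False using \<chi>(2) nt C.isomorphic_sym by simp
      qed
      then obtain x where x: "x \<in> F" "\<chi> x \<noteq> 1" by blast
      have "x \<noteq> \<one>" using x \<chi>(1) unfolding character_def by auto
      have tf: "fixed_weight t" using t fixed_weight_iff_normalizes by blast
      have "t \<triangleright> x \<noteq> x"
      proof
        assume "t \<triangleright> x = x"
        then have "t \<otimes> x = x \<otimes> t" using act(3)[OF t(1) x(1)] tf x(1) unfolding fixed_weight_def by simp
        then show False using centralizer[OF t(1) x(1) \<open>x \<noteq> \<one>\<close>] t(3) by simp
      qed
      then have "\<chi> (t \<triangleright> x) \<noteq> \<chi> x"
        using nontrivial_character_injective[OF \<chi>(1) _ act(1)[OF t(1) x(1)] x(1)] x by blast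
      then show ?thesis using t tf triv(1) x(1)
        by (intro exI[of _ t] exI[of _ "\<lambda>_. 1"] exI[of _ x]) simp
    qed
    then obtain u \<psi> x where u: "u \<in> \<Gamma>" "u \<in> A" "fixed_weight u" "character (\<psi> :: 'a \<Rightarrow> 'k)" "x \<in> F"
      "\<chi> (u \<triangleright> x) * \<psi> x \<noteq> \<psi> (s \<triangleright> x) * \<chi> x" by blast
    let ?W = "one_dim u \<psi>"
    have W: "simple_object (Rep ?H) ?W" using u by (intro standard_simple) (auto simp: standard_module_def)
    obtain V where V: "simple_object (Rep ?H) V" "hom_nonzero (Rep ?H) V (one_dim s \<chi> \<boxtimes>\<^bsub>Rep ?H\<^esub> ?W)"
        "\<not> hom_nonzero (Rep ?H) V (?W \<boxtimes>\<^bsub>Rep ?H\<^esub> one_dim s \<chi>)"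
      using one_dim_noncentral[OF s\<Gamma> sfix \<chi>(1) u(1,3,4,5,6)] by blast
    have rW: "isomorphic (Rep ?H) ?W ?W" and rV: "isomorphic (Rep ?H) V V"
      using C.isomorphic_refl C.simple_objectD(1) W V(1) by auto
    have "hom_nonzero (Rep ?H) V (Z \<boxtimes>\<^bsub>Rep ?H\<^esub> ?W)" "\<not> hom_nonzero (Rep ?H) V (?W \<boxtimes>\<^bsub>Rep ?H\<^esub> Z)"
      using V C.hom_nonzero_isomorphic[OF rV isomorphic_TenO_Rep[OF \<chi>(2) rW]]
        C.hom_nonzero_isomorphic[OF rV isomorphic_TenO_Rep[OF rW \<chi>(2)]] by auto
    moreover have "u \<in> coset_supp ?W"
      unfolding coset_supp_def weights_one_dim[OF u(1,4)]
      using double_coset_self[OF F \<Gamma>.mem_carrier[OF u(1)]] by simp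
    ultimately show "\<exists>W V. simple_object (Rep ?H) W \<and> simple_object (Rep ?H) V \<and> coset_supp W \<inter> A \<noteq> {} \<and>
        hom_nonzero (Rep ?H) V (Z \<boxtimes>\<^bsub>Rep ?H\<^esub> W) \<noteq> hom_nonzero (Rep ?H) V (W \<boxtimes>\<^bsub>Rep ?H\<^esub> Z)"
      using W V(1) u(2) by blast
  qed
qed

end

section \<open>Rotations as affine permutations modulo n\<close>

definition cyclic_residue :: "nat \<Rightarrow> nat \<Rightarrow> nat"
  where "cyclic_residue n j = (if n dvd j then n else j mod n)"

text \<open>Residues are represented in {1..n}, with n in the place of 0, because these are the
  points permuted by \<open>sym_group n\<close>. Rotations have slope 1, and maps without
  translation part fix n.\<close>

definition affine_map :: "nat \<Rightarrow> nat \<Rightarrow> nat \<Rightarrow> nat \<Rightarrow> nat"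
  where "affine_map n c d i = (if i \<in> {1..n} then cyclic_residue n (c * i + d) else i)"

lemma cyclic_residue_range: "0 < n \<Longrightarrow> cyclic_residue n j \<in> {1..n}"
  unfolding cyclic_residue_def by (auto simp: Suc_le_eq mod_greater_zero_iff_not_dvd less_imp_le)

lemma cyclic_residue_cong: "[cyclic_residue n j = j] (mod n)"
  unfolding cyclic_residue_def by (auto simp: cong_def)

lemma cyclic_residue_eq_iff: "cyclic_residue n i = cyclic_residue n j \<longleftrightarrow> [i = j] (mod n)"
proof
  assume "cyclic_residue n i = cyclic_residue n j"
  then show "[i = j] (mod n)" using cyclic_residue_cong[of n i] cyclic_residue_cong[of n j]
    by (metis cong_sym cong_trans)
qed (auto simp: cyclic_residue_def cong_def dvd_eq_mod_eq_0)

lemma cyclic_residue_id: "i \<in> {1..n} \<Longrightarrow> cyclic_residue n i = i"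
  unfolding cyclic_residue_def by (cases "i = n") (auto dest: dvd_imp_le)

lemma affine_map_cong: "[c = c'] (mod n) \<Longrightarrow> [d = d'] (mod n) \<Longrightarrow> affine_map n c d = affine_map n c' d'"
  unfolding affine_map_def by (auto simp: fun_eq_iff cyclic_residue_eq_iff intro!: cong_add cong_mult)

lemma affine_map_comp:
  assumes "0 < n"
  shows "affine_map n c d \<circ> affine_map n c' d' = affine_map n (c * c') (c * d' + d)"
proof
  fix i
  have "[c * cyclic_residue n (c' * i + d') + d = c * (c' * i + d') + d] (mod n)"
    by (intro cong_add cong_mult cyclic_residue_cong cong_refl)
  then have "[c * cyclic_residue n (c' * i + d') + d = c * c' * i + (c * d' + d)] (mod n)"
    by (simp add: algebra_simps)
  then show "(affine_map n c d \<circ> affine_map n c' d') i = affine_map n (c * c') (c * d' + d) i"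
    using cyclic_residue_range[OF assms] unfolding affine_map_def by (simp add: cyclic_residue_eq_iff)
qed

lemma affine_map_id: "affine_map n 1 0 = id"
  unfolding affine_map_def by (auto simp: fun_eq_iff cyclic_residue_id)

lemma affine_map_permutes:
  assumes n: "0 < n" and c: "coprime c n"
  shows "affine_map n c d permutes {1..n}"
proof (rule bij_imp_permutes)
  have "inj_on (affine_map n c d) {1..n}"
  proof (rule inj_onI)
    fix i j assume ij: "i \<in> {1..n}" "j \<in> {1..n}" "affine_map n c d i = affine_map n c d j"
    then have "[c * i = c * j] (mod n)"
      unfolding affine_map_def by (simp add: cyclic_residue_eq_iff cong_add_rcancel_nat)
    then have "[i = j] (mod n)" using c by (simp add: cong_mult_lcancel_nat)
    then have "cyclic_residue n i = cyclic_residue n j" by (simp add: cyclic_residue_eq_iff)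
    then show "i = j" using ij cyclic_residue_id by simp
  qed
  moreover have "affine_map n c d ` {1..n} \<subseteq> {1..n}"
    using cyclic_residue_range[OF n] unfolding affine_map_def by auto
  ultimately show "bij_betw (affine_map n c d) {1..n} {1..n}"
    unfolding bij_betw_def using endo_inj_surj by blast
qed (auto simp: affine_map_def)

lemma long_cycle_eq:
  assumes n: "2 \<le> n"
  shows "long_cycle n = affine_map n 1 1"
proof
  fix i
  show "long_cycle n i = affine_map n 1 1 i"
  proof (cases "i \<in> {1..n}")
    case False
    then show ?thesis unfolding long_cycle_def affine_map_def by (subst id_outside_supp) auto
  next
    case True
    then have l: "i - 1 < length [1..<Suc n]" by auto
    have "map (cycle_of_list [1..<Suc n] ^^ 1) [1..<Suc n] = rotate 1 [1..<Suc n]"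
      by (rule cyclic_rotation) simp
    then have "cycle_of_list [1..<Suc n] ([1..<Suc n] ! (i - 1)) = rotate1 [1..<Suc n] ! (i - 1)"
      using nth_map[OF l, of "cycle_of_list [1..<Suc n]"] by (simp del: upt_Suc)
    also have "\<dots> = [1..<Suc n] ! (i mod n)"
      using True by (subst nth_rotate1) (auto simp del: upt_Suc)
    also have "\<dots> = Suc (i mod n)" using n by (subst nth_upt) (auto simp del: upt_Suc)
    also have "\<dots> = cyclic_residue n (i + 1)"
      unfolding cyclic_residue_def using True n
      by (cases "i = n") (auto dest: dvd_imp_le simp: mod_Suc dvd_eq_mod_eq_0)
    also have "[1..<Suc n] ! (i - 1) = i" using True by (subst nth_upt) (auto simp del: upt_Suc)
    finally show ?thesis unfolding long_cycle_def affine_map_def using True by simp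
  qed
qed

lemma long_cycle_funpow:
  assumes "2 \<le> n"
  shows "long_cycle n ^^ k = affine_map n 1 k"
proof (induction k)
  case 0 then show ?case by (simp add: affine_map_id[unfolded One_nat_def])
next
  case (Suc k)
  then show ?case using assms affine_map_comp[of n 1 1 1 k] by (simp add: long_cycle_eq)
qed

lemma sym_group_pow: "\<sigma> [^]\<^bsub>sym_group n\<^esub> (k::nat) = \<sigma> ^^ k"
  by (induction k) (simp_all add: sym_group_one sym_group_mult funpow_swap1 fun_eq_iff)

lemma generate_long_cycle:
  assumes n: "2 \<le> n"
  shows "generate (sym_group n) {long_cycle n} = range (affine_map n 1)"
proof -
  interpret G: group "sym_group n" by (rule sym_group_is_group)
  have fin: "finite (carrier (sym_group n))" by (simp add: sym_group_def finite_permutations)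
  have "long_cycle n \<in> carrier (sym_group n)"
    unfolding long_cycle_eq[OF n] sym_group_carrier using n by (intro affine_map_permutes) auto
  from G.generate_pow_on_finite_carrier[OF fin this] show ?thesis
    by (auto simp: sym_group_pow long_cycle_funpow[OF n])
qed

lemma affine_map_rotation_eq_iff:
  assumes "0 < n"
  shows "affine_map n 1 d n = affine_map n 1 d' n \<longleftrightarrow> [d = d'] (mod n)"
    and "affine_map n 1 d = affine_map n 1 d' \<longleftrightarrow> [d = d'] (mod n)"
proof -
  show *: "affine_map n 1 d n = affine_map n 1 d' n \<longleftrightarrow> [d = d'] (mod n)"
    unfolding affine_map_def using assms by (simp add: cyclic_residue_eq_iff cong_add_lcancel_nat)
  show "affine_map n 1 d = affine_map n 1 d' \<longleftrightarrow> [d = d'] (mod n)"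
    using * affine_map_cong[OF cong_refl] by metis
qed

lemma affine_map_rotation_top: "i \<in> {1..n} \<Longrightarrow> affine_map n 1 i n = i"
  unfolding affine_map_def using cyclic_residue_id[of i n] cyclic_residue_eq_iff[of n "n + i" i]
  by (auto simp: cong_def)

lemma card_rotations:
  assumes n: "0 < n"
  shows "card (range (affine_map n 1)) = n"
proof -
  have "range (affine_map n 1) = affine_map n 1 ` {..<n}"
  proof (intro subset_antisym image_subsetI)
    fix d
    have "affine_map n 1 d = affine_map n 1 (d mod n)"
      using affine_map_rotation_eq_iff(2)[OF n] by (simp add: cong_def)
    then show "affine_map n 1 d \<in> affine_map n 1 ` {..<n}" using n by auto
  qed auto
  moreover have "inj_on (affine_map n 1) {..<n}"
    by (rule inj_onI) (auto simp: affine_map_rotation_eq_iff(2)[OF n, unfolded One_nat_def] cong_def)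
  ultimately show ?thesis by (simp add: card_image)
qed

lemma evenperm_comp_self: "\<sigma> permutes S \<Longrightarrow> finite S \<Longrightarrow> evenperm (\<sigma> \<circ> \<sigma>)"
  using evenperm_comp permutation_permutes by blast

text \<open>For odd \<open>n\<close> every rotation, and multiplication by 4, is the square of a permutation.\<close>

lemma rotation_even:
  assumes n: "odd n"
  shows "affine_map n 1 d \<in> carrier (alt_group n)"
proof -
  have n0: "0 < n" using n by (auto intro: odd_pos)
  \<comment> \<open>m + 1 is the inverse of 2 modulo n, so the rotation by d is the square of the
    rotation by d (m + 1).\<close>
  obtain m where m: "n = 2 * m + 1" using n by (elim oddE)
  have "1 * (d * (m + 1)) + d * (m + 1) = d * n + d" by (simp add: m algebra_simps)
  then have "[1 * (d * (m + 1)) + d * (m + 1) = d] (mod n)" by (simp only: cong_def mod_mult_self3)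
  then have "affine_map n 1 (d * (m + 1)) \<circ> affine_map n 1 (d * (m + 1)) = affine_map n 1 d"
    unfolding affine_map_comp[OF n0] by (intro affine_map_cong) (simp_all add: cong_refl)
  then show ?thesis
    using evenperm_comp_self[OF affine_map_permutes[OF n0, of 1 "d * (m + 1)"]] affine_map_permutes[OF n0, of 1 d]
    by (simp add: alt_group_carrier)
qed

lemma quadruple_even:
  assumes n: "odd n"
  shows "affine_map n 4 0 \<in> carrier (alt_group n)"
proof -
  have n0: "0 < n" using n by (auto intro: odd_pos)
  have c: "coprime 2 n" "coprime 4 n" using n coprime_power_left_iff[of 2 2 n] by auto
  show ?thesis
    using affine_map_comp[OF n0, of 2 0 2 0] evenperm_comp_self[OF affine_map_permutes[OF n0 c(1), of 0]]
      affine_map_permutes[OF n0 c(2), of 0] by (simp add: alt_group_carrier)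
qed

text \<open>For prime n a nontrivial rotation generates all of them. A permutation commuting with
  every rotation is determined by its value at n.\<close>

lemma rotation_centralizer:
  assumes n: "Factorial_Ring.prime n" and s: "s permutes {1..n}" "s n = n"
    and k: "affine_map n 1 k \<noteq> id" and comm: "s \<circ> affine_map n 1 k = affine_map n 1 k \<circ> s"
  shows "s = id"
proof -
  have n0: "0 < n" using n prime_gt_0_nat by blast
  have pow: "affine_map n 1 k ^^ j = affine_map n 1 (j * k)" for j
  proof (induction j)
    case 0 show ?case by (simp add: affine_map_id[unfolded One_nat_def])
  next
    case (Suc j) then show ?case by (simp add: affine_map_comp[OF n0] add.commute)
  qed
  have s_pow: "s \<circ> affine_map n 1 k ^^ j = affine_map n 1 k ^^ j \<circ> s" for j
  proof (induction j)
    case (Suc j)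
    have "s \<circ> affine_map n 1 k ^^ Suc j = affine_map n 1 k \<circ> (s \<circ> affine_map n 1 k ^^ j)"
      using comm by (metis comp_assoc funpow.simps(2))
    also have "\<dots> = affine_map n 1 k ^^ Suc j \<circ> s" unfolding Suc by (simp add: comp_assoc)
    finally show ?case .
  qed simp
  have "\<not> [k = 0] (mod n)" using k affine_map_id affine_map_rotation_eq_iff(2)[OF n0] by metis
  then have "coprime k n" using n using prime_imp_coprime[of n k] by (simp add: cong_0_iff coprime_commute)
  \<comment> \<open>With l inverse to k, the power i l of the given rotation is the rotation by i,
    which sends n to i.\<close>
  then obtain l where l: "[k * l = 1] (mod n)" using cong_solve_coprime_nat by auto
  have "s i = i" if i: "i \<in> {1..n}" for i
  proof -
    have "[i * l * k = i] (mod n)" using cong_mult[OF cong_refl l, of i] by (simp add: ac_simps)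
    then have e: "affine_map n 1 k ^^ (i * l) = affine_map n 1 i"
      unfolding pow by (simp add: affine_map_rotation_eq_iff(2)[OF n0, unfolded One_nat_def])
    have "s (affine_map n 1 i n) = affine_map n 1 i (s n)" using s_pow[of "i * l"] unfolding e by (simp add: fun_eq_iff)
    then show ?thesis unfolding s(2) affine_map_rotation_top[OF i] .
  qed
  then show ?thesis using s(1) by (auto simp: fun_eq_iff permutes_def)
qed

text \<open>A subgroup \<open>S\<close> between the alternating and the symmetric group treats both
  Hopf algebras at once.\<close>

lemma cycle_factorization:
  assumes n: "Factorial_Ring.prime n" "odd n"
    and S: "subgroup S (sym_group n)" "carrier (alt_group n) \<subseteq> S"
  shows "prime_factorization ((sym_group n)\<lparr>carrier := S\<rparr>) (range (affine_map n 1)) {\<sigma> \<in> S. \<sigma> n = n}"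
    (is "prime_factorization ?M ?F ?\<Gamma>")
proof -
  interpret G: group "sym_group n" by (rule sym_group_is_group)
  have n0: "0 < n" using n prime_gt_0_nat by blast
  have n2: "2 \<le> n" using n prime_ge_2_nat by blast
  have FS: "?F \<subseteq> S" using rotation_even[OF n(2)] S(2) by blast
  have M: "group ?M" by (rule G.subgroup_imp_group[OF S(1)])
  have Scar: "S \<subseteq> carrier (sym_group n)" by (rule subgroup.subset[OF S(1)])
  have F: "subgroup ?F (sym_group n)"
    unfolding generate_long_cycle[OF n2, symmetric] using rotation_even[OF n(2), of 1] Scar S(2)
    by (intro G.generate_is_subgroup) (auto simp: long_cycle_eq[OF n2])
  have \<Gamma>: "subgroup ?\<Gamma> (sym_group n)"
  proof (rule G.subgroupI)
    show "?\<Gamma> \<noteq> {}" using subgroup.one_closed[OF S(1)] by (auto simp: sym_group_one)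
    fix a assume a: "a \<in> ?\<Gamma>"
    then have "inv' a n = n" using permutes_inv_eq[of a "{1..n}" n n] Scar by (auto simp: sym_group_carrier)
    then show "inv\<^bsub>sym_group n\<^esub> a \<in> ?\<Gamma>" using a Scar subgroup.m_inv_closed[OF S(1)] by fastforce
    fix b assume "b \<in> ?\<Gamma>"
    then show "a \<otimes>\<^bsub>sym_group n\<^esub> b \<in> ?\<Gamma>" using a subgroup.m_closed[OF S(1)] by (fastforce simp: sym_group_mult)
  qed (use Scar in auto)
  have rot0: "affine_map n 1 d n = n \<longleftrightarrow> affine_map n 1 d = id" for d
    using affine_map_rotation_eq_iff[OF n0, of d 0] affine_map_id by (metis id_apply)
  show ?thesis
  proof (intro prime_factorization.intro exact_factorization.intro exact_factorization_axioms.intro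
      prime_factorization_axioms.intro)
    show "group ?M" by (rule M)
    show "subgroup ?F ?M" "subgroup ?\<Gamma> ?M" using G.subgroup_incl F \<Gamma> S(1) FS by auto
    show "finite (carrier ?M)" using finite_subset[OF Scar] by (simp add: sym_group_def finite_permutations)
    have "id \<in> ?F" using affine_map_id[of n] by (metis rangeI)
    then show "?F \<inter> ?\<Gamma> = {\<one>\<^bsub>?M\<^esub>}"
      using rot0 subgroup.one_closed[OF S(1)] by (auto simp: sym_group_one)
    show "Factorial_Ring.prime (card ?F)" using n card_rotations[OF n0] by simp
    fix m assume m: "m \<in> carrier ?M"
    have mp: "m permutes {1..n}" using m Scar by (auto simp: sym_group_carrier)
    \<comment> \<open>The rotation agreeing with \<open>m\<close> at n; removing it leaves a
      permutation fixing n.\<close>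
    define x where "x = affine_map n 1 (m n)"
    have xF: "x \<in> ?F" unfolding x_def by simp
    have xM: "x \<in> S" "x \<in> carrier (sym_group n)" using xF FS Scar by auto
    have "m n \<in> {1..n}" using permutes_in_image[OF mp, of n] n0 by simp
    then have xn: "x n = m n" unfolding x_def by (rule affine_map_rotation_top)
    have xp: "x permutes {1..n}" using xM(2) by (simp add: sym_group_carrier)
    let ?s = "inv' x \<circ> m"
    have "inv' x (m n) = n" using permutes_inv_eq[OF xp] xn by simp
    moreover have "?s \<in> S"
      using subgroup.m_closed[OF S(1) subgroup.m_inv_closed[OF S(1) xM(1)]] m xM(2) by (simp add: sym_group_mult)
    ultimately have s: "?s \<in> ?\<Gamma>" by simp
    have "m = x \<otimes>\<^bsub>?M\<^esub> ?s" using permutes_inv_o(1)[OF xp] by (simp add: sym_group_mult comp_assoc[symmetric])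
    then show "\<exists>x\<in>?F. \<exists>s\<in>?\<Gamma>. m = x \<otimes>\<^bsub>?M\<^esub> s" using xF s by blast
  qed
qed

lemma cycle_coset_support:
  fixes C :: "('o, 'm, 'k :: {alg_closed_field, field_char_0}) mon_cat"
  assumes n: "Factorial_Ring.prime n" "odd n" "5 \<le> n"
    and S: "subgroup S (sym_group n)" "carrier (alt_group n) \<subseteq> S"
    and C: "fusion_category C" "grothendieck_equivalent C
      (Rep (bismash_product ((sym_group n)\<lparr>carrier := S\<rparr>) (range (affine_map n 1)) {\<sigma> \<in> S. \<sigma> n = n}))"
  shows "has_coset_support (sym_group n) (range (affine_map n 1)) (carrier (alt_group n)) C"
proof -
  let ?M = "(sym_group n)\<lparr>carrier := S\<rparr>" and ?F = "range (affine_map n 1)" and ?\<Gamma> = "{\<sigma> \<in> S. \<sigma> n = n}"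
  \<comment> \<open>Doubling may be an odd permutation, as for n = 5; its square, multiplication by
    4, is even. It fixes n, normalizes the rotations and moves 1 to 4.\<close>
  let ?t = "affine_map n 4 0"
  have n0: "0 < n" using n by simp
  interpret prime_factorization ?M ?F ?\<Gamma> by (rule cycle_factorization[OF n(1,2) S])
  have Scar: "S \<subseteq> carrier (sym_group n)" by (rule subgroup.subset[OF S(1)])
  have tn: "?t n = n" unfolding affine_map_def cyclic_residue_def using n0 by simp
  have "?t 1 = 4" using cyclic_residue_id[of 4 n] n(3) unfolding affine_map_def by simp
  then have t1: "?t \<noteq> id" by auto
  have norm: "normalizes ?M ?F ?t"
    unfolding normalizes_def using affine_map_comp[OF n0, of 4 0 1] affine_map_comp[OF n0, of 1 _ 4 0]
    by (auto simp: sym_group_mult)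
  have "coset_support ?M ?F (carrier (alt_group n)) (carrier ?M)
    (Rep (bismash_product ?M ?F ?\<Gamma> :: ((nat \<Rightarrow> nat) \<times> (nat \<Rightarrow> nat), 'k) hopf_algebra)) coset_supp"
  proof (rule coset_support_Rep)
    fix s x assume sx: "s \<in> ?\<Gamma>" "x \<in> ?F" "x \<noteq> \<one>\<^bsub>?M\<^esub>" "s \<otimes>\<^bsub>?M\<^esub> x = x \<otimes>\<^bsub>?M\<^esub> s"
    then show "s = \<one>\<^bsub>?M\<^esub>"
      using rotation_centralizer[OF n(1), of s] Scar by (auto simp: sym_group_mult sym_group_one sym_group_carrier)
  next
    show "\<one>\<^bsub>?M\<^esub> \<in> carrier (alt_group n)"
      using subgroup.one_closed[OF alt_group_is_subgroup[of n]] by simp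
    show "?t \<in> ?\<Gamma>" using quadruple_even[OF n(2)] S(2) tn by auto
    show "?t \<in> carrier (alt_group n)" by (rule quadruple_even[OF n(2)])
    show "?t \<noteq> \<one>\<^bsub>?M\<^esub>" using t1 by (simp add: sym_group_one)
    show "normalizes ?M ?F ?t" by (rule norm)
  qed
  then obtain u where "coset_support ?M ?F (carrier (alt_group n)) S C u"
    using has_coset_support_grothendieck[OF C] by fastforce
  then have "coset_support (sym_group n) ?F (carrier (alt_group n)) S C u"
    by (subst coset_support_mult_cong[of _ ?M]) simp_all
  then show ?thesis unfolding has_coset_support_def using S by blast
qed

text \<open>The bound n \<ge> 5 enters through the perfectness of the alternating group.\<close>

lemma cycle_coset_setting:
  assumes n: "odd n" "5 \<le> n"
  shows "coset_setting (sym_group n) (range (affine_map n 1)) (carrier (alt_group n))"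
proof -
  interpret G: group "sym_group n" by (rule sym_group_is_group)
  have n0: "0 < n" and n2: "2 \<le> n" using n by auto
  have FA: "range (affine_map n 1) \<subseteq> carrier (alt_group n)" using rotation_even[OF n(1)] by blast
  have F: "subgroup (range (affine_map n 1)) (sym_group n)"
    unfolding generate_long_cycle[OF n2, symmetric]
    using rotation_even[OF n(1), of 1] subgroup.subset[OF alt_group_is_subgroup[of n]]
    by (intro G.generate_is_subgroup) (auto simp: long_cycle_eq[OF n2])
  \<comment> \<open>The 3-cycle sending 1 to 2, 2 to 3 and 3 to 1.\<close>
  let ?m = "transpose 1 2 \<circ> transpose 2 (3::nat)"
  have perfect: "derived (sym_group n) (carrier (alt_group n)) = carrier (alt_group n)"
    using derived_alt_group_const[OF n(2)] G.derived_consistent[OF subset_refl alt_group_is_subgroup[of n]]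
    by (simp add: alt_group_def)
  have m: "?m \<in> carrier (alt_group n)"
    unfolding alt_group_carrier using n
    by (auto intro!: permutes_compose permutes_swap_id simp: evenperm_comp permutation_swap_id evenperm_swap)
  have "\<not> normalizes (sym_group n) (range (affine_map n 1)) ?m"
  proof
    assume "normalizes (sym_group n) (range (affine_map n 1)) ?m"
    then obtain d where "?m \<circ> affine_map n 1 1 = affine_map n 1 d \<circ> ?m"
      unfolding normalizes_def by (auto simp: sym_group_mult)
    then have e: "?m (affine_map n 1 1 i) = affine_map n 1 d (?m i)" for i by (simp add: fun_eq_iff)
    have v: "?m 1 = 2" "?m 2 = 3" "?m 3 = 1" "affine_map n 1 1 1 = 2" "affine_map n 1 1 2 = 3"
      using cyclic_residue_id[of "Suc (Suc 0)" n] cyclic_residue_id[of 3 n] n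
      unfolding affine_map_def by (auto simp: transpose_def)
    have d: "affine_map n 1 d 2 = 3" "affine_map n 1 d 3 = 1" using e[of 1] e[of 2] v by auto
    \<comment> \<open>The first congruence makes d equal to 1 and the second makes it -2 modulo n,
      so n would divide 3.\<close>
    have "[2 + d = 3] (mod n)" "[3 + d = 1] (mod n)"
      using d n cyclic_residue_cong[of n "2 + d"] cyclic_residue_cong[of n "3 + d"]
      unfolding affine_map_def by (auto simp: cong_sym)
    then have "[3 + (2 + d) = 3 + 3] (mod n)" "[2 + (3 + d) = 2 + 1] (mod n)"
      using cong_add[OF cong_refl] by blast+
    moreover have "3 + (2 + d) = 2 + (3 + d)" by simp
    ultimately have "[3 + 3 = 2 + 1 :: nat] (mod n)" using cong_sym cong_trans by metis
    then have "n dvd 3" by (simp add: cong_def mod_eq_dvd_iff_nat)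
    then show False using n(2) dvd_imp_le[of n 3] by simp
  qed
  then show ?thesis
    using F FA perfect m alt_group_is_subgroup sym_group_is_group
    by (intro coset_setting.intro coset_setting_axioms.intro) auto
qed

theorem theorem4p14:
  fixes p :: nat
    and C :: "('o, 'm, 'k :: {alg_closed_field, field_char_0}) mon_cat"
  assumes "Factorial_Ring.prime p" and "p \<ge> 5"
    and "fusion_category C"
    and "grothendieck_equivalent C (Rep (Jhopf p)) \<or> grothendieck_equivalent C (Rep (Khopf p))"
  shows "\<not> solvable_category TYPE('u) TYPE('v) C"
proof -
  interpret G: group "sym_group p" by (rule sym_group_is_group)
  have p: "odd p" "2 \<le> p" using assms(1,2) prime_odd_nat[of p] by auto
  \<comment> \<open>Written as a subgroup of the symmetric group, the alternating group becomes the
    second instance of \<open>S\<close> in \<open>cycle_coset_support\<close>.\<close>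
  have alt: "alt_group p = (sym_group p)\<lparr>carrier := carrier (alt_group p)\<rparr>"
    by (simp add: alt_group_def)
  have "{long_cycle p} \<subseteq> carrier (alt_group p)"
    using rotation_even[OF p(1), of 1] by (simp add: long_cycle_eq[OF p(2)])
  then have gen: "generate (alt_group p) {long_cycle p} = range (affine_map p 1)"
    using G.generate_consistent[OF _ alt_group_is_subgroup[of p]] alt generate_long_cycle[OF p(2)] by simp
  have sym: "sym_group p = (sym_group p)\<lparr>carrier := carrier (sym_group p)\<rparr>" by simp
  have altsub: "carrier (alt_group p) \<subseteq> carrier (sym_group p)"
    by (rule subgroup.subset[OF alt_group_is_subgroup])
  have "has_coset_support (sym_group p) (range (affine_map p 1)) (carrier (alt_group p)) C"
    using assms(4)
  proof
    assume "grothendieck_equivalent C (Rep (Jhopf p))"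
    then show ?thesis
      unfolding Jhopf_def generate_long_cycle[OF p(2)]
      using cycle_coset_support[OF assms(1) p(1) assms(2) G.subgroup_self altsub assms(3)] by simp
  next
    assume "grothendieck_equivalent C (Rep (Khopf p))"
    then show ?thesis
      unfolding Khopf_def gen
      using cycle_coset_support[OF assms(1) p(1) assms(2) alt_group_is_subgroup subset_refl assms(3)] alt by simp
  qed
  then show ?thesis by (rule coset_setting.coset_support_not_solvable[OF cycle_coset_setting[OF p(1) assms(2)]])
qed

end
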